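(* The assignment $\Psi$, sending a $0$-cell $\Gamma_\bullet$ of $\mathbf{UC}$ to $A_\infty$, a $1$-cell $\Lambda_\bullet:\Gamma_\bullet\to\Delta_\bullet$ to the $A_\infty$-$B_\infty$ right correspondence $H_\infty$, and a $2$-cell $\{\eta^{(k)}\}_{k\ge K}:\Lambda_\bullet\to\Omega_\bullet$ to the adjointable intertwiner $\Phi_{\eta^{(k)}_{\Gamma_k\cdots\Gamma_1m_0}}$ ($k\ge K$), is a $*$-linear, fully faithful (i.e. bijective on spaces of $2$-cells), tensor-reversing $2$-functor from the $2$-category $\mathbf{UC}$ of unitary connections to the $2$-category of right correspondences over pairs of AFD pre-C*-algebras.
   Context: **Conventions.** A finite semisimple C*-category is a semisimple C*-category (finite-dimensional morphism spaces, closed under finite direct sums and subobjects) with finitely many isomorphism classes of simple objects; $V_{\mathcal M}$ is a set of representatives of the simple objects of $\mathcal M$. A $*$-linear functor is bi-faithful if it and its adjoint are faithful. Composition of functors is juxtaposition; $\mathrm{NT}(F,G)$ is the space of natural linear transformations; $F(\eta)$, $\eta_F$ are whiskerings. **The 2-category $\mathbf{UC}$.** *0-cells* $\Gamma_\bullet$: sequences of $*$-linear bi-faithful functors $\Gamma_k:\mathcal M_{k-1}\to\mathcal M_k$ ($k\ge1$) between finite semisimple C*-categories. *1-cells* $\Lambda_\bullet=(\Lambda_\bullet,W^\Lambda_\bullet)$ from $\Gamma_\bullet$ to $\Delta_\bullet=\{\Delta_k:\mathcal N_{k-1}\to\mathcal N_k\}$: $*$-linear bi-faithful functors $\Lambda_k:\mathcal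 M_k\to\mathcal N_k$ ($k\ge0$) and natural unitaries $W^\Lambda_k:\Delta_k\Lambda_{k-1}\to\Lambda_k\Gamma_k$ ($k\ge1$). *2-cells*: a pair $(\eta,\kappa)\in\mathrm{NT}(\Lambda_k,\Omega_k)\times\mathrm{NT}(\Lambda_{k+1},\Omega_{k+1})$ satisfies the exchange relation if $W^\Omega_{k+1}\circ\Delta_{k+1}(\eta)=\kappa_{\Gamma_{k+1}}\circ W^\Lambda_{k+1}$; $\mathbf{UC}_2(\Lambda_\bullet,\Omega_\bullet)$ is the space of sequences $\{\eta^{(k)}\in\mathrm{NT}(\Lambda_k,\Omega_k)\}_{k\ge0}$ whose consecutive pairs eventually satisfy the exchange relation, modulo the eventually zero ones; a class is written as a truncated representative $\{\eta^{(k)}\}_{k\ge K}$ whose consecutive pairs all satisfy the exchange relation. *Vertical composition* and $*$: componentwise. *Composition of 1-cells* $\Lambda_\bullet:\Gamma_\bullet\to\Delta_\bullet$, $\Omega_\bullet:\Delta_\bullet\to\Sigma_\bullet$: $\Omega_\bullet\boxtimes\Lambda_\bullet$ has functors $\Omega_k\Lambda_k$ and unitaries $\Omega_k(W^\Lambda_k)\circ(W^\Omega_k)_{\Lambda_{k-1}}$. *Horizontal composition* of $\underline\eta:\Lambda^1_\bullet\to\Lambda^2_\bullet$, $\underline\kappa:\Omega^1_\bullet\to\Omega^2_\bullet$: $(\underline\kappa\boxtimes\underline\eta)^{(k)}=\Omega^2_k(\eta^{(k)})\circ\kappa^{(k)}_{\Lambda^1_k}$ for $k$ large. **$\Psi$.**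 For $\Gamma_\bullet$ put $m_0=\bigoplus_{v\in V_{\mathcal M_0}}v$, $x_k=\Gamma_k\cdots\Gamma_1m_0$, $A_k=\mathrm{End}(x_k)$ with unital inclusions $A_{k-1}\ni\alpha\mapsto\Gamma_k\alpha\in A_k$, $A_\infty=\bigcup_kA_k$; let $n_0,B_k,B_\infty$ be the analogous objects for $\Delta_\bullet$. For a 1-cell $\Lambda_\bullet$: $H_k=\mathcal N_k(\Delta_k\cdots\Delta_1n_0,\Lambda_kx_k)$, actions $\alpha\cdot\xi\cdot\beta=\Lambda_k(\alpha)\circ\xi\circ\beta$, inner product $\langle\xi,\zeta\rangle_{B_k}=\zeta^*\circ\xi$, inclusions $\xi\mapsto(W^\Lambda_{k+1})_{x_k}\circ\Delta_{k+1}\xi$ into $H_{k+1}$, $H_\infty=\bigcup_kH_k$. For $\Omega_\bullet:\Gamma_\bullet\to\Delta_\bullet$ with correspondence $G_\infty$ and $\gamma\in\mathcal N_k(\Lambda_kx_k,\Omega_kx_k)$, put $\gamma_0=\gamma$, $\gamma_{j+1}=(W^\Omega_{k+j+1})_{x_{k+j}}\circ\Delta_{k+j+1}(\gamma_j)\circ(W^\Lambda_{k+j+1})^*_{x_{k+j}}$; then $\Phi_\gamma:H_\infty\to G_\infty$ is $\Phi_\gamma(\xi)=\gamma_l\circ\xi$ for $\xi\in H_{k+l}$, $l\geq 0$. For a 2-cell, $\Phi_{\eta^{(k)}_{x_k}}$ does not depend on $k\ge K$. **Target.** 0-cells: AFD pre-C*-algebras, i.e. unital $*$-algebras that are increasing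 unions of finite-dimensional C*-algebras. 1-cells: $A$-$B$ right correspondences (right $B$-modules with $B$-valued inner product and left $A$-action by adjointable operators). 2-cells: adjointable $A$-$B$-linear maps. Composition of 1-cells: relative tensor product $H\otimes_BG$ with $\langle\xi_1\otimes\zeta_1,\xi_2\otimes\zeta_2\rangle_C=\langle\langle\xi_1,\xi_2\rangle_B\zeta_1,\zeta_2\rangle_C$ (modulo null vectors). Tensor-reversing means $\Psi(\Omega_\bullet\boxtimes\Lambda_\bullet)\cong\Psi(\Lambda_\bullet)\otimes_{B_\infty}\Psi(\Omega_\bullet)$, compatibly with 2-cells. *)

theory Defs
  imports Complex_Main "HOL-Library.FuncSet"
begin

section \<open>Complex vector spaces on carrier sets\<close>

definition lsum :: "('v \<Rightarrow> 'v \<Rightarrow> 'v) \<Rightarrow> 'v \<Rightarrow> 'v list \<Rightarrow> 'v" where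
  "lsum add z vs = foldr add vs z"

definition complex_space ::
    "'v set \<Rightarrow> ('v \<Rightarrow> 'v \<Rightarrow> 'v) \<Rightarrow> 'v \<Rightarrow> (complex \<Rightarrow> 'v \<Rightarrow> 'v) \<Rightarrow> bool" where
  "complex_space S add z sc \<longleftrightarrow>
     z \<in> S \<and>
     (\<forall>u\<in>S. \<forall>v\<in>S. add u v \<in> S \<and> add u v = add v u) \<and>
     (\<forall>u\<in>S. \<forall>v\<in>S. \<forall>w\<in>S. add (add u v) w = add u (add v w)) \<and>
     (\<forall>u\<in>S. add z u = u \<and> add u (sc (-1) u) = z) \<and>
     (\<forall>c. \<forall>u\<in>S. sc c u \<in> S) \<and>
     (\<forall>c. \<forall>u\<in>S. \<forall>v\<in>S. sc c (add u v) = add (sc c u) (sc c v)) \<and>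
     (\<forall>c d. \<forall>u\<in>S. sc (c + d) u = add (sc c u) (sc d u) \<and> sc (c * d) u = sc c (sc d u)) \<and>
     (\<forall>u\<in>S. sc 1 u = u)"

definition finite_dim ::
    "'v set \<Rightarrow> ('v \<Rightarrow> 'v \<Rightarrow> 'v) \<Rightarrow> 'v \<Rightarrow> (complex \<Rightarrow> 'v \<Rightarrow> 'v) \<Rightarrow> bool" where
  "finite_dim S add z sc \<longleftrightarrow>
     (\<exists>bs. set bs \<subseteq> S \<and>
        (\<forall>v\<in>S. \<exists>cs. length cs = length bs \<and> v = lsum add z (map2 sc cs bs)))"

definition norm_on ::
    "'v set \<Rightarrow> ('v \<Rightarrow> 'v \<Rightarrow> 'v) \<Rightarrow> 'v \<Rightarrow> (complex \<Rightarrow> 'v \<Rightarrow> 'v) \<Rightarrow> ('v \<Rightarrow> real) \<Rightarrow> bool" where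
  "norm_on S add z sc nm \<longleftrightarrow>
     (\<forall>u\<in>S. 0 \<le> nm u \<and> (nm u = 0 \<longleftrightarrow> u = z)) \<and>
     (\<forall>u\<in>S. \<forall>v\<in>S. nm (add u v) \<le> nm u + nm v) \<and>
     (\<forall>c. \<forall>u\<in>S. nm (sc c u) = cmod c * nm u)"


section \<open>Finite semisimple C*-categories\<close>

record ('o, 'm) cat =
  obj :: "'o set"
  arr :: "'m set"
  src :: "'m \<Rightarrow> 'o"
  tgt :: "'m \<Rightarrow> 'o"
  idn :: "'o \<Rightarrow> 'm"
  cmp :: "'m \<Rightarrow> 'm \<Rightarrow> 'm"    \<comment> \<open>\<open>cmp C g f\<close> is \<open>g\<close> after \<open>f\<close>\<close>
  zer :: "'o \<Rightarrow> 'o \<Rightarrow> 'm"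
  pls :: "'m \<Rightarrow> 'm \<Rightarrow> 'm"
  scl :: "complex \<Rightarrow> 'm \<Rightarrow> 'm"
  adj :: "'m \<Rightarrow> 'm"

definition hom :: "('o, 'm) cat \<Rightarrow> 'o \<Rightarrow> 'o \<Rightarrow> 'm set" where
  "hom C a b = {f \<in> arr C. src C f = a \<and> tgt C f = b}"

definition category :: "('o, 'm) cat \<Rightarrow> bool" where
  "category C \<longleftrightarrow>
     (\<forall>f\<in>arr C. src C f \<in> obj C \<and> tgt C f \<in> obj C) \<and>
     (\<forall>a\<in>obj C. idn C a \<in> hom C a a) \<and>
     (\<forall>f\<in>arr C. \<forall>g\<in>arr C. src C g = tgt C f \<longrightarrow> cmp C g f \<in> hom C (src C f) (tgt C g)) \<and>
     (\<forall>f\<in>arr C. cmp C f (idn C (src C f)) = f \<and> cmp C (idn C (tgt C f)) f = f) \<and>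
     (\<forall>f\<in>arr C. \<forall>g\<in>arr C. \<forall>h\<in>arr C. src C g = tgt C f \<longrightarrow> src C h = tgt C g \<longrightarrow>
        cmp C h (cmp C g f) = cmp C (cmp C h g) f)"

definition star_category :: "('o, 'm) cat \<Rightarrow> bool" where
  "star_category C \<longleftrightarrow> category C \<and>
     (\<forall>a\<in>obj C. \<forall>b\<in>obj C. complex_space (hom C a b) (pls C) (zer C a b) (scl C)) \<and>
     (\<forall>a\<in>obj C. \<forall>b\<in>obj C. \<forall>c\<in>obj C. \<forall>f\<in>hom C a b. \<forall>f'\<in>hom C a b. \<forall>g\<in>hom C b c. \<forall>g'\<in>hom C b c.
        cmp C g (pls C f f') = pls C (cmp C g f) (cmp C g f') \<and>
        cmp C (pls C g g') f = pls C (cmp C g f) (cmp C g' f) \<and>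
        (\<forall>z. cmp C g (scl C z f) = scl C z (cmp C g f) \<and>
             cmp C (scl C z g) f = scl C z (cmp C g f))) \<and>
     (\<forall>a\<in>obj C. \<forall>b\<in>obj C. \<forall>f\<in>hom C a b. \<forall>f'\<in>hom C a b.
        adj C f \<in> hom C b a \<and> adj C (adj C f) = f \<and>
        adj C (pls C f f') = pls C (adj C f) (adj C f') \<and>
        (\<forall>z. adj C (scl C z f) = scl C (cnj z) (adj C f))) \<and>
     (\<forall>f\<in>arr C. \<forall>g\<in>arr C. src C g = tgt C f \<longrightarrow>
        adj C (cmp C g f) = cmp C (adj C f) (adj C g))"

text \<open>A C*-category with finite-dimensional morphism spaces: completeness of the morphism spaces is
  then automatic, and the C*-norm is unique, so that it need not be part of the data.\<close>

definition fd_cstar_category :: "('o, 'm) cat \<Rightarrow> bool" where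
  "fd_cstar_category C \<longleftrightarrow> star_category C \<and>
     (\<forall>a\<in>obj C. \<forall>b\<in>obj C. finite_dim (hom C a b) (pls C) (zer C a b) (scl C)) \<and>
     (\<exists>nm. (\<forall>a\<in>obj C. \<forall>b\<in>obj C. norm_on (hom C a b) (pls C) (zer C a b) (scl C) nm) \<and>
           (\<forall>f\<in>arr C. \<forall>g\<in>arr C. src C g = tgt C f \<longrightarrow> nm (cmp C g f) \<le> nm g * nm f) \<and>
           (\<forall>f\<in>arr C. nm (cmp C (adj C f) f) = (nm f)\<^sup>2)) \<and>
     (\<forall>f\<in>arr C. \<exists>g\<in>hom C (src C f) (src C f). cmp C (adj C f) f = cmp C (adj C g) g)"

definition iso_obj :: "('o, 'm) cat \<Rightarrow> 'o \<Rightarrow> 'o \<Rightarrow> bool" where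
  "iso_obj C a b \<longleftrightarrow>
     (\<exists>f\<in>hom C a b. \<exists>g\<in>hom C b a. cmp C g f = idn C a \<and> cmp C f g = idn C b)"

definition simple_obj :: "('o, 'm) cat \<Rightarrow> 'o \<Rightarrow> bool" where
  "simple_obj C a \<longleftrightarrow> a \<in> obj C \<and> idn C a \<noteq> zer C a a \<and>
     (\<forall>f\<in>hom C a a. \<exists>z. f = scl C z (idn C a))"

text \<open>\<open>m\<close> is an (orthogonal) direct sum of the family of objects \<open>vs\<close>; for \<open>vs = []\<close> a zero object.\<close>

definition direct_sum :: "('o, 'm) cat \<Rightarrow> 'o list \<Rightarrow> 'o \<Rightarrow> bool" where
  "direct_sum C vs m \<longleftrightarrow> m \<in> obj C \<and>
     (\<exists>us. length us = length vs \<and>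
        (\<forall>i<length vs. us ! i \<in> hom C (vs ! i) m) \<and>
        (\<forall>i<length vs. \<forall>j<length vs. cmp C (adj C (us ! i)) (us ! j) =
           (if i = j then idn C (vs ! i) else zer C (vs ! j) (vs ! i))) \<and>
        lsum (pls C) (zer C m m) (map (\<lambda>u. cmp C u (adj C u)) us) = idn C m)"

text \<open>\<open>vs\<close> enumerates a set of representatives of the simple objects.\<close>

definition simple_reps :: "('o, 'm) cat \<Rightarrow> 'o list \<Rightarrow> bool" where
  "simple_reps C vs \<longleftrightarrow>
     (\<forall>v\<in>set vs. simple_obj C v) \<and>
     (\<forall>i<length vs. \<forall>j<length vs. i \<noteq> j \<longrightarrow> \<not> iso_obj C (vs ! i) (vs ! j)) \<and>
     (\<forall>a. simple_obj C a \<longrightarrow> (\<exists>v\<in>set vs. iso_obj C a v))"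

definition finite_semisimple :: "('o, 'm) cat \<Rightarrow> bool" where
  "finite_semisimple C \<longleftrightarrow> fd_cstar_category C \<and>
     (\<forall>vs. set vs \<subseteq> obj C \<longrightarrow> (\<exists>m. direct_sum C vs m)) \<and>
     (\<forall>a\<in>obj C. \<forall>p\<in>hom C a a. cmp C p p = p \<longrightarrow> adj C p = p \<longrightarrow>
        (\<exists>b\<in>obj C. \<exists>u\<in>hom C b a. cmp C (adj C u) u = idn C b \<and> cmp C u (adj C u) = p)) \<and>
     (\<exists>vs. simple_reps C vs)"


section \<open>Functors and natural transformations\<close>

text \<open>Object and arrow maps, and natural transformations, are extensional functions on the relevant
  sets, so that equality is equality of functors and of transformations.\<close>

record ('o, 'm) functr =
  fob :: "'o \<Rightarrow> 'o"
  fmp :: "'m \<Rightarrow> 'm"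

definition star_functor :: "('o, 'm) cat \<Rightarrow> ('o, 'm) cat \<Rightarrow> ('o, 'm) functr \<Rightarrow> bool" where
  "star_functor M N F \<longleftrightarrow>
     fob F \<in> obj M \<rightarrow>\<^sub>E obj N \<and> fmp F \<in> arr M \<rightarrow>\<^sub>E arr N \<and>
     (\<forall>f\<in>arr M. src N (fmp F f) = fob F (src M f) \<and> tgt N (fmp F f) = fob F (tgt M f)) \<and>
     (\<forall>a\<in>obj M. fmp F (idn M a) = idn N (fob F a)) \<and>
     (\<forall>f\<in>arr M. \<forall>g\<in>arr M. src M g = tgt M f \<longrightarrow>
        fmp F (cmp M g f) = cmp N (fmp F g) (fmp F f)) \<and>
     (\<forall>a\<in>obj M. \<forall>b\<in>obj M. \<forall>f\<in>hom M a b. \<forall>g\<in>hom M a b.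
        fmp F (pls M f g) = pls N (fmp F f) (fmp F g)) \<and>
     (\<forall>z. \<forall>f\<in>arr M. fmp F (scl M z f) = scl N z (fmp F f)) \<and>
     (\<forall>f\<in>arr M. fmp F (adj M f) = adj N (fmp F f))"

definition fid :: "('o, 'm) cat \<Rightarrow> ('o, 'm) functr" where
  "fid M = \<lparr>fob = (\<lambda>a\<in>obj M. a), fmp = (\<lambda>f\<in>arr M. f)\<rparr>"

definition fcomp :: "('o, 'm) cat \<Rightarrow> ('o, 'm) functr \<Rightarrow> ('o, 'm) functr \<Rightarrow> ('o, 'm) functr" where
  "fcomp M G F = \<lparr>fob = compose (obj M) (fob G) (fob F), fmp = compose (arr M) (fmp G) (fmp F)\<rparr>"

definition faithful :: "('o, 'm) cat \<Rightarrow> ('o, 'm) functr \<Rightarrow> bool" where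
  "faithful M F \<longleftrightarrow> (\<forall>a\<in>obj M. \<forall>b\<in>obj M. inj_on (fmp F) (hom M a b))"

definition NT ::
    "('o, 'm) cat \<Rightarrow> ('o, 'm) cat \<Rightarrow> ('o, 'm) functr \<Rightarrow> ('o, 'm) functr \<Rightarrow> ('o \<Rightarrow> 'm) set" where
  "NT M N F G = {\<eta> \<in> (\<Pi>\<^sub>E a\<in>obj M. hom N (fob F a) (fob G a)).
     \<forall>f\<in>arr M. cmp N (\<eta> (tgt M f)) (fmp F f) = cmp N (fmp G f) (\<eta> (src M f))}"

text \<open>\<open>F\<close> is left adjoint to \<open>G\<close>. For *-functors the adjoints of unit and counit also make \<open>F\<close> right
  adjoint to \<open>G\<close>, so one speaks of the adjoint, which is unique up to natural isomorphism.\<close>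

definition adjoint_functors ::
    "('o, 'm) cat \<Rightarrow> ('o, 'm) cat \<Rightarrow> ('o, 'm) functr \<Rightarrow> ('o, 'm) functr \<Rightarrow> bool" where
  "adjoint_functors M N F G \<longleftrightarrow>
     (\<exists>\<eta> \<in> NT M M (fid M) (fcomp M G F). \<exists>\<epsilon> \<in> NT N N (fcomp N F G) (fid N).
        (\<forall>a\<in>obj M. cmp N (\<epsilon> (fob F a)) (fmp F (\<eta> a)) = idn N (fob F a)) \<and>
        (\<forall>b\<in>obj N. cmp M (fmp G (\<epsilon> b)) (\<eta> (fob G b)) = idn M (fob G b)))"

definition bifaithful :: "('o, 'm) cat \<Rightarrow> ('o, 'm) cat \<Rightarrow> ('o, 'm) functr \<Rightarrow> bool" where
  "bifaithful M N F \<longleftrightarrow> star_functor M N F \<and> faithful M F \<and>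
     (\<exists>G. star_functor N M G \<and> adjoint_functors M N F G \<and> faithful N G)"


section \<open>Bicategories with *-linear structure on 2-cells, and 2-functors\<close>

text \<open>\<open>Comp g f\<close> and \<open>Horiz \<beta> \<alpha>\<close> are written in functional order, i.e. \<open>Src1 g = Tgt1 f\<close>.
  \<open>Assoc h g f\<close> goes from \<open>(h g) f\<close> to \<open>h (g f)\<close>, \<open>LUnit f\<close> from \<open>1 f\<close> to \<open>f\<close>,
  \<open>RUnit f\<close> from \<open>f 1\<close> to \<open>f\<close>.\<close>

record ('a, 'b, 'c) bicat =
  Cell0 :: "'a set"
  Cell1 :: "'b set"
  Cell2 :: "'c set"
  Src1 :: "'b \<Rightarrow> 'a"
  Tgt1 :: "'b \<Rightarrow> 'a"
  Src2 :: "'c \<Rightarrow> 'b"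
  Tgt2 :: "'c \<Rightarrow> 'b"
  Id1 :: "'a \<Rightarrow> 'b"
  Comp :: "'b \<Rightarrow> 'b \<Rightarrow> 'b"
  Id2 :: "'b \<Rightarrow> 'c"
  Vert :: "'c \<Rightarrow> 'c \<Rightarrow> 'c"
  Horiz :: "'c \<Rightarrow> 'c \<Rightarrow> 'c"
  Assoc :: "'b \<Rightarrow> 'b \<Rightarrow> 'b \<Rightarrow> 'c"
  LUnit :: "'b \<Rightarrow> 'c"
  RUnit :: "'b \<Rightarrow> 'c"
  Add2 :: "'c \<Rightarrow> 'c \<Rightarrow> 'c"
  Scale2 :: "complex \<Rightarrow> 'c \<Rightarrow> 'c"
  Star2 :: "'c \<Rightarrow> 'c"

definition Hom1 :: "('a, 'b, 'c) bicat \<Rightarrow> 'a \<Rightarrow> 'a \<Rightarrow> 'b set" where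
  "Hom1 C a b = {f \<in> Cell1 C. Src1 C f = a \<and> Tgt1 C f = b}"

definition Hom2 :: "('a, 'b, 'c) bicat \<Rightarrow> 'b \<Rightarrow> 'b \<Rightarrow> 'c set" where
  "Hom2 C f g = {\<alpha> \<in> Cell2 C. Src2 C \<alpha> = f \<and> Tgt2 C \<alpha> = g}"

definition Unitary2 :: "('a, 'b, 'c) bicat \<Rightarrow> 'b \<Rightarrow> 'b \<Rightarrow> 'c set" where
  "Unitary2 C f g = {\<alpha> \<in> Hom2 C f g.
     Vert C (Star2 C \<alpha>) \<alpha> = Id2 C f \<and> Vert C \<alpha> (Star2 C \<alpha>) = Id2 C g}"

text \<open>A (pseudo) 2-functor with unitary comparison 2-cells \<open>\<phi> g f : F(g) F(f) \<rightarrow> F(g f)\<close> and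
  \<open>\<upsilon> a : 1 \<rightarrow> F(1)\<close>, natural in the 2-cells and coherent with associators and unitors.\<close>

definition two_functor_with ::
    "('a, 'b, 'c) bicat \<Rightarrow> ('d, 'e, 'f) bicat \<Rightarrow> ('a \<Rightarrow> 'd) \<Rightarrow> ('b \<Rightarrow> 'e) \<Rightarrow> ('c \<Rightarrow> 'f) \<Rightarrow>
     ('b \<Rightarrow> 'b \<Rightarrow> 'f) \<Rightarrow> ('a \<Rightarrow> 'f) \<Rightarrow> bool" where
  "two_functor_with C D F0 F1 F2 \<phi> \<upsilon> \<longleftrightarrow>
     (\<forall>a\<in>Cell0 C. F0 a \<in> Cell0 D) \<and>
     (\<forall>a\<in>Cell0 C. \<forall>b\<in>Cell0 C. \<forall>f\<in>Hom1 C a b. F1 f \<in> Hom1 D (F0 a) (F0 b)) \<and>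
     (\<forall>f\<in>Cell1 C. \<forall>g\<in>Cell1 C. \<forall>\<alpha>\<in>Hom2 C f g. F2 \<alpha> \<in> Hom2 D (F1 f) (F1 g)) \<and>
     (\<forall>f\<in>Cell1 C. F2 (Id2 C f) = Id2 D (F1 f)) \<and>
     (\<forall>\<alpha>\<in>Cell2 C. \<forall>\<beta>\<in>Cell2 C. Src2 C \<beta> = Tgt2 C \<alpha> \<longrightarrow>
        F2 (Vert C \<beta> \<alpha>) = Vert D (F2 \<beta>) (F2 \<alpha>)) \<and>
     (\<forall>f\<in>Cell1 C. \<forall>g\<in>Cell1 C. Src1 C g = Tgt1 C f \<longrightarrow>
        \<phi> g f \<in> Unitary2 D (Comp D (F1 g) (F1 f)) (F1 (Comp C g f))) \<and>
     (\<forall>a\<in>Cell0 C. \<upsilon> a \<in> Unitary2 D (Id1 D (F0 a)) (F1 (Id1 C a))) \<and>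
     (\<forall>\<alpha>\<in>Cell2 C. \<forall>\<beta>\<in>Cell2 C. Src1 C (Src2 C \<beta>) = Tgt1 C (Src2 C \<alpha>) \<longrightarrow>
        Vert D (\<phi> (Tgt2 C \<beta>) (Tgt2 C \<alpha>)) (Horiz D (F2 \<beta>) (F2 \<alpha>)) =
        Vert D (F2 (Horiz C \<beta> \<alpha>)) (\<phi> (Src2 C \<beta>) (Src2 C \<alpha>))) \<and>
     (\<forall>f\<in>Cell1 C. \<forall>g\<in>Cell1 C. \<forall>h\<in>Cell1 C.
        Src1 C g = Tgt1 C f \<longrightarrow> Src1 C h = Tgt1 C g \<longrightarrow>
        Vert D (F2 (Assoc C h g f))
          (Vert D (\<phi> (Comp C h g) f) (Horiz D (\<phi> h g) (Id2 D (F1 f)))) =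
        Vert D (\<phi> h (Comp C g f))
          (Vert D (Horiz D (Id2 D (F1 h)) (\<phi> g f)) (Assoc D (F1 h) (F1 g) (F1 f)))) \<and>
     (\<forall>f\<in>Cell1 C.
        Vert D (F2 (LUnit C f))
          (Vert D (\<phi> (Id1 C (Tgt1 C f)) f) (Horiz D (\<upsilon> (Tgt1 C f)) (Id2 D (F1 f)))) =
        LUnit D (F1 f) \<and>
        Vert D (F2 (RUnit C f))
          (Vert D (\<phi> f (Id1 C (Src1 C f))) (Horiz D (Id2 D (F1 f)) (\<upsilon> (Src1 C f)))) =
        RUnit D (F1 f))"

definition two_functor ::
    "('a, 'b, 'c) bicat \<Rightarrow> ('d, 'e, 'f) bicat \<Rightarrow> ('a \<Rightarrow> 'd) \<Rightarrow> ('b \<Rightarrow> 'e) \<Rightarrow> ('c \<Rightarrow> 'f) \<Rightarrow> bool" where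
  "two_functor C D F0 F1 F2 \<longleftrightarrow> (\<exists>\<phi> \<upsilon>. two_functor_with C D F0 F1 F2 \<phi> \<upsilon>)"

definition star_linear_on_2cells ::
    "('a, 'b, 'c) bicat \<Rightarrow> ('d, 'e, 'f) bicat \<Rightarrow> ('c \<Rightarrow> 'f) \<Rightarrow> bool" where
  "star_linear_on_2cells C D F2 \<longleftrightarrow>
     (\<forall>\<alpha>\<in>Cell2 C. \<forall>\<beta>\<in>Cell2 C. Src2 C \<alpha> = Src2 C \<beta> \<longrightarrow> Tgt2 C \<alpha> = Tgt2 C \<beta> \<longrightarrow>
        F2 (Add2 C \<alpha> \<beta>) = Add2 D (F2 \<alpha>) (F2 \<beta>)) \<and>
     (\<forall>z. \<forall>\<alpha>\<in>Cell2 C. F2 (Scale2 C z \<alpha>) = Scale2 D z (F2 \<alpha>)) \<and>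
     (\<forall>\<alpha>\<in>Cell2 C. F2 (Star2 C \<alpha>) = Star2 D (F2 \<alpha>))"

definition fully_faithful_on_2cells ::
    "('a, 'b, 'c) bicat \<Rightarrow> ('d, 'e, 'f) bicat \<Rightarrow> ('b \<Rightarrow> 'e) \<Rightarrow> ('c \<Rightarrow> 'f) \<Rightarrow> bool" where
  "fully_faithful_on_2cells C D F1 F2 \<longleftrightarrow>
     (\<forall>f\<in>Cell1 C. \<forall>g\<in>Cell1 C. Src1 C f = Src1 C g \<longrightarrow> Tgt1 C f = Tgt1 C g \<longrightarrow>
        bij_betw F2 (Hom2 C f g) (Hom2 D (F1 f) (F1 g)))"


section \<open>The 2-category of unitary connections\<close>

text \<open>Index shift: \<open>gam \<Gamma> k\<close> is $\Gamma_{k+1}$, from \<open>cats \<Gamma> k\<close> to \<open>cats \<Gamma> (Suc k)\<close>, and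
  \<open>ucon \<Lambda> k\<close> is $W_{k+1}$.\<close>

record ('o, 'm) ucell0 =
  cats :: "nat \<Rightarrow> ('o, 'm) cat"
  gam :: "nat \<Rightarrow> ('o, 'm) functr"

record ('o, 'm) ucell1 =
  udom :: "('o, 'm) ucell0"
  ucod :: "('o, 'm) ucell0"
  ufun :: "nat \<Rightarrow> ('o, 'm) functr"
  ucon :: "nat \<Rightarrow> 'o \<Rightarrow> 'm"

text \<open>A 2-cell is a class of sequences of natural transformations, with source and target 1-cells.\<close>

record ('o, 'm) ucell2 =
  usrc :: "('o, 'm) ucell1"
  utgt :: "('o, 'm) ucell1"
  ucls :: "(nat \<Rightarrow> 'o \<Rightarrow> 'm) set"

definition uc0 :: "('o, 'm) ucell0 set" where
  "uc0 = {\<Gamma>. \<forall>k. finite_semisimple (cats \<Gamma> k) \<and>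
                  bifaithful (cats \<Gamma> k) (cats \<Gamma> (Suc k)) (gam \<Gamma> k)}"

definition uc1 :: "('o, 'm) ucell1 set" where
  "uc1 = {\<Lambda>. udom \<Lambda> \<in> uc0 \<and> ucod \<Lambda> \<in> uc0 \<and>
     (\<forall>k. let M = cats (udom \<Lambda>); N = cats (ucod \<Lambda>) in
        bifaithful (M k) (N k) (ufun \<Lambda> k) \<and>
        ucon \<Lambda> k \<in> NT (M k) (N (Suc k))
          (fcomp (M k) (gam (ucod \<Lambda>) k) (ufun \<Lambda> k))
          (fcomp (M k) (ufun \<Lambda> (Suc k)) (gam (udom \<Lambda>) k)) \<and>
        (\<forall>a\<in>obj (M k). let w = ucon \<Lambda> k a in
           cmp (N (Suc k)) (adj (N (Suc k)) w) w = idn (N (Suc k)) (src (N (Suc k)) w) \<and>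
           cmp (N (Suc k)) w (adj (N (Suc k)) w) = idn (N (Suc k)) (tgt (N (Suc k)) w)))}"

definition exchange ::
    "('o, 'm) ucell1 \<Rightarrow> ('o, 'm) ucell1 \<Rightarrow> nat \<Rightarrow> ('o \<Rightarrow> 'm) \<Rightarrow> ('o \<Rightarrow> 'm) \<Rightarrow> bool" where
  "exchange \<Lambda> \<Omega> k \<eta> \<kappa> \<longleftrightarrow>
     (\<forall>a\<in>obj (cats (udom \<Lambda>) k). let N = cats (ucod \<Lambda>) (Suc k) in
        cmp N (ucon \<Omega> k a) (fmp (gam (ucod \<Lambda>) k) (\<eta> a)) =
        cmp N (\<kappa> (fob (gam (udom \<Lambda>) k) a)) (ucon \<Lambda> k a))"

definition uc_seqs ::
    "('o, 'm) ucell1 \<Rightarrow> ('o, 'm) ucell1 \<Rightarrow> (nat \<Rightarrow> 'o \<Rightarrow> 'm) set" where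
  "uc_seqs \<Lambda> \<Omega> = {\<eta>.
     (\<forall>k. \<eta> k \<in> NT (cats (udom \<Lambda>) k) (cats (ucod \<Lambda>) k) (ufun \<Lambda> k) (ufun \<Omega> k)) \<and>
     (\<forall>\<^sub>F k in sequentially. exchange \<Lambda> \<Omega> k (\<eta> k) (\<eta> (Suc k)))}"

text \<open>Working modulo eventually zero sequences: two sequences are identified iff they eventually agree.\<close>

definition uc_rel ::
    "('o, 'm) ucell1 \<Rightarrow> ('o, 'm) ucell1 \<Rightarrow> ((nat \<Rightarrow> 'o \<Rightarrow> 'm) \<times> (nat \<Rightarrow> 'o \<Rightarrow> 'm)) set" where
  "uc_rel \<Lambda> \<Omega> = {(\<eta>, \<eta>'). \<eta> \<in> uc_seqs \<Lambda> \<Omega> \<and> \<eta>' \<in> uc_seqs \<Lambda> \<Omega> \<and>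
     (\<forall>\<^sub>F k in sequentially. \<eta> k = \<eta>' k)}"

definition uc2 :: "('o, 'm) ucell2 set" where
  "uc2 = {\<eta>. usrc \<eta> \<in> uc1 \<and> utgt \<eta> \<in> uc1 \<and>
     udom (usrc \<eta>) = udom (utgt \<eta>) \<and> ucod (usrc \<eta>) = ucod (utgt \<eta>) \<and>
     ucls \<eta> \<in> uc_seqs (usrc \<eta>) (utgt \<eta>) // uc_rel (usrc \<eta>) (utgt \<eta>)}"

definition uc_id1 :: "('o, 'm) ucell0 \<Rightarrow> ('o, 'm) ucell1" where
  "uc_id1 \<Gamma> = \<lparr>udom = \<Gamma>, ucod = \<Gamma>, ufun = (\<lambda>k. fid (cats \<Gamma> k)),
     ucon = (\<lambda>k. \<lambda>a\<in>obj (cats \<Gamma> k). idn (cats \<Gamma> (Suc k)) (fob (gam \<Gamma> k) a))\<rparr>"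

definition uc_comp :: "('o, 'm) ucell1 \<Rightarrow> ('o, 'm) ucell1 \<Rightarrow> ('o, 'm) ucell1" where
  "uc_comp \<Omega> \<Lambda> = \<lparr>udom = udom \<Lambda>, ucod = ucod \<Omega>,
     ufun = (\<lambda>k. fcomp (cats (udom \<Lambda>) k) (ufun \<Omega> k) (ufun \<Lambda> k)),
     ucon = (\<lambda>k. \<lambda>a\<in>obj (cats (udom \<Lambda>) k).
       cmp (cats (ucod \<Omega>) (Suc k))
         (fmp (ufun \<Omega> (Suc k)) (ucon \<Lambda> k a)) (ucon \<Omega> k (fob (ufun \<Lambda> k) a)))\<rparr>"

text \<open>The class of all admissible sequences that eventually agree with some sequence from \<open>S\<close>.\<close>

definition uc_class ::
    "('o, 'm) ucell1 \<Rightarrow> ('o, 'm) ucell1 \<Rightarrow> (nat \<Rightarrow> 'o \<Rightarrow> 'm) set \<Rightarrow> ('o, 'm) ucell2" where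
  "uc_class \<Lambda> \<Omega> S = \<lparr>usrc = \<Lambda>, utgt = \<Omega>,
     ucls = {\<theta> \<in> uc_seqs \<Lambda> \<Omega>. \<exists>\<theta>'\<in>S. \<forall>\<^sub>F k in sequentially. \<theta> k = \<theta>' k}\<rparr>"

abbreviation uobj :: "('o, 'm) ucell2 \<Rightarrow> nat \<Rightarrow> 'o set" where
  "uobj \<eta> k \<equiv> obj (cats (udom (usrc \<eta>)) k)"

abbreviation utcat :: "('o, 'm) ucell2 \<Rightarrow> nat \<Rightarrow> ('o, 'm) cat" where
  "utcat \<eta> k \<equiv> cats (ucod (usrc \<eta>)) k"

definition uc_id2 :: "('o, 'm) ucell1 \<Rightarrow> ('o, 'm) ucell2" where
  "uc_id2 \<Lambda> = uc_class \<Lambda> \<Lambda>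
     {\<lambda>k. \<lambda>a\<in>obj (cats (udom \<Lambda>) k). idn (cats (ucod \<Lambda>) k) (fob (ufun \<Lambda> k) a)}"

definition uc_vert :: "('o, 'm) ucell2 \<Rightarrow> ('o, 'm) ucell2 \<Rightarrow> ('o, 'm) ucell2" where
  "uc_vert \<kappa> \<eta> = uc_class (usrc \<eta>) (utgt \<kappa>)
     {\<lambda>k. \<lambda>a\<in>uobj \<eta> k. cmp (utcat \<eta> k) (g k a) (h k a) | g h. g \<in> ucls \<kappa> \<and> h \<in> ucls \<eta>}"

definition uc_horiz :: "('o, 'm) ucell2 \<Rightarrow> ('o, 'm) ucell2 \<Rightarrow> ('o, 'm) ucell2" where
  "uc_horiz \<kappa> \<eta> = uc_class (uc_comp (usrc \<kappa>) (usrc \<eta>)) (uc_comp (utgt \<kappa>) (utgt \<eta>))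
     {\<lambda>k. \<lambda>a\<in>uobj \<eta> k. cmp (utcat \<kappa> k)
        (fmp (ufun (utgt \<kappa>) k) (h k a)) (g k (fob (ufun (usrc \<eta>) k) a))
      | g h. g \<in> ucls \<kappa> \<and> h \<in> ucls \<eta>}"

definition uc_add :: "('o, 'm) ucell2 \<Rightarrow> ('o, 'm) ucell2 \<Rightarrow> ('o, 'm) ucell2" where
  "uc_add \<kappa> \<eta> = uc_class (usrc \<eta>) (utgt \<eta>)
     {\<lambda>k. \<lambda>a\<in>uobj \<eta> k. pls (utcat \<eta> k) (g k a) (h k a) | g h. g \<in> ucls \<kappa> \<and> h \<in> ucls \<eta>}"

definition uc_scale :: "complex \<Rightarrow> ('o, 'm) ucell2 \<Rightarrow> ('o, 'm) ucell2" where
  "uc_scale z \<eta> = uc_class (usrc \<eta>) (utgt \<eta>)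
     {\<lambda>k. \<lambda>a\<in>uobj \<eta> k. scl (utcat \<eta> k) z (h k a) | h. h \<in> ucls \<eta>}"

definition uc_star :: "('o, 'm) ucell2 \<Rightarrow> ('o, 'm) ucell2" where
  "uc_star \<eta> = uc_class (utgt \<eta>) (usrc \<eta>)
     {\<lambda>k. \<lambda>a\<in>uobj \<eta> k. adj (utcat \<eta> k) (h k a) | h. h \<in> ucls \<eta>}"

text \<open>Composition of 1-cells is strictly associative and unital, so the constraint 2-cells are identities.\<close>

definition UC :: "(('o, 'm) ucell0, ('o, 'm) ucell1, ('o, 'm) ucell2) bicat" where
  "UC = \<lparr>Cell0 = uc0, Cell1 = uc1, Cell2 = uc2,
     Src1 = udom, Tgt1 = ucod, Src2 = usrc, Tgt2 = utgt,
     Id1 = uc_id1, Comp = uc_comp, Id2 = uc_id2, Vert = uc_vert, Horiz = uc_horiz,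
     Assoc = (\<lambda>h g f. uc_id2 (uc_comp h (uc_comp g f))), LUnit = uc_id2, RUnit = uc_id2,
     Add2 = uc_add, Scale2 = uc_scale, Star2 = uc_star\<rparr>"


section \<open>Right correspondences over AFD pre-C*-algebras\<close>

record 'e alg =
  acar :: "'e set"
  aadd :: "'e \<Rightarrow> 'e \<Rightarrow> 'e"
  azero :: "'e"
  ascl :: "complex \<Rightarrow> 'e \<Rightarrow> 'e"
  amul :: "'e \<Rightarrow> 'e \<Rightarrow> 'e"
  aone :: "'e"
  astar :: "'e \<Rightarrow> 'e"

definition star_algebra :: "'e alg \<Rightarrow> bool" where
  "star_algebra A \<longleftrightarrow> complex_space (acar A) (aadd A) (azero A) (ascl A) \<and>
     aone A \<in> acar A \<and>
     (\<forall>x\<in>acar A. amul A (aone A) x = x \<and> amul A x (aone A) = x \<and>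
        astar A x \<in> acar A \<and> astar A (astar A x) = x) \<and>
     (\<forall>x\<in>acar A. \<forall>y\<in>acar A. amul A x y \<in> acar A \<and>
        astar A (amul A x y) = amul A (astar A y) (astar A x) \<and>
        astar A (aadd A x y) = aadd A (astar A x) (astar A y) \<and>
        (\<forall>z. amul A (ascl A z x) y = ascl A z (amul A x y) \<and>
             amul A x (ascl A z y) = ascl A z (amul A x y) \<and>
             astar A (ascl A z x) = ascl A (cnj z) (astar A x))) \<and>
     (\<forall>x\<in>acar A. \<forall>y\<in>acar A. \<forall>w\<in>acar A.
        amul A (amul A x y) w = amul A x (amul A y w) \<and>
        amul A (aadd A x y) w = aadd A (amul A x w) (amul A y w) \<and>
        amul A w (aadd A x y) = aadd A (amul A w x) (amul A w y))"

definition fd_cstar_algebra :: "'e alg \<Rightarrow> bool" where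
  "fd_cstar_algebra A \<longleftrightarrow> star_algebra A \<and>
     finite_dim (acar A) (aadd A) (azero A) (ascl A) \<and>
     (\<exists>nm. norm_on (acar A) (aadd A) (azero A) (ascl A) nm \<and>
        (\<forall>x\<in>acar A. \<forall>y\<in>acar A. nm (amul A x y) \<le> nm x * nm y) \<and>
        (\<forall>x\<in>acar A. nm (amul A (astar A x) x) = (nm x)\<^sup>2))"

definition afd_pre_cstar_algebra :: "'e alg \<Rightarrow> bool" where
  "afd_pre_cstar_algebra A \<longleftrightarrow> star_algebra A \<and>
     (\<exists>S :: nat \<Rightarrow> 'e set. (\<forall>k. S k \<subseteq> S (Suc k)) \<and> (\<Union>k. S k) = acar A \<and>
        (\<forall>k. fd_cstar_algebra (A\<lparr>acar := S k\<rparr>)))"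

text \<open>Positivity in a union of finite-dimensional C*-algebras.\<close>

definition apos :: "'e alg \<Rightarrow> 'e \<Rightarrow> bool" where
  "apos A x \<longleftrightarrow> (\<exists>y\<in>acar A. x = amul A (astar A y) y)"

text \<open>Vectors of correspondences are drawn from a type closed under formal sums of pairs of vectors, so
  that the relative tensor product of two correspondences is again one over the same type.\<close>

datatype 'e tvec = Elem (elem: 'e) | Formal (terms: "('e tvec \<times> 'e tvec) list")

record 'e corr =
  lalg :: "'e alg"
  ralg :: "'e alg"
  hcar :: "'e tvec set"
  hadd :: "'e tvec \<Rightarrow> 'e tvec \<Rightarrow> 'e tvec"
  hzero :: "'e tvec"
  hscl :: "complex \<Rightarrow> 'e tvec \<Rightarrow> 'e tvec"
  lact :: "'e \<Rightarrow> 'e tvec \<Rightarrow> 'e tvec"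
  ract :: "'e tvec \<Rightarrow> 'e \<Rightarrow> 'e tvec"
  hip :: "'e tvec \<Rightarrow> 'e tvec \<Rightarrow> 'e"   \<comment> \<open>linear in the first variable\<close>

definition right_correspondence :: "'e corr \<Rightarrow> bool" where
  "right_correspondence H \<longleftrightarrow>
     afd_pre_cstar_algebra (lalg H) \<and> afd_pre_cstar_algebra (ralg H) \<and>
     complex_space (hcar H) (hadd H) (hzero H) (hscl H) \<and>
     (\<forall>x\<in>hcar H. \<forall>b\<in>acar (ralg H). ract H x b \<in> hcar H \<and>
        (\<forall>b'\<in>acar (ralg H).
           ract H x (amul (ralg H) b b') = ract H (ract H x b) b' \<and>
           ract H x (aadd (ralg H) b b') = hadd H (ract H x b) (ract H x b')) \<and>
        (\<forall>y\<in>hcar H. ract H (hadd H x y) b = hadd H (ract H x b) (ract H y b)) \<and>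
        (\<forall>z. ract H (hscl H z x) b = hscl H z (ract H x b) \<and>
             ract H x (ascl (ralg H) z b) = hscl H z (ract H x b))) \<and>
     (\<forall>x\<in>hcar H. \<forall>a\<in>acar (lalg H). lact H a x \<in> hcar H \<and>
        (\<forall>a'\<in>acar (lalg H).
           lact H (amul (lalg H) a a') x = lact H a (lact H a' x) \<and>
           lact H (aadd (lalg H) a a') x = hadd H (lact H a x) (lact H a' x)) \<and>
        (\<forall>y\<in>hcar H. lact H a (hadd H x y) = hadd H (lact H a x) (lact H a y)) \<and>
        (\<forall>z. lact H a (hscl H z x) = hscl H z (lact H a x) \<and>
             lact H (ascl (lalg H) z a) x = hscl H z (lact H a x)) \<and>
        (\<forall>b\<in>acar (ralg H). lact H a (ract H x b) = ract H (lact H a x) b) \<and>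
        (\<forall>y\<in>hcar H. hip H (lact H a x) y = hip H x (lact H (astar (lalg H) a) y))) \<and>
     (\<forall>x\<in>hcar H. ract H x (aone (ralg H)) = x \<and> lact H (aone (lalg H)) x = x) \<and>
     (\<forall>x\<in>hcar H. \<forall>y\<in>hcar H. hip H x y \<in> acar (ralg H) \<and>
        hip H y x = astar (ralg H) (hip H x y) \<and>
        (\<forall>w\<in>hcar H. hip H (hadd H x w) y = aadd (ralg H) (hip H x y) (hip H w y)) \<and>
        (\<forall>z. hip H (hscl H z x) y = ascl (ralg H) z (hip H x y)) \<and>
        (\<forall>b\<in>acar (ralg H). hip H (ract H x b) y = amul (ralg H) (hip H x y) b)) \<and>
     (\<forall>x\<in>hcar H. apos (ralg H) (hip H x x) \<and> (hip H x x = azero (ralg H) \<longrightarrow> x = hzero H))"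

definition adjoint_maps :: "'e corr \<Rightarrow> 'e corr \<Rightarrow> ('e tvec \<Rightarrow> 'e tvec) \<Rightarrow> ('e tvec \<Rightarrow> 'e tvec) \<Rightarrow> bool" where
  "adjoint_maps H G T S \<longleftrightarrow> S \<in> hcar G \<rightarrow>\<^sub>E hcar H \<and>
     (\<forall>x\<in>hcar H. \<forall>y\<in>hcar G. hip G (T x) y = hip H x (S y))"

definition intertwiners :: "'e corr \<Rightarrow> 'e corr \<Rightarrow> ('e tvec \<Rightarrow> 'e tvec) set" where
  "intertwiners H G = {T \<in> hcar H \<rightarrow>\<^sub>E hcar G.
     (\<forall>x\<in>hcar H. \<forall>y\<in>hcar H. T (hadd H x y) = hadd G (T x) (T y)) \<and>
     (\<forall>z. \<forall>x\<in>hcar H. T (hscl H z x) = hscl G z (T x)) \<and>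
     (\<forall>a\<in>acar (lalg H). \<forall>x\<in>hcar H. T (lact H a x) = lact G a (T x)) \<and>
     (\<forall>b\<in>acar (ralg H). \<forall>x\<in>hcar H. T (ract H x b) = ract G (T x) b) \<and>
     (\<exists>S. adjoint_maps H G T S)}"

record 'e ccell2 =
  csrc :: "'e corr"
  ctgt :: "'e corr"
  cmap :: "'e tvec \<Rightarrow> 'e tvec"

definition corr2 :: "'e ccell2 set" where
  "corr2 = {t. right_correspondence (csrc t) \<and> right_correspondence (ctgt t) \<and>
     lalg (csrc t) = lalg (ctgt t) \<and> ralg (csrc t) = ralg (ctgt t) \<and>
     cmap t \<in> intertwiners (csrc t) (ctgt t)}"

definition corr_id1 :: "'e alg \<Rightarrow> 'e corr" where
  "corr_id1 A = \<lparr>lalg = A, ralg = A, hcar = Elem ` acar A,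
     hadd = (\<lambda>x y. Elem (aadd A (elem x) (elem y))), hzero = Elem (azero A),
     hscl = (\<lambda>z x. Elem (ascl A z (elem x))),
     lact = (\<lambda>a x. Elem (amul A a (elem x))), ract = (\<lambda>x b. Elem (amul A (elem x) b)),
     hip = (\<lambda>x y. amul A (astar A (elem y)) (elem x))\<rparr>"

text \<open>Relative tensor product: formal sums of simple tensors, given as lists of pairs, with the
  sesquilinear extension of $\langle\langle\xi_1,\xi_2\rangle\zeta_1,\zeta_2\rangle$, modulo null vectors.
  Each class is represented by a chosen formal sum in it.\<close>

definition tens_sums :: "'e corr \<Rightarrow> 'e corr \<Rightarrow> ('e tvec \<times> 'e tvec) list set" where
  "tens_sums H G = {s. set s \<subseteq> hcar H \<times> hcar G}"

definition tens_ip ::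
    "'e corr \<Rightarrow> 'e corr \<Rightarrow> ('e tvec \<times> 'e tvec) list \<Rightarrow> ('e tvec \<times> 'e tvec) list \<Rightarrow> 'e" where
  "tens_ip H G s t = lsum (aadd (ralg G)) (azero (ralg G))
     (map (\<lambda>((\<xi>1, \<zeta>1), (\<xi>2, \<zeta>2)). hip G (lact G (hip H \<xi>1 \<xi>2) \<zeta>1) \<zeta>2) (List.product s t))"

definition tens_scl :: "'e corr \<Rightarrow> complex \<Rightarrow> ('e tvec \<times> 'e tvec) list \<Rightarrow> ('e tvec \<times> 'e tvec) list" where
  "tens_scl H z = map (\<lambda>(\<xi>, \<zeta>). (hscl H z \<xi>, \<zeta>))"

definition tens_eq ::
    "'e corr \<Rightarrow> 'e corr \<Rightarrow> ('e tvec \<times> 'e tvec) list \<Rightarrow> ('e tvec \<times> 'e tvec) list \<Rightarrow> bool" where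
  "tens_eq H G s t \<longleftrightarrow>
     (let d = s @ tens_scl H (-1) t in tens_ip H G d d = azero (ralg G))"

definition tens_cls :: "'e corr \<Rightarrow> 'e corr \<Rightarrow> ('e tvec \<times> 'e tvec) list \<Rightarrow> 'e tvec" where
  "tens_cls H G s = Formal (SOME t. t \<in> tens_sums H G \<and> tens_eq H G t s)"

definition tensor :: "'e corr \<Rightarrow> 'e corr \<Rightarrow> 'e corr" where
  "tensor H G = \<lparr>lalg = lalg H, ralg = ralg G, hcar = tens_cls H G ` tens_sums H G,
     hadd = (\<lambda>x y. tens_cls H G (terms x @ terms y)), hzero = tens_cls H G [],
     hscl = (\<lambda>z x. tens_cls H G (tens_scl H z (terms x))),
     lact = (\<lambda>a x. tens_cls H G (map (\<lambda>(\<xi>, \<zeta>). (lact H a \<xi>, \<zeta>)) (terms x))),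
     ract = (\<lambda>x c. tens_cls H G (map (\<lambda>(\<xi>, \<zeta>). (\<xi>, ract G \<zeta> c)) (terms x))),
     hip = (\<lambda>x y. tens_ip H G (terms x) (terms y))\<rparr>"

definition corr_id2 :: "'e corr \<Rightarrow> 'e ccell2" where
  "corr_id2 H = \<lparr>csrc = H, ctgt = H, cmap = (\<lambda>x\<in>hcar H. x)\<rparr>"

definition corr_vert :: "'e ccell2 \<Rightarrow> 'e ccell2 \<Rightarrow> 'e ccell2" where
  "corr_vert t s = \<lparr>csrc = csrc s, ctgt = ctgt t, cmap = compose (hcar (csrc s)) (cmap t) (cmap s)\<rparr>"

definition corr_tensor2 :: "'e ccell2 \<Rightarrow> 'e ccell2 \<Rightarrow> 'e ccell2" where
  "corr_tensor2 s t = \<lparr>csrc = tensor (csrc s) (csrc t), ctgt = tensor (ctgt s) (ctgt t),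
     cmap = (\<lambda>x\<in>hcar (tensor (csrc s) (csrc t)).
       tens_cls (ctgt s) (ctgt t) (map (\<lambda>(\<xi>, \<zeta>). (cmap s \<xi>, cmap t \<zeta>)) (terms x)))\<rparr>"

text \<open>$\xi\otimes(\zeta\otimes\kappa)\mapsto(\xi\otimes\zeta)\otimes\kappa$.\<close>

definition corr_reassoc :: "'e corr \<Rightarrow> 'e corr \<Rightarrow> 'e corr \<Rightarrow> 'e ccell2" where
  "corr_reassoc H G K = \<lparr>csrc = tensor H (tensor G K), ctgt = tensor (tensor H G) K,
     cmap = (\<lambda>x\<in>hcar (tensor H (tensor G K)). tens_cls (tensor H G) K
       (concat (map (\<lambda>(\<xi>, y). map (\<lambda>(\<zeta>, \<kappa>). (tens_cls H G [(\<xi>, \<zeta>)], \<kappa>)) (terms y)) (terms x))))\<rparr>"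

text \<open>$\xi\otimes b\mapsto\xi b$ and $a\otimes\xi\mapsto a\xi$.\<close>

definition corr_unit_right :: "'e corr \<Rightarrow> 'e ccell2" where
  "corr_unit_right H = \<lparr>csrc = tensor H (corr_id1 (ralg H)), ctgt = H,
     cmap = (\<lambda>x\<in>hcar (tensor H (corr_id1 (ralg H))).
       lsum (hadd H) (hzero H) (map (\<lambda>(\<xi>, b). ract H \<xi> (elem b)) (terms x)))\<rparr>"

definition corr_unit_left :: "'e corr \<Rightarrow> 'e ccell2" where
  "corr_unit_left H = \<lparr>csrc = tensor (corr_id1 (lalg H)) H, ctgt = H,
     cmap = (\<lambda>x\<in>hcar (tensor (corr_id1 (lalg H)) H).
       lsum (hadd H) (hzero H) (map (\<lambda>(a, \<xi>). lact H (elem a) \<xi>) (terms x)))\<rparr>"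

definition corr_add :: "'e ccell2 \<Rightarrow> 'e ccell2 \<Rightarrow> 'e ccell2" where
  "corr_add s t = \<lparr>csrc = csrc s, ctgt = ctgt s,
     cmap = (\<lambda>x\<in>hcar (csrc s). hadd (ctgt s) (cmap s x) (cmap t x))\<rparr>"

definition corr_scale :: "complex \<Rightarrow> 'e ccell2 \<Rightarrow> 'e ccell2" where
  "corr_scale z s = \<lparr>csrc = csrc s, ctgt = ctgt s,
     cmap = (\<lambda>x\<in>hcar (csrc s). hscl (ctgt s) z (cmap s x))\<rparr>"

definition corr_star :: "'e ccell2 \<Rightarrow> 'e ccell2" where
  "corr_star s = \<lparr>csrc = ctgt s, ctgt = csrc s,
     cmap = (THE S. adjoint_maps (csrc s) (ctgt s) (cmap s) S)\<rparr>"

text \<open>An $A$-$B$ correspondence is a 1-cell from $A$ to $B$. As compositions in \<open>bicat\<close> are in functional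
  order, the composite of \<open>G\<close> after \<open>H\<close> is \<open>tensor H G\<close>: a 2-functor into \<open>CORR\<close> has comparison maps
  $F(f)\otimes F(g)\cong F(g f)$, i.e. it reverses tensor products.\<close>

definition CORR :: "('e alg, 'e corr, 'e ccell2) bicat" where
  "CORR = \<lparr>Cell0 = Collect afd_pre_cstar_algebra, Cell1 = Collect right_correspondence, Cell2 = corr2,
     Src1 = lalg, Tgt1 = ralg, Src2 = csrc, Tgt2 = ctgt,
     Id1 = corr_id1, Comp = (\<lambda>G H. tensor H G),
     Id2 = corr_id2, Vert = corr_vert, Horiz = (\<lambda>t s. corr_tensor2 s t),
     Assoc = (\<lambda>K G H. corr_reassoc H G K), LUnit = corr_unit_right, RUnit = corr_unit_left,
     Add2 = corr_add, Scale2 = corr_scale, Star2 = corr_star\<rparr>"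


section \<open>Inductive limits of sequences of inclusions\<close>

record 'v tower =
  lev :: "nat \<Rightarrow> 'v set"
  inc :: "nat \<Rightarrow> 'v \<Rightarrow> 'v"    \<comment> \<open>\<open>inc T k\<close> maps \<open>lev T k\<close> to \<open>lev T (Suc k)\<close>\<close>

primrec push :: "'v tower \<Rightarrow> nat \<Rightarrow> nat \<Rightarrow> 'v \<Rightarrow> 'v" where
  "push T k 0 v = v"
| "push T k (Suc j) v = inc T (k + j) (push T k j v)"

text \<open>The element of the limit given by \<open>v\<close> at level \<open>k\<close>.\<close>

definition germ :: "'v tower \<Rightarrow> nat \<Rightarrow> 'v \<Rightarrow> (nat \<times> 'v) set" where
  "germ T k v = {(l, w). w \<in> lev T l \<and> (\<exists>i j. k + i = l + j \<and> push T k i v = push T l j w)}"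

definition lim_set :: "'v tower \<Rightarrow> (nat \<times> 'v) set set" where
  "lim_set T = {germ T k v | k v. v \<in> lev T k}"

text \<open>Extension of levelwise operations to the limit.\<close>

definition lim1 :: "'v tower \<Rightarrow> 'v tower \<Rightarrow> (nat \<Rightarrow> 'v \<Rightarrow> 'v) \<Rightarrow> (nat \<times> 'v) set \<Rightarrow> (nat \<times> 'v) set" where
  "lim1 S T f x = (THE z. \<exists>k. \<exists>s\<in>lev S k. x = germ S k s \<and> z = germ T k (f k s))"

definition lim2 ::
    "'v tower \<Rightarrow> 'v tower \<Rightarrow> 'v tower \<Rightarrow> (nat \<Rightarrow> 'v \<Rightarrow> 'v \<Rightarrow> 'v) \<Rightarrow>
     (nat \<times> 'v) set \<Rightarrow> (nat \<times> 'v) set \<Rightarrow> (nat \<times> 'v) set" where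
  "lim2 R S T f x y = (THE z. \<exists>k. \<exists>r\<in>lev R k. \<exists>s\<in>lev S k.
     x = germ R k r \<and> y = germ S k s \<and> z = germ T k (f k r s))"


section \<open>The assignment \<open>\<Psi>\<close>\<close>

text \<open>The parameter \<open>b\<close> chooses, for each category, a direct sum of representatives of its simple objects.\<close>

definition base_choice :: "(('o, 'm) cat \<Rightarrow> 'o) \<Rightarrow> bool" where
  "base_choice b \<longleftrightarrow> (\<forall>M. finite_semisimple M \<longrightarrow> (\<exists>vs. simple_reps M vs \<and> direct_sum M vs (b M)))"

primrec xob :: "(('o, 'm) cat \<Rightarrow> 'o) \<Rightarrow> ('o, 'm) ucell0 \<Rightarrow> nat \<Rightarrow> 'o" where
  "xob b \<Gamma> 0 = b (cats \<Gamma> 0)"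
| "xob b \<Gamma> (Suc k) = fob (gam \<Gamma> k) (xob b \<Gamma> k)"

definition alg_tower :: "(('o, 'm) cat \<Rightarrow> 'o) \<Rightarrow> ('o, 'm) ucell0 \<Rightarrow> 'm tower" where
  "alg_tower b \<Gamma> = \<lparr>lev = (\<lambda>k. hom (cats \<Gamma> k) (xob b \<Gamma> k) (xob b \<Gamma> k)), inc = (\<lambda>k. fmp (gam \<Gamma> k))\<rparr>"

definition Psi0 :: "(('o, 'm) cat \<Rightarrow> 'o) \<Rightarrow> ('o, 'm) ucell0 \<Rightarrow> (nat \<times> 'm) set alg" where
  "Psi0 b \<Gamma> = (let T = alg_tower b \<Gamma>; M = cats \<Gamma>; x = xob b \<Gamma> in
     \<lparr>acar = lim_set T,
      aadd = lim2 T T T (\<lambda>k. pls (M k)),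
      azero = germ T 0 (zer (M 0) (x 0) (x 0)),
      ascl = (\<lambda>z. lim1 T T (\<lambda>k. scl (M k) z)),
      amul = lim2 T T T (\<lambda>k. cmp (M k)),
      aone = germ T 0 (idn (M 0) (x 0)),
      astar = lim1 T T (\<lambda>k. adj (M k))\<rparr>)"

definition corr_tower :: "(('o, 'm) cat \<Rightarrow> 'o) \<Rightarrow> ('o, 'm) ucell1 \<Rightarrow> 'm tower" where
  "corr_tower b \<Lambda> = (let x = xob b (udom \<Lambda>); y = xob b (ucod \<Lambda>); N = cats (ucod \<Lambda>) in
     \<lparr>lev = (\<lambda>k. hom (N k) (y k) (fob (ufun \<Lambda> k) (x k))),
      inc = (\<lambda>k \<xi>. cmp (N (Suc k)) (ucon \<Lambda> k (x k)) (fmp (gam (ucod \<Lambda>) k) \<xi>))\<rparr>)"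

definition Psi1 :: "(('o, 'm) cat \<Rightarrow> 'o) \<Rightarrow> ('o, 'm) ucell1 \<Rightarrow> (nat \<times> 'm) set corr" where
  "Psi1 b \<Lambda> = (let T = corr_tower b \<Lambda>; TA = alg_tower b (udom \<Lambda>); TB = alg_tower b (ucod \<Lambda>);
       x = xob b (udom \<Lambda>); y = xob b (ucod \<Lambda>); N = cats (ucod \<Lambda>) in
     \<lparr>lalg = Psi0 b (udom \<Lambda>),
      ralg = Psi0 b (ucod \<Lambda>),
      hcar = Elem ` lim_set T,
      hadd = (\<lambda>\<xi> \<zeta>. Elem (lim2 T T T (\<lambda>k. pls (N k)) (elem \<xi>) (elem \<zeta>))),
      hzero = Elem (germ T 0 (zer (N 0) (y 0) (fob (ufun \<Lambda> 0) (x 0)))),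
      hscl = (\<lambda>z \<xi>. Elem (lim1 T T (\<lambda>k. scl (N k) z) (elem \<xi>))),
      lact = (\<lambda>\<alpha> \<xi>. Elem (lim2 TA T T (\<lambda>k a v. cmp (N k) (fmp (ufun \<Lambda> k) a) v) \<alpha> (elem \<xi>))),
      ract = (\<lambda>\<xi> \<beta>. Elem (lim2 T TB T (\<lambda>k. cmp (N k)) (elem \<xi>) \<beta>)),
      hip = (\<lambda>\<xi> \<zeta>. lim2 T T TB (\<lambda>k v w. cmp (N k) (adj (N k) w) v) (elem \<xi>) (elem \<zeta>))\<rparr>)"

text \<open>The sequence $\gamma_j$ starting from \<open>\<gamma>\<close> at level \<open>k\<close>.\<close>

primrec transport ::
    "(('o, 'm) cat \<Rightarrow> 'o) \<Rightarrow> ('o, 'm) ucell1 \<Rightarrow> ('o, 'm) ucell1 \<Rightarrow> nat \<Rightarrow> 'm \<Rightarrow> nat \<Rightarrow> 'm" where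
  "transport b \<Lambda> \<Omega> k \<gamma> 0 = \<gamma>"
| "transport b \<Lambda> \<Omega> k \<gamma> (Suc j) =
     (let N = cats (ucod \<Lambda>) (Suc (k + j)); x = xob b (udom \<Lambda>) (k + j) in
      cmp N (cmp N (ucon \<Omega> (k + j) x) (fmp (gam (ucod \<Lambda>) (k + j)) (transport b \<Lambda> \<Omega> k \<gamma> j)))
        (adj N (ucon \<Lambda> (k + j) x)))"

definition Phi ::
    "(('o, 'm) cat \<Rightarrow> 'o) \<Rightarrow> ('o, 'm) ucell1 \<Rightarrow> ('o, 'm) ucell1 \<Rightarrow> nat \<Rightarrow> 'm \<Rightarrow>
     (nat \<times> 'm) set tvec \<Rightarrow> (nat \<times> 'm) set tvec" where
  "Phi b \<Lambda> \<Omega> k \<gamma> = (\<lambda>\<xi>\<in>hcar (Psi1 b \<Lambda>). Elem (THE z. \<exists>l. \<exists>v\<in>lev (corr_tower b \<Lambda>) (k + l).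
     elem \<xi> = germ (corr_tower b \<Lambda>) (k + l) v \<and>
     z = germ (corr_tower b \<Omega>) (k + l) (cmp (cats (ucod \<Lambda>) (k + l)) (transport b \<Lambda> \<Omega> k \<gamma> l) v)))"

text \<open>The common value of \<open>Phi\<close> at all representatives and all levels from which the exchange relations hold.\<close>

definition Psi2 :: "(('o, 'm) cat \<Rightarrow> 'o) \<Rightarrow> ('o, 'm) ucell2 \<Rightarrow> (nat \<times> 'm) set ccell2" where
  "Psi2 b \<eta> = \<lparr>csrc = Psi1 b (usrc \<eta>), ctgt = Psi1 b (utgt \<eta>),
     cmap = (THE T. \<forall>h\<in>ucls \<eta>. \<forall>K. (\<forall>k\<ge>K. exchange (usrc \<eta>) (utgt \<eta>) k (h k) (h (Suc k))) \<longrightarrow>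
       (\<forall>k\<ge>K. T = Phi b (usrc \<eta>) (utgt \<eta>) k (h k (xob b (udom (usrc \<eta>)) k))))\<rparr>"

end

theory Submission
  imports Defs "HOL-Computational_Algebra.Fundamental_Theorem_Algebra"
begin

text \<open>
  A finite-dimensional C*-algebra has enough projections for every object of a finite semisimple
  C*-category to contain a simple one. Hence the sum of the simple objects generates, and since the
  adjoints of the \<open>\<Gamma>\<^sub>k\<close> are faithful, so does every \<open>x\<^sub>k\<close>: each object \<open>a\<close> admits finitely many
  \<open>c\<^sub>i, e\<^sub>i : x\<^sub>k \<rightarrow> a\<close> with \<open>\<Sum> c\<^sub>i e\<^sub>i\<^sup>* = 1\<close>.

  For the generator of the target 0-cell and \<open>a = \<Lambda>\<^sub>0 x\<^sub>0\<close>, the images of the \<open>c\<^sub>i\<close> form a finite generating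
  family of the right module \<open>H\<^sub>\<infinity>\<close>. An intertwiner \<open>T\<close> sends all of them into one level, so from some
  level on it is composition with \<open>\<gamma>\<^sub>k = \<Sum> T(c\<^sub>i) e\<^sub>i\<^sup>*\<close>. As \<open>\<gamma>\<^sub>k\<close> intertwines the actions of \<open>A\<^sub>k\<close>, it extends
  uniquely from the generator \<open>x\<^sub>k\<close> to a natural transformation, and naturality reduces the exchange
  relations to \<open>x\<^sub>k\<close>. This gives fullness, and uniqueness of the extension gives faithfulness.

  The comparison map \<open>\<xi> \<otimes> \<zeta> \<mapsto> \<Omega>\<^sub>k(\<xi>) \<zeta>\<close> is isometric, and onto because
  \<open>\<theta> = \<Sum> \<Omega>\<^sub>k(c\<^sub>i) \<Omega>\<^sub>k(e\<^sub>i\<^sup>*) \<theta>\<close>.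
\<close>

section \<open>Complex spaces on carrier sets\<close>

text \<open>The categories are given only by carriers and axioms, so projections have to be made by
  hand: an eigenvector of a self-adjoint h is sought among the polynomials in h, through its minimal
  polynomial. A resolution has two families c and e rather than one because the inverse of an
  eigenvalue is absorbed in e, which avoids square roots. In the fullness argument one level K must
  serve all vectors at once. This works because the unitaries W make the image of a resolution under
  the inclusions a resolution again: a single finite family, fixed at level 0, resolves every later
  level. The tensor product consists of formal sums with chosen representatives, and its inner
  product is not visibly positive. Nothing is therefore proved about it directly: equality,
  operations and axioms are read off in the correspondence of the composite 1-cell, through the
  isometric comparison map. Since 1-cells compose strictly, the coherence laws become equalities of
  sums inside one and the same correspondence.\<close>

locale cspace =
  fixes S :: "'v set" and add z sc
  assumes complex_space: "complex_space S add z sc"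
begin

lemma
  shows zero_closed [simp]: "z \<in> S"
    and add_closed [simp]: "u \<in> S \<Longrightarrow> v \<in> S \<Longrightarrow> add u v \<in> S"
    and add_commute: "u \<in> S \<Longrightarrow> v \<in> S \<Longrightarrow> add u v = add v u"
    and add_assoc: "u \<in> S \<Longrightarrow> v \<in> S \<Longrightarrow> w \<in> S \<Longrightarrow> add (add u v) w = add u (add v w)"
    and add_0_left [simp]: "u \<in> S \<Longrightarrow> add z u = u"
    and add_minus [simp]: "u \<in> S \<Longrightarrow> add u (sc (-1) u) = z"
    and sc_closed [simp]: "u \<in> S \<Longrightarrow> sc c u \<in> S"
    and sc_add: "u \<in> S \<Longrightarrow> v \<in> S \<Longrightarrow> sc c (add u v) = add (sc c u) (sc c v)"
    and sc_plus: "u \<in> S \<Longrightarrow> sc (c + d) u = add (sc c u) (sc d u)"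
    and sc_sc [simp]: "u \<in> S \<Longrightarrow> sc c (sc d u) = sc (c * d) u"
    and sc_1 [simp]: "u \<in> S \<Longrightarrow> sc 1 u = u"
  using complex_space unfolding complex_space_def by metis+

lemma add_0_right [simp]: "u \<in> S \<Longrightarrow> add u z = u"
  using add_commute by fastforce

lemma add_left_commute:
  "u \<in> S \<Longrightarrow> v \<in> S \<Longrightarrow> w \<in> S \<Longrightarrow> add u (add v w) = add v (add u w)"
  by (metis add_assoc add_commute)

lemmas add_ac = add_assoc add_commute add_left_commute

lemma add_left_cancel:
  assumes "u \<in> S" "v \<in> S" "w \<in> S" "add u v = add u w"
  shows "v = w"
proof -
  have "v = add (add (sc (-1) u) u) v" "w = add (add (sc (-1) u) u) w"
    using assms by (simp_all add: add_commute[of "sc (-1) u"])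
  then show ?thesis
    using assms by (metis add_assoc sc_closed)
qed

lemma sc_0 [simp]:
  assumes "u \<in> S"
  shows "sc 0 u = z"
proof -
  have "add (sc 0 u) (sc 0 u) = add (sc 0 u) z"
    using assms sc_plus[of u 0 0] by simp
  then show ?thesis
    using add_left_cancel[of "sc 0 u"] assms by simp
qed

lemma sc_zero [simp]: "sc c z = z"
proof -
  have "sc c z = sc c (sc 0 z)" by simp
  also have "\<dots> = z" by (subst sc_sc) simp_all
  finally show ?thesis .
qed

lemma sc_eq_0: 
  assumes "u \<in> S" "sc c u = z" "c \<noteq> 0"
  shows "u = z"
proof -
  have "u = sc (1 / c) (sc c u)" using assms(1,3) by simp
  then show ?thesis by (simp add: assms(2))
qed

lemma minus_eq_0:
  assumes "u \<in> S" "v \<in> S" "add u (sc (-1) v) = z"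
  shows "u = v"
proof -
  have "add (sc (-1) v) u = add (sc (-1) v) v"
    using assms by (metis add_commute add_minus sc_closed)
  then show ?thesis using add_left_cancel[of "sc (-1) v" u v] assms by simp
qed

lemma lsum_closed [simp]: "set vs \<subseteq> S \<Longrightarrow> lsum add z vs \<in> S"
  by (induction vs) (auto simp: lsum_def)

lemma lsum_append:
  "set vs \<subseteq> S \<Longrightarrow> set ws \<subseteq> S \<Longrightarrow> lsum add z (vs @ ws) = add (lsum add z vs) (lsum add z ws)"
proof (induction vs)
  case Nil
  then show ?case using lsum_closed[of ws] by (simp add: lsum_def)
next
  case (Cons a vs)
  then show ?case using lsum_closed[of vs] lsum_closed[of ws] by (simp add: lsum_def add_assoc)
qed

end

lemma lsum_Nil [simp]: "lsum add z [] = z"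
  by (simp add: lsum_def)

lemma lsum_Cons [simp]: "lsum add z (v # vs) = add v (lsum add z vs)"
  by (simp add: lsum_def)

text \<open>Additivity is asked for on \<open>S\<close> only, because composition, functors and
  intertwiners are additive only on the relevant carrier. The induction therefore carries membership
  of the partial sum along.\<close>

lemma lsum_image:
  assumes "f z = z'" "\<And>u v. u \<in> S \<Longrightarrow> v \<in> S \<Longrightarrow> f (add u v) = add' (f u) (f v)"
    and "z \<in> S" "\<And>u v. u \<in> S \<Longrightarrow> v \<in> S \<Longrightarrow> add u v \<in> S" "set vs \<subseteq> S"
  shows "f (lsum add z vs) = lsum add' z' (map f vs)"
proof -
  have "lsum add z vs \<in> S \<and> f (lsum add z vs) = lsum add' z' (map f vs)"
    using assms(5) by (induction vs) (auto simp: assms)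
  then show ?thesis ..
qed

section \<open>Linear dependence of families longer than a spanning list\<close>

context cspace
begin

text \<open>A family, not a set: repeated vectors count as dependent, as is needed for the powers of
  an endomorphism, which may coincide. The relation runs over a distinct list because
  \<open>lsum\<close> adds up lists.\<close>

definition lin_dep :: "'i set \<Rightarrow> ('i \<Rightarrow> 'v) \<Rightarrow> bool" where
  "lin_dep J v \<longleftrightarrow> (\<exists>js a. set js \<subseteq> J \<and> distinct js \<and> (\<exists>j\<in>set js. a j \<noteq> 0) \<and>
     lsum add z (map (\<lambda>j. sc (a j) (v j)) js) = z)"

lemma lsum_sc_add:
  assumes "\<And>j. j \<in> set js \<Longrightarrow> v j \<in> S" "u \<in> S"
  shows "lsum add z (map (\<lambda>j. sc (a j) (add (v j) (sc (c j) u))) js) =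
    add (lsum add z (map (\<lambda>j. sc (a j) (v j)) js)) (sc (\<Sum>j\<leftarrow>js. a j * c j) u)"
  using assms(1)
proof (induction js)
  case Nil
  then show ?case using assms by simp
next
  case (Cons j js)
  have L: "lsum add z (map (\<lambda>j. sc (a j) (v j)) js) \<in> S"
    using Cons.prems by (intro lsum_closed) auto
  show ?case
    using Cons L assms(2) by (simp add: sc_add sc_plus add_ac)
qed

text \<open>Gaussian elimination along the spanning list. A vector with a non-zero coefficient at
  the head \<open>b\<close> is used to clear \<open>b\<close> from all others, which leaves one
  vector fewer and a shorter list.\<close>

lemma spanned_lin_dep:
  assumes "finite J" "length bs < card J" "set bs \<subseteq> S"
    and "\<And>j. j \<in> J \<Longrightarrow> \<exists>cs. length cs = length bs \<and> v j = lsum add z (map2 sc cs bs)"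
  shows "lin_dep J v"
  using assms
proof (induction bs arbitrary: J v)
  case Nil
  then obtain j where "j \<in> J" by fastforce
  moreover have "v j = z" using Nil(4)[OF \<open>j \<in> J\<close>] by simp
  ultimately show ?case unfolding lin_dep_def
    by (intro exI[of _ "[j]"] exI[of _ "\<lambda>_. 1"]) simp
next
  case (Cons b bs)
  from Cons.prems(4) have "\<forall>j\<in>J. \<exists>c w. (\<exists>cs. length cs = length bs \<and> w = lsum add z (map2 sc cs bs)) \<and>
      v j = add (sc c b) w"
    by (fastforce simp: length_Suc_conv)
  then obtain c w where w: "\<And>j. j \<in> J \<Longrightarrow> \<exists>cs. length cs = length bs \<and> w j = lsum add z (map2 sc cs bs)"
    and v: "\<And>j. j \<in> J \<Longrightarrow> v j = add (sc (c j) b) (w j)" by metis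
  have b: "b \<in> S" "set bs \<subseteq> S" using Cons.prems by auto
  have comb: "lsum add z (map2 sc cs bs) \<in> S" for cs
    using b(2) by (intro lsum_closed) (auto dest!: set_zip_rightD)
  have wS: "w j \<in> S" if "j \<in> J" for j using w[OF that] comb by auto
  have vS: "v j \<in> S" if "j \<in> J" for j using v[OF that] wS[OF that] b by auto
  show ?case
  proof (cases "\<forall>j\<in>J. c j = 0")
    case True
    have "v j = w j" if "j \<in> J" for j using v[OF that] wS[OF that] True b that by simp
    then show ?thesis using Cons.IH[of J v] Cons.prems w b by auto
  next
    case False
    then obtain i where i: "i \<in> J" "c i \<noteq> 0" by blast
    \<comment> \<open>Adding \<open>d j\<close> times \<open>v i\<close> cancels the
      \<open>b\<close>-component of \<open>v j\<close>.\<close>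
    define d where "d j = - c j / c i" for j
    define u where "u j = add (v j) (sc (d j) (v i))" for j
    have "\<exists>cs. length cs = length bs \<and> u j = lsum add z (map2 sc cs bs)" if j: "j \<in> J - {i}" for j
    proof -
      obtain p q where p: "length p = length bs" "w j = lsum add z (map2 sc p bs)"
        and q: "length q = length bs" "w i = lsum add z (map2 sc q bs)"
        using w i j by (metis Diff_iff)
      have lin: "add (lsum add z (map2 sc p bs)) (sc e (lsum add z (map2 sc q bs)))
          = lsum add z (map2 sc (map2 (\<lambda>x y. x + e * y) p q) bs)" for e
      proof -
        have "length p = length q" "length q = length bs" "set bs \<subseteq> S" using p q b by auto
        then show ?thesis
        proof (induction p q bs rule: list_induct3)
          case Nil
          then show ?case by simp
        next
          case (Cons x p y q b bs)
          have [simp]: "lsum add z (map2 sc cs bs) \<in> S" for cs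
            using Cons.prems by (intro lsum_closed) (auto dest!: set_zip_rightD)
          show ?case using Cons by (simp add: Cons.IH[symmetric] sc_add sc_plus add_ac)
        qed
      qed
      have "u j = add (add (sc (c j) b) (sc (d j * c i) b)) (add (w j) (sc (d j) (w i)))"
        using i j b wS unfolding u_def by (simp add: v sc_add add_ac)
      also have "add (sc (c j) b) (sc (d j * c i) b) = z"
        using i b by (simp add: sc_plus[symmetric] d_def)
      finally have "u j = lsum add z (map2 sc (map2 (\<lambda>x y. x + d j * y) p q) bs)"
        using wS i j by (simp add: p(2) q(2) lin comb)
      then show ?thesis using p q by (intro exI[of _ "map2 (\<lambda>x y. x + d j * y) p q"]) simp
    qed
    then have "lin_dep (J - {i}) u"
      using Cons.prems b i by (intro Cons.IH) auto
    then obtain js a where js: "set js \<subseteq> J - {i}" "distinct js" "\<exists>j\<in>set js. a j \<noteq> 0"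
      "lsum add z (map (\<lambda>j. sc (a j) (u j)) js) = z" unfolding lin_dep_def by blast
    \<comment> \<open>A relation among the \<open>u j\<close> is one among the \<open>v j\<close> in
      which \<open>v i\<close> collects all the correction terms.\<close>
    define a' where "a' = a(i := (\<Sum>j\<leftarrow>js. a j * d j))"
    have "lsum add z (map (\<lambda>j. sc (a j) (u j)) js) =
        add (lsum add z (map (\<lambda>j. sc (a j) (v j)) js)) (sc (\<Sum>j\<leftarrow>js. a j * d j) (v i))"
      unfolding u_def using js i vS by (intro lsum_sc_add) auto
    moreover have "map (\<lambda>j. sc (a j) (v j)) js = map (\<lambda>j. sc (a' j) (v j)) js"
      using js by (auto simp: a'_def)
    moreover have "lsum add z (map (\<lambda>j. sc (a' j) (v j)) js) \<in> S"
      using js vS by (intro lsum_closed) auto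
    ultimately have "lsum add z (map (\<lambda>j. sc (a' j) (v j)) (i # js)) = z"
      using js(4) i vS by (simp add: a'_def add_commute)
    then show ?thesis unfolding lin_dep_def using js i
      by (intro exI[of _ "i # js"] exI[of _ a']) (auto simp: a'_def)
  qed
qed

lemma finite_dim_lin_dep:
  assumes "finite_dim S add z sc"
  obtains n where "\<And>J v. finite J \<Longrightarrow> n < card J \<Longrightarrow> (\<And>j. j \<in> J \<Longrightarrow> v j \<in> S) \<Longrightarrow> lin_dep J v"
proof -
  obtain bs where "set bs \<subseteq> S" "\<forall>v\<in>S. \<exists>cs. length cs = length bs \<and> v = lsum add z (map2 sc cs bs)"
    using assms unfolding finite_dim_def by blast
  then show ?thesis using that[of "length bs"] by (meson spanned_lin_dep)
qed

end

section \<open>Star categories\<close>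

text \<open>As a rewrite rule this turns every hom-set into source and target equations, the form in
  which the simplifier meets the side conditions of the laws below.\<close>

lemma in_hom [simp]: "f \<in> hom C a b \<longleftrightarrow> f \<in> arr C \<and> src C f = a \<and> tgt C f = b"
  by (auto simp: hom_def)

locale starcat =
  fixes C :: "('o, 'm) cat"
  assumes star_category: "star_category C"
begin

lemma category: "category C"
  using star_category by (simp add: star_category_def)

lemma hom_space: "a \<in> obj C \<Longrightarrow> b \<in> obj C \<Longrightarrow> cspace (hom C a b) (pls C) (zer C a b) (scl C)"
  using star_category by (simp add: star_category_def cspace_def)

lemma src_obj [simp]: "f \<in> arr C \<Longrightarrow> src C f \<in> obj C"
  and tgt_obj [simp]: "f \<in> arr C \<Longrightarrow> tgt C f \<in> obj C"
  using category unfolding category_def by auto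

lemma idn_arr [simp]: "a \<in> obj C \<Longrightarrow> idn C a \<in> arr C"
  and src_idn [simp]: "a \<in> obj C \<Longrightarrow> src C (idn C a) = a"
  and tgt_idn [simp]: "a \<in> obj C \<Longrightarrow> tgt C (idn C a) = a"
  using category unfolding category_def by auto

lemma cmp_arr [simp]: "f \<in> arr C \<Longrightarrow> g \<in> arr C \<Longrightarrow> src C g = tgt C f \<Longrightarrow> cmp C g f \<in> arr C"
  and src_cmp [simp]: "f \<in> arr C \<Longrightarrow> g \<in> arr C \<Longrightarrow> src C g = tgt C f \<Longrightarrow> src C (cmp C g f) = src C f"
  and tgt_cmp [simp]: "f \<in> arr C \<Longrightarrow> g \<in> arr C \<Longrightarrow> src C g = tgt C f \<Longrightarrow> tgt C (cmp C g f) = tgt C g"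
  using category unfolding category_def by auto

lemma cmp_idn [simp]: "f \<in> arr C \<Longrightarrow> src C f = a \<Longrightarrow> cmp C f (idn C a) = f"
  and idn_cmp [simp]: "f \<in> arr C \<Longrightarrow> tgt C f = a \<Longrightarrow> cmp C (idn C a) f = f"
  and cmp_assoc [simp]: "f \<in> arr C \<Longrightarrow> g \<in> arr C \<Longrightarrow> h \<in> arr C \<Longrightarrow> src C g = tgt C f \<Longrightarrow>
     src C h = tgt C g \<Longrightarrow> cmp C (cmp C h g) f = cmp C h (cmp C g f)"
  using category unfolding category_def by auto

lemma zer_arr [simp]: "a \<in> obj C \<Longrightarrow> b \<in> obj C \<Longrightarrow> zer C a b \<in> arr C"
  and src_zer [simp]: "a \<in> obj C \<Longrightarrow> b \<in> obj C \<Longrightarrow> src C (zer C a b) = a"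
  and tgt_zer [simp]: "a \<in> obj C \<Longrightarrow> b \<in> obj C \<Longrightarrow> tgt C (zer C a b) = b"
  using cspace.zero_closed[OF hom_space, of a b] by auto

lemma
  assumes "f \<in> arr C" "g \<in> arr C" "src C f = src C g" "tgt C f = tgt C g"
  shows pls_arr [simp]: "pls C f g \<in> arr C"
    and src_pls [simp]: "src C (pls C f g) = src C f"
    and tgt_pls [simp]: "tgt C (pls C f g) = tgt C f"
    and pls_commute: "pls C f g = pls C g f"
  using cspace.add_closed[OF hom_space, of "src C f" "tgt C f" f g]
    cspace.add_commute[OF hom_space, of "src C f" "tgt C f" f g] assms by auto

lemma
  assumes "f \<in> arr C" "g \<in> arr C" "src C f = src C g" "tgt C f = tgt C g"
    "h \<in> arr C" "src C g = src C h" "tgt C g = tgt C h" 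
  shows pls_assoc: "pls C (pls C f g) h = pls C f (pls C g h)"
    and pls_left_commute: "pls C f (pls C g h) = pls C g (pls C f h)"
  using cspace.add_assoc[OF hom_space, of "src C f" "tgt C f" f g h]
    cspace.add_left_commute[OF hom_space, of "src C f" "tgt C f" f g h] assms by auto

lemma
  assumes "f \<in> arr C"
  shows scl_arr [simp]: "scl C c f \<in> arr C"
    and src_scl [simp]: "src C (scl C c f) = src C f"
    and tgt_scl [simp]: "tgt C (scl C c f) = tgt C f"
    and scl_scl [simp]: "scl C c (scl C d f) = scl C (c * d) f"
    and scl_1 [simp]: "scl C 1 f = f"
    and scl_plus: "scl C (c + d) f = pls C (scl C c f) (scl C d f)"
  using cspace.sc_closed[OF hom_space, of "src C f" "tgt C f" f c]
    cspace.sc_sc[OF hom_space, of "src C f" "tgt C f" f c d]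
    cspace.sc_1[OF hom_space, of "src C f" "tgt C f" f]
    cspace.sc_plus[OF hom_space, of "src C f" "tgt C f" f c d] assms by auto

lemma scl_0 [simp]: "f \<in> arr C \<Longrightarrow> scl C 0 f = zer C (src C f) (tgt C f)"
  using cspace.sc_0[OF hom_space, of "src C f" "tgt C f" f] by auto

lemma scl_zer [simp]: "a \<in> obj C \<Longrightarrow> b \<in> obj C \<Longrightarrow> scl C c (zer C a b) = zer C a b"
  using cspace.sc_zero[OF hom_space, of a b c] by auto

lemma scl_pls: "f \<in> arr C \<Longrightarrow> g \<in> arr C \<Longrightarrow> src C f = src C g \<Longrightarrow> tgt C f = tgt C g \<Longrightarrow>
    scl C c (pls C f g) = pls C (scl C c f) (scl C c g)"
  using cspace.sc_add[OF hom_space, of "src C f" "tgt C f" f g c] by auto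

lemma zer_pls [simp]: "f \<in> arr C \<Longrightarrow> src C f = a \<Longrightarrow> tgt C f = b \<Longrightarrow> pls C (zer C a b) f = f"
  and pls_zer [simp]: "f \<in> arr C \<Longrightarrow> src C f = a \<Longrightarrow> tgt C f = b \<Longrightarrow> pls C f (zer C a b) = f"
  using cspace.add_0_left[OF hom_space, of a b f] cspace.add_0_right[OF hom_space, of a b f] by auto

lemma pls_minus [simp]: "f \<in> arr C \<Longrightarrow> pls C f (scl C (-1) f) = zer C (src C f) (tgt C f)"
  using cspace.add_minus[OF hom_space, of "src C f" "tgt C f" f] by auto

lemma scl_eq_zer:
  assumes "f \<in> arr C" "scl C c f = zer C (src C f) (tgt C f)" "c \<noteq> 0"
  shows "f = zer C (src C f) (tgt C f)"
  using cspace.sc_eq_0[OF hom_space, of "src C f" "tgt C f" f c] assms by auto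

lemma bilinear:
  assumes "f \<in> hom C a b" "f' \<in> hom C a b" "g \<in> hom C b c" "g' \<in> hom C b c"
  shows "cmp C g (pls C f f') = pls C (cmp C g f) (cmp C g f') \<and>
    cmp C (pls C g g') f = pls C (cmp C g f) (cmp C g' f) \<and>
    (\<forall>z. cmp C g (scl C z f) = scl C z (cmp C g f) \<and> cmp C (scl C z g) f = scl C z (cmp C g f))"
proof -
  have "a \<in> obj C" "b \<in> obj C" "c \<in> obj C" using assms by auto
  then show ?thesis using star_category assms unfolding star_category_def by blast
qed

lemma
  assumes "f \<in> arr C" "g \<in> arr C" "h \<in> arr C" "src C f = src C g" "tgt C f = tgt C g"
  shows cmp_pls: "src C h = tgt C f \<Longrightarrow> cmp C h (pls C f g) = pls C (cmp C h f) (cmp C h g)"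
    and pls_cmp: "src C f = tgt C h \<Longrightarrow> cmp C (pls C f g) h = pls C (cmp C f h) (cmp C g h)"
  using bilinear[of f "src C f" "tgt C f" g h "tgt C h" h]
    bilinear[of h "src C h" "tgt C h" h f "tgt C f" g] assms by auto

lemma
  assumes "f \<in> arr C" "g \<in> arr C" "src C g = tgt C f"
  shows cmp_scl [simp]: "cmp C g (scl C c f) = scl C c (cmp C g f)"
    and scl_cmp [simp]: "cmp C (scl C c g) f = scl C c (cmp C g f)"
  using bilinear[of f "src C f" "tgt C f" f g "tgt C g" g] assms by auto

lemma cmp_zer [simp]: "f \<in> arr C \<Longrightarrow> a \<in> obj C \<Longrightarrow> src C f = b \<Longrightarrow> cmp C f (zer C a b) = zer C a (tgt C f)"
  using cmp_scl[of "zer C a b" f 0] by auto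

lemma zer_cmp [simp]: "f \<in> arr C \<Longrightarrow> c \<in> obj C \<Longrightarrow> tgt C f = b \<Longrightarrow> cmp C (zer C b c) f = zer C (src C f) c"
  using scl_cmp[of f "zer C b c" 0] by auto

lemma adj_antilinear:
  assumes "f \<in> hom C a b" "f' \<in> hom C a b"
  shows "adj C f \<in> hom C b a \<and> adj C (adj C f) = f \<and>
        adj C (pls C f f') = pls C (adj C f) (adj C f') \<and>
        (\<forall>z. adj C (scl C z f) = scl C (cnj z) (adj C f))"
proof -
  have "a \<in> obj C" "b \<in> obj C" using assms by auto
  then show ?thesis using star_category assms unfolding star_category_def by blast
qed

lemma
  assumes "f \<in> arr C"
  shows adj_arr [simp]: "adj C f \<in> arr C"
    and src_adj [simp]: "src C (adj C f) = tgt C f"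
    and tgt_adj [simp]: "tgt C (adj C f) = src C f"
    and adj_adj [simp]: "adj C (adj C f) = f"
    and adj_scl [simp]: "adj C (scl C c f) = scl C (cnj c) (adj C f)"
  using adj_antilinear[of f "src C f" "tgt C f" f] assms by auto

lemma adj_pls [simp]: "f \<in> arr C \<Longrightarrow> g \<in> arr C \<Longrightarrow> src C f = src C g \<Longrightarrow> tgt C f = tgt C g \<Longrightarrow>
    adj C (pls C f g) = pls C (adj C f) (adj C g)"
  using adj_antilinear[of f "src C f" "tgt C f" g] by auto

lemma adj_cmp [simp]: "f \<in> arr C \<Longrightarrow> g \<in> arr C \<Longrightarrow> src C g = tgt C f \<Longrightarrow>
    adj C (cmp C g f) = cmp C (adj C f) (adj C g)"
  using star_category unfolding star_category_def by auto

lemma adj_zer [simp]: "a \<in> obj C \<Longrightarrow> b \<in> obj C \<Longrightarrow> adj C (zer C a b) = zer C b a"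
  using adj_scl[of "zer C a b" 0] by auto

lemma adj_idn [simp]: 
  assumes "a \<in> obj C"
  shows "adj C (idn C a) = idn C a"
  using adj_cmp[of "idn C a" "adj C (idn C a)"] assms by simp

lemma lsum_hom:
  assumes "a \<in> obj C" "b \<in> obj C" "set fs \<subseteq> hom C a b"
  shows "lsum (pls C) (zer C a b) fs \<in> hom C a b"
  using assms cspace.lsum_closed[OF hom_space] by blast

lemma cmp_lsum:
  assumes "a \<in> obj C" "set fs \<subseteq> hom C a b" "h \<in> arr C" "src C h = b"
  shows "cmp C h (lsum (pls C) (zer C a b) fs) = lsum (pls C) (zer C a (tgt C h)) (map (cmp C h) fs)"
  using assms cmp_pls by (intro lsum_image[where S = "hom C a b"]) auto

lemma lsum_cmp:
  assumes "b \<in> obj C" "set fs \<subseteq> hom C a b" "h \<in> arr C" "tgt C h = a"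
  shows "cmp C (lsum (pls C) (zer C a b) fs) h =
     lsum (pls C) (zer C (src C h) b) (map (\<lambda>f. cmp C f h) fs)"
  using assms pls_cmp by (intro lsum_image[where S = "hom C a b"]) auto

end

locale cstarcat = starcat C for C :: "('o, 'm) cat" +
  assumes fd_cstar_category: "fd_cstar_category C"
begin

lemma fd_hom: "a \<in> obj C \<Longrightarrow> b \<in> obj C \<Longrightarrow> finite_dim (hom C a b) (pls C) (zer C a b) (scl C)"
  using fd_cstar_category unfolding fd_cstar_category_def by blast

text \<open>By the C*-identity the squared norm of \<open>f\<close> is the norm of
  \<open>cmp C (adj C f) f\<close>. The spectral arguments below know the norm only through this
  definiteness.\<close>

lemma adj_cmp_self_0: 
  assumes "f \<in> arr C" "cmp C (adj C f) f = zer C (src C f) (src C f)"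
  shows "f = zer C (src C f) (tgt C f)"
proof -
  obtain nm where nm: "\<And>a b. a \<in> obj C \<Longrightarrow> b \<in> obj C \<Longrightarrow> norm_on (hom C a b) (pls C) (zer C a b) (scl C) nm"
    "\<And>f. f \<in> arr C \<Longrightarrow> nm (cmp C (adj C f) f) = (nm f)\<^sup>2"
    using fd_cstar_category unfolding fd_cstar_category_def by blast
  have "nm (zer C (src C f) (src C f)) = 0"
    using nm(1)[of "src C f" "src C f"] assms by (simp add: norm_on_def)
  then have "nm f = 0" using nm(2)[of f] assms by simp
  then show ?thesis using nm(1)[of "src C f" "tgt C f"] assms by (simp add: norm_on_def)
qed

lemma positive_endo:
  assumes "f \<in> arr C"
  obtains g where "g \<in> hom C (src C f) (src C f)" "cmp C (adj C f) f = cmp C (adj C g) g"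
  using fd_cstar_category assms unfolding fd_cstar_category_def by blast

end

section \<open>Polynomials in an endomorphism, and eigenprojections of self-adjoint ones\<close>

context cstarcat
begin

text \<open>The value p(h) by Horner's scheme; constants act as multiples of the identity on the
  source of \<open>h\<close>.\<close>

definition peval :: "'m \<Rightarrow> complex poly \<Rightarrow> 'm" where
  "peval h p = fold_coeffs (\<lambda>c g. pls C (scl C c (idn C (src C h))) (cmp C h g)) p (zer C (src C h) (src C h))"

context
  fixes h a
  assumes h: "h \<in> arr C" "src C h = a" "tgt C h = a"
begin

lemma obj_a [simp]: "a \<in> obj C"
  using h by auto

lemma peval_0 [simp]: "peval h 0 = zer C a a"
  using h by (simp add: peval_def)

text \<open>\<open>pCons 0 0\<close> has no coefficients to fold over, hence the case distinction;
  there both sides are zero.\<close>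

lemma peval_pCons [simp]: "peval h (pCons c p) = pls C (scl C c (idn C a)) (cmp C h (peval h p))"
proof (cases "c = 0 \<and> p = 0")
  case True
  then show ?thesis using h by simp
next
  case False
  then show ?thesis using h by (auto simp: peval_def)
qed

lemma peval_arr [simp]: "peval h p \<in> arr C"
  and src_peval [simp]: "src C (peval h p) = a"
  and tgt_peval [simp]: "tgt C (peval h p) = a"
proof -
  have "peval h p \<in> arr C \<and> src C (peval h p) = a \<and> tgt C (peval h p) = a"
    using h by (induction p) auto
  then show "peval h p \<in> arr C" "src C (peval h p) = a" "tgt C (peval h p) = a" by auto
qed

lemma peval_smult [simp]: "peval h (smult c p) = scl C c (peval h p)"
  using h by (induction p) (simp_all add: scl_pls)

lemma peval_add: "peval h (p + q) = pls C (peval h p) (peval h q)"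
proof (induction p arbitrary: q)
  case 0
  then show ?case using h by simp
next
  case (pCons c p)
  obtain d q' where q: "q = pCons d q'" by (cases q)
  show ?case
    using h by (simp add: q pCons.IH scl_plus cmp_pls pls_assoc pls_left_commute)
qed

lemma peval_commute: "cmp C (peval h p) h = cmp C h (peval h p)"
  using h by (induction p) (simp_all add: pls_cmp cmp_pls)

lemma peval_adj: "adj C h = h \<Longrightarrow> adj C (peval h p) = peval h (map_poly cnj p)"
  using h by (induction p) (simp_all add: map_poly_pCons peval_commute[symmetric])

lemma peval_eigen:
  assumes "g \<in> arr C" "tgt C g = a" "cmp C h g = scl C c g"
  shows "cmp C (peval h p) g = scl C (poly p c) g"
proof (induction p)
  case 0
  then show ?case using assms by simp
next
  case (pCons d p)
  then show ?case using assms h by (simp add: pls_cmp scl_plus mult.commute)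
qed

text \<open>More powers of \<open>h\<close> than the dimension allows are linearly dependent, and
  the coefficients of a relation are those of the polynomial \<open>r\<close>; distinctness of the
  list keeps them apart, so \<open>r\<close> is non-zero.\<close>

lemma peval_annihilator: "\<exists>r. r \<noteq> 0 \<and> peval h r = zer C a a"
proof -
  interpret V: cspace "hom C a a" "pls C" "zer C a a" "scl C"
    using hom_space h by auto
  obtain n where n: "\<And>(J :: nat set) v. finite J \<Longrightarrow> n < card J \<Longrightarrow> (\<And>j. j \<in> J \<Longrightarrow> v j \<in> hom C a a) \<Longrightarrow> V.lin_dep J v"
    using V.finite_dim_lin_dep fd_hom h by (metis obj_a)
  have "V.lin_dep {..n} (\<lambda>j. peval h (monom 1 j))"
    by (rule n) auto
  then obtain js c where js: "distinct js" "\<exists>j\<in>set js. c j \<noteq> 0"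
    and 0: "lsum (pls C) (zer C a a) (map (\<lambda>j. scl C (c j) (peval h (monom 1 j))) js) = zer C a a"
    unfolding V.lin_dep_def by blast
  define r where "r = (\<Sum>j\<in>set js. monom (c j) j)"
  have peval_monom: "peval h (monom d j) = scl C d (peval h (monom 1 j))" for d j
    using peval_smult[of d "monom 1 j"] by (simp add: smult_monom)
  have "peval h r = lsum (pls C) (zer C a a) (map (\<lambda>j. scl C (c j) (peval h (monom 1 j))) js)"
    unfolding r_def using js(1) by (induction js) (auto simp: peval_add peval_monom[of "c _"])
  moreover have "coeff r j = c j" if "j \<in> set js" for j
    using that by (simp add: r_def coeff_sum)
  ultimately show ?thesis using js(2) 0 by (metis coeff_0)
qed

text \<open>If c is a root of the minimal polynomial r = (X - c) t, then t(h) is non-zero by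
  minimality and h t(h) = c t(h). Self-adjointness enters to find a root other than 0: with 0 as the
  only root \<open>h\<close> would be nilpotent, and a self-adjoint nilpotent element is
  zero.\<close>

lemma nonzero_eigenvalue:
  assumes sa: "adj C h = h" and nz: "h \<noteq> zer C a a"
  obtains c t where "c \<noteq> 0" "peval h t \<noteq> zer C a a" "cmp C h (peval h t) = scl C c (peval h t)"
proof -
  \<comment> \<open>Up to a scalar, \<open>r\<close> is the minimal polynomial of
    \<open>h\<close>.\<close>
  obtain r where r: "r \<noteq> 0" "peval h r = zer C a a"
    and least: "\<And>s. s \<noteq> 0 \<Longrightarrow> peval h s = zer C a a \<Longrightarrow> degree r \<le> degree s"
    using peval_annihilator ex_has_least_nat[of "\<lambda>r. r \<noteq> 0 \<and> peval h r = zer C a a" _ degree]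
    by blast
  have proper: "peval h s \<noteq> zer C a a" if "s \<noteq> 0" "degree s < degree r" for s
    using least[of s] that by auto
  have root_exists: "\<exists>c. poly s c = 0" if "degree s > 0" for s :: "complex poly"
    using fundamental_theorem_of_algebra[of s] that by (simp add: constant_degree)
  have factor: "\<exists>t. r = [:-c, 1:] * t \<and> t \<noteq> 0 \<and> degree t < degree r" if c: "poly r c = 0" for c
  proof -
    obtain t where t: "r = [:-c, 1:] * t" using c by (metis dvdE poly_eq_0_iff_dvd)
    then have "t \<noteq> 0" using r by auto
    then show ?thesis using t degree_mult_eq[of "[:-c, 1:]" t] by auto
  qed
  have linear: "peval h ([:-c, 1:] * t) = pls C (scl C (-c) (peval h t)) (cmp C h (peval h t))" for c t
  proof -
    have "[:-c, 1:] * t = smult (-c) t + pCons 0 t" by (simp add: mult_pCons_left)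
    then have "peval h ([:-c, 1:] * t) = pls C (scl C (-c) (peval h t)) (peval h (pCons 0 t))"
      by (simp only: peval_add peval_smult)
    then show ?thesis using h by simp
  qed
  have nz1: "idn C a \<noteq> zer C a a"
    using nz h by (metis cmp_idn cmp_zer obj_a)
  have "\<exists>c. poly r c = 0 \<and> c \<noteq> 0"
  proof (rule ccontr)
    assume no: "\<nexists>c. poly r c = 0 \<and> c \<noteq> 0"
    have "degree r > 0"
    proof (rule ccontr)
      assume "\<not> degree r > 0"
      then obtain d where "r = [:d:]" by (metis degree_eq_zeroE not_gr_zero)
      then show False using r nz1 h scl_eq_zer[of "idn C a" d] by simp
    qed
    then have "poly r 0 = 0" using root_exists no by metis
    then obtain t where t: "r = pCons 0 t" "t \<noteq> 0" "degree t < degree r"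
      using factor[of 0] by (auto simp: mult_pCons_left)
    have ht: "cmp C h (peval h t) = zer C a a" using r t h by simp
    have "degree t > 0"
    proof (rule ccontr)
      assume "\<not> degree t > 0"
      then obtain d where "t = [:d:]" by (metis degree_eq_zeroE not_gr_zero)
      then show False using ht t nz h scl_eq_zer[of h d] by simp
    qed
    then obtain c where "poly t c = 0" using root_exists by blast
    then have "poly t 0 = 0" using no t by auto
    then obtain s where s: "t = pCons 0 s" by (metis pCons_cases poly_pCons add.right_neutral mult_zero_left)
    \<comment> \<open>With t = X s and \<open>h\<close> self-adjoint, the left side is the adjoint
      of s(h) times h t(h), and h t(h) = 0.\<close>
    have "cmp C (adj C (peval h t)) (peval h t) = zer C a a"
      using h sa ht by (simp add: s cmp_pls)
    then have "peval h t = zer C a a" using adj_cmp_self_0[of "peval h t"] by simp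
    then show False using proper t by blast
  qed
  then obtain c where c: "poly r c = 0" "c \<noteq> 0" by blast
  obtain t where t: "r = [:-c, 1:] * t" "t \<noteq> 0" "degree t < degree r" using factor[OF c(1)] by blast
  have "pls C (cmp C h (peval h t)) (scl C (-1) (scl C c (peval h t))) = zer C a a"
    using linear[of c t] r t h by (simp add: pls_commute[of "cmp C h (peval h t)"])
  then have "cmp C h (peval h t) = scl C c (peval h t)"
    using cspace.minus_eq_0[OF hom_space, of a a "cmp C h (peval h t)" "scl C c (peval h t)"] h by simp
  then show ?thesis using that[of c t] c proper t by blast
qed

text \<open>An eigenvector \<open>g = t(h)\<close> inside the algebra generated by \<open>h\<close> satisfies \<open>g\<^sup>* g \<in> \<complex> g\<close>,
  so a positive multiple of \<open>g\<^sup>* g\<close> is an eigenprojection.\<close>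

lemma eigenprojection:
  assumes sa: "adj C h = h" and nz: "h \<noteq> zer C a a"
  obtains c p where "c \<noteq> 0" "p \<in> hom C a a" "p \<noteq> zer C a a" "cmp C p p = p" "adj C p = p"
    "cmp C h p = scl C c p"
proof -
  obtain c t where t: "c \<noteq> 0" "peval h t \<noteq> zer C a a" "cmp C h (peval h t) = scl C c (peval h t)"
    using nonzero_eigenvalue assms by blast
  define g where "g = peval h t"
  define d where "d = poly (map_poly cnj t) c"
  have g [simp]: "g \<in> arr C" "src C g = a" "tgt C g = a" by (simp_all add: g_def)
  \<comment> \<open>The adjoint of t(h) is the conjugate polynomial at \<open>h\<close>, which acts
    on the eigenvector \<open>g\<close> as the scalar \<open>d\<close>.\<close>
  have gg: "cmp C (adj C g) g = scl C d g"
    using peval_eigen[OF g(1,3), of c "map_poly cnj t"] t(3) sa by (simp add: g_def d_def peval_adj)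
  have d: "d \<noteq> 0"
  proof
    assume "d = 0"
    then have "g = zer C a a" using gg adj_cmp_self_0[of g] by simp
    then show False using t by (simp add: g_def)
  qed
  define q where "q = scl C d g"
  have q [simp]: "q \<in> arr C" "src C q = a" "tgt C q = a" by (simp_all add: q_def)
  have q_eq: "q = cmp C (adj C g) g" by (simp add: gg q_def)
  have qsa: "adj C q = q" unfolding q_eq by simp
  have "cmp C q q = cmp C (adj C q) q" by (simp add: qsa)
  also have "\<dots> = scl C (d * cnj d) q" by (simp add: q_def gg mult_ac)
  finally have qq: "cmp C q q = scl C (d * cnj d) q" .
  have hq: "cmp C h q = scl C c q" using h t(3) by (simp add: q_def g_def[symmetric] mult_ac)
  have qnz: "q \<noteq> zer C a a" using d t scl_eq_zer[of g d] by (auto simp: q_def g_def)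
  \<comment> \<open>By \<open>qq\<close> the square of \<open>q\<close> is |d|^2 times
    \<open>q\<close>, so dividing by |d|^2 produces an idempotent.\<close>
  define e where "e = 1 / (d * cnj d)"
  have e: "e \<noteq> 0" "cnj e = e" "e * (e * (d * cnj d)) = e" using d by (auto simp: e_def)
  show ?thesis
  proof (rule that[of c "scl C e q"])
    show "scl C e q \<noteq> zer C a a" using scl_eq_zer[of q e] e qnz by auto
    show "cmp C (scl C e q) (scl C e q) = scl C e q" using e qq by (simp add: mult_ac)
  qed (use t e hq h qsa in \<open>simp_all add: mult_ac\<close>)
qed

end

end

section \<open>Generating objects\<close>

context starcat
begin

text \<open>The weak form of being a generator: no non-zero object is orthogonal to
  \<open>y\<close>. This form passes easily along functors, and \<open>generates_resolves\<close>
  upgrades it to resolutions. Zero objects receive only the zero morphism and are exempt.\<close>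

definition generates :: "'o \<Rightarrow> bool" where
  "generates y \<longleftrightarrow> y \<in> obj C \<and>
     (\<forall>a\<in>obj C. idn C a \<noteq> zer C a a \<longrightarrow> (\<exists>f\<in>hom C y a. f \<noteq> zer C y a))"

text \<open>A resolution of the identity of \<open>a\<close> through \<open>y\<close>, in effect
  \<open>a\<close> as a summand of a multiple of \<open>y\<close>. Having separate c and e leaves
  room for the inverse eigenvalue that arises in \<open>generates_resolves\<close>.\<close>

definition resolves :: "'o \<Rightarrow> 'o \<Rightarrow> ('m \<times> 'm) list \<Rightarrow> bool" where
  "resolves y a ps \<longleftrightarrow> set ps \<subseteq> hom C y a \<times> hom C y a \<and>
     lsum (pls C) (zer C a a) (map (\<lambda>(c, e). cmp C c (adj C e)) ps) = idn C a"

definition proj :: "'o \<Rightarrow> 'm \<Rightarrow> bool" where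
  "proj a p \<longleftrightarrow> p \<in> hom C a a \<and> cmp C p p = p \<and> adj C p = p"

definition perp :: "'m \<Rightarrow> 'm" where
  "perp p = pls C (idn C (src C p)) (scl C (-1) p)"

definition orth :: "'o \<Rightarrow> 'm set \<Rightarrow> bool" where
  "orth a P \<longleftrightarrow> (\<forall>p\<in>P. proj a p \<and> p \<noteq> zer C a a) \<and> (\<forall>p\<in>P. \<forall>q\<in>P. p \<noteq> q \<longrightarrow> cmp C p q = zer C a a)"

text \<open>A substitute for the size of the endomorphism algebra that drops under splitting. It is
  the induction measure both for simple subobjects and for resolutions.\<close>

definition rank_le :: "nat \<Rightarrow> 'o \<Rightarrow> bool" where
  "rank_le n a \<longleftrightarrow> (\<forall>P. finite P \<longrightarrow> orth a P \<longrightarrow> card P \<le> n)"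

lemma projD:
  assumes "proj a p"
  shows "p \<in> arr C" "src C p = a" "tgt C p = a" "cmp C p p = p" "adj C p = p" "a \<in> obj C"
  using assms by (auto simp: proj_def)

lemma minus_pls:
  assumes "f \<in> arr C" "src C f = a" "tgt C f = b"
  shows "pls C (scl C (-1) f) f = zer C a b"
  using assms pls_minus[of f] pls_commute[of f "scl C (-1) f"] by auto

lemma perp_proj:
  assumes "proj a p"
  shows "proj a (perp p)" "cmp C p (perp p) = zer C a a" "cmp C (perp p) p = zer C a a"
    "pls C p (perp p) = idn C a"
proof -
  note [simp] = projD[OF assms]
  show 1: "cmp C p (perp p) = zer C a a" "cmp C (perp p) p = zer C a a" 
    by (simp_all add: perp_def cmp_pls pls_cmp minus_pls)
  show "pls C p (perp p) = idn C a"
    by (simp add: perp_def pls_left_commute[of p] minus_pls)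
  have "perp p \<in> hom C a a" "adj C (perp p) = perp p" by (simp_all add: perp_def)
  moreover have "cmp C (perp p) (perp p) = perp p"
    using calculation 1 by (subst (2) perp_def) (simp add: cmp_pls)
  ultimately show "proj a (perp p)" by (simp add: proj_def)
qed

lemma perp_eq_idn: 
  assumes "proj a p" "perp p = idn C a"
  shows "p = zer C a a"
  using perp_proj[OF assms(1)] projD[OF assms(1)] assms(2) by simp

lemma perp_eq_zer: 
  assumes "proj a p" "perp p = zer C a a"
  shows "p = idn C a"
  using perp_proj[OF assms(1)] projD[OF assms(1)] assms(2) by simp

lemma idn_proj: "a \<in> obj C \<Longrightarrow> proj a (idn C a)"
  by (simp add: proj_def)

lemma rank_leD: "rank_le n a \<Longrightarrow> finite P \<Longrightarrow> orth a P \<Longrightarrow> card P \<le> n"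
  by (simp add: rank_le_def)

lemma rank_le_0:
  assumes "rank_le 0 a" "a \<in> obj C"
  shows "idn C a = zer C a a"
proof (rule ccontr)
  assume "idn C a \<noteq> zer C a a"
  then have "orth a {idn C a}" using idn_proj[OF assms(2)] by (simp add: orth_def)
  then have "card {idn C a} \<le> 0" by (rule rank_leD[OF assms(1), rotated]) simp
  then show False by simp
qed

text \<open>Conjugation by \<open>u\<close> carries orthogonal projections of \<open>b\<close>
  injectively to projections of \<open>a\<close> below \<open>q\<close>. The complement
  \<open>perp q\<close> is non-zero and orthogonal to all of them, so the bound drops by
  one.\<close>

lemma rank_le_split:
  assumes r: "rank_le (Suc n) a" and q: "proj a q" "q \<noteq> idn C a"
    and u: "u \<in> hom C b a" "cmp C (adj C u) u = idn C b" "cmp C u (adj C u) = q"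
  shows "rank_le n b"
  unfolding rank_le_def
proof (intro allI impI)
  fix P assume P: "finite P" "orth b P"
  have [simp]: "u \<in> arr C" "src C u = b" "tgt C u = a" "a \<in> obj C" "b \<in> obj C" using u by auto
  have uu: "cmp C (adj C u) (cmp C u f) = f" if "f \<in> arr C" "tgt C f = b" for f
    using that u(2) cmp_assoc[of f u "adj C u"] by simp
  define g where "g p = cmp C u (cmp C p (adj C u))" for p
  have g_inv: "cmp C (adj C u) (cmp C (g p) u) = p" if "p \<in> arr C" "src C p = b" "tgt C p = b" for p
    using that by (simp add: g_def uu u(2))
  have Pp: "p \<in> P \<Longrightarrow> proj b p" and Pz: "p \<in> P \<Longrightarrow> p \<noteq> zer C b b"
    and Po: "p \<in> P \<Longrightarrow> p' \<in> P \<Longrightarrow> p \<noteq> p' \<Longrightarrow> cmp C p p' = zer C b b" for p p'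
    using P(2) unfolding orth_def by auto
  have inj: "inj_on g P"
    by (rule inj_on_inverseI[of _ "\<lambda>p. cmp C (adj C u) (cmp C p u)"]) (use Pp g_inv projD in metis)
  have gg: "cmp C (g p) (g p') = g (cmp C p p')" if "p \<in> P" "p' \<in> P" for p p'
    using projD[OF Pp[OF that(1)]] projD[OF Pp[OF that(2)]] by (simp add: g_def uu)
  have g0: "g (zer C b b) = zer C a a" by (simp add: g_def)
  have go: "cmp C (g p) (g p') = zer C a a" if "p \<in> P" "p' \<in> P" "g p \<noteq> g p'" for p p'
    using gg[of p p'] Po[of p p'] g0 that by metis
  have gp: "proj a (g p)" if "p \<in> P" for p
    using gg[OF that that] projD[OF Pp[OF that]] unfolding proj_def by (simp add: g_def)
  have gz: "g p \<noteq> zer C a a" if "p \<in> P" for p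
    using g_inv[of p] projD[OF Pp[OF that]] Pz[OF that] by auto
  have qg: "cmp C q (g p) = g p" "cmp C (g p) q = g p" if "p \<in> P" for p
    using projD[OF Pp[OF that]] by (simp_all add: u(3)[symmetric] g_def uu)
  have pg: "cmp C (perp q) (g p) = zer C a a" "cmp C (g p) (perp q) = zer C a a" if "p \<in> P" for p
    using projD[OF gp[OF that]] qg[OF that] projD[OF q(1)] by (simp_all add: perp_def pls_cmp cmp_pls minus_pls)
  have nz: "perp q \<noteq> zer C a a" using perp_eq_zer q by blast
  \<comment> \<open>A member of the image is killed by \<open>perp q\<close>, whereas a non-zero
    idempotent is not killed by itself.\<close>
  have nin: "perp q \<notin> g ` P" 
    using pg perp_proj(1)[OF q(1)] nz by (auto simp: proj_def)
  have "orth a (insert (perp q) (g ` P))"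
    unfolding orth_def using gp gz nz perp_proj(1)[OF q(1)] pg go by auto
  then have "card (insert (perp q) (g ` P)) \<le> Suc n"
    using rank_leD[OF r] P(1) by simp
  then show "card P \<le> n"
    using nin inj P(1) by (simp add: card_image)
qed

end

context cstarcat
begin

text \<open>Non-zero orthogonal projections are linearly independent: composing a relation with one
  of them isolates its coefficient. Finite dimension therefore bounds their number.\<close>

lemma rank_le_ex:
  assumes "a \<in> obj C"
  shows "\<exists>n. rank_le n a"
proof -
  interpret V: cspace "hom C a a" "pls C" "zer C a a" "scl C"
    using hom_space assms by auto
  obtain n where n: "\<And>(J :: 'm set) v. finite J \<Longrightarrow> n < card J \<Longrightarrow> (\<And>j. j \<in> J \<Longrightarrow> v j \<in> hom C a a) \<Longrightarrow> V.lin_dep J v"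
    using V.finite_dim_lin_dep[OF fd_hom] assms by metis
  have "card P \<le> n" if P: "finite P" "orth a P" for P
  proof (rule ccontr)
    assume "\<not> card P \<le> n"
    then have "V.lin_dep P (\<lambda>p. p)"
      using P by (intro n) (auto simp: orth_def dest: projD)
    then obtain js c i where js: "set js \<subseteq> P" "distinct js" "i \<in> set js" "c i \<noteq> 0"
      and 0: "lsum (pls C) (zer C a a) (map (\<lambda>j. scl C (c j) j) js) = zer C a a"
      unfolding V.lin_dep_def by blast
    have Pp: "p \<in> P \<Longrightarrow> proj a p \<and> p \<noteq> zer C a a"
      and Po: "p \<in> P \<Longrightarrow> p' \<in> P \<Longrightarrow> p \<noteq> p' \<Longrightarrow> cmp C p p' = zer C a a" for p p'
      using P(2) unfolding orth_def by auto
    have i: "i \<in> P" using js by auto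
    have "cmp C i (lsum (pls C) (zer C a a) (map (\<lambda>j. scl C (c j) j) js)) =
        (if i \<in> set js then scl C (c i) i else zer C a a)"
      using js(1,2)
    proof (induction js)
      case Nil
      then show ?case using assms Pp[OF i] projD[of a i] by simp
    next
      case (Cons j js)
      have "lsum (pls C) (zer C a a) (map (\<lambda>j. scl C (c j) j) js) \<in> hom C a a"
        using Cons.prems Pp assms projD[of a] by (intro lsum_hom) auto
      then show ?case
        using Cons projD[of a j] projD[of a i] Pp[of j] Pp[OF i] Po[OF i, of j] assms
        by (cases "i = j") (auto simp: cmp_pls)
    qed
    then have "scl C (c i) i = zer C a a" using 0 js Pp[OF i] projD[of a i] assms by simp
    then show False using scl_eq_zer[of i "c i"] js(4) Pp[OF i] projD[of a i] by simp
  qed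
  then show ?thesis unfolding rank_le_def by blast
qed

end

locale semisimple = cstarcat C for C :: "('o, 'm) cat" +
  assumes finite_semisimple: "finite_semisimple C"
begin

lemma split_projection:
  assumes "proj a p"
  obtains b u where "u \<in> hom C b a" "cmp C (adj C u) u = idn C b" "cmp C u (adj C u) = p"
proof -
  have "a \<in> obj C" "p \<in> hom C a a" using projD[OF assms] by auto
  then show ?thesis
    using assms finite_semisimple that unfolding finite_semisimple_def proj_def by blast
qed

text \<open>The eigenprojection of a non-zero self-adjoint endomorphism must be the identity, so
  that endomorphism is its eigenvalue times the identity. A general endomorphism is a combination of
  two self-adjoint ones.\<close>

lemma simple_obj_if_no_projection:
  assumes a: "a \<in> obj C" "idn C a \<noteq> zer C a a"
    and triv: "\<And>p. proj a p \<Longrightarrow> p = zer C a a \<or> p = idn C a"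
  shows "simple_obj C a"
  unfolding simple_obj_def
proof (intro conjI ballI)
  have sa: "\<exists>c. h = scl C c (idn C a)" if h: "h \<in> hom C a a" "adj C h = h" for h
  proof (cases "h = zer C a a")
    case True
    then show ?thesis using a by (intro exI[of _ 0]) simp
  next
    case False
    have h': "h \<in> arr C" "src C h = a" "tgt C h = a" using h by auto
    obtain c p where p: "p \<in> hom C a a" "p \<noteq> zer C a a" "cmp C p p = p" "adj C p = p"
      "cmp C h p = scl C c p" using eigenprojection[OF h' h(2) False] by metis
    then have "p = idn C a" using triv[of p] by (auto simp: proj_def)
    then show ?thesis using p h by auto
  qed
  fix f assume f: "f \<in> hom C a a"
  \<comment> \<open>Real and imaginary part: both are self-adjoint and f = h + i k.\<close>
  define h where "h = pls C (scl C (1/2) f) (scl C (1/2) (adj C f))"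
  define k where "k = pls C (scl C (-\<i>/2) f) (scl C (\<i>/2) (adj C f))"
  obtain c where c: "h = scl C c (idn C a)"
    using sa[of h] f by (auto simp: h_def pls_commute)
  obtain d where d: "k = scl C d (idn C a)"
    using sa[of k] f by (auto simp: k_def pls_commute)
  have *: "pls C (scl C (1/2) (adj C f)) (pls C (scl C (1/2) f) (scl C (-1/2) (adj C f))) = scl C (1/2) f"
    using f scl_plus[of "adj C f" "1/2" "-1/2", symmetric]
      pls_left_commute[of "scl C (1/2) (adj C f)" "scl C (1/2) f" "scl C (-1/2) (adj C f)"] by simp
  have "pls C h (scl C \<i> k) = f"
    using f scl_plus[of f "1/2" "1/2"] *
    by (simp add: h_def k_def scl_pls pls_assoc)
  then have "f = pls C (scl C c (idn C a)) (scl C (\<i> * d) (idn C a))"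
    using c d a by simp
  then show "\<exists>z. f = scl C z (idn C a)"
    using a scl_plus[of "idn C a" c "\<i> * d", symmetric] by auto
qed (use a in auto)

text \<open>Descent on the rank bound: a non-trivial projection splits off a non-zero subobject of
  smaller rank, and isometries compose.\<close>

lemma simple_subobject:
  assumes "a \<in> obj C" "idn C a \<noteq> zer C a a"
  obtains s u where "simple_obj C s" "u \<in> hom C s a" "cmp C (adj C u) u = idn C s"
proof -
  have "\<exists>s u. simple_obj C s \<and> u \<in> hom C s a \<and> cmp C (adj C u) u = idn C s"
    if "rank_le n a" for n using that assms
  proof (induction n arbitrary: a)
    case 0
    then show ?case using rank_le_0 by blast
  next
    case (Suc n)
    show ?case
    proof (cases "\<forall>p. proj a p \<longrightarrow> p = zer C a a \<or> p = idn C a")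
      case True
      then have "simple_obj C a" using simple_obj_if_no_projection Suc.prems by blast
      then show ?thesis using Suc.prems by (intro exI[of _ a] exI[of _ "idn C a"]) simp
    next
      case False
      then obtain q where q: "proj a q" "q \<noteq> zer C a a" "q \<noteq> idn C a" by blast
      obtain b u where u: "u \<in> hom C b a" "cmp C (adj C u) u = idn C b" "cmp C u (adj C u) = q"
        using split_projection[OF q(1)] by blast
      have b [simp]: "b \<in> obj C" using u by auto
      have "idn C b \<noteq> zer C b b"
      proof
        assume "idn C b = zer C b b"
        then have "cmp C u (cmp C (idn C b) (adj C u)) = zer C a a" using u by auto
        then show False using u q by auto
      qed
      then obtain s v where v: "simple_obj C s" "v \<in> hom C s b" "cmp C (adj C v) v = idn C s"
        using Suc.IH[of b] rank_le_split[OF Suc.prems(1) q(1,3) u] by auto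
      have "cmp C (adj C u) (cmp C u v) = v" using u v cmp_assoc[of v u "adj C u"] by auto
      then show ?thesis using u v by (intro exI[of _ s] exI[of _ "cmp C u v"]) auto
    qed
  qed
  then show ?thesis using rank_le_ex[OF assms(1)] that by blast
qed

text \<open>A non-zero object contains a simple one, which is isomorphic to some summand of
  \<open>m\<close>. Projecting \<open>m\<close> onto that summand and including it into the object
  gives the required morphism.\<close>

lemma direct_sum_simple_generates:
  assumes vs: "simple_reps C vs" and m: "direct_sum C vs m"
  shows "generates m"
  unfolding generates_def
proof (intro conjI ballI impI)
  show "m \<in> obj C" using m by (simp add: direct_sum_def)
  fix a assume a: "a \<in> obj C" "idn C a \<noteq> zer C a a"
  obtain s u where s: "simple_obj C s" and u: "u \<in> hom C s a" "cmp C (adj C u) u = idn C s"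
    using simple_subobject[OF a] by blast
  obtain v where "v \<in> set vs" "iso_obj C s v" using vs s unfolding simple_reps_def by blast
  then obtain i g g' where i: "i < length vs" "vs ! i = v"
    and g: "g \<in> hom C s v" "g' \<in> hom C v s" "cmp C g' g = idn C s"
    unfolding iso_obj_def in_set_conv_nth by auto
  from m obtain us where us: "\<forall>i<length vs. us ! i \<in> hom C (vs ! i) m"
    "\<forall>i<length vs. \<forall>j<length vs. cmp C (adj C (us ! i)) (us ! j) =
       (if i = j then idn C (vs ! i) else zer C (vs ! j) (vs ! i))"
    unfolding direct_sum_def by blast
  define w where "w = us ! i"
  have w: "w \<in> hom C v m" "cmp C (adj C w) w = idn C v"
    using us i by (simp_all add: w_def)
  define f where "f = cmp C u (cmp C g' (adj C w))"
  have f: "f \<in> hom C m a" using u g w by (auto simp: f_def)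
  have "cmp C (adj C w) (cmp C w g) = g" using w g cmp_assoc[of g w "adj C w"] by auto
  then have "cmp C f (cmp C w g) = u" using u g w by (auto simp: f_def)
  moreover have "u \<noteq> zer C s a"
  proof
    assume "u = zer C s a"
    then have "cmp C (adj C u) u = zer C s s" using s a by (simp add: simple_obj_def)
    then show False using s u by (simp add: simple_obj_def)
  qed
  ultimately have "f \<noteq> zer C m a" using g w a by auto
  then show "\<exists>f\<in>hom C m a. f \<noteq> zer C m a" using f by blast
qed

text \<open>A non-zero morphism f from \<open>y\<close> yields an eigenprojection p of f composed
  with its adjoint, and p factors through \<open>y\<close>. The complement of p splits off as an
  object of smaller rank, whose resolution is carried over along the isometry
  \<open>u\<close>.\<close>

lemma generates_resolves:
  assumes y: "generates y" and a: "a \<in> obj C"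
  obtains ps where "resolves y a ps"
proof -
  have "\<exists>ps. resolves y a ps" if "rank_le n a" for n using that a
  proof (induction n arbitrary: a)
    case 0
    then have "resolves y a []" using rank_le_0 by (simp add: resolves_def)
    then show ?case by blast
  next
    case (Suc n)
    have [simp]: "a \<in> obj C" by (fact Suc.prems)
    show ?case
    proof (cases "idn C a = zer C a a")
      case True
      then have "resolves y a []" by (simp add: resolves_def)
      then show ?thesis by blast
    next
      case False
      then obtain f where f: "f \<in> hom C y a" "f \<noteq> zer C y a"
        using y Suc.prems unfolding generates_def by blast
      have [simp]: "y \<in> obj C" using f by auto
      define h where "h = cmp C f (adj C f)"
      have h: "h \<in> arr C" "src C h = a" "tgt C h = a" "adj C h = h" using f by (auto simp: h_def)
      have "h \<noteq> zer C a a"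
      proof
        assume "h = zer C a a"
        then have "adj C f = zer C a y" using adj_cmp_self_0[of "adj C f"] f by (auto simp: h_def)
        then have "adj C (adj C f) = zer C y a" by simp
        then show False using f by simp
      qed
      then obtain c p where c: "c \<noteq> 0" and p0: "p \<in> hom C a a" "cmp C p p = p" "adj C p = p"
        and nz: "p \<noteq> zer C a a" and hp: "cmp C h p = scl C c p"
        using eigenprojection[OF h(1-3)] h(4) by metis
      have p: "proj a p" using p0 by (simp add: proj_def)
      \<comment> \<open>The product of \<open>g\<close> with the adjoint of \<open>e\<close> is p h
        p divided by the eigenvalue c, that is, p. The conjugate is there because the adjoint is
        antilinear.\<close>
      define g e where "g = cmp C p f" and "e = scl C (cnj (1 / c)) g"
      have g: "g \<in> hom C y a" "e \<in> hom C y a" using f projD[OF p] by (auto simp: g_def e_def)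
      have "cmp C p (cmp C h p) = scl C c p" using hp projD[OF p] by simp
      then have ge: "cmp C g (adj C e) = p" using f projD[OF p] c by (simp add: g_def e_def h_def)
      obtain b u where u: "u \<in> hom C b a" "cmp C (adj C u) u = idn C b" "cmp C u (adj C u) = perp p"
        using split_projection[OF perp_proj(1)[OF p]] by blast
      have b [simp]: "b \<in> obj C" using u by auto
      have "perp p \<noteq> idn C a" using perp_eq_idn p nz by blast
      then obtain ps where ps: "resolves y b ps"
        using Suc.IH[of b] rank_le_split[OF Suc.prems(1) perp_proj(1)[OF p] _ u] by auto
      then have ps1: "set ps \<subseteq> hom C y b \<times> hom C y b"
        and ps2: "lsum (pls C) (zer C b b) (map (\<lambda>(c, e). cmp C c (adj C e)) ps) = idn C b"
        by (auto simp: resolves_def)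
      have psD: "fst x \<in> arr C \<and> src C (fst x) = y \<and> tgt C (fst x) = b \<and>
          snd x \<in> arr C \<and> src C (snd x) = y \<and> tgt C (snd x) = b"
        if "x \<in> set ps" for x using that ps1 by (cases x) auto
      \<comment> \<open>Conjugated by \<open>u\<close>, the resolution of \<open>b\<close> adds up
        to \<open>perp p\<close>; the pair of \<open>g\<close> and \<open>e\<close> contributes the
        missing p.\<close>
      have "perp p = cmp C u (cmp C (lsum (pls C) (zer C b b) (map (\<lambda>(c, e). cmp C c (adj C e)) ps)) (adj C u))"
        using u by (simp add: ps2)
      also have "\<dots> = lsum (pls C) (zer C a a) (map (\<lambda>(c, e). cmp C (cmp C u c) (adj C (cmp C u e))) ps)"
      proof -
        have "cmp C (lsum (pls C) (zer C b b) (map (\<lambda>(c, e). cmp C c (adj C e)) ps)) (adj C u) =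
            lsum (pls C) (zer C a b) (map (\<lambda>(c, e). cmp C (cmp C c (adj C e)) (adj C u)) ps)"
          using u by (subst lsum_cmp[where a = b]) (auto simp: comp_def case_prod_unfold dest!: psD)
        moreover have "cmp C u (lsum (pls C) (zer C a b) (map (\<lambda>(c, e). cmp C (cmp C c (adj C e)) (adj C u)) ps)) =
            lsum (pls C) (zer C a a) (map (\<lambda>(c, e). cmp C u (cmp C (cmp C c (adj C e)) (adj C u))) ps)"
          using u by (subst cmp_lsum[where b = b]) (auto simp: comp_def case_prod_unfold dest!: psD)
        moreover have "map (\<lambda>(c, e). cmp C u (cmp C (cmp C c (adj C e)) (adj C u))) ps =
            map (\<lambda>(c, e). cmp C (cmp C u c) (adj C (cmp C u e))) ps"
          using u by (intro map_cong) (auto simp: case_prod_unfold dest!: psD)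
        ultimately show ?thesis by simp
      qed
      finally have "perp p = \<dots>" .
      then have "resolves y a ((g, e) # map (\<lambda>(c, e). (cmp C u c, cmp C u e)) ps)"
        using g u perp_proj(4)[OF p] ge unfolding resolves_def
        by (auto simp: comp_def case_prod_unfold dest!: psD)
      then show ?thesis by blast
    qed
  qed
  then show ?thesis using rank_le_ex[OF a] that by blast
qed

end

section \<open>Star functors\<close>

locale starfun = M: starcat M + N: starcat N for M N :: "('o, 'm) cat" +
  fixes F
  assumes star_functor: "star_functor M N F"
begin

lemma
  shows fob_extensional: "fob F \<in> obj M \<rightarrow>\<^sub>E obj N"
    and fmp_extensional: "fmp F \<in> arr M \<rightarrow>\<^sub>E arr N"
    and fob_obj [simp]: "a \<in> obj M \<Longrightarrow> fob F a \<in> obj N"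
    and fmp_arr [simp]: "f \<in> arr M \<Longrightarrow> fmp F f \<in> arr N"
    and src_fmp [simp]: "f \<in> arr M \<Longrightarrow> src N (fmp F f) = fob F (src M f)"
    and tgt_fmp [simp]: "f \<in> arr M \<Longrightarrow> tgt N (fmp F f) = fob F (tgt M f)"
    and fmp_idn [simp]: "a \<in> obj M \<Longrightarrow> fmp F (idn M a) = idn N (fob F a)"
    and fmp_cmp [simp]: "f \<in> arr M \<Longrightarrow> g \<in> arr M \<Longrightarrow> src M g = tgt M f \<Longrightarrow>
        fmp F (cmp M g f) = cmp N (fmp F g) (fmp F f)"
    and fmp_scl [simp]: "f \<in> arr M \<Longrightarrow> fmp F (scl M z f) = scl N z (fmp F f)"
    and fmp_adj [simp]: "f \<in> arr M \<Longrightarrow> fmp F (adj M f) = adj N (fmp F f)"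
  using star_functor unfolding star_functor_def by (auto simp: PiE_mem)

lemma fmp_pls [simp]:
  assumes "f \<in> arr M" "g \<in> arr M" "src M f = src M g" "tgt M f = tgt M g"
  shows "fmp F (pls M f g) = pls N (fmp F f) (fmp F g)"
proof -
  have "a \<in> obj M \<Longrightarrow> b \<in> obj M \<Longrightarrow> f \<in> hom M a b \<Longrightarrow> g \<in> hom M a b \<Longrightarrow>
      fmp F (pls M f g) = pls N (fmp F f) (fmp F g)" for a b
    using star_functor unfolding star_functor_def by blast
  from this[of "src M f" "tgt M f"] show ?thesis using assms by simp
qed

lemma fmp_zer [simp]: "a \<in> obj M \<Longrightarrow> b \<in> obj M \<Longrightarrow> fmp F (zer M a b) = zer N (fob F a) (fob F b)"
  using fmp_scl[of "zer M a b" 0] by simp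

lemma fmp_lsum:
  assumes "a \<in> obj M" "b \<in> obj M" "set fs \<subseteq> hom M a b"
  shows "fmp F (lsum (pls M) (zer M a b) fs) = lsum (pls N) (zer N (fob F a) (fob F b)) (map (fmp F) fs)"
  using assms by (intro lsum_image[where S = "hom M a b"]) auto

end

text \<open>The faithful adjoint \<open>G\<close> sends a non-zero object to a non-zero one, which
  receives a non-zero morphism from \<open>y\<close>. The transpose of that morphism under the
  adjunction is the one required.\<close>

lemma (in starfun) generates_image:
  assumes bif: "bifaithful M N F" and y: "M.generates y"
  shows "N.generates (fob F y)"
  unfolding N.generates_def
proof (intro conjI ballI impI)
  show "fob F y \<in> obj N" using y by (simp add: M.generates_def)
  fix a assume a: "a \<in> obj N" "idn N a \<noteq> zer N a a"
  obtain G where "star_functor N M G" and adjunction: "adjoint_functors M N F G" and "faithful N G"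
    using bif unfolding bifaithful_def by blast
  interpret G: starfun N M G by standard fact
  obtain \<eta> \<epsilon> where eta: "\<eta> \<in> NT M M (fid M) (fcomp M G F)" and eps: "\<epsilon> \<in> NT N N (fcomp N F G) (fid N)"
    and triangle: "\<forall>b\<in>obj N. cmp M (fmp G (\<epsilon> b)) (\<eta> (fob G b)) = idn M (fob G b)"
    using adjunction unfolding adjoint_functors_def by blast
  have eta_hom: "\<eta> c \<in> hom M c (fob G (fob F c))" if "c \<in> obj M" for c
    using eta that unfolding NT_def fid_def fcomp_def by (auto simp: PiE_mem compose_eq dest!: PiE_mem)
  have eps_hom: "\<epsilon> c \<in> hom N (fob F (fob G c)) c" if "c \<in> obj N" for c
    using eps that unfolding NT_def fid_def fcomp_def by (auto simp: PiE_mem compose_eq dest!: PiE_mem)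
  have eta_nat: "cmp M (\<eta> (tgt M f)) f = cmp M (fmp G (fmp F f)) (\<eta> (src M f))" if "f \<in> arr M" for f
    using eta that unfolding NT_def fid_def fcomp_def by (auto simp: compose_eq)
  have "idn M (fob G a) \<noteq> zer M (fob G a) (fob G a)"
    using \<open>faithful N G\<close> a inj_onD[of "fmp G" "hom N a a" "idn N a" "zer N a a"]
    unfolding faithful_def by auto
  then obtain f where f: "f \<in> hom M y (fob G a)" "f \<noteq> zer M y (fob G a)"
    using y a unfolding M.generates_def by (meson G.fob_obj)
  have y: "y \<in> obj M" using f by auto
  define g where "g = cmp N (\<epsilon> a) (fmp F f)"
  have g: "g \<in> hom N (fob F y) a" using f eps_hom[OF a(1)] by (auto simp: g_def)
  \<comment> \<open>Transposing \<open>g\<close> back by the unit recovers \<open>f\<close>, so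
    \<open>g\<close> cannot vanish.\<close>
  have "cmp M (fmp G g) (\<eta> y) = cmp M (fmp G (\<epsilon> a)) (cmp M (fmp G (fmp F f)) (\<eta> y))"
    using f eps_hom[OF a(1)] eta_hom[OF y] by (auto simp: g_def)
  also have "\<dots> = cmp M (cmp M (fmp G (\<epsilon> a)) (\<eta> (fob G a))) f"
    using eta_nat[of f] f eps_hom[OF a(1)] eta_hom[of "fob G a"] a by auto
  also have "\<dots> = f" using triangle a f by auto
  finally have "cmp M (fmp G g) (\<eta> y) = f" .
  then have "g \<noteq> zer N (fob F y) a"
    using f eta_hom[OF y] a y by auto
  then show "\<exists>f\<in>hom N (fob F y) a. f \<noteq> zer N (fob F y) a" using g by blast
qed


section \<open>Inductive limits\<close>

locale tower =
  fixes T :: "'v tower"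
  assumes inc_lev [simp]: "v \<in> lev T k \<Longrightarrow> inc T k v \<in> lev T (Suc k)"
    and inc_inj: "inj_on (inc T k) (lev T k)"
begin

lemma push_lev [simp]: "v \<in> lev T k \<Longrightarrow> push T k j v \<in> lev T (k + j)"
  by (induction j) auto

lemma push_add: "push T k (i + j) v = push T (k + i) j (push T k i v)"
  by (induction j) (auto simp: add.assoc)

lemma push_inj: "v \<in> lev T k \<Longrightarrow> w \<in> lev T k \<Longrightarrow> push T k j v = push T k j w \<Longrightarrow> v = w"
  by (induction j) (auto dest!: inj_onD[OF inc_inj])

lemma germ_mono:
  assumes "k + i = l + j" "push T k i v = push T l j w"
  shows "push T k (i + n) v = push T l (j + n) w"
  using assms by (simp add: push_add)

lemma germ_inc [simp]:
  shows "germ T (Suc k) (inc T k v) = germ T k v"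
proof -
  have 1: "push T (Suc k) i (inc T k v) = push T k (Suc i) v" for i
    using push_add[of k 1 i v] by simp
  have "(\<exists>i j. Suc k + i = l + j \<and> push T (Suc k) i (inc T k v) = push T l j w) \<longleftrightarrow>
      (\<exists>i j. k + i = l + j \<and> push T k i v = push T l j w)" for l w
  proof
    assume "\<exists>i j. k + i = l + j \<and> push T k i v = push T l j w"
    then obtain i j where ij: "k + i = l + j" "push T k i v = push T l j w" by blast
    show "\<exists>i j. Suc k + i = l + j \<and> push T (Suc k) i (inc T k v) = push T l j w"
      using germ_mono[OF ij, of 1] ij(1) by (intro exI[of _ i] exI[of _ "Suc j"]) (simp add: 1)
  next
    assume "\<exists>i j. Suc k + i = l + j \<and> push T (Suc k) i (inc T k v) = push T l j w"
    then show "\<exists>i j. k + i = l + j \<and> push T k i v = push T l j w"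
      by (metis 1 add_Suc_shift)
  qed
  then show ?thesis by (simp add: germ_def)
qed

lemma germ_push [simp]: "germ T (k + j) (push T k j v) = germ T k v"
  by (induction j) auto

text \<open>Injective inclusions make every level embed in the limit. This is what allows an
  equation between germs to be read back as an equation between morphisms at that level.\<close>

lemma germ_inj:
  assumes "germ T k v = germ T k w" "v \<in> lev T k" "w \<in> lev T k"
  shows "v = w"
proof -
  have "(k, v) \<in> germ T k v" using assms(2) by (auto simp: germ_def)
  then have "(k, v) \<in> germ T k w" using assms(1) by simp
  then obtain i where "push T k i w = push T k i v" unfolding germ_def by auto
  then show ?thesis using push_inj assms by metis
qed

lemma germ_lim [simp]: "v \<in> lev T k \<Longrightarrow> germ T k v \<in> lim_set T"
  by (auto simp: lim_set_def)

text \<open>Stated with an eventual quantifier, so that finitely many elements, possibly of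
  different limits, are brought to a common level by a conjunction of filter statements.\<close>

lemma lim_eventually:
  assumes "x \<in> lim_set T"
  shows "\<forall>\<^sub>F k in sequentially. \<exists>v\<in>lev T k. x = germ T k v"
proof -
  obtain k v where v: "v \<in> lev T k" "x = germ T k v" using assms by (auto simp: lim_set_def)
  have "\<exists>v\<in>lev T l. x = germ T l v" if "l \<ge> k" for l
    using that v by (metis germ_push push_lev le_add_diff_inverse)
  then show ?thesis by (auto simp: eventually_sequentially)
qed

lemma eventually_cases:
  assumes "x \<in> lim_set T" "\<forall>\<^sub>F k in sequentially. P k"
  obtains k v where "P k" "v \<in> lev T k" "x = germ T k v"
  using eventually_happens[OF eventually_conj[OF lim_eventually[OF assms(1)] assms(2)]] by auto

end

lemma lim_cases2:
  assumes "tower S" "tower T" "x \<in> lim_set S" "y \<in> lim_set T"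
  obtains k v w where "v \<in> lev S k" "x = germ S k v" "w \<in> lev T k" "y = germ T k w"
  using tower.eventually_cases[OF assms(1,3) tower.lim_eventually[OF assms(2,4)]] by metis

lemma lim_cases3:
  assumes "tower R" "tower S" "tower T" "x \<in> lim_set R" "y \<in> lim_set S" "z \<in> lim_set T"
  obtains k u v w where "u \<in> lev R k" "x = germ R k u" "v \<in> lev S k" "y = germ S k v"
    "w \<in> lev T k" "z = germ T k w"
proof -
  have "\<forall>\<^sub>F k in sequentially. (\<exists>v\<in>lev S k. y = germ S k v) \<and> (\<exists>v\<in>lev T k. z = germ T k v)"
    by (intro eventually_conj tower.lim_eventually assms)
  then obtain k u where "(\<exists>v\<in>lev S k. y = germ S k v) \<and> (\<exists>v\<in>lev T k. z = germ T k v)"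
    "u \<in> lev R k" "x = germ R k u"
    by (rule tower.eventually_cases[OF assms(1,4)])
  then show ?thesis using that by blast
qed

text \<open>Compatibility with the inclusions is required from \<open>K\<close> on only, since a
  sequence representing a 2-cell satisfies the exchange relations only eventually.\<close>

lemma germ_map_cong:
  assumes S: "tower S" and T: "tower T"
    and inc: "\<And>k v. K \<le> k \<Longrightarrow> v \<in> lev S k \<Longrightarrow> f (Suc k) (inc S k v) = inc T k (f k v)"
    and s: "s \<in> lev S k" "s' \<in> lev S l" "K \<le> k" "K \<le> l" and eq: "germ S k s = germ S l s'"
  shows "germ T k (f k s) = germ T l (f l s')"
proof -
  interpret S: tower S by fact
  interpret T: tower T by fact
  have push: "v \<in> lev S k \<Longrightarrow> K \<le> k \<Longrightarrow> f (k + j) (push S k j v) = push T k j (f k v)" for k j v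
    by (induction j) (auto simp: inc)
  \<comment> \<open>Both vectors are compared at level k + l, wherever their germs first meet;
    injectivity of the inclusions permits this.\<close>
  define i j where "i = l" and "j = k"
  have ij: "k + i = l + j" by (simp add: i_def j_def)
  have "germ S (k + i) (push S k i s) = germ S (k + i) (push S l j s')"
    using eq by (simp add: ij) (simp add: ij[symmetric])
  moreover have "push S k i s \<in> lev S (k + i)" "push S l j s' \<in> lev S (k + i)"
    using S.push_lev[OF s(1), of i] S.push_lev[OF s(2), of j] ij by simp_all
  ultimately have "push S k i s = push S l j s'" using S.germ_inj by blast
  then have "push T k i (f k s) = push T l j (f l s')"
    using push[OF s(1,3), of i] push[OF s(2,4), of j] by (simp add: ij)
  then have "germ T (k + i) (push T k i (f k s)) = germ T (l + j) (push T l j (f l s'))"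
    by (simp only: ij)
  then show ?thesis by simp
qed

text \<open>The definite description in \<open>lim1\<close> has a value because
  \<open>germ_map_cong\<close> makes the result independent of the representative.\<close>

lemma lim1_germ:
  assumes S: "tower S" and T: "tower T"
    and inc: "\<And>k v. v \<in> lev S k \<Longrightarrow> f (Suc k) (inc S k v) = inc T k (f k v)"
    and s: "s \<in> lev S k"
  shows "lim1 S T f (germ S k s) = germ T k (f k s)"
  unfolding lim1_def
proof (rule the_equality)
  show "\<exists>l. \<exists>s'\<in>lev S l. germ S k s = germ S l s' \<and> germ T k (f k s) = germ T l (f l s')"
    using s by blast
next
  fix z assume "\<exists>l. \<exists>s'\<in>lev S l. germ S k s = germ S l s' \<and> z = germ T l (f l s')"
  then obtain l s' where "s' \<in> lev S l" "germ S k s = germ S l s'" "z = germ T l (f l s')" by blast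
  then show "z = germ T k (f k s)"
    using germ_map_cong[where f = f and K = 0, OF S T inc s, of s' l] by simp
qed

lemma lim2_germ:
  assumes R: "tower R" and S: "tower S" and T: "tower T"
    and inc: "\<And>k u v. u \<in> lev R k \<Longrightarrow> v \<in> lev S k \<Longrightarrow> f (Suc k) (inc R k u) (inc S k v) = inc T k (f k u v)"
    and r: "r \<in> lev R k" and s: "s \<in> lev S k"
  shows "lim2 R S T f (germ R k r) (germ S k s) = germ T k (f k r s)"
proof -
  interpret R: tower R by fact
  interpret S: tower S by fact
  interpret T: tower T by fact
  have push: "u \<in> lev R k \<Longrightarrow> v \<in> lev S k \<Longrightarrow>
      f (k + j) (push R k j u) (push S k j v) = push T k j (f k u v)" for k j u v
    by (induction j) (auto simp: inc)
  have eq: "germ T k (f k r s) = germ T l (f l r' s')"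
    if *: "r' \<in> lev R l" "germ R k r = germ R l r'" "s' \<in> lev S l" "germ S k s = germ S l s'" for l r' s'
  proof -
    define i j where "i = l" and "j = k"
    have ij: "k + i = l + j" by (simp add: i_def j_def)
    have "germ S (k + i) (push S k i s) = germ S (k + i) (push S l j s')"
      using * by (simp add: ij) (simp add: ij[symmetric])
    moreover have "push S k i s \<in> lev S (k + i)" "push S l j s' \<in> lev S (k + i)"
      using S.push_lev[OF s, of i] S.push_lev[OF *(3), of j] ij by simp_all
    ultimately have 1: "push S k i s = push S l j s'" using S.germ_inj by blast
    have "germ R (k + i) (push R k i r) = germ R (k + i) (push R l j r')"
      using * by (simp add: ij) (simp add: ij[symmetric])
    moreover have "push R k i r \<in> lev R (k + i)" "push R l j r' \<in> lev R (k + i)"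
      using R.push_lev[OF r, of i] R.push_lev[OF *(1), of j] ij by simp_all
    ultimately have 2: "push R k i r = push R l j r'" using R.germ_inj by blast
    have "push T k i (f k r s) = push T l j (f l r' s')"
      using push[OF r s, of i] push[OF *(1,3), of j] 1 2 by (simp add: ij)
    then have "germ T (k + i) (push T k i (f k r s)) = germ T (l + j) (push T l j (f l r' s'))"
      by (simp only: ij)
    then show ?thesis by simp
  qed
  show ?thesis unfolding lim2_def
  proof (rule the_equality)
    show "\<exists>l. \<exists>r'\<in>lev R l. \<exists>s'\<in>lev S l. germ R k r = germ R l r' \<and> germ S k s = germ S l s' \<and>
        germ T k (f k r s) = germ T l (f l r' s')"
      using r s by blast
  next
    fix z assume "\<exists>l. \<exists>r'\<in>lev R l. \<exists>s'\<in>lev S l. germ R k r = germ R l r' \<and>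
        germ S k s = germ S l s' \<and> z = germ T l (f l r' s')"
    then obtain l r' s' where "r' \<in> lev R l" "s' \<in> lev S l" "germ R k r = germ R l r'"
      "germ S k s = germ S l s'" "z = germ T l (f l r' s')" by blast
    then show "z = germ T k (f k r s)" using eq[of r' l s'] by simp
  qed
qed

lemma (in tower) lim_complex_space:
  assumes sp: "\<And>k. complex_space (lev T k) (add k) (z k) (sc k)"
    and add: "\<And>k u v. u \<in> lev T k \<Longrightarrow> v \<in> lev T k \<Longrightarrow> inc T k (add k u v) = add (Suc k) (inc T k u) (inc T k v)"
    and sc: "\<And>k c u. u \<in> lev T k \<Longrightarrow> inc T k (sc k c u) = sc (Suc k) c (inc T k u)"
  shows "complex_space (lim_set T) (lim2 T T T add) (germ T 0 (z 0)) (\<lambda>c. lim1 T T (\<lambda>k. sc k c))"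
    and "germ T k (z k) = germ T 0 (z 0)"
proof -
  interpret V: cspace "lev T k" "add k" "z k" "sc k" for k
    by (simp add: cspace_def sp)
  have tow: "tower T" by unfold_locales
  \<comment> \<open>Zero is 0 times itself, so compatibility with scalars already carries zero to
    zero.\<close>
  have z: "inc T k (z k) = z (Suc k)" for k
    using sc[of "z k" k 0] by (simp)
  show zk: "germ T k (z k) = germ T 0 (z 0)" for k
  proof (induction k)
    case (Suc k)
    then show ?case using germ_inc[of k "z k"] z[of k] by simp
  qed simp
  have A: "lim2 T T T add (germ T k u) (germ T k v) = germ T k (add k u v)"
    if "u \<in> lev T k" "v \<in> lev T k" for k u v
    using that by (intro lim2_germ tow) (auto simp: add)
  have S: "lim1 T T (\<lambda>k. sc k c) (germ T k u) = germ T k (sc k c u)" if "u \<in> lev T k" for k c u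
    using that by (intro lim1_germ tow) (auto simp: sc)
  note cases1 = eventually_cases[OF _ eventually_True]
  note cases2 = lim_cases2[OF tow tow]
  note cases3 = lim_cases3[OF tow tow tow]
  show "complex_space (lim_set T) (lim2 T T T add) (germ T 0 (z 0)) (\<lambda>c. lim1 T T (\<lambda>k. sc k c))"
    unfolding complex_space_def
  proof (intro conjI ballI allI)
    fix u v w assume "u \<in> lim_set T" "v \<in> lim_set T" "w \<in> lim_set T"
    then show "lim2 T T T add (lim2 T T T add u v) w = lim2 T T T add u (lim2 T T T add v w)"
      by (rule cases3) (simp add: A V.add_assoc)
  next
    fix u v assume *: "u \<in> lim_set T" "v \<in> lim_set T"
    show "lim2 T T T add u v \<in> lim_set T" using * by (rule cases2) (simp add: A)
    show "lim2 T T T add u v = lim2 T T T add v u" using * by (rule cases2) (simp add: A V.add_commute)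
    show "lim1 T T (\<lambda>k. sc k c) (lim2 T T T add u v) =
        lim2 T T T add (lim1 T T (\<lambda>k. sc k c) u) (lim1 T T (\<lambda>k. sc k c) v)" for c
      using * by (rule cases2) (simp add: A S V.sc_add)
  next
    fix u assume "u \<in> lim_set T"
    then obtain k v where u: "v \<in> lev T k" "u = germ T k v" by (rule cases1)
    show "lim2 T T T add (germ T 0 (z 0)) u = u"
      "lim2 T T T add u (lim1 T T (\<lambda>k. sc k (-1)) u) = germ T 0 (z 0)"
      "lim1 T T (\<lambda>k. sc k c) u \<in> lim_set T"
      "lim1 T T (\<lambda>k. sc k (c + d)) u = lim2 T T T add (lim1 T T (\<lambda>k. sc k c) u) (lim1 T T (\<lambda>k. sc k d) u)"
      "lim1 T T (\<lambda>k. sc k (c * d)) u = lim1 T T (\<lambda>k. sc k c) (lim1 T T (\<lambda>k. sc k d) u)"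
      "lim1 T T (\<lambda>k. sc k 1) u = u" for c d
      using u by (simp_all add: A S V.sc_plus zk[of k, symmetric])
  qed simp
qed

section \<open>The algebra of a 0-cell\<close>

text \<open>\<open>xob b \<Gamma> 0\<close> has to stay folded: the rules for level k mention
  \<open>xob b \<Gamma> k\<close> and are also applied at level 0.\<close>

declare xob.simps(1) [simp del]

lemma finite_dim_image:
  assumes fd: "finite_dim S add z sc" and cs: "cspace S add z sc"
    and f: "f z = z'" "\<And>u v. u \<in> S \<Longrightarrow> v \<in> S \<Longrightarrow> f (add u v) = add' (f u) (f v)"
      "\<And>c u. u \<in> S \<Longrightarrow> f (sc c u) = sc' c (f u)"
  shows "finite_dim (f ` S) add' z' sc'"
proof -
  interpret cspace S add z sc by fact
  obtain bs where bs: "set bs \<subseteq> S" "\<forall>v\<in>S. \<exists>cs. length cs = length bs \<and> v = lsum add z (map2 sc cs bs)"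
    using fd unfolding finite_dim_def by blast
  have "\<exists>cs. length cs = length (map f bs) \<and> f v = lsum add' z' (map2 sc' cs (map f bs))" if v: "v \<in> S" for v
  proof -
    obtain cs where c: "length cs = length bs" "v = lsum add z (map2 sc cs bs)" using bs v by blast
    have "set (map2 sc cs bs) \<subseteq> S" using bs by (auto dest!: set_zip_rightD)
    then have "f v = lsum add' z' (map f (map2 sc cs bs))"
      unfolding c(2) using f by (intro lsum_image[where S = S]) auto
    also have "map f (map2 sc cs bs) = map2 sc' cs (map f bs)"
      using bs(1) by (auto simp: zip_map2 f dest!: set_zip_rightD)
    finally show ?thesis using c by auto
  qed
  then show ?thesis unfolding finite_dim_def using bs(1) by (intro exI[of _ "map f bs"]) auto
qed

lemma star_algebraD:
  assumes "star_algebra A" "x \<in> acar A"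
  shows "amul A (aone A) x = x" "amul A x (aone A) = x" "astar A x \<in> acar A" "astar A (astar A x) = x"
    and "y \<in> acar A \<Longrightarrow> amul A x y \<in> acar A"
    and "y \<in> acar A \<Longrightarrow> astar A (amul A x y) = amul A (astar A y) (astar A x)"
    and "y \<in> acar A \<Longrightarrow> astar A (aadd A x y) = aadd A (astar A x) (astar A y)"
    and "y \<in> acar A \<Longrightarrow> amul A (ascl A c x) y = ascl A c (amul A x y)"
    and "y \<in> acar A \<Longrightarrow> amul A x (ascl A c y) = ascl A c (amul A x y)"
    and "astar A (ascl A c x) = ascl A (cnj c) (astar A x)"
    and "y \<in> acar A \<Longrightarrow> w \<in> acar A \<Longrightarrow> amul A (amul A x y) w = amul A x (amul A y w)"
    and "y \<in> acar A \<Longrightarrow> w \<in> acar A \<Longrightarrow> amul A (aadd A x y) w = aadd A (amul A x w) (amul A y w)"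
    and "y \<in> acar A \<Longrightarrow> w \<in> acar A \<Longrightarrow> amul A x (aadd A y w) = aadd A (amul A x y) (amul A x w)"
  using assms unfolding star_algebra_def by blast+

lemma star_algebra_restrict:
  assumes A: "star_algebra A" and S: "S \<subseteq> acar A" "azero A \<in> S" "aone A \<in> S"
    and closed: "\<And>x y. x \<in> S \<Longrightarrow> y \<in> S \<Longrightarrow> aadd A x y \<in> S" "\<And>x y. x \<in> S \<Longrightarrow> y \<in> S \<Longrightarrow> amul A x y \<in> S"
      "\<And>c x. x \<in> S \<Longrightarrow> ascl A c x \<in> S" "\<And>x. x \<in> S \<Longrightarrow> astar A x \<in> S"
  shows "star_algebra (A\<lparr>acar := S\<rparr>)"
proof -
  have in_A: "x \<in> S \<Longrightarrow> x \<in> acar A" for x using S(1) by auto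
  interpret cspace "acar A" "aadd A" "azero A" "ascl A"
    using A by (simp add: star_algebra_def cspace_def)
  have "complex_space S (aadd A) (azero A) (ascl A)"
    unfolding complex_space_def
    by (intro conjI ballI allI) (use S closed in \<open>simp_all add: in_A add_ac sc_add sc_plus\<close>)
  then show ?thesis
    unfolding star_algebra_def
    by (intro conjI ballI allI) (use S(3) closed in \<open>simp_all add: star_algebraD[OF A] in_A\<close>)
qed

locale zcell =
  fixes b :: "('o, 'm) cat \<Rightarrow> 'o" and \<Gamma> :: "('o, 'm) ucell0"
  assumes base_choice: "base_choice b" and uc0: "\<Gamma> \<in> uc0"
begin

lemma finite_semisimple [simp]: "finite_semisimple (cats \<Gamma> k)"
  and bifaithful: "bifaithful (cats \<Gamma> k) (cats \<Gamma> (Suc k)) (gam \<Gamma> k)"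
  using uc0 by (auto simp: uc0_def)

end

sublocale zcell \<subseteq> K: semisimple "cats \<Gamma> k" for k
  using finite_semisimple[of k]
  by unfold_locales (auto simp: finite_semisimple_def fd_cstar_category_def)

sublocale zcell \<subseteq> G: starfun "cats \<Gamma> k" "cats \<Gamma> (Suc k)" "gam \<Gamma> k" for k
  using bifaithful[of k] by unfold_locales (auto simp: bifaithful_def)

context zcell
begin

abbreviation "TA \<equiv> alg_tower b \<Gamma>"
abbreviation "A \<equiv> Psi0 b \<Gamma>"
abbreviation "X \<equiv> xob b \<Gamma>"

lemma xob_generates: "K.generates k (X k)"
proof (induction k)
  case 0
  obtain vs where "simple_reps (cats \<Gamma> 0) vs" "direct_sum (cats \<Gamma> 0) vs (b (cats \<Gamma> 0))"
    using base_choice finite_semisimple[of 0] unfolding base_choice_def by blast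
  then show ?case using K.direct_sum_simple_generates by (simp add: xob.simps)
next
  case (Suc k)
  then show ?case using G.generates_image[OF bifaithful] by simp
qed

lemma xob_obj [simp]: "X k \<in> obj (cats \<Gamma> k)"
  using xob_generates unfolding K.generates_def by blast

lemma gam_inj: 
  assumes "f \<in> arr (cats \<Gamma> k)" "g \<in> arr (cats \<Gamma> k)" "src (cats \<Gamma> k) f = src (cats \<Gamma> k) g"
    "tgt (cats \<Gamma> k) f = tgt (cats \<Gamma> k) g" "fmp (gam \<Gamma> k) f = fmp (gam \<Gamma> k) g"
  shows "f = g"
proof -
  have "inj_on (fmp (gam \<Gamma> k)) (hom (cats \<Gamma> k) (src (cats \<Gamma> k) g) (tgt (cats \<Gamma> k) g))"
    using bifaithful[of k] assms unfolding bifaithful_def faithful_def by simp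
  from inj_onD[OF this assms(5)] show ?thesis using assms by simp
qed

lemma lev_TA [simp]: "lev TA k = hom (cats \<Gamma> k) (X k) (X k)"
  and inc_TA [simp]: "inc TA k = fmp (gam \<Gamma> k)"
  by (simp_all add: alg_tower_def)

lemma tower_TA: "tower TA"
proof
  show "inj_on (inc TA k) (lev TA k)" for k
    by (rule inj_onI, rule gam_inj) auto
qed auto

end

sublocale zcell \<subseteq> TA: tower "alg_tower b \<Gamma>"
  by (rule tower_TA)

context zcell
begin

lemma acar_A [simp]: "acar A = lim_set TA"
  by (simp add: Psi0_def Let_def)

text \<open>Zero is defined as a germ at level 0 but is met at the level of whichever operands
  occur, hence its description at arbitrary k. The unit is treated in the same way below.\<close>

lemma A_complex_space: "complex_space (lim_set TA) (aadd A) (azero A) (ascl A)"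
  and azero_germ: "azero A = germ TA k (zer (cats \<Gamma> k) (X k) (X k))"
proof -
  have sp: "complex_space (lev TA k) (pls (cats \<Gamma> k)) (zer (cats \<Gamma> k) (X k) (X k)) (scl (cats \<Gamma> k))" for k
    using cspace.complex_space[OF K.hom_space[of "X k" k "X k"]] by simp
  note * = TA.lim_complex_space[where add = "\<lambda>k. pls (cats \<Gamma> k)"
      and z = "\<lambda>k. zer (cats \<Gamma> k) (X k) (X k)" and sc = "\<lambda>k. scl (cats \<Gamma> k)", OF sp]
  show "complex_space (lim_set TA) (aadd A) (azero A) (ascl A)"
    using *(1) by (simp add: Psi0_def Let_def)
  show "azero A = germ TA k (zer (cats \<Gamma> k) (X k) (X k))"
    using *(2)[of k] by (simp add: Psi0_def Let_def)
qed

lemma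
  assumes "u \<in> lev TA k" "v \<in> lev TA k"
  shows aadd_germ [simp]: "aadd A (germ TA k u) (germ TA k v) = germ TA k (pls (cats \<Gamma> k) u v)"
    and amul_germ [simp]: "amul A (germ TA k u) (germ TA k v) = germ TA k (cmp (cats \<Gamma> k) u v)"
  using assms lim2_germ[OF tower_TA tower_TA tower_TA, where f = "\<lambda>k. pls (cats \<Gamma> k)"]
    lim2_germ[OF tower_TA tower_TA tower_TA, where f = "\<lambda>k. cmp (cats \<Gamma> k)"]
  by (auto simp: Psi0_def Let_def)

lemma
  assumes "u \<in> lev TA k"
  shows ascl_germ [simp]: "ascl A c (germ TA k u) = germ TA k (scl (cats \<Gamma> k) c u)"
    and astar_germ [simp]: "astar A (germ TA k u) = germ TA k (adj (cats \<Gamma> k) u)"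
  using assms lim1_germ[OF tower_TA tower_TA, where f = "\<lambda>k. scl (cats \<Gamma> k) c"]
    lim1_germ[OF tower_TA tower_TA, where f = "\<lambda>k. adj (cats \<Gamma> k)"]
  by (auto simp: Psi0_def Let_def)

lemma aone_germ: "aone A = germ TA k (idn (cats \<Gamma> k) (X k))"
proof (induction k)
  case 0
  then show ?case by (simp add: Psi0_def Let_def)
next
  case (Suc k)
  then show ?case using TA.germ_inc[of k "idn (cats \<Gamma> k) (X k)"] by simp
qed

lemmas A_cases1 = TA.eventually_cases[OF _ eventually_True]
lemmas A_cases2 = lim_cases2[OF tower_TA tower_TA]
lemmas A_cases3 = lim_cases3[OF tower_TA tower_TA tower_TA]

lemma A_star_algebra: "star_algebra A"
  unfolding star_algebra_def
proof (intro conjI ballI allI)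
  show "complex_space (acar A) (aadd A) (azero A) (ascl A)" by (simp add: A_complex_space)
  show "aone A \<in> acar A" by (simp add: aone_germ[of 0])
next
  fix u assume "u \<in> acar A"
  then obtain k v where u: "v \<in> lev TA k" "u = germ TA k v" by (auto elim: A_cases1)
  show "amul A (aone A) u = u" "amul A u (aone A) = u" "astar A u \<in> acar A" "astar A (astar A u) = u"
    using u by (simp_all add: aone_germ[of k])
next
  fix u v c assume "u \<in> acar A" "v \<in> acar A"
  then obtain k f g where *: "f \<in> lev TA k" "u = germ TA k f" "g \<in> lev TA k" "v = germ TA k g"
    by (auto elim: A_cases2)
  show "amul A u v \<in> acar A" "astar A (amul A u v) = amul A (astar A v) (astar A u)"
    "astar A (aadd A u v) = aadd A (astar A u) (astar A v)"
    "amul A (ascl A c u) v = ascl A c (amul A u v)" "amul A u (ascl A c v) = ascl A c (amul A u v)"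
    "astar A (ascl A c u) = ascl A (cnj c) (astar A u)"
    using * by simp_all
next
  fix u v w assume "u \<in> acar A" "v \<in> acar A" "w \<in> acar A"
  then obtain k f g h where *: "f \<in> lev TA k" "u = germ TA k f" "g \<in> lev TA k" "v = germ TA k g"
    "h \<in> lev TA k" "w = germ TA k h"
    by (auto elim: A_cases3)
  show "amul A (amul A u v) w = amul A u (amul A v w)"
    "amul A (aadd A u v) w = aadd A (amul A u w) (amul A v w)"
    "amul A w (aadd A u v) = aadd A (amul A w u) (amul A w v)"
    using * by (simp_all add: K.cmp_pls K.pls_cmp)
qed

text \<open>Germs at one level are injective, so the norm of the endomorphism algebra of
  \<open>X k\<close> can be carried over to its image in the limit along the inverse map.\<close>

lemma A_level: "fd_cstar_algebra (A\<lparr>acar := germ TA k ` lev TA k\<rparr>)"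
proof -
  let ?C = "cats \<Gamma> k"
  define ungerm where "ungerm = inv_into (lev TA k) (germ TA k)"
  have ungerm: "ungerm (germ TA k v) = v" if "v \<in> lev TA k" for v
    unfolding ungerm_def using that by (intro inv_into_f_f inj_onI) (auto dest: TA.germ_inj)
  have sub: "star_algebra (A\<lparr>acar := germ TA k ` lev TA k\<rparr>)"
  proof (rule star_algebra_restrict[OF A_star_algebra])
    show "azero A \<in> germ TA k ` lev TA k" "aone A \<in> germ TA k ` lev TA k"
      by (auto simp: azero_germ[of k] aone_germ[of k])
  qed auto
  have fd: "finite_dim (germ TA k ` lev TA k) (aadd A) (azero A) (ascl A)"
    using K.fd_hom[of "X k" k "X k"] K.hom_space[of "X k" k "X k"] azero_germ[of k]
    by (intro finite_dim_image[where S = "lev TA k"]) auto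
  obtain nm where nm: "\<forall>a\<in>obj ?C. \<forall>b\<in>obj ?C. norm_on (hom ?C a b) (pls ?C) (zer ?C a b) (scl ?C) nm"
    "\<And>f g. f \<in> arr ?C \<Longrightarrow> g \<in> arr ?C \<Longrightarrow> src ?C g = tgt ?C f \<Longrightarrow> nm (cmp ?C g f) \<le> nm g * nm f"
    "\<And>f. f \<in> arr ?C \<Longrightarrow> nm (cmp ?C (adj ?C f) f) = (nm f)\<^sup>2"
    using K.fd_cstar_category[of k] unfolding fd_cstar_category_def by blast
  have nm1: "norm_on (lev TA k) (pls ?C) (zer ?C (X k) (X k)) (scl ?C) nm"
    using nm(1) by simp
  have "germ TA k v = azero A \<longleftrightarrow> v = zer ?C (X k) (X k)" if "v \<in> lev TA k" for v
    using that azero_germ[of k] TA.germ_inj[of k v "zer ?C (X k) (X k)"] by auto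
  then have "norm_on (germ TA k ` lev TA k) (aadd A) (azero A) (ascl A) (nm \<circ> ungerm)"
    using nm1 unfolding norm_on_def by (simp add: ungerm)
  then show ?thesis
    unfolding fd_cstar_algebra_def using sub fd nm(2,3)
    by (auto simp: ungerm intro!: exI[of _ "nm \<circ> ungerm"])
qed

lemma A_afd: "afd_pre_cstar_algebra A"
  unfolding afd_pre_cstar_algebra_def
proof (intro conjI exI[of _ "\<lambda>k. germ TA k ` lev TA k"] allI)
  fix k
  have "germ TA k v \<in> germ TA (Suc k) ` lev TA (Suc k)" if "v \<in> lev TA k" for v
    using TA.germ_inc[of k v] TA.inc_lev[OF that] by (metis imageI)
  then show "germ TA k ` lev TA k \<subseteq> germ TA (Suc k) ` lev TA (Suc k)" by blast
  show "(\<Union>k. germ TA k ` lev TA k) = acar A" unfolding acar_A lim_set_def by blast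
qed (rule A_star_algebra A_level)+

text \<open>Positivity asks for a root inside the algebra, whereas \<open>f\<close> may end at a
  different object. The positivity axiom of a C*-category replaces it by an endomorphism of
  \<open>X k\<close>.\<close>

lemma apos_germ: "f \<in> hom (cats \<Gamma> k) (X k) c \<Longrightarrow> apos A (germ TA k (cmp (cats \<Gamma> k) (adj (cats \<Gamma> k) f) f))"
proof -
  assume f: "f \<in> hom (cats \<Gamma> k) (X k) c"
  then obtain g where "g \<in> lev TA k" "cmp (cats \<Gamma> k) (adj (cats \<Gamma> k) f) f = cmp (cats \<Gamma> k) (adj (cats \<Gamma> k) g) g"
    using K.positive_endo[of f k] by auto
  then show ?thesis unfolding apos_def by (intro bexI[of _ "germ TA k g"]) auto
qed

end

section \<open>The correspondence of a 1-cell\<close>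

text \<open>Bi-faithfulness of the functors is left out, so that closure under composition does not involve
  composites of adjoint functors.\<close>

locale conn = D: zcell b \<Gamma> + C: zcell b \<Delta>
  for b :: "('o, 'm) cat \<Rightarrow> 'o" and \<Gamma> \<Delta> :: "('o, 'm) ucell0" +
  fixes \<Lambda> :: "('o, 'm) ucell1"
  assumes udom [simp]: "udom \<Lambda> = \<Gamma>" and ucod [simp]: "ucod \<Lambda> = \<Delta>"
    and ufun_star_functor: "star_functor (cats \<Gamma> k) (cats \<Delta> k) (ufun \<Lambda> k)"
    and ucon_NT: "ucon \<Lambda> k \<in> NT (cats \<Gamma> k) (cats \<Delta> (Suc k))
       (fcomp (cats \<Gamma> k) (gam \<Delta> k) (ufun \<Lambda> k)) (fcomp (cats \<Gamma> k) (ufun \<Lambda> (Suc k)) (gam \<Gamma> k))"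
    and ucon_unitary: "a \<in> obj (cats \<Gamma> k) \<Longrightarrow>
       cmp (cats \<Delta> (Suc k)) (adj (cats \<Delta> (Suc k)) (ucon \<Lambda> k a)) (ucon \<Lambda> k a) =
         idn (cats \<Delta> (Suc k)) (src (cats \<Delta> (Suc k)) (ucon \<Lambda> k a)) \<and>
       cmp (cats \<Delta> (Suc k)) (ucon \<Lambda> k a) (adj (cats \<Delta> (Suc k)) (ucon \<Lambda> k a)) =
         idn (cats \<Delta> (Suc k)) (tgt (cats \<Delta> (Suc k)) (ucon \<Lambda> k a))"

sublocale conn \<subseteq> L: starfun "cats \<Gamma> k" "cats \<Delta> k" "ufun \<Lambda> k" for k
  using ufun_star_functor[of k] by unfold_locales

context conn
begin

abbreviation "M \<equiv> cats \<Gamma>"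
abbreviation "N \<equiv> cats \<Delta>"
abbreviation "F \<equiv> ufun \<Lambda>"
abbreviation "W \<equiv> ucon \<Lambda>"
abbreviation "X \<equiv> xob b \<Gamma>"
abbreviation "Y \<equiv> xob b \<Delta>"
abbreviation "TH \<equiv> corr_tower b \<Lambda>"
abbreviation "H \<equiv> Psi1 b \<Lambda>"

lemma ucon_extensional: "W k \<in> extensional (obj (M k))"
  using ucon_NT[of k] by (simp add: NT_def PiE_def)

lemma ucon_arr [simp]: "a \<in> obj (M k) \<Longrightarrow> W k a \<in> arr (N (Suc k))"
  and src_ucon [simp]: "a \<in> obj (M k) \<Longrightarrow> src (N (Suc k)) (W k a) = fob (gam \<Delta> k) (fob (F k) a)"
  and tgt_ucon [simp]: "a \<in> obj (M k) \<Longrightarrow> tgt (N (Suc k)) (W k a) = fob (F (Suc k)) (fob (gam \<Gamma> k) a)"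
  using ucon_NT[of k] by (auto simp: NT_def fcomp_def compose_eq dest!: PiE_mem)

lemma ucon_natural [simp]:
  assumes "f \<in> arr (M k)" "tgt (M k) f = a"
  shows "cmp (N (Suc k)) (W k a) (fmp (gam \<Delta> k) (fmp (F k) f)) =
     cmp (N (Suc k)) (fmp (F (Suc k)) (fmp (gam \<Gamma> k) f)) (W k (src (M k) f))"
  using ucon_NT[of k] assms by (auto simp: NT_def fcomp_def compose_eq)

text \<open>\<open>cmp_assoc\<close> nests composites to the right and thereby hides the left side
  of \<open>ucon_natural\<close> inside longer composites; the variant with a further factor
  \<open>g\<close> applies there. \<open>ucon_unitary2\<close> does the same for unitarity.\<close>

lemma ucon_natural_cmp [simp]:
  assumes "f \<in> arr (M k)" "tgt (M k) f = a" "g \<in> arr (N (Suc k))"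
    "tgt (N (Suc k)) g = fob (gam \<Delta> k) (fob (F k) (src (M k) f))"
  shows "cmp (N (Suc k)) (W k a) (cmp (N (Suc k)) (fmp (gam \<Delta> k) (fmp (F k) f)) g) =
     cmp (N (Suc k)) (fmp (F (Suc k)) (fmp (gam \<Gamma> k) f)) (cmp (N (Suc k)) (W k (src (M k) f)) g)"
proof -
  have "cmp (N (Suc k)) (W k a) (cmp (N (Suc k)) (fmp (gam \<Delta> k) (fmp (F k) f)) g) =
      cmp (N (Suc k)) (cmp (N (Suc k)) (W k a) (fmp (gam \<Delta> k) (fmp (F k) f))) g"
    using assms by (auto simp del: ucon_natural)
  then show ?thesis using assms by auto
qed

lemma ucon_unitary1 [simp]:
  assumes "a \<in> obj (M k)"
  shows "cmp (N (Suc k)) (adj (N (Suc k)) (W k a)) (W k a) = idn (N (Suc k)) (fob (gam \<Delta> k) (fob (F k) a))"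
    and "cmp (N (Suc k)) (W k a) (adj (N (Suc k)) (W k a)) = idn (N (Suc k)) (fob (F (Suc k)) (fob (gam \<Gamma> k) a))"
  using ucon_unitary[OF assms] assms by simp_all

lemma ucon_unitary2 [simp]:
  assumes "a \<in> obj (M k)" "f \<in> arr (N (Suc k))"
  shows "tgt (N (Suc k)) f = fob (gam \<Delta> k) (fob (F k) a) \<Longrightarrow>
       cmp (N (Suc k)) (adj (N (Suc k)) (W k a)) (cmp (N (Suc k)) (W k a) f) = f"
    and "tgt (N (Suc k)) f = fob (F (Suc k)) (fob (gam \<Gamma> k) a) \<Longrightarrow>
       cmp (N (Suc k)) (W k a) (cmp (N (Suc k)) (adj (N (Suc k)) (W k a)) f) = f"
proof -
  assume t: "tgt (N (Suc k)) f = fob (gam \<Delta> k) (fob (F k) a)"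
  have "cmp (N (Suc k)) (adj (N (Suc k)) (W k a)) (cmp (N (Suc k)) (W k a) f) =
      cmp (N (Suc k)) (cmp (N (Suc k)) (adj (N (Suc k)) (W k a)) (W k a)) f"
    by (rule C.K.cmp_assoc[symmetric]) (simp_all add: assms t)
  then show "cmp (N (Suc k)) (adj (N (Suc k)) (W k a)) (cmp (N (Suc k)) (W k a) f) = f"
    by (simp add: assms t)
next
  assume t: "tgt (N (Suc k)) f = fob (F (Suc k)) (fob (gam \<Gamma> k) a)"
  have "cmp (N (Suc k)) (W k a) (cmp (N (Suc k)) (adj (N (Suc k)) (W k a)) f) =
      cmp (N (Suc k)) (cmp (N (Suc k)) (W k a) (adj (N (Suc k)) (W k a))) f"
    by (rule C.K.cmp_assoc[symmetric]) (simp_all add: assms t)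
  then show "cmp (N (Suc k)) (W k a) (cmp (N (Suc k)) (adj (N (Suc k)) (W k a)) f) = f"
    by (simp add: assms t)
qed

lemma lev_TH [simp]: "lev TH k = hom (N k) (Y k) (fob (F k) (X k))"
  and inc_TH [simp]: "inc TH k v = cmp (N (Suc k)) (W k (X k)) (fmp (gam \<Delta> k) v)"
  by (simp_all add: corr_tower_def Let_def)

lemma ucon_cancel:
  assumes "a \<in> obj (M k)" "f \<in> arr (N (Suc k))" "g \<in> arr (N (Suc k))"
    "tgt (N (Suc k)) f = fob (gam \<Delta> k) (fob (F k) a)" "tgt (N (Suc k)) g = fob (gam \<Delta> k) (fob (F k) a)"
    "cmp (N (Suc k)) (W k a) f = cmp (N (Suc k)) (W k a) g"
  shows "f = g"
  using ucon_unitary2(1)[OF assms(1,2,4)] ucon_unitary2(1)[OF assms(1,3,5)] assms(6) by metis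

text \<open>Unitarity cancels \<open>W\<close>, and faithfulness of the functors of \<Delta> cancels
  the rest.\<close>

lemma tower_TH: "tower TH"
proof
  show "inj_on (inc TH k) (lev TH k)" for k
  proof (rule inj_onI)
    fix f g assume *: "f \<in> lev TH k" "g \<in> lev TH k" "inc TH k f = inc TH k g"
    then have "fmp (gam \<Delta> k) f = fmp (gam \<Delta> k) g"
      by (rule_tac ucon_cancel[of "X k" k]) auto
    then show "f = g" using * by (rule_tac C.gam_inj[of f k g]) auto
  qed
qed auto

end

sublocale conn \<subseteq> TH: tower "corr_tower b \<Lambda>"
  by (rule tower_TH)

context conn
begin

lemma lalg_H [simp]: "lalg H = Psi0 b \<Gamma>"
  and ralg_H [simp]: "ralg H = Psi0 b \<Delta>"
  and hcar_H: "hcar H = Elem ` lim_set TH"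
  by (simp_all add: Psi1_def Let_def)

lemma hcar_cases:
  assumes "\<xi> \<in> hcar H"
  obtains k v where "v \<in> lev TH k" "\<xi> = Elem (germ TH k v)"
  using assms unfolding hcar_H by (auto simp: lim_set_def)

lemma hcar_eventually:
  assumes "\<xi> \<in> hcar H"
  shows "\<forall>\<^sub>F k in sequentially. \<exists>v\<in>lev TH k. \<xi> = Elem (germ TH k v)"
proof -
  obtain x where "x \<in> lim_set TH" "\<xi> = Elem x" using assms by (auto simp: hcar_H)
  then show ?thesis using TH.lim_eventually[of x] by simp
qed

lemma germ_hcar [simp]: "v \<in> lev TH k \<Longrightarrow> Elem (germ TH k v) \<in> hcar H"
  unfolding hcar_H by (intro imageI TH.germ_lim)

lemma H_complex_space: "complex_space (hcar H) (hadd H) (hzero H) (hscl H)"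
  and hzero_germ: "hzero H = Elem (germ TH k (zer (N k) (Y k) (fob (F k) (X k))))"
proof -
  have sp: "complex_space (lev TH k) (pls (N k)) (zer (N k) (Y k) (fob (F k) (X k))) (scl (N k))" for k
    using cspace.complex_space[OF C.K.hom_space[of "Y k" k "fob (F k) (X k)"]] by simp
  note * = TH.lim_complex_space[where add = "\<lambda>k. pls (N k)" and z = "\<lambda>k. zer (N k) (Y k) (fob (F k) (X k))"
      and sc = "\<lambda>k. scl (N k)", OF sp]
  have "complex_space (lim_set TH) (lim2 TH TH TH (\<lambda>k. pls (N k))) (germ TH 0 (zer (N 0) (Y 0) (fob (F 0) (X 0))))
      (\<lambda>c. lim1 TH TH (\<lambda>k. scl (N k) c))"
    by (rule *(1)) (auto simp: C.K.cmp_pls)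
  then show "complex_space (hcar H) (hadd H) (hzero H) (hscl H)"
    unfolding complex_space_def by (auto simp: Psi1_def Let_def)
  have "germ TH k (zer (N k) (Y k) (fob (F k) (X k))) = germ TH 0 (zer (N 0) (Y 0) (fob (F 0) (X 0)))"
    by (rule *(2)) (auto simp: C.K.cmp_pls)
  then show "hzero H = Elem (germ TH k (zer (N k) (Y k) (fob (F k) (X k))))"
    by (simp add: Psi1_def Let_def)
qed

lemma hadd_germ [simp]: "u \<in> lev TH k \<Longrightarrow> v \<in> lev TH k \<Longrightarrow>
    hadd H (Elem (germ TH k u)) (Elem (germ TH k v)) = Elem (germ TH k (pls (N k) u v))"
  using lim2_germ[OF tower_TH tower_TH tower_TH, where f = "\<lambda>k. pls (N k)"]
  by (auto simp: Psi1_def Let_def C.K.cmp_pls)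

lemma hscl_germ [simp]: "v \<in> lev TH k \<Longrightarrow>
    hscl H c (Elem (germ TH k v)) = Elem (germ TH k (scl (N k) c v))"
  using lim1_germ[OF tower_TH tower_TH, where f = "\<lambda>k. scl (N k) c"]
  by (auto simp: Psi1_def Let_def)

text \<open>The left action commutes with the inclusions by naturality of \<open>W\<close> at
  endomorphisms of \<open>X k\<close>.\<close>

lemma lact_germ [simp]: "a \<in> lev D.TA k \<Longrightarrow> v \<in> lev TH k \<Longrightarrow>
    lact H (germ D.TA k a) (Elem (germ TH k v)) = Elem (germ TH k (cmp (N k) (fmp (F k) a) v))"
  using lim2_germ[OF D.tower_TA tower_TH tower_TH, where f = "\<lambda>k a v. cmp (N k) (fmp (F k) a) v"]
  by (auto simp: Psi1_def Let_def)

lemma ract_germ [simp]: "v \<in> lev TH k \<Longrightarrow> c \<in> lev C.TA k \<Longrightarrow>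
    ract H (Elem (germ TH k v)) (germ C.TA k c) = Elem (germ TH k (cmp (N k) v c))"
  using lim2_germ[OF tower_TH C.tower_TA tower_TH, where f = "\<lambda>k. cmp (N k)"]
  by (auto simp: Psi1_def Let_def)

text \<open>Inclusions preserve inner products because \<open>W\<close> and its adjoint meet in the
  middle and cancel.\<close>

lemma hip_germ [simp]: "u \<in> lev TH k \<Longrightarrow> v \<in> lev TH k \<Longrightarrow>
    hip H (Elem (germ TH k u)) (Elem (germ TH k v)) = germ C.TA k (cmp (N k) (adj (N k) v) u)"
  using lim2_germ[OF tower_TH tower_TH C.tower_TA, where f = "\<lambda>k v w. cmp (N k) (adj (N k) w) v"]
  by (auto simp: Psi1_def Let_def)

lemma H_cases2:
  assumes "\<xi> \<in> hcar H" "\<zeta> \<in> hcar H"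
  obtains k u v where "u \<in> lev TH k" "\<xi> = Elem (germ TH k u)" "v \<in> lev TH k" "\<zeta> = Elem (germ TH k v)"
  using eventually_happens[OF eventually_conj[OF hcar_eventually[OF assms(1)] hcar_eventually[OF assms(2)]]]
  by auto

lemma H_cases3:
  assumes "\<xi> \<in> hcar H" "\<zeta> \<in> hcar H" "\<kappa> \<in> hcar H"
  obtains k u v w where "u \<in> lev TH k" "\<xi> = Elem (germ TH k u)" "v \<in> lev TH k" "\<zeta> = Elem (germ TH k v)"
    "w \<in> lev TH k" "\<kappa> = Elem (germ TH k w)"
  using eventually_happens[OF eventually_conj[OF hcar_eventually[OF assms(1)]
    eventually_conj[OF hcar_eventually[OF assms(2)] hcar_eventually[OF assms(3)]]]]
  by auto

lemma H_right_cases: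
  assumes "\<xi> \<in> hcar H" "\<zeta> \<in> hcar H" "b1 \<in> acar (ralg H)" "b2 \<in> acar (ralg H)"
  obtains k u v d1 d2 where "u \<in> lev TH k" "\<xi> = Elem (germ TH k u)" "v \<in> lev TH k" "\<zeta> = Elem (germ TH k v)"
    "d1 \<in> lev C.TA k" "b1 = germ C.TA k d1" "d2 \<in> lev C.TA k" "b2 = germ C.TA k d2"
proof -
  have "\<forall>\<^sub>F k in sequentially. (\<exists>v\<in>lev TH k. \<xi> = Elem (germ TH k v)) \<and> (\<exists>v\<in>lev TH k. \<zeta> = Elem (germ TH k v))
      \<and> (\<exists>v\<in>lev C.TA k. b1 = germ C.TA k v) \<and> (\<exists>v\<in>lev C.TA k. b2 = germ C.TA k v)"
    using assms by (intro eventually_conj hcar_eventually C.TA.lim_eventually) auto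
  from eventually_happens[OF this] show ?thesis using that by auto
qed

lemma H_left_cases:
  assumes "\<xi> \<in> hcar H" "\<zeta> \<in> hcar H" "a1 \<in> acar (lalg H)" "a2 \<in> acar (lalg H)"
  obtains k u v d1 d2 where "u \<in> lev TH k" "\<xi> = Elem (germ TH k u)" "v \<in> lev TH k" "\<zeta> = Elem (germ TH k v)"
    "d1 \<in> lev D.TA k" "a1 = germ D.TA k d1" "d2 \<in> lev D.TA k" "a2 = germ D.TA k d2"
proof -
  have "\<forall>\<^sub>F k in sequentially. (\<exists>v\<in>lev TH k. \<xi> = Elem (germ TH k v)) \<and> (\<exists>v\<in>lev TH k. \<zeta> = Elem (germ TH k v))
      \<and> (\<exists>v\<in>lev D.TA k. a1 = germ D.TA k v) \<and> (\<exists>v\<in>lev D.TA k. a2 = germ D.TA k v)"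
    using assms by (intro eventually_conj hcar_eventually D.TA.lim_eventually) auto
  from eventually_happens[OF this] show ?thesis using that by auto
qed

lemma H_bimodule_cases:
  assumes "\<xi> \<in> hcar H" "a \<in> acar (lalg H)" "c \<in> acar (ralg H)"
  obtains k v f g where "v \<in> lev TH k" "\<xi> = Elem (germ TH k v)"
    "f \<in> lev D.TA k" "a = germ D.TA k f" "g \<in> lev C.TA k" "c = germ C.TA k g"
proof -
  have "\<forall>\<^sub>F k in sequentially. (\<exists>v\<in>lev TH k. \<xi> = Elem (germ TH k v)) \<and>
      (\<exists>v\<in>lev D.TA k. a = germ D.TA k v) \<and> (\<exists>v\<in>lev C.TA k. c = germ C.TA k v)"
    using assms by (intro eventually_conj hcar_eventually D.TA.lim_eventually C.TA.lim_eventually) auto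
  from eventually_happens[OF this] show ?thesis using that by auto
qed

text \<open>The elements in each axiom are represented at one common level, where the axiom becomes
  a law of composition, addition or the adjoint in a single category.\<close>

lemma H_right_correspondence: "right_correspondence H"
  unfolding right_correspondence_def
proof (intro conjI ballI allI impI)
  show "afd_pre_cstar_algebra (lalg H)" "afd_pre_cstar_algebra (ralg H)"
    by (simp_all add: D.A_afd C.A_afd)
  show "complex_space (hcar H) (hadd H) (hzero H) (hscl H)" by (rule H_complex_space)
next
  fix \<xi> b1 b2 \<zeta> c
  assume "\<xi> \<in> hcar H" "\<zeta> \<in> hcar H" "b1 \<in> acar (ralg H)" "b2 \<in> acar (ralg H)"
  then obtain k u v d1 d2 where *: "u \<in> lev TH k" "\<xi> = Elem (germ TH k u)" "v \<in> lev TH k" "\<zeta> = Elem (germ TH k v)"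
    "d1 \<in> lev C.TA k" "b1 = germ C.TA k d1" "d2 \<in> lev C.TA k" "b2 = germ C.TA k d2"
    by (rule H_right_cases)
  show "ract H (hadd H \<xi> \<zeta>) b1 = hadd H (ract H \<xi> b1) (ract H \<zeta> b1)"
    using * by (simp add: C.K.pls_cmp)
  show "hip H (ract H \<xi> b1) \<zeta> = amul (ralg H) (hip H \<xi> \<zeta>) b1"
    using * by simp
next
  fix \<xi> b1 b2 c
  assume "\<xi> \<in> hcar H" "b1 \<in> acar (ralg H)" "b2 \<in> acar (ralg H)"
  then obtain k u v d1 d2 where *: "u \<in> lev TH k" "\<xi> = Elem (germ TH k u)"
    "d1 \<in> lev C.TA k" "b1 = germ C.TA k d1" "d2 \<in> lev C.TA k" "b2 = germ C.TA k d2"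
    using H_right_cases[of \<xi> \<xi> b1 b2] by metis
  show "ract H \<xi> (amul (ralg H) b1 b2) = ract H (ract H \<xi> b1) b2"
    "ract H \<xi> (aadd (ralg H) b1 b2) = hadd H (ract H \<xi> b1) (ract H \<xi> b2)"
    using * by (simp_all add: C.K.cmp_pls)
next
  fix \<xi> b1 c
  assume "\<xi> \<in> hcar H" "b1 \<in> acar (ralg H)"
  then obtain k u v d1 d2 where *: "u \<in> lev TH k" "\<xi> = Elem (germ TH k u)"
    "d1 \<in> lev C.TA k" "b1 = germ C.TA k d1"
    using H_right_cases[of \<xi> \<xi> b1 b1] by metis
  show "ract H \<xi> b1 \<in> hcar H" "ract H (hscl H c \<xi>) b1 = hscl H c (ract H \<xi> b1)"
    "ract H \<xi> (ascl (ralg H) c b1) = hscl H c (ract H \<xi> b1)"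
    using * by simp_all
next
  fix \<xi> \<zeta> a1
  assume "\<xi> \<in> hcar H" "\<zeta> \<in> hcar H" "a1 \<in> acar (lalg H)"
  then obtain k u v d1 d2 where *: "u \<in> lev TH k" "\<xi> = Elem (germ TH k u)" "v \<in> lev TH k" "\<zeta> = Elem (germ TH k v)"
    "d1 \<in> lev D.TA k" "a1 = germ D.TA k d1"
    using H_left_cases[of \<xi> \<zeta> a1 a1] by metis
  show "lact H a1 (hadd H \<xi> \<zeta>) = hadd H (lact H a1 \<xi>) (lact H a1 \<zeta>)"
    using * by (simp add: C.K.cmp_pls)
  show "hip H (lact H a1 \<xi>) \<zeta> = hip H \<xi> (lact H (astar (lalg H) a1) \<zeta>)"
    using * by simp
next
  fix \<xi> a1 a2
  assume "\<xi> \<in> hcar H" "a1 \<in> acar (lalg H)" "a2 \<in> acar (lalg H)"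
  then obtain k u v d1 d2 where *: "u \<in> lev TH k" "\<xi> = Elem (germ TH k u)"
    "d1 \<in> lev D.TA k" "a1 = germ D.TA k d1" "d2 \<in> lev D.TA k" "a2 = germ D.TA k d2"
    using H_left_cases[of \<xi> \<xi> a1 a2] by metis
  show "lact H (amul (lalg H) a1 a2) \<xi> = lact H a1 (lact H a2 \<xi>)"
    "lact H (aadd (lalg H) a1 a2) \<xi> = hadd H (lact H a1 \<xi>) (lact H a2 \<xi>)"
    using * by (simp_all add: C.K.pls_cmp)
next
  fix \<xi> a1 c
  assume "\<xi> \<in> hcar H" "a1 \<in> acar (lalg H)"
  then obtain k u v d1 d2 where *: "u \<in> lev TH k" "\<xi> = Elem (germ TH k u)"
    "d1 \<in> lev D.TA k" "a1 = germ D.TA k d1"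
    using H_left_cases[of \<xi> \<xi> a1 a1] by metis
  show "lact H a1 \<xi> \<in> hcar H" "lact H a1 (hscl H c \<xi>) = hscl H c (lact H a1 \<xi>)"
    "lact H (ascl (lalg H) c a1) \<xi> = hscl H c (lact H a1 \<xi>)"
    using * by simp_all
next
  fix \<xi> a c
  assume "\<xi> \<in> hcar H" "a \<in> acar (lalg H)" "c \<in> acar (ralg H)"
  then obtain k v f g where *: "v \<in> lev TH k" "\<xi> = Elem (germ TH k v)"
    "f \<in> lev D.TA k" "a = germ D.TA k f" "g \<in> lev C.TA k" "c = germ C.TA k g"
    by (rule H_bimodule_cases)
  show "lact H a (ract H \<xi> c) = ract H (lact H a \<xi>) c" using * by simp
next
  fix \<xi> assume "\<xi> \<in> hcar H"
  then obtain k v where *: "v \<in> lev TH k" "\<xi> = Elem (germ TH k v)" by (rule hcar_cases)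
  show "ract H \<xi> (aone (ralg H)) = \<xi>" "lact H (aone (lalg H)) \<xi> = \<xi>"
    using * by (simp_all add: C.aone_germ[of k] D.aone_germ[of k])
  show "apos (ralg H) (hip H \<xi> \<xi>)" using * C.apos_germ by simp
  assume "hip H \<xi> \<xi> = azero (ralg H)"
  \<comment> \<open>Definiteness descends to the level by injectivity of germs and is there the
    definiteness of the C*-norm.\<close>
  then have "cmp (N k) (adj (N k) v) v = zer (N k) (Y k) (Y k)"
    using * C.TA.germ_inj[of k] by (simp add: C.azero_germ[of k])
  then have "v = zer (N k) (Y k) (fob (F k) (X k))"
    using * C.K.adj_cmp_self_0[of v k] by simp
  then show "\<xi> = hzero H" using * by (simp add: hzero_germ[of k])
next
  fix \<xi> \<zeta> c assume "\<xi> \<in> hcar H" "\<zeta> \<in> hcar H"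
  then obtain k u v where *: "u \<in> lev TH k" "\<xi> = Elem (germ TH k u)" "v \<in> lev TH k" "\<zeta> = Elem (germ TH k v)"
    by (rule H_cases2)
  show "hip H \<xi> \<zeta> \<in> acar (ralg H)" "hip H \<zeta> \<xi> = astar (ralg H) (hip H \<xi> \<zeta>)"
    "hip H (hscl H c \<xi>) \<zeta> = ascl (ralg H) c (hip H \<xi> \<zeta>)"
    using * by simp_all
next
  fix \<xi> \<zeta> \<kappa> assume "\<xi> \<in> hcar H" "\<zeta> \<in> hcar H" "\<kappa> \<in> hcar H"
  then obtain k u v w where *: "u \<in> lev TH k" "\<xi> = Elem (germ TH k u)" "v \<in> lev TH k" "\<zeta> = Elem (germ TH k v)"
    "w \<in> lev TH k" "\<kappa> = Elem (germ TH k w)"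
    by (rule H_cases3)
  show "hip H (hadd H \<xi> \<kappa>) \<zeta> = aadd (ralg H) (hip H \<xi> \<zeta>) (hip H \<kappa> \<zeta>)"
    using * by (simp add: C.K.cmp_pls)
qed

end

section \<open>The intertwiner of a 2-cell\<close>

text \<open>The formula for \<open>Phi\<close>, required at late levels only. Every vector lives at
  all late levels, so this still determines the map, and it is insensitive to the choice of a
  starting level and of a representative sequence.\<close>

definition acts :: "(('o, 'm) cat \<Rightarrow> 'o) \<Rightarrow> ('o, 'm) ucell1 \<Rightarrow> ('o, 'm) ucell1 \<Rightarrow> (nat \<Rightarrow> 'o \<Rightarrow> 'm) \<Rightarrow>
    ((nat \<times> 'm) set tvec \<Rightarrow> (nat \<times> 'm) set tvec) \<Rightarrow> bool" where
  "acts b \<Lambda> \<Omega> h t \<longleftrightarrow> (\<forall>\<^sub>F k in sequentially. \<forall>v\<in>lev (corr_tower b \<Lambda>) k.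
     t (Elem (germ (corr_tower b \<Lambda>) k v)) =
     Elem (germ (corr_tower b \<Omega>) k (cmp (cats (ucod \<Lambda>) k) (h k (xob b (udom \<Lambda>) k)) v)))"

text \<open>The intertwiner of a single sequence, obtained by applying \<open>Psi2\<close> to a
  singleton. A singleton is in general no equivalence class, but the description in
  \<open>Psi2\<close> only looks at the members.\<close>

definition seq_map :: "(('o, 'm) cat \<Rightarrow> 'o) \<Rightarrow> ('o, 'm) ucell1 \<Rightarrow> ('o, 'm) ucell1 \<Rightarrow> (nat \<Rightarrow> 'o \<Rightarrow> 'm) \<Rightarrow>
    (nat \<times> 'm) set tvec \<Rightarrow> (nat \<times> 'm) set tvec" where
  "seq_map b \<Lambda> \<Omega> h = cmap (Psi2 b \<lparr>usrc = \<Lambda>, utgt = \<Omega>, ucls = {h}\<rparr>)"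

text \<open>All that the evaluation of \<open>Psi2\<close> needs to know about a class. It can be
  verified for horizontal composites without showing that the composite 1-cells lie in
  \<open>uc1\<close>.\<close>

definition represents :: "(nat \<Rightarrow> 'o \<Rightarrow> 'm) \<Rightarrow> ('o, 'm) ucell2 \<Rightarrow> bool" where
  "represents h \<eta> \<longleftrightarrow> h \<in> ucls \<eta> \<and> ucls \<eta> \<subseteq> uc_seqs (usrc \<eta>) (utgt \<eta>) \<and>
     (\<forall>h'\<in>ucls \<eta>. \<forall>\<^sub>F k in sequentially. h' k = h k)"

locale parallel = L: conn b \<Gamma> \<Delta> \<Lambda> + O: conn b \<Gamma> \<Delta> \<Omega> for b \<Gamma> \<Delta> \<Lambda> \<Omega>
begin

lemma seqD:
  assumes "h \<in> uc_seqs \<Lambda> \<Omega>"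
  shows "a \<in> obj (cats \<Gamma> k) \<Longrightarrow> h k a \<in> arr (cats \<Delta> k)"
    and "a \<in> obj (cats \<Gamma> k) \<Longrightarrow> src (cats \<Delta> k) (h k a) = fob (ufun \<Lambda> k) a"
    and "a \<in> obj (cats \<Gamma> k) \<Longrightarrow> tgt (cats \<Delta> k) (h k a) = fob (ufun \<Omega> k) a"
    and "f \<in> arr (cats \<Gamma> k) \<Longrightarrow> tgt (cats \<Gamma> k) f = a \<Longrightarrow> cmp (cats \<Delta> k) (h k a) (fmp (ufun \<Lambda> k) f) =
       cmp (cats \<Delta> k) (fmp (ufun \<Omega> k) f) (h k (src (cats \<Gamma> k) f))"
    and "h k \<in> extensional (obj (cats \<Gamma> k))"
    and "\<forall>\<^sub>F k in sequentially. exchange \<Lambda> \<Omega> k (h k) (h (Suc k))"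
proof -
  have NT: "h k \<in> NT (cats \<Gamma> k) (cats \<Delta> k) (ufun \<Lambda> k) (ufun \<Omega> k)"
    and ex: "\<forall>\<^sub>F k in sequentially. exchange \<Lambda> \<Omega> k (h k) (h (Suc k))"
    using assms by (auto simp: uc_seqs_def)
  have ext: "h k \<in> (\<Pi>\<^sub>E a\<in>obj (cats \<Gamma> k). hom (cats \<Delta> k) (fob (ufun \<Lambda> k) a) (fob (ufun \<Omega> k) a))"
    using NT by (simp add: NT_def)
  show "a \<in> obj (cats \<Gamma> k) \<Longrightarrow> h k a \<in> arr (cats \<Delta> k)"
    "a \<in> obj (cats \<Gamma> k) \<Longrightarrow> src (cats \<Delta> k) (h k a) = fob (ufun \<Lambda> k) a"
    "a \<in> obj (cats \<Gamma> k) \<Longrightarrow> tgt (cats \<Delta> k) (h k a) = fob (ufun \<Omega> k) a"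
    using PiE_mem[OF ext, of a] by simp_all
  show "h k \<in> extensional (obj (cats \<Gamma> k))" using ext by (simp add: PiE_def)
  show "f \<in> arr (cats \<Gamma> k) \<Longrightarrow> tgt (cats \<Gamma> k) f = a \<Longrightarrow> cmp (cats \<Delta> k) (h k a) (fmp (ufun \<Lambda> k) f) =
       cmp (cats \<Delta> k) (fmp (ufun \<Omega> k) f) (h k (src (cats \<Gamma> k) f))"
    using NT by (auto simp: NT_def)
  show "\<forall>\<^sub>F k in sequentially. exchange \<Lambda> \<Omega> k (h k) (h (Suc k))" by (fact ex)
qed

lemma seqI:
  assumes "\<And>k a. a \<in> obj (cats \<Gamma> k) \<Longrightarrow> h k a \<in> hom (cats \<Delta> k) (fob (ufun \<Lambda> k) a) (fob (ufun \<Omega> k) a)"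
    and "\<And>k. h k \<in> extensional (obj (cats \<Gamma> k))"
    and "\<And>k f. f \<in> arr (cats \<Gamma> k) \<Longrightarrow> cmp (cats \<Delta> k) (h k (tgt (cats \<Gamma> k) f)) (fmp (ufun \<Lambda> k) f) =
       cmp (cats \<Delta> k) (fmp (ufun \<Omega> k) f) (h k (src (cats \<Gamma> k) f))"
    and "\<forall>\<^sub>F k in sequentially. exchange \<Lambda> \<Omega> k (h k) (h (Suc k))"
  shows "h \<in> uc_seqs \<Lambda> \<Omega>"
  using assms by (simp add: uc_seqs_def NT_def PiE_def)

lemma exchange_iff:
  "exchange \<Lambda> \<Omega> k \<eta> \<kappa> \<longleftrightarrow> (\<forall>a\<in>obj (cats \<Gamma> k).
     cmp (cats \<Delta> (Suc k)) (ucon \<Omega> k a) (fmp (gam \<Delta> k) (\<eta> a)) =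
     cmp (cats \<Delta> (Suc k)) (\<kappa> (fob (gam \<Gamma> k) a)) (ucon \<Lambda> k a))"
  by (simp add: exchange_def Let_def)

lemma acts_iff:
  "acts b \<Lambda> \<Omega> h t \<longleftrightarrow> (\<forall>\<^sub>F k in sequentially. \<forall>v\<in>lev L.TH k.
     t (Elem (germ L.TH k v)) = Elem (germ O.TH k (cmp (cats \<Delta> k) (h k (L.X k)) v)))"
  by (simp add: acts_def)

text \<open>By the exchange relation each step of the transport is the next component of
  \<open>h\<close> times the unitary of \<Lambda> and its adjoint, which cancel.\<close>

lemma transport_seq:
  assumes h: "h \<in> uc_seqs \<Lambda> \<Omega>" and K: "\<forall>k\<ge>K. exchange \<Lambda> \<Omega> k (h k) (h (Suc k))" and k: "K \<le> k"
  shows "transport b \<Lambda> \<Omega> k (h k (L.X k)) j = h (k + j) (L.X (k + j))"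
proof (induction j)
  case (Suc j)
  note [simp] = seqD(1-3)[OF h]
  have "cmp (cats \<Delta> (Suc (k + j))) (ucon \<Omega> (k + j) (L.X (k + j))) (fmp (gam \<Delta> (k + j)) (h (k + j) (L.X (k + j)))) =
     cmp (cats \<Delta> (Suc (k + j))) (h (Suc (k + j)) (L.X (Suc (k + j)))) (ucon \<Lambda> (k + j) (L.X (k + j)))"
    using K[rule_format, of "k + j"] k unfolding exchange_iff by simp
  then show ?case by (simp add: Suc.IH Let_def)
qed simp

text \<open>The exchange relation at \<open>L.X k\<close> makes composition with
  \<open>h k (L.X k)\<close> commute with the inclusions of the two towers.\<close>

lemma seq_germ_cong:
  assumes h: "h \<in> uc_seqs \<Lambda> \<Omega>" and K: "\<forall>k\<ge>K. exchange \<Lambda> \<Omega> k (h k) (h (Suc k))"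
    and "v \<in> lev L.TH k" "w \<in> lev L.TH l" "K \<le> k" "K \<le> l" "germ L.TH k v = germ L.TH l w"
  shows "germ O.TH k (cmp (cats \<Delta> k) (h k (L.X k)) v) = germ O.TH l (cmp (cats \<Delta> l) (h l (L.X l)) w)"
proof (rule germ_map_cong[OF L.tower_TH O.tower_TH _ assms(3-7)])
  fix k v assume "K \<le> k" "v \<in> lev L.TH k"
  note [simp] = seqD(1-3)[OF h]
  have v: "v \<in> arr (cats \<Delta> k)" "src (cats \<Delta> k) v = L.Y k" "tgt (cats \<Delta> k) v = fob (ufun \<Lambda> k) (L.X k)"
    using \<open>v \<in> lev L.TH k\<close> by auto
  have ex: "cmp (cats \<Delta> (Suc k)) (ucon \<Omega> k (L.X k)) (fmp (gam \<Delta> k) (h k (L.X k))) =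
      cmp (cats \<Delta> (Suc k)) (h (Suc k) (L.X (Suc k))) (ucon \<Lambda> k (L.X k))"
    using K \<open>K \<le> k\<close> unfolding exchange_iff by simp
  have "inc O.TH k (cmp (cats \<Delta> k) (h k (L.X k)) v) =
     cmp (cats \<Delta> (Suc k)) (cmp (cats \<Delta> (Suc k)) (ucon \<Omega> k (L.X k)) (fmp (gam \<Delta> k) (h k (L.X k)))) (fmp (gam \<Delta> k) v)"
    using v by simp
  also have "\<dots> = cmp (cats \<Delta> (Suc k)) (h (Suc k) (L.X (Suc k))) (inc L.TH k v)"
    unfolding ex using v by simp
  finally show "cmp (cats \<Delta> (Suc k)) (h (Suc k) (L.X (Suc k))) (inc L.TH k v) =
      inc O.TH k (cmp (cats \<Delta> k) (h k (L.X k)) v)" by simp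
qed

lemma Phi_germ:
  assumes h: "h \<in> uc_seqs \<Lambda> \<Omega>" and K: "\<forall>k\<ge>K. exchange \<Lambda> \<Omega> k (h k) (h (Suc k))"
    and k: "K \<le> k" and v: "v \<in> lev L.TH l" "k \<le> l"
  shows "Phi b \<Lambda> \<Omega> k (h k (L.X k)) (Elem (germ L.TH l v)) = Elem (germ O.TH l (cmp (cats \<Delta> l) (h l (L.X l)) v))"
proof -
  have "(THE z. \<exists>j. \<exists>w\<in>lev L.TH (k + j). germ L.TH l v = germ L.TH (k + j) w \<and>
      z = germ O.TH (k + j) (cmp (cats \<Delta> (k + j)) (transport b \<Lambda> \<Omega> k (h k (L.X k)) j) w)) =
      germ O.TH l (cmp (cats \<Delta> l) (h l (L.X l)) v)"
    unfolding transport_seq[OF h K k]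
  proof (rule the_equality)
    show "\<exists>j. \<exists>w\<in>lev L.TH (k + j). germ L.TH l v = germ L.TH (k + j) w \<and>
      germ O.TH l (cmp (cats \<Delta> l) (h l (L.X l)) v) =
      germ O.TH (k + j) (cmp (cats \<Delta> (k + j)) (h (k + j) (L.X (k + j))) w)"
      using v by (intro exI[of _ "l - k"] bexI[of _ v]) simp_all
  next
    fix z assume "\<exists>j. \<exists>w\<in>lev L.TH (k + j). germ L.TH l v = germ L.TH (k + j) w \<and>
      z = germ O.TH (k + j) (cmp (cats \<Delta> (k + j)) (h (k + j) (L.X (k + j))) w)"
    then obtain j w where "w \<in> lev L.TH (k + j)" "germ L.TH l v = germ L.TH (k + j) w"
      and z: "z = germ O.TH (k + j) (cmp (cats \<Delta> (k + j)) (h (k + j) (L.X (k + j))) w)" by blast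
    then show "z = germ O.TH l (cmp (cats \<Delta> l) (h l (L.X l)) v)"
      unfolding z using k v by (intro seq_germ_cong[OF h K, symmetric]) auto
  qed
  then show ?thesis using v(1) by (simp add: Phi_def del: L.lev_TH)
qed

text \<open>A given vector has representatives at all late levels; at one where both formulas hold
  and the sequences agree, the two values coincide.\<close>

lemma acts_unique:
  assumes "acts b \<Lambda> \<Omega> h t" "acts b \<Lambda> \<Omega> h' t'" "\<forall>\<^sub>F k in sequentially. h k = h' k"
    and "t \<in> extensional (hcar L.H)" "t' \<in> extensional (hcar L.H)"
  shows "t = t'"
proof (rule extensionalityI[OF assms(4,5)])
  fix \<xi> assume "\<xi> \<in> hcar L.H"
  from eventually_happens[OF eventually_conj[OF L.hcar_eventually[OF this]
      eventually_conj[OF assms(1)[unfolded acts_iff] eventually_conj[OF assms(2)[unfolded acts_iff] assms(3)]]]]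
  show "t \<xi> = t' \<xi>" by (auto simp del: L.lev_TH)
qed

lemma Psi2_represented:
  assumes src: "usrc \<eta> = \<Lambda>" "utgt \<eta> = \<Omega>" and rep: "represents h \<eta>"
  shows "cmap (Psi2 b \<eta>) \<in> extensional (hcar L.H) \<and> acts b \<Lambda> \<Omega> h (cmap (Psi2 b \<eta>))"
proof -
  have h: "h \<in> uc_seqs \<Lambda> \<Omega>" "h \<in> ucls \<eta>" using rep src by (auto simp: represents_def)
  have ext: "Phi b \<Lambda> \<Omega> k g \<in> extensional (hcar L.H)" for k g by (simp add: Phi_def)
  have ac: "acts b \<Lambda> \<Omega> h' (Phi b \<Lambda> \<Omega> k (h' k (L.X k)))"
    if "h' \<in> uc_seqs \<Lambda> \<Omega>" "\<forall>k\<ge>K. exchange \<Lambda> \<Omega> k (h' k) (h' (Suc k))" "K \<le> k" for h' K k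
    unfolding acts_iff eventually_sequentially using Phi_germ[OF that] by blast
  obtain K where K: "\<forall>k\<ge>K. exchange \<Lambda> \<Omega> k (h k) (h (Suc k))"
    using seqD(6)[OF h(1)] by (auto simp: eventually_sequentially)
  \<comment> \<open>One representative and one admissible level provide the value. All other choices
    give the same map by \<open>acts_unique\<close>, so the description in \<open>Psi2\<close> is
    met.\<close>
  define T where "T = Phi b \<Lambda> \<Omega> K (h K (L.X K))"
  have "cmap (Psi2 b \<eta>) = T"
    unfolding Psi2_def src ucell2.simps ccell2.simps L.udom
  proof (rule the_equality)
    show "\<forall>h\<in>ucls \<eta>. \<forall>K. (\<forall>k\<ge>K. exchange \<Lambda> \<Omega> k (h k) (h (Suc k))) \<longrightarrow>
        (\<forall>k\<ge>K. T = Phi b \<Lambda> \<Omega> k (h k (L.X k)))"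
    proof (intro ballI allI impI)
      fix h' K' k assume h': "h' \<in> ucls \<eta>" and K': "\<forall>k\<ge>K'. exchange \<Lambda> \<Omega> k (h' k) (h' (Suc k))" "K' \<le> k"
      then have "h' \<in> uc_seqs \<Lambda> \<Omega>" "\<forall>\<^sub>F k in sequentially. h k = h' k"
        using rep src by (auto simp: represents_def eq_commute)
      then show "T = Phi b \<Lambda> \<Omega> k (h' k (L.X k))"
        unfolding T_def using ac[OF h(1) K] ac[OF _ K'] ext by (intro acts_unique) auto
    qed
  next
    fix T' assume "\<forall>h\<in>ucls \<eta>. \<forall>K. (\<forall>k\<ge>K. exchange \<Lambda> \<Omega> k (h k) (h (Suc k))) \<longrightarrow>
        (\<forall>k\<ge>K. T' = Phi b \<Lambda> \<Omega> k (h k (L.X k)))"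
    then show "T' = T" unfolding T_def using h(2) K by blast
  qed
  then show ?thesis using ac[OF h(1) K order_refl] ext by (simp add: T_def)
qed

lemma
  assumes h: "h \<in> uc_seqs \<Lambda> \<Omega>"
  shows seq_map_extensional: "seq_map b \<Lambda> \<Omega> h \<in> extensional (hcar L.H)"
    and seq_map_acts: "acts b \<Lambda> \<Omega> h (seq_map b \<Lambda> \<Omega> h)"
  using Psi2_represented[of "\<lparr>usrc = \<Lambda>, utgt = \<Omega>, ucls = {h}\<rparr>" h] h
  by (simp_all add: represents_def seq_map_def)

lemma seq_map_eqI:
  assumes "h \<in> uc_seqs \<Lambda> \<Omega>" "acts b \<Lambda> \<Omega> h t" "t \<in> extensional (hcar L.H)"
  shows "seq_map b \<Lambda> \<Omega> h = t"
  using acts_unique[OF seq_map_acts[OF assms(1)] assms(2)] seq_map_extensional[OF assms(1)] assms(3) by simp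

lemma Psi2_eq:
  assumes "usrc \<eta> = \<Lambda>" "utgt \<eta> = \<Omega>" "represents h \<eta>"
  shows "Psi2 b \<eta> = \<lparr>csrc = L.H, ctgt = O.H, cmap = seq_map b \<Lambda> \<Omega> h\<rparr>"
proof -
  have h: "h \<in> uc_seqs \<Lambda> \<Omega>" using assms by (auto simp: represents_def)
  have "cmap (Psi2 b \<eta>) = seq_map b \<Lambda> \<Omega> h"
    using Psi2_represented[OF assms] seq_map_eqI[OF h] by metis
  then show ?thesis by (simp add: Psi2_def assms)
qed

lemma represents_class:
  assumes "s \<in> S" "\<And>s'. s' \<in> S \<Longrightarrow> s' \<in> uc_seqs \<Lambda> \<Omega> \<and> (\<forall>\<^sub>F k in sequentially. s' k = s k)"
  shows "represents s (uc_class \<Lambda> \<Omega> S)"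
proof -
  have "\<forall>\<^sub>F k in sequentially. h k = s k" if "s' \<in> S" "\<forall>\<^sub>F k in sequentially. h k = s' k" for h s'
    using eventually_elim2[OF that(2) conjunct2[OF assms(2)[OF that(1)]]] by simp
  then show ?thesis using assms unfolding represents_def uc_class_def by (auto intro!: bexI[of _ s])
qed

text \<open>An operation that works level by level respects eventual equality of representatives.
  Scaling and adjoint are of this kind; the version with two arguments covers the sum and both
  compositions.\<close>

lemma represents_class1:
  assumes h: "represents h \<alpha>"
    and f: "\<And>h. h \<in> uc_seqs (usrc \<alpha>) (utgt \<alpha>) \<Longrightarrow> f h \<in> uc_seqs \<Lambda> \<Omega>"
    and levelwise: "\<And>h h' k. h k = h' k \<Longrightarrow> f h k = f h' k"
  shows "represents (f h) (uc_class \<Lambda> \<Omega> {f h |h. h \<in> ucls \<alpha>})"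
proof (rule represents_class)
  show "f h \<in> {f h |h. h \<in> ucls \<alpha>}" using h by (auto simp: represents_def)
  fix s assume "s \<in> {f h |h. h \<in> ucls \<alpha>}"
  then obtain h' where s: "s = f h'" "h' \<in> ucls \<alpha>" by blast
  then have ev: "\<forall>\<^sub>F k in sequentially. h' k = h k" and seq: "h' \<in> uc_seqs (usrc \<alpha>) (utgt \<alpha>)"
    using h by (auto simp: represents_def)
  have "\<forall>\<^sub>F k in sequentially. f h' k = f h k" using ev by (rule eventually_mono) (rule levelwise)
  then show "s \<in> uc_seqs \<Lambda> \<Omega> \<and> (\<forall>\<^sub>F k in sequentially. s k = f h k)"
    unfolding s(1) using f[OF seq] by blast
qed

lemma represents_class2:
  assumes g: "represents g \<beta>" and h: "represents h \<alpha>"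
    and f: "\<And>g h. g \<in> uc_seqs (usrc \<beta>) (utgt \<beta>) \<Longrightarrow> h \<in> uc_seqs (usrc \<alpha>) (utgt \<alpha>) \<Longrightarrow> f g h \<in> uc_seqs \<Lambda> \<Omega>"
    and levelwise: "\<And>g g' h h' k. g k = g' k \<Longrightarrow> h k = h' k \<Longrightarrow> f g h k = f g' h' k"
  shows "represents (f g h) (uc_class \<Lambda> \<Omega> {f g h |g h. g \<in> ucls \<beta> \<and> h \<in> ucls \<alpha>})"
proof (rule represents_class)
  show "f g h \<in> {f g h |g h. g \<in> ucls \<beta> \<and> h \<in> ucls \<alpha>}" using g h by (auto simp: represents_def)
  fix s assume "s \<in> {f g h |g h. g \<in> ucls \<beta> \<and> h \<in> ucls \<alpha>}"
  then obtain g' h' where s: "s = f g' h'" "g' \<in> ucls \<beta>" "h' \<in> ucls \<alpha>" by blast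
  then have ev: "\<forall>\<^sub>F k in sequentially. g' k = g k" "\<forall>\<^sub>F k in sequentially. h' k = h k"
    and seq: "g' \<in> uc_seqs (usrc \<beta>) (utgt \<beta>)" "h' \<in> uc_seqs (usrc \<alpha>) (utgt \<alpha>)"
    using g h by (auto simp: represents_def)
  have "\<forall>\<^sub>F k in sequentially. f g' h' k = f g h k" using ev by (rule eventually_elim2) (rule levelwise)
  then show "s \<in> uc_seqs \<Lambda> \<Omega> \<and> (\<forall>\<^sub>F k in sequentially. s k = f g h k)"
    unfolding s(1) using f[OF seq] by blast
qed

lemma seq_map_germ:
  assumes h: "h \<in> uc_seqs \<Lambda> \<Omega>"
  shows "\<forall>\<^sub>F k in sequentially. \<forall>v\<in>lev L.TH k.
     seq_map b \<Lambda> \<Omega> h (Elem (germ L.TH k v)) = Elem (germ O.TH k (cmp (cats \<Delta> k) (h k (L.X k)) v))"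
  using seq_map_acts[OF h] unfolding acts_iff .

lemma adjoint_seq:
  assumes h: "h \<in> uc_seqs \<Lambda> \<Omega>"
  shows "(\<lambda>k. \<lambda>a\<in>obj (cats \<Gamma> k). adj (cats \<Delta> k) (h k a)) \<in> uc_seqs \<Omega> \<Lambda>"
proof -
  interpret R: parallel b \<Gamma> \<Delta> \<Omega> \<Lambda> by unfold_locales
  note [simp] = seqD(1-3)[OF h]
  show ?thesis
  proof (rule R.seqI)
    fix k f assume f: "f \<in> arr (cats \<Gamma> k)"
    \<comment> \<open>Naturality of the adjoint family at \<open>f\<close> is the adjoint of
      naturality of \<open>h\<close> at the adjoint of \<open>f\<close>.\<close>
    have "adj (cats \<Delta> k) (cmp (cats \<Delta> k) (h k (src (cats \<Gamma> k) f)) (fmp (ufun \<Lambda> k) (adj (cats \<Gamma> k) f))) =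
      adj (cats \<Delta> k) (cmp (cats \<Delta> k) (fmp (ufun \<Omega> k) (adj (cats \<Gamma> k) f)) (h k (tgt (cats \<Gamma> k) f)))"
      using f seqD(4)[OF h, of "adj (cats \<Gamma> k) f" k] by simp
    then show "cmp (cats \<Delta> k) ((\<lambda>a\<in>obj (cats \<Gamma> k). adj (cats \<Delta> k) (h k a)) (tgt (cats \<Gamma> k) f)) (fmp (ufun \<Omega> k) f) =
         cmp (cats \<Delta> k) (fmp (ufun \<Lambda> k) f) ((\<lambda>a\<in>obj (cats \<Gamma> k). adj (cats \<Delta> k) (h k a)) (src (cats \<Gamma> k) f))"
      using f by simp
  next
    show "\<forall>\<^sub>F k in sequentially. exchange \<Omega> \<Lambda> k (\<lambda>a\<in>obj (cats \<Gamma> k). adj (cats \<Delta> k) (h k a))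
        (\<lambda>a\<in>obj (cats \<Gamma> (Suc k)). adj (cats \<Delta> (Suc k)) (h (Suc k) a))"
      using seqD(6)[OF h]
    proof eventually_elim
      case (elim k)
      show ?case unfolding R.exchange_iff
      proof
        fix a assume a: "a \<in> obj (cats \<Gamma> k)"
        let ?C = "cats \<Delta> (Suc k)"
        let ?h = "h (Suc k) (fob (gam \<Gamma> k) a)"
        have ex: "cmp ?C (ucon \<Omega> k a) (fmp (gam \<Delta> k) (h k a)) = cmp ?C ?h (ucon \<Lambda> k a)"
          using elim a unfolding exchange_iff by simp
        \<comment> \<open>Inserting the unitary of \<Lambda> times its adjoint brings in the adjoint
          of one side of the exchange relation for \<open>h\<close>; the other side is then
          substituted for it.\<close>
        have "cmp ?C (adj ?C ?h) (ucon \<Omega> k a) =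
            cmp ?C (ucon \<Lambda> k a) (cmp ?C (adj ?C (cmp ?C ?h (ucon \<Lambda> k a))) (ucon \<Omega> k a))"
          using a by simp
        also have "\<dots> = cmp ?C (ucon \<Lambda> k a) (fmp (gam \<Delta> k) (adj (cats \<Delta> k) (h k a)))"
          unfolding ex[symmetric] using a by simp
        finally show "cmp ?C (ucon \<Lambda> k a) (fmp (gam \<Delta> k) ((\<lambda>a\<in>obj (cats \<Gamma> k). adj (cats \<Delta> k) (h k a)) a)) =
            cmp ?C ((\<lambda>a\<in>obj (cats \<Gamma> (Suc k)). adj ?C (h (Suc k) a)) (fob (gam \<Gamma> k) a)) (ucon \<Omega> k a)"
          using a by simp
      qed
    qed
  qed auto
qed

lemma seq_map_funcset:
  assumes h: "h \<in> uc_seqs \<Lambda> \<Omega>"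
  shows "seq_map b \<Lambda> \<Omega> h \<in> hcar L.H \<rightarrow>\<^sub>E hcar O.H"
proof -
  have "seq_map b \<Lambda> \<Omega> h \<xi> \<in> hcar O.H" if "\<xi> \<in> hcar L.H" for \<xi>
  proof -
    note [simp] = seqD(1-3)[OF h]
    from eventually_happens[OF eventually_conj[OF L.hcar_eventually[OF that] seq_map_germ[OF h]]]
    obtain k v where "v \<in> lev L.TH k" "\<xi> = Elem (germ L.TH k v)"
      "seq_map b \<Lambda> \<Omega> h \<xi> = Elem (germ O.TH k (cmp (cats \<Delta> k) (h k (L.X k)) v))"
      by (auto simp del: L.lev_TH)
    then show ?thesis by simp
  qed
  then show ?thesis using seq_map_extensional[OF h] by (auto simp: PiE_def)
qed

lemma seq_map_adjoint:
  assumes h: "h \<in> uc_seqs \<Lambda> \<Omega>"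
  shows "adjoint_maps L.H O.H (seq_map b \<Lambda> \<Omega> h)
     (seq_map b \<Omega> \<Lambda> (\<lambda>k. \<lambda>a\<in>obj (cats \<Gamma> k). adj (cats \<Delta> k) (h k a)))"
proof -
  interpret R: parallel b \<Gamma> \<Delta> \<Omega> \<Lambda> by unfold_locales
  note [simp] = seqD(1-3)[OF h]
  note h' = adjoint_seq[OF h]
  show ?thesis unfolding adjoint_maps_def
  proof (intro conjI ballI)
    fix \<xi> \<zeta> assume "\<xi> \<in> hcar L.H" "\<zeta> \<in> hcar O.H"
    from eventually_happens[OF eventually_conj[OF L.hcar_eventually[OF this(1)]
      eventually_conj[OF O.hcar_eventually[OF this(2)] eventually_conj[OF seq_map_germ[OF h] R.seq_map_germ[OF h']]]]]
    obtain k v w where "v \<in> lev L.TH k" "\<xi> = Elem (germ L.TH k v)" "w \<in> lev O.TH k" "\<zeta> = Elem (germ O.TH k w)"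
      "seq_map b \<Lambda> \<Omega> h \<xi> = Elem (germ O.TH k (cmp (cats \<Delta> k) (h k (L.X k)) v))"
      "seq_map b \<Omega> \<Lambda> (\<lambda>k. \<lambda>a\<in>obj (cats \<Gamma> k). adj (cats \<Delta> k) (h k a)) \<zeta> =
         Elem (germ L.TH k (cmp (cats \<Delta> k) (adj (cats \<Delta> k) (h k (L.X k))) w))"
      by (auto simp del: L.lev_TH O.lev_TH)
    then show "hip O.H (seq_map b \<Lambda> \<Omega> h \<xi>) \<zeta> =
      hip L.H \<xi> (seq_map b \<Omega> \<Lambda> (\<lambda>k. \<lambda>a\<in>obj (cats \<Gamma> k). adj (cats \<Delta> k) (h k a)) \<zeta>)"
      by simp
  qed (rule R.seq_map_funcset[OF h'])
qed

text \<open>Right linearity is associativity of composition, left linearity is naturality of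
  \<open>h\<close> at endomorphisms of \<open>L.X k\<close>.\<close>

lemma seq_map_intertwiner:
  assumes h: "h \<in> uc_seqs \<Lambda> \<Omega>"
  shows "seq_map b \<Lambda> \<Omega> h \<in> intertwiners L.H O.H"
  unfolding intertwiners_def
proof (intro CollectI conjI ballI allI)
  note [simp] = seqD(1-3)[OF h]
  note hn = seqD(4)[OF h]
  let ?T = "seq_map b \<Lambda> \<Omega> h"
  show "?T \<in> hcar L.H \<rightarrow>\<^sub>E hcar O.H" by (rule seq_map_funcset[OF h])
  show "\<exists>S. adjoint_maps L.H O.H ?T S" using seq_map_adjoint[OF h] by blast
  fix \<xi> assume xi: "\<xi> \<in> hcar L.H"
  {
    fix \<zeta> assume "\<zeta> \<in> hcar L.H"
    from eventually_happens[OF eventually_conj[OF L.hcar_eventually[OF xi]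
      eventually_conj[OF L.hcar_eventually[OF this] seq_map_germ[OF h]]]]
    obtain k v w where "v \<in> lev L.TH k" "\<xi> = Elem (germ L.TH k v)" "w \<in> lev L.TH k" "\<zeta> = Elem (germ L.TH k w)"
      and T: "\<forall>v\<in>lev L.TH k. ?T (Elem (germ L.TH k v)) = Elem (germ O.TH k (cmp (cats \<Delta> k) (h k (L.X k)) v))"
      by (auto simp del: L.lev_TH)
    then show "?T (hadd L.H \<xi> \<zeta>) = hadd O.H (?T \<xi>) (?T \<zeta>)"
      by (simp add: L.C.K.cmp_pls)
  next
    fix z
    from eventually_happens[OF eventually_conj[OF L.hcar_eventually[OF xi] seq_map_germ[OF h]]]
    obtain k v where "v \<in> lev L.TH k" "\<xi> = Elem (germ L.TH k v)"
      and T: "\<forall>v\<in>lev L.TH k. ?T (Elem (germ L.TH k v)) = Elem (germ O.TH k (cmp (cats \<Delta> k) (h k (L.X k)) v))"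
      by (auto simp del: L.lev_TH)
    then show "?T (hscl L.H z \<xi>) = hscl O.H z (?T \<xi>)"
      by simp
  next
    fix a assume "a \<in> acar (lalg L.H)"
    then have "a \<in> lim_set L.D.TA" by simp
    from eventually_happens[OF eventually_conj[OF L.hcar_eventually[OF xi]
      eventually_conj[OF L.D.TA.lim_eventually[OF this] seq_map_germ[OF h]]]]
    obtain k v f where "v \<in> lev L.TH k" "\<xi> = Elem (germ L.TH k v)" "f \<in> lev L.D.TA k" "a = germ L.D.TA k f"
      and T: "\<forall>v\<in>lev L.TH k. ?T (Elem (germ L.TH k v)) = Elem (germ O.TH k (cmp (cats \<Delta> k) (h k (L.X k)) v))"
      by (auto simp del: L.lev_TH L.D.lev_TA)
    moreover from this have "cmp (cats \<Delta> k) (h k (L.X k)) (cmp (cats \<Delta> k) (fmp (ufun \<Lambda> k) f) v) =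
        cmp (cats \<Delta> k) (cmp (cats \<Delta> k) (h k (L.X k)) (fmp (ufun \<Lambda> k) f)) v" by simp
    ultimately show "?T (lact L.H a \<xi>) = lact O.H a (?T \<xi>)"
      by (simp add: hn[of f])
  next
    fix c assume "c \<in> acar (ralg L.H)"
    then have "c \<in> lim_set L.C.TA" by simp
    from eventually_happens[OF eventually_conj[OF L.hcar_eventually[OF xi]
      eventually_conj[OF L.C.TA.lim_eventually[OF this] seq_map_germ[OF h]]]]
    obtain k v f where "v \<in> lev L.TH k" "\<xi> = Elem (germ L.TH k v)" "f \<in> lev L.C.TA k" "c = germ L.C.TA k f"
      and T: "\<forall>v\<in>lev L.TH k. ?T (Elem (germ L.TH k v)) = Elem (germ O.TH k (cmp (cats \<Delta> k) (h k (L.X k)) v))"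
      by (auto simp del: L.lev_TH L.C.lev_TA)
    then show "?T (ract L.H \<xi> c) = ract O.H (?T \<xi>) c"
      by simp
  }
qed

end

text \<open>Two adjoints differ by vectors orthogonal to all of \<open>H\<close>, and the inner
  product is definite. Uniqueness gives the definite description in \<open>corr_star\<close> its
  value.\<close>

lemma adjoint_maps_unique:
  assumes H: "right_correspondence H" and T: "T \<in> hcar H \<rightarrow>\<^sub>E hcar G"
    and S: "adjoint_maps H G T S" and S': "adjoint_maps H G T S'"
  shows "S = S'"
proof (rule extensionalityI)
  show "S \<in> extensional (hcar G)" "S' \<in> extensional (hcar G)"
    using S S' by (auto simp: adjoint_maps_def PiE_def)
  fix \<zeta> assume z: "\<zeta> \<in> hcar G"
  interpret V: cspace "hcar H" "hadd H" "hzero H" "hscl H"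
    using H by (simp add: right_correspondence_def cspace_def)
  interpret A: cspace "acar (ralg H)" "aadd (ralg H)" "azero (ralg H)" "ascl (ralg H)"
    using H by (simp add: right_correspondence_def cspace_def afd_pre_cstar_algebra_def star_algebra_def)
  have z1: "S \<zeta> \<in> hcar H" "S' \<zeta> \<in> hcar H" using S S' z by (auto simp: adjoint_maps_def)
  have eq: "hip H \<xi> (S \<zeta>) = hip H \<xi> (S' \<zeta>)" if "\<xi> \<in> hcar H" for \<xi>
    using S S' z that by (metis adjoint_maps_def)
  have ip: "\<And>x y. x \<in> hcar H \<Longrightarrow> y \<in> hcar H \<Longrightarrow> hip H x y \<in> acar (ralg H) \<and> hip H y x = astar (ralg H) (hip H x y) \<and>
      (\<forall>w\<in>hcar H. hip H (hadd H x w) y = aadd (ralg H) (hip H x y) (hip H w y)) \<and>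
      (\<forall>z. hip H (hscl H z x) y = ascl (ralg H) z (hip H x y))"
    "\<And>x. x \<in> hcar H \<Longrightarrow> hip H x x = azero (ralg H) \<Longrightarrow> x = hzero H"
    using H unfolding right_correspondence_def by blast+
  define d where "d = hadd H (S \<zeta>) (hscl H (-1) (S' \<zeta>))"
  have d: "d \<in> hcar H" using z1 by (simp add: d_def)
  have "hip H d \<xi> = azero (ralg H)" if x: "\<xi> \<in> hcar H" for \<xi>
  proof -
    have "hip H (S \<zeta>) \<xi> = hip H (S' \<zeta>) \<xi>"
      using ip(1)[OF x z1(1)] ip(1)[OF x z1(2)] eq[OF x] by metis
    then show ?thesis using ip(1)[of "S \<zeta>" \<xi>] ip(1)[of "S' \<zeta>" \<xi>] z1 x by (simp add: d_def)
  qed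
  then have "d = hzero H" using ip(2) d by blast
  then show "S \<zeta> = S' \<zeta>" using V.minus_eq_0 z1 by (simp add: d_def)
qed

section \<open>Operations on 1-cells and 2-cells\<close>

lemma fob_fcomp [simp]: "a \<in> obj M \<Longrightarrow> fob (fcomp M G F) a = fob G (fob F a)"
  and fmp_fcomp [simp]: "f \<in> arr M \<Longrightarrow> fmp (fcomp M G F) f = fmp G (fmp F f)"
  by (simp_all add: fcomp_def compose_eq)

lemma fob_fid [simp]: "a \<in> obj M \<Longrightarrow> fob (fid M) a = a"
  and fmp_fid [simp]: "f \<in> arr M \<Longrightarrow> fmp (fid M) f = f"
  by (simp_all add: fid_def)

lemma star_functor_fid:
  assumes "star_category M"
  shows "star_functor M M (fid M)"
proof -
  interpret starcat M by unfold_locales fact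
  have "fob (fid M) \<in> obj M \<rightarrow>\<^sub>E obj M" "fmp (fid M) \<in> arr M \<rightarrow>\<^sub>E arr M" by (simp_all add: fid_def)
  then show ?thesis unfolding star_functor_def by auto
qed

lemma star_functor_fcomp:
  assumes "starfun M N F" "starfun N P G"
  shows "star_functor M P (fcomp M G F)"
proof -
  interpret F: starfun M N F by fact
  interpret G: starfun N P G by fact
  have "fob (fcomp M G F) \<in> obj M \<rightarrow>\<^sub>E obj P" "fmp (fcomp M G F) \<in> arr M \<rightarrow>\<^sub>E arr P"
    using F.fob_obj G.fob_obj F.fmp_arr G.fmp_arr by (auto simp: fcomp_def compose_def)
  then show ?thesis unfolding star_functor_def by auto
qed

lemma NT_I:
  assumes "\<And>a. a \<in> obj M \<Longrightarrow> \<eta> a \<in> hom N (fob F a) (fob G a)" "\<eta> \<in> extensional (obj M)"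
    and "\<And>f. f \<in> arr M \<Longrightarrow> cmp N (\<eta> (tgt M f)) (fmp F f) = cmp N (fmp G f) (\<eta> (src M f))"
  shows "\<eta> \<in> NT M N F G"
  using assms by (simp add: NT_def PiE_def)

lemma conn_uc1:
  assumes "base_choice b" "\<Lambda> \<in> uc1"
  shows "conn b (udom \<Lambda>) (ucod \<Lambda>) \<Lambda>"
proof -
  interpret D: zcell b "udom \<Lambda>" using assms by unfold_locales (simp_all add: uc1_def)
  interpret C: zcell b "ucod \<Lambda>" using assms by unfold_locales (simp_all add: uc1_def)
  show ?thesis
    by unfold_locales (use assms(2) in \<open>auto simp: uc1_def Let_def bifaithful_def\<close>)
qed

lemma conn_id:
  assumes "zcell b \<Gamma>"
  shows "conn b \<Gamma> \<Gamma> (uc_id1 \<Gamma>)"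
proof -
  interpret zcell b \<Gamma> by fact
  show ?thesis
  proof
    show "udom (uc_id1 \<Gamma>) = \<Gamma>" "ucod (uc_id1 \<Gamma>) = \<Gamma>" by (simp_all add: uc_id1_def)
    show "star_functor (cats \<Gamma> k) (cats \<Gamma> k) (ufun (uc_id1 \<Gamma>) k)" for k
      using star_functor_fid[OF K.star_category] by (simp add: uc_id1_def)
    show "ucon (uc_id1 \<Gamma>) k \<in> NT (cats \<Gamma> k) (cats \<Gamma> (Suc k))
       (fcomp (cats \<Gamma> k) (gam \<Gamma> k) (ufun (uc_id1 \<Gamma>) k))
       (fcomp (cats \<Gamma> k) (ufun (uc_id1 \<Gamma>) (Suc k)) (gam \<Gamma> k))" for k
      by (rule NT_I) (auto simp: uc_id1_def)
  qed (auto simp: uc_id1_def)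
qed

text \<open>The unitary of the composite is a product of two; its laws are those of \<Omega>
  together with the image under \<open>ufun \<Omega> (Suc k)\<close> of those of \<Lambda>.\<close>

lemma conn_comp:
  assumes "conn b \<Gamma> \<Delta> \<Lambda>" "conn b \<Delta> \<Sigma> \<Omega>"
  shows "conn b \<Gamma> \<Sigma> (uc_comp \<Omega> \<Lambda>)"
proof -
  interpret L: conn b \<Gamma> \<Delta> \<Lambda> by fact
  interpret O: conn b \<Delta> \<Sigma> \<Omega> by fact
  show ?thesis
  proof
    show "udom (uc_comp \<Omega> \<Lambda>) = \<Gamma>" "ucod (uc_comp \<Omega> \<Lambda>) = \<Sigma>" by (simp_all add: uc_comp_def)
    show "star_functor (cats \<Gamma> k) (cats \<Sigma> k) (ufun (uc_comp \<Omega> \<Lambda>) k)" for k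
      using star_functor_fcomp[OF L.L.starfun_axioms O.L.starfun_axioms] by (simp add: uc_comp_def)
    show "ucon (uc_comp \<Omega> \<Lambda>) k \<in> NT (cats \<Gamma> k) (cats \<Sigma> (Suc k))
       (fcomp (cats \<Gamma> k) (gam \<Sigma> k) (ufun (uc_comp \<Omega> \<Lambda>) k))
       (fcomp (cats \<Gamma> k) (ufun (uc_comp \<Omega> \<Lambda>) (Suc k)) (gam \<Gamma> k))" for k
    proof (rule NT_I)
      fix f assume f: "f \<in> arr (cats \<Gamma> k)"
      have "fmp (ufun \<Omega> (Suc k)) (cmp (cats \<Delta> (Suc k)) (ucon \<Lambda> k (tgt (cats \<Gamma> k) f)) (fmp (gam \<Delta> k) (fmp (ufun \<Lambda> k) f))) =
          fmp (ufun \<Omega> (Suc k)) (cmp (cats \<Delta> (Suc k)) (fmp (ufun \<Lambda> (Suc k)) (fmp (gam \<Gamma> k) f)) (ucon \<Lambda> k (src (cats \<Gamma> k) f)))"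
        using f by simp
      then have *: "cmp (cats \<Sigma> (Suc k)) (fmp (ufun \<Omega> (Suc k)) (ucon \<Lambda> k (tgt (cats \<Gamma> k) f)))
            (fmp (ufun \<Omega> (Suc k)) (fmp (gam \<Delta> k) (fmp (ufun \<Lambda> k) f))) =
          cmp (cats \<Sigma> (Suc k)) (fmp (ufun \<Omega> (Suc k)) (fmp (ufun \<Lambda> (Suc k)) (fmp (gam \<Gamma> k) f)))
            (fmp (ufun \<Omega> (Suc k)) (ucon \<Lambda> k (src (cats \<Gamma> k) f)))"
        using f by (simp del: L.ucon_natural)
      have "cmp (cats \<Sigma> (Suc k)) (ucon (uc_comp \<Omega> \<Lambda>) k (tgt (cats \<Gamma> k) f))
          (fmp (gam \<Sigma> k) (fmp (ufun \<Omega> k) (fmp (ufun \<Lambda> k) f))) =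
        cmp (cats \<Sigma> (Suc k)) (cmp (cats \<Sigma> (Suc k)) (fmp (ufun \<Omega> (Suc k)) (ucon \<Lambda> k (tgt (cats \<Gamma> k) f)))
            (fmp (ufun \<Omega> (Suc k)) (fmp (gam \<Delta> k) (fmp (ufun \<Lambda> k) f)))) (ucon \<Omega> k (fob (ufun \<Lambda> k) (src (cats \<Gamma> k) f)))"
        using f by (simp add: uc_comp_def)
      then show "cmp (cats \<Sigma> (Suc k)) (ucon (uc_comp \<Omega> \<Lambda>) k (tgt (cats \<Gamma> k) f))
          (fmp (fcomp (cats \<Gamma> k) (gam \<Sigma> k) (ufun (uc_comp \<Omega> \<Lambda>) k)) f) =
        cmp (cats \<Sigma> (Suc k)) (fmp (fcomp (cats \<Gamma> k) (ufun (uc_comp \<Omega> \<Lambda>) (Suc k)) (gam \<Gamma> k)) f)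
          (ucon (uc_comp \<Omega> \<Lambda>) k (src (cats \<Gamma> k) f))"
        unfolding * using f by (simp add: uc_comp_def)
    qed (auto simp: uc_comp_def)
  next
    fix a k assume a: "a \<in> obj (cats \<Gamma> k)"
    \<comment> \<open>The functor is kept outside the composite here, so that unitarity for
      \<Lambda> applies before functoriality splits the product.\<close>
    have 1: "fmp (ufun \<Omega> (Suc k)) (cmp (cats \<Delta> (Suc k)) (adj (cats \<Delta> (Suc k)) (ucon \<Lambda> k a)) (ucon \<Lambda> k a)) =
        idn (cats \<Sigma> (Suc k)) (fob (ufun \<Omega> (Suc k)) (fob (gam \<Delta> k) (fob (ufun \<Lambda> k) a)))"
      "fmp (ufun \<Omega> (Suc k)) (cmp (cats \<Delta> (Suc k)) (ucon \<Lambda> k a) (adj (cats \<Delta> (Suc k)) (ucon \<Lambda> k a))) =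
        idn (cats \<Sigma> (Suc k)) (fob (ufun \<Omega> (Suc k)) (fob (ufun \<Lambda> (Suc k)) (fob (gam \<Gamma> k) a)))"
      using a by (simp_all del: L.L.fmp_cmp O.L.fmp_cmp)
    let ?C = "cats \<Sigma> (Suc k)" and ?w = "fmp (ufun \<Omega> (Suc k)) (ucon \<Lambda> k a)"
      and ?w' = "ucon \<Omega> k (fob (ufun \<Lambda> k) a)"
    have 2: "cmp ?C (adj ?C ?w) ?w = idn ?C (fob (ufun \<Omega> (Suc k)) (fob (gam \<Delta> k) (fob (ufun \<Lambda> k) a)))"
      "cmp ?C ?w (adj ?C ?w) = idn ?C (fob (ufun \<Omega> (Suc k)) (fob (ufun \<Lambda> (Suc k)) (fob (gam \<Gamma> k) a)))"
      using 1 a by (simp_all del: L.ucon_unitary1)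
    have 3: "cmp ?C (adj ?C ?w) (cmp ?C ?w ?w') = ?w'"
      using a 2 O.C.K.cmp_assoc[of ?w' "Suc k" ?w "adj ?C ?w", symmetric] by (simp del: O.C.K.cmp_assoc)
    show "cmp (cats \<Sigma> (Suc k)) (adj (cats \<Sigma> (Suc k)) (ucon (uc_comp \<Omega> \<Lambda>) k a)) (ucon (uc_comp \<Omega> \<Lambda>) k a) =
         idn (cats \<Sigma> (Suc k)) (src (cats \<Sigma> (Suc k)) (ucon (uc_comp \<Omega> \<Lambda>) k a)) \<and>
       cmp (cats \<Sigma> (Suc k)) (ucon (uc_comp \<Omega> \<Lambda>) k a) (adj (cats \<Sigma> (Suc k)) (ucon (uc_comp \<Omega> \<Lambda>) k a)) =
         idn (cats \<Sigma> (Suc k)) (tgt (cats \<Sigma> (Suc k)) (ucon (uc_comp \<Omega> \<Lambda>) k a))"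
      using a 2 3 by (simp add: uc_comp_def)
  qed
qed

lemma id_seq:
  assumes "conn b \<Gamma> \<Delta> \<Lambda>"
  shows "(\<lambda>k. \<lambda>a\<in>obj (cats \<Gamma> k). idn (cats \<Delta> k) (fob (ufun \<Lambda> k) a)) \<in> uc_seqs \<Lambda> \<Lambda>"
    and "seq_map b \<Lambda> \<Lambda> (\<lambda>k. \<lambda>a\<in>obj (cats \<Gamma> k). idn (cats \<Delta> k) (fob (ufun \<Lambda> k) a)) = (\<lambda>\<xi>\<in>hcar (Psi1 b \<Lambda>). \<xi>)"
proof -
  interpret L: conn b \<Gamma> \<Delta> \<Lambda> by fact
  interpret P: parallel b \<Gamma> \<Delta> \<Lambda> \<Lambda> by unfold_locales
  show *: "(\<lambda>k. \<lambda>a\<in>obj (cats \<Gamma> k). idn (cats \<Delta> k) (fob (ufun \<Lambda> k) a)) \<in> uc_seqs \<Lambda> \<Lambda>"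
    by (rule P.seqI) (auto simp: P.exchange_iff)
  show "seq_map b \<Lambda> \<Lambda> (\<lambda>k. \<lambda>a\<in>obj (cats \<Gamma> k). idn (cats \<Delta> k) (fob (ufun \<Lambda> k) a)) = (\<lambda>\<xi>\<in>hcar (Psi1 b \<Lambda>). \<xi>)"
    by (rule P.seq_map_eqI[OF *]) (auto simp: P.acts_iff L.germ_hcar[simplified])
qed

text \<open>The exchange squares of \<open>h\<close> and \<open>g\<close> are pasted along the
  unitary of the middle 1-cell \<Omega>.\<close>

lemma vert_seq:
  assumes "conn b \<Gamma> \<Delta> \<Lambda>" "conn b \<Gamma> \<Delta> \<Omega>" "conn b \<Gamma> \<Delta> \<Theta>"
    and h: "h \<in> uc_seqs \<Lambda> \<Omega>" and g: "g \<in> uc_seqs \<Omega> \<Theta>"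
  shows "(\<lambda>k. \<lambda>a\<in>obj (cats \<Gamma> k). cmp (cats \<Delta> k) (g k a) (h k a)) \<in> uc_seqs \<Lambda> \<Theta>" (is "?gh \<in> _")
    and "seq_map b \<Lambda> \<Theta> (\<lambda>k. \<lambda>a\<in>obj (cats \<Gamma> k). cmp (cats \<Delta> k) (g k a) (h k a)) =
      compose (hcar (Psi1 b \<Lambda>)) (seq_map b \<Omega> \<Theta> g) (seq_map b \<Lambda> \<Omega> h)"
proof -
  interpret L: conn b \<Gamma> \<Delta> \<Lambda> by fact
  interpret O: conn b \<Gamma> \<Delta> \<Omega> by fact
  interpret T: conn b \<Gamma> \<Delta> \<Theta> by fact
  interpret P: parallel b \<Gamma> \<Delta> \<Lambda> \<Omega> by unfold_locales
  interpret Q: parallel b \<Gamma> \<Delta> \<Omega> \<Theta> by unfold_locales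
  interpret R: parallel b \<Gamma> \<Delta> \<Lambda> \<Theta> by unfold_locales
  note [simp] = P.seqD(1-3)[OF h] Q.seqD(1-3)[OF g]
  show gh: "?gh \<in> uc_seqs \<Lambda> \<Theta>"
  proof (rule R.seqI)
    fix k f assume f: "f \<in> arr (cats \<Gamma> k)"
    have "cmp (cats \<Delta> k) (g k (tgt (cats \<Gamma> k) f)) (cmp (cats \<Delta> k) (h k (tgt (cats \<Gamma> k) f)) (fmp (ufun \<Lambda> k) f)) =
        cmp (cats \<Delta> k) (cmp (cats \<Delta> k) (g k (tgt (cats \<Gamma> k) f)) (fmp (ufun \<Omega> k) f)) (h k (src (cats \<Gamma> k) f))"
      using f P.seqD(4)[OF h, of f k] by simp
    also have "\<dots> = cmp (cats \<Delta> k) (fmp (ufun \<Theta> k) f) (cmp (cats \<Delta> k) (g k (src (cats \<Gamma> k) f)) (h k (src (cats \<Gamma> k) f)))"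
      using f Q.seqD(4)[OF g, of f k] by simp
    finally show "cmp (cats \<Delta> k) (?gh k (tgt (cats \<Gamma> k) f)) (fmp (ufun \<Lambda> k) f) =
         cmp (cats \<Delta> k) (fmp (ufun \<Theta> k) f) (?gh k (src (cats \<Gamma> k) f))"
      using f by simp
  next
    show "\<forall>\<^sub>F k in sequentially. exchange \<Lambda> \<Theta> k (?gh k) (?gh (Suc k))"
      using P.seqD(6)[OF h] Q.seqD(6)[OF g]
    proof eventually_elim
      case (elim k)
      show ?case unfolding R.exchange_iff
      proof
        fix a assume a: "a \<in> obj (cats \<Gamma> k)"
        let ?C = "cats \<Delta> (Suc k)"
        have 1: "cmp ?C (ucon \<Omega> k a) (fmp (gam \<Delta> k) (h k a)) = cmp ?C (h (Suc k) (fob (gam \<Gamma> k) a)) (ucon \<Lambda> k a)"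
          and 2: "cmp ?C (ucon \<Theta> k a) (fmp (gam \<Delta> k) (g k a)) = cmp ?C (g (Suc k) (fob (gam \<Gamma> k) a)) (ucon \<Omega> k a)"
          using elim a unfolding P.exchange_iff Q.exchange_iff by auto
        have "cmp ?C (ucon \<Theta> k a) (fmp (gam \<Delta> k) (?gh k a)) =
            cmp ?C (cmp ?C (ucon \<Theta> k a) (fmp (gam \<Delta> k) (g k a))) (fmp (gam \<Delta> k) (h k a))"
          using a by simp
        also have "\<dots> = cmp ?C (g (Suc k) (fob (gam \<Gamma> k) a)) (cmp ?C (ucon \<Omega> k a) (fmp (gam \<Delta> k) (h k a)))"
          unfolding 2 using a by simp
        also have "\<dots> = cmp ?C (?gh (Suc k) (fob (gam \<Gamma> k) a)) (ucon \<Lambda> k a)"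
          unfolding 1 using a by simp
        finally show "cmp ?C (ucon \<Theta> k a) (fmp (gam \<Delta> k) (?gh k a)) =
            cmp ?C (?gh (Suc k) (fob (gam \<Gamma> k) a)) (ucon \<Lambda> k a)" .
      qed
    qed
  qed auto
  show "seq_map b \<Lambda> \<Theta> ?gh = compose (hcar (Psi1 b \<Lambda>)) (seq_map b \<Omega> \<Theta> g) (seq_map b \<Lambda> \<Omega> h)"
  proof (rule R.seq_map_eqI[OF gh])
    show "acts b \<Lambda> \<Theta> ?gh (compose (hcar (Psi1 b \<Lambda>)) (seq_map b \<Omega> \<Theta> g) (seq_map b \<Lambda> \<Omega> h))"
      unfolding R.acts_iff using P.seq_map_germ[OF h] Q.seq_map_germ[OF g]
    proof eventually_elim
      case (elim k)
      show ?case
      proof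
        fix v assume v: "v \<in> lev L.TH k"
        then have "Elem (germ L.TH k v) \<in> hcar L.H" by (rule L.germ_hcar)
        then show "compose (hcar L.H) (seq_map b \<Omega> \<Theta> g) (seq_map b \<Lambda> \<Omega> h) (Elem (germ L.TH k v)) =
           Elem (germ T.TH k (cmp (cats \<Delta> k) (?gh k (L.X k)) v))"
          using elim v by (simp add: compose_eq)
      qed
    qed
  qed simp
qed

lemma add_seq:
  assumes "conn b \<Gamma> \<Delta> \<Lambda>" "conn b \<Gamma> \<Delta> \<Omega>" and h: "h \<in> uc_seqs \<Lambda> \<Omega>" and g: "g \<in> uc_seqs \<Lambda> \<Omega>"
  shows "(\<lambda>k. \<lambda>a\<in>obj (cats \<Gamma> k). pls (cats \<Delta> k) (g k a) (h k a)) \<in> uc_seqs \<Lambda> \<Omega>" (is "?gh \<in> _")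
    and "seq_map b \<Lambda> \<Omega> (\<lambda>k. \<lambda>a\<in>obj (cats \<Gamma> k). pls (cats \<Delta> k) (g k a) (h k a)) =
      (\<lambda>\<xi>\<in>hcar (Psi1 b \<Lambda>). hadd (Psi1 b \<Omega>) (seq_map b \<Lambda> \<Omega> g \<xi>) (seq_map b \<Lambda> \<Omega> h \<xi>))"
proof -
  interpret L: conn b \<Gamma> \<Delta> \<Lambda> by fact
  interpret O: conn b \<Gamma> \<Delta> \<Omega> by fact
  interpret P: parallel b \<Gamma> \<Delta> \<Lambda> \<Omega> by unfold_locales
  note [simp] = P.seqD(1-3)[OF h] P.seqD(1-3)[OF g]
  show gh: "?gh \<in> uc_seqs \<Lambda> \<Omega>"
  proof (rule P.seqI)
    show "\<forall>\<^sub>F k in sequentially. exchange \<Lambda> \<Omega> k (?gh k) (?gh (Suc k))"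
      using P.seqD(6)[OF h] P.seqD(6)[OF g]
      by eventually_elim (simp add: P.exchange_iff L.C.K.cmp_pls L.C.K.pls_cmp)
  qed (use P.seqD(4)[OF h] P.seqD(4)[OF g] in \<open>auto simp: L.C.K.cmp_pls L.C.K.pls_cmp\<close>)
  show "seq_map b \<Lambda> \<Omega> ?gh = (\<lambda>\<xi>\<in>hcar (Psi1 b \<Lambda>). hadd (Psi1 b \<Omega>) (seq_map b \<Lambda> \<Omega> g \<xi>) (seq_map b \<Lambda> \<Omega> h \<xi>))"
  proof (rule P.seq_map_eqI[OF gh])
    show "acts b \<Lambda> \<Omega> ?gh (\<lambda>\<xi>\<in>hcar L.H. hadd O.H (seq_map b \<Lambda> \<Omega> g \<xi>) (seq_map b \<Lambda> \<Omega> h \<xi>))"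
      unfolding P.acts_iff using P.seq_map_germ[OF h] P.seq_map_germ[OF g]
    proof eventually_elim
      case (elim k)
      show ?case
      proof
        fix v assume v: "v \<in> lev L.TH k"
        then have "Elem (germ L.TH k v) \<in> hcar L.H" by (rule L.germ_hcar)
        then show "(\<lambda>\<xi>\<in>hcar L.H. hadd O.H (seq_map b \<Lambda> \<Omega> g \<xi>) (seq_map b \<Lambda> \<Omega> h \<xi>)) (Elem (germ L.TH k v)) =
           Elem (germ O.TH k (cmp (cats \<Delta> k) (?gh k (L.X k)) v))"
          using elim v by (simp add: L.C.K.pls_cmp)
      qed
    qed
  qed simp
qed

lemma scale_seq:
  assumes "conn b \<Gamma> \<Delta> \<Lambda>" "conn b \<Gamma> \<Delta> \<Omega>" and h: "h \<in> uc_seqs \<Lambda> \<Omega>"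
  shows "(\<lambda>k. \<lambda>a\<in>obj (cats \<Gamma> k). scl (cats \<Delta> k) z (h k a)) \<in> uc_seqs \<Lambda> \<Omega>" (is "?gh \<in> _")
    and "seq_map b \<Lambda> \<Omega> (\<lambda>k. \<lambda>a\<in>obj (cats \<Gamma> k). scl (cats \<Delta> k) z (h k a)) =
      (\<lambda>\<xi>\<in>hcar (Psi1 b \<Lambda>). hscl (Psi1 b \<Omega>) z (seq_map b \<Lambda> \<Omega> h \<xi>))"
proof -
  interpret L: conn b \<Gamma> \<Delta> \<Lambda> by fact
  interpret O: conn b \<Gamma> \<Delta> \<Omega> by fact
  interpret P: parallel b \<Gamma> \<Delta> \<Lambda> \<Omega> by unfold_locales
  note [simp] = P.seqD(1-3)[OF h]
  show gh: "?gh \<in> uc_seqs \<Lambda> \<Omega>"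
  proof (rule P.seqI)
    show "\<forall>\<^sub>F k in sequentially. exchange \<Lambda> \<Omega> k (?gh k) (?gh (Suc k))"
      using P.seqD(6)[OF h] by eventually_elim (simp add: P.exchange_iff)
  qed (use P.seqD(4)[OF h] in auto)
  show "seq_map b \<Lambda> \<Omega> ?gh = (\<lambda>\<xi>\<in>hcar (Psi1 b \<Lambda>). hscl (Psi1 b \<Omega>) z (seq_map b \<Lambda> \<Omega> h \<xi>))"
  proof (rule P.seq_map_eqI[OF gh])
    show "acts b \<Lambda> \<Omega> ?gh (\<lambda>\<xi>\<in>hcar L.H. hscl O.H z (seq_map b \<Lambda> \<Omega> h \<xi>))"
      unfolding P.acts_iff using P.seq_map_germ[OF h]
    proof eventually_elim
      case (elim k)
      show ?case
      proof
        fix v assume v: "v \<in> lev L.TH k"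
        then have "Elem (germ L.TH k v) \<in> hcar L.H" by (rule L.germ_hcar)
        then show "(\<lambda>\<xi>\<in>hcar L.H. hscl O.H z (seq_map b \<Lambda> \<Omega> h \<xi>)) (Elem (germ L.TH k v)) =
           Elem (germ O.TH k (cmp (cats \<Delta> k) (?gh k (L.X k)) v))"
          using elim v by simp
      qed
    qed
  qed simp
qed

section \<open>Right correspondences and relative tensor products\<close>

locale rcorr =
  fixes H :: "'e corr"
  assumes right_correspondence: "right_correspondence H"

sublocale rcorr \<subseteq> V: cspace "hcar H" "hadd H" "hzero H" "hscl H"
  using right_correspondence by (simp add: right_correspondence_def cspace_def)

sublocale rcorr \<subseteq> R: cspace "acar (ralg H)" "aadd (ralg H)" "azero (ralg H)" "ascl (ralg H)"
  using right_correspondence by (simp add: right_correspondence_def cspace_def afd_pre_cstar_algebra_def star_algebra_def)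

context rcorr
begin

lemma afd_lalg: "afd_pre_cstar_algebra (lalg H)" and afd_ralg: "afd_pre_cstar_algebra (ralg H)"
  using right_correspondence by (simp_all add: right_correspondence_def)

lemma R_algebra: "star_algebra (ralg H)" and L_algebra: "star_algebra (lalg H)"
  using afd_lalg afd_ralg by (simp_all add: afd_pre_cstar_algebra_def)

lemma
  assumes "x \<in> hcar H" "b \<in> acar (ralg H)"
  shows ract_closed [simp]: "ract H x b \<in> hcar H"
    and ract_amul: "b' \<in> acar (ralg H) \<Longrightarrow> ract H x (amul (ralg H) b b') = ract H (ract H x b) b'"
    and ract_aadd: "b' \<in> acar (ralg H) \<Longrightarrow> ract H x (aadd (ralg H) b b') = hadd H (ract H x b) (ract H x b')"
    and ract_hadd: "y \<in> hcar H \<Longrightarrow> ract H (hadd H x y) b = hadd H (ract H x b) (ract H y b)"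
    and ract_hscl: "ract H (hscl H z x) b = hscl H z (ract H x b)"
    and ract_ascl: "ract H x (ascl (ralg H) z b) = hscl H z (ract H x b)"
  using right_correspondence assms unfolding right_correspondence_def by blast+

lemma
  assumes "x \<in> hcar H" "a \<in> acar (lalg H)"
  shows lact_closed [simp]: "lact H a x \<in> hcar H"
    and lact_amul: "a' \<in> acar (lalg H) \<Longrightarrow> lact H (amul (lalg H) a a') x = lact H a (lact H a' x)"
    and lact_aadd: "a' \<in> acar (lalg H) \<Longrightarrow> lact H (aadd (lalg H) a a') x = hadd H (lact H a x) (lact H a' x)"
    and lact_hadd: "y \<in> hcar H \<Longrightarrow> lact H a (hadd H x y) = hadd H (lact H a x) (lact H a y)"
    and lact_hscl: "lact H a (hscl H z x) = hscl H z (lact H a x)"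
    and lact_ascl: "lact H (ascl (lalg H) z a) x = hscl H z (lact H a x)"
    and lact_ract: "b \<in> acar (ralg H) \<Longrightarrow> lact H a (ract H x b) = ract H (lact H a x) b"
    and hip_lact: "y \<in> hcar H \<Longrightarrow> hip H (lact H a x) y = hip H x (lact H (astar (lalg H) a) y)"
  using right_correspondence assms unfolding right_correspondence_def by blast+

lemma
  assumes "x \<in> hcar H"
  shows ract_aone: "ract H x (aone (ralg H)) = x"
    and lact_aone: "lact H (aone (lalg H)) x = x"
    and apos_hip: "apos (ralg H) (hip H x x)"
    and hip_definite: "hip H x x = azero (ralg H) \<Longrightarrow> x = hzero H"
  using right_correspondence assms unfolding right_correspondence_def by blast+

lemma
  assumes "x \<in> hcar H" "y \<in> hcar H"
  shows hip_closed [simp]: "hip H x y \<in> acar (ralg H)"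
    and hip_commute: "hip H y x = astar (ralg H) (hip H x y)"
    and hip_hadd: "w \<in> hcar H \<Longrightarrow> hip H (hadd H x w) y = aadd (ralg H) (hip H x y) (hip H w y)"
    and hip_hscl: "hip H (hscl H z x) y = ascl (ralg H) z (hip H x y)"
    and hip_ract: "b \<in> acar (ralg H) \<Longrightarrow> hip H (ract H x b) y = amul (ralg H) (hip H x y) b"
  using right_correspondence assms unfolding right_correspondence_def by blast+

lemma hip_hadd_right:
  "x \<in> hcar H \<Longrightarrow> y \<in> hcar H \<Longrightarrow> w \<in> hcar H \<Longrightarrow> hip H x (hadd H y w) = aadd (ralg H) (hip H x y) (hip H x w)"
  using hip_commute[of "hadd H y w" x] hip_commute[of y x] hip_commute[of w x] hip_hadd[of y x w]
  by (simp add: star_algebraD[OF R_algebra])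

lemma hip_0_left [simp]: "y \<in> hcar H \<Longrightarrow> hip H (hzero H) y = azero (ralg H)"
  using hip_hscl[of "hzero H" y 0] by simp

lemma hip_0_right [simp]: "y \<in> hcar H \<Longrightarrow> hip H y (hzero H) = azero (ralg H)"
  using hip_commute[of "hzero H" y] star_algebraD(10)[OF R_algebra, of "azero (ralg H)" 0]
    R.sc_0[OF star_algebraD(3)[OF R_algebra R.zero_closed]] by simp

lemma hip_eq_0_iff [simp]: "x \<in> hcar H \<Longrightarrow> hip H x x = azero (ralg H) \<longleftrightarrow> x = hzero H"
  using hip_definite by auto

lemma lact_0 [simp]: "a \<in> acar (lalg H) \<Longrightarrow> lact H a (hzero H) = hzero H"
  using lact_hscl[of "hzero H" a 0] by simp

lemma ract_0 [simp]: "b \<in> acar (ralg H) \<Longrightarrow> ract H (hzero H) b = hzero H"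
  using ract_hscl[of "hzero H" b 0] by simp

end

text \<open>\<open>H\<close> is not assumed to be a correspondence, only closed under its
  operations. Tensor products and identity correspondences acquire the axioms from \<open>K\<close>
  in this way.\<close>

definition corr_iso :: "'e corr \<Rightarrow> 'e corr \<Rightarrow> ('e tvec \<Rightarrow> 'e tvec) \<Rightarrow> bool" where
  "corr_iso H K t \<longleftrightarrow> bij_betw t (hcar H) (hcar K) \<and> lalg H = lalg K \<and> ralg H = ralg K \<and>
     hzero H \<in> hcar H \<and> t (hzero H) = hzero K \<and>
     (\<forall>x\<in>hcar H. \<forall>y\<in>hcar H. hadd H x y \<in> hcar H \<and> t (hadd H x y) = hadd K (t x) (t y) \<and>
        hip H x y = hip K (t x) (t y)) \<and>
     (\<forall>x\<in>hcar H. \<forall>c. hscl H c x \<in> hcar H \<and> t (hscl H c x) = hscl K c (t x)) \<and>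
     (\<forall>x\<in>hcar H. \<forall>a\<in>acar (lalg K). lact H a x \<in> hcar H \<and> t (lact H a x) = lact K a (t x)) \<and>
     (\<forall>x\<in>hcar H. \<forall>a\<in>acar (ralg K). ract H x a \<in> hcar H \<and> t (ract H x a) = ract K (t x) a)"

locale corr_isomorphism = K: rcorr K for K :: "'e corr" + fixes H t
  assumes corr_iso: "corr_iso H K t"
begin

lemma
  shows t_bij: "bij_betw t (hcar H) (hcar K)"
    and algs [simp]: "lalg H = lalg K" "ralg H = ralg K"
    and t_hzero [simp]: "hzero H \<in> hcar H" "t (hzero H) = hzero K"
    and t_closed [simp]: "x \<in> hcar H \<Longrightarrow> t x \<in> hcar K"
    and t_inj: "x \<in> hcar H \<Longrightarrow> y \<in> hcar H \<Longrightarrow> t x = t y \<Longrightarrow> x = y"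
    and t_hadd [simp]: "x \<in> hcar H \<Longrightarrow> y \<in> hcar H \<Longrightarrow> hadd H x y \<in> hcar H"
      "x \<in> hcar H \<Longrightarrow> y \<in> hcar H \<Longrightarrow> t (hadd H x y) = hadd K (t x) (t y)"
    and t_hip: "x \<in> hcar H \<Longrightarrow> y \<in> hcar H \<Longrightarrow> hip H x y = hip K (t x) (t y)"
    and t_hscl [simp]: "x \<in> hcar H \<Longrightarrow> hscl H c x \<in> hcar H" "x \<in> hcar H \<Longrightarrow> t (hscl H c x) = hscl K c (t x)"
    and t_lact [simp]: "x \<in> hcar H \<Longrightarrow> a \<in> acar (lalg K) \<Longrightarrow> lact H a x \<in> hcar H"
      "x \<in> hcar H \<Longrightarrow> a \<in> acar (lalg K) \<Longrightarrow> t (lact H a x) = lact K a (t x)"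
    and t_ract [simp]: "x \<in> hcar H \<Longrightarrow> b \<in> acar (ralg K) \<Longrightarrow> ract H x b \<in> hcar H"
      "x \<in> hcar H \<Longrightarrow> b \<in> acar (ralg K) \<Longrightarrow> t (ract H x b) = ract K (t x) b"
  using corr_iso unfolding corr_iso_def by (auto simp: bij_betw_def inj_on_def)

text \<open>Each equation between vectors holds after applying the injective map \<open>t\<close>,
  and the inner products are those of the images.\<close>

lemma source_right_correspondence: "right_correspondence H"
proof -
  note K_laws = K.ract_amul K.ract_aadd K.ract_hadd K.ract_hscl K.ract_ascl K.lact_amul K.lact_aadd
    K.lact_hadd K.lact_hscl K.lact_ascl K.lact_ract K.ract_aone K.lact_aone
  note alg_laws = star_algebraD[OF K.R_algebra] star_algebraD[OF K.L_algebra]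
  have [simp]: "aone (ralg K) \<in> acar (ralg K)" "aone (lalg K) \<in> acar (lalg K)"
    using K.R_algebra K.L_algebra by (simp_all add: star_algebra_def)
  have [simp]: "aadd (lalg K) a a' \<in> acar (lalg K)" "ascl (lalg K) z a \<in> acar (lalg K)"
    if "a \<in> acar (lalg K)" "a' \<in> acar (lalg K)" for a a' z
    using K.L_algebra that by (auto simp: star_algebra_def complex_space_def)
  have cs: "complex_space (hcar H) (hadd H) (hzero H) (hscl H)"
    unfolding complex_space_def
  proof (intro conjI ballI allI)
    fix x y w c d assume *: "x \<in> hcar H" "y \<in> hcar H" "w \<in> hcar H"
    show "hadd H (hadd H x y) w = hadd H x (hadd H y w)"
      by (rule t_inj) (simp_all add: * K.V.add_ac)
  next
    fix x y assume *: "x \<in> hcar H" "y \<in> hcar H"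
    show "hadd H x y = hadd H y x"
      by (rule t_inj) (simp_all add: * K.V.add_ac)
    show "hscl H c (hadd H x y) = hadd H (hscl H c x) (hscl H c y)" for c
      by (rule t_inj) (simp_all add: * K.V.sc_add)
  next
    fix x assume *: "x \<in> hcar H"
    show "hadd H (hzero H) x = x" "hadd H x (hscl H (-1) x) = hzero H" "hscl H 1 x = x"
      by (rule t_inj; simp add: *)+
    show "hscl H (c + d) x = hadd H (hscl H c x) (hscl H d x)"
      "hscl H (c * d) x = hscl H c (hscl H d x)" for c d
      by (rule t_inj; simp add: * K.V.sc_plus)+
  qed simp_all
  show ?thesis unfolding right_correspondence_def
  proof (intro conjI ballI allI impI)
    fix x y assume *: "x \<in> hcar H" "y \<in> hcar H"
    show "hip H x y \<in> acar (ralg H)" "hip H y x = astar (ralg H) (hip H x y)"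
      using * K.hip_commute[of "t x" "t y"] by (simp_all add: t_hip)
    show "hip H (hadd H x w) y = aadd (ralg H) (hip H x y) (hip H w y)" if "w \<in> hcar H" for w
      using * that by (simp add: t_hip K.hip_hadd)
    show "hip H (hscl H z x) y = ascl (ralg H) z (hip H x y)" for z
      using * by (simp add: t_hip K.hip_hscl)
    show "hip H (ract H x b) y = amul (ralg H) (hip H x y) b" if "b \<in> acar (ralg H)" for b
      using * that by (simp add: t_hip K.hip_ract)
  next
    fix x assume *: "x \<in> hcar H"
    show "apos (ralg H) (hip H x x)" using * by (simp add: t_hip K.apos_hip)
    show "x = hzero H" if "hip H x x = azero (ralg H)"
      by (rule t_inj) (use * that in \<open>simp_all add: t_hip\<close>)
    show "ract H x (aone (ralg H)) = x" "lact H (aone (lalg H)) x = x"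
      by (rule t_inj; simp add: * K_laws)+
  next
    fix x b b' z assume *: "x \<in> hcar H" "b \<in> acar (ralg H)"
    show "ract H x b \<in> hcar H" using * by simp
    show "ract H (hscl H z x) b = hscl H z (ract H x b)" "ract H x (ascl (ralg H) z b) = hscl H z (ract H x b)"
      by (rule t_inj; use * in \<open>simp add: K_laws\<close>)+
    show "ract H (hadd H x y) b = hadd H (ract H x b) (ract H y b)" if "y \<in> hcar H" for y
      by (rule t_inj; use * that in \<open>simp add: K_laws\<close>)+
  next
    fix x b b' assume *: "x \<in> hcar H" "b \<in> acar (ralg H)" "b' \<in> acar (ralg H)"
    show "ract H x (amul (ralg H) b b') = ract H (ract H x b) b'"
      "ract H x (aadd (ralg H) b b') = hadd H (ract H x b) (ract H x b')"
      by (rule t_inj; use * in \<open>simp add: K_laws alg_laws\<close>)+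
  next
    fix x a z assume *: "x \<in> hcar H" "a \<in> acar (lalg H)"
    show "lact H a x \<in> hcar H" using * by simp
    show "lact H a (hscl H z x) = hscl H z (lact H a x)" "lact H (ascl (lalg H) z a) x = hscl H z (lact H a x)"
      by (rule t_inj; use * in \<open>simp add: K_laws\<close>)+
    show "lact H a (hadd H x y) = hadd H (lact H a x) (lact H a y)" if "y \<in> hcar H" for y
      by (rule t_inj; use * that in \<open>simp add: K_laws\<close>)+
    show "lact H a (ract H x b) = ract H (lact H a x) b" if "b \<in> acar (ralg H)" for b
      by (rule t_inj; use * that in \<open>simp add: K_laws\<close>)+
    show "hip H (lact H a x) y = hip H x (lact H (astar (lalg H) a) y)" if "y \<in> hcar H" for y
      using * that by (simp add: t_hip K.hip_lact alg_laws)
  next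
    fix x a a' assume *: "x \<in> hcar H" "a \<in> acar (lalg H)" "a' \<in> acar (lalg H)"
    show "lact H (amul (lalg H) a a') x = lact H a (lact H a' x)"
      "lact H (aadd (lalg H) a a') x = hadd H (lact H a x) (lact H a' x)"
      by (rule t_inj; use * in \<open>simp add: K_laws alg_laws\<close>)+
  qed (simp_all add: cs K.afd_lalg K.afd_ralg)
qed

text \<open>A bijection that preserves inner products has its inverse as adjoint.\<close>

lemma unitary:
  assumes ext: "t \<in> extensional (hcar H)"
  shows "\<lparr>csrc = H, ctgt = K, cmap = t\<rparr> \<in> Unitary2 CORR H K"
proof -
  \<comment> \<open>Restricted to the carrier, because adjoints are extensional functions.\<close>
  define S where "S = (\<lambda>y\<in>hcar K. inv_into (hcar H) t y)"
  have img: "t ` hcar H = hcar K" and inj: "inj_on t (hcar H)" using t_bij by (auto simp: bij_betw_def)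
  have St: "S (t x) = x" if "x \<in> hcar H" for x using that inj by (simp add: S_def)
  have S: "S y \<in> hcar H" "t (S y) = y" if "y \<in> hcar K" for y
    using that img by (simp_all add: S_def inv_into_into f_inv_into_f)
  have tf: "t \<in> hcar H \<rightarrow>\<^sub>E hcar K" using ext by (auto simp: PiE_def)
  have adj: "adjoint_maps H K t S"
    unfolding adjoint_maps_def using S by (auto simp: t_hip S_def)
  have star: "corr_star \<lparr>csrc = H, ctgt = K, cmap = t\<rparr> = \<lparr>csrc = K, ctgt = H, cmap = S\<rparr>"
  proof -
    have "(THE S. adjoint_maps H K t S) = S"
      by (rule the_equality[where P = "adjoint_maps H K t", OF adj])
        (rule adjoint_maps_unique[OF source_right_correspondence tf _ adj])
    then show ?thesis by (simp add: corr_star_def)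
  qed
  have "t \<in> intertwiners H K" unfolding intertwiners_def using tf adj by auto
  then have mem: "\<lparr>csrc = H, ctgt = K, cmap = t\<rparr> \<in> corr2"
    using source_right_correspondence K.right_correspondence by (simp add: corr2_def)
  have "compose (hcar H) S t = (\<lambda>x\<in>hcar H. x)" "compose (hcar K) t S = (\<lambda>x\<in>hcar K. x)"
    using S St by (auto simp: compose_def)
  then show ?thesis
    using mem star by (simp add: Unitary2_def Hom2_def CORR_def corr_vert_def corr_id2_def)
qed

end

section \<open>The relative tensor product seen through a balanced map\<close>

lemma tensor_simps:
  "lalg (tensor H G) = lalg H" "ralg (tensor H G) = ralg G"
  "hcar (tensor H G) = tens_cls H G ` tens_sums H G"
  "hadd (tensor H G) x y = tens_cls H G (terms x @ terms y)"
  "hzero (tensor H G) = tens_cls H G []"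
  "hscl (tensor H G) z x = tens_cls H G (tens_scl H z (terms x))"
  "lact (tensor H G) a x = tens_cls H G (map (\<lambda>(\<xi>, \<zeta>). (lact H a \<xi>, \<zeta>)) (terms x))"
  "ract (tensor H G) x c = tens_cls H G (map (\<lambda>(\<xi>, \<zeta>). (\<xi>, ract G \<zeta> c)) (terms x))"
  "hip (tensor H G) x y = tens_ip H G (terms x) (terms y)"
  by (simp_all add: tensor_def)

text \<open>The identity \<open>\<beta>_hip\<close> alone makes two formal sums equal in the tensor product iff they have the same
  image in \<open>K\<close>; if \<open>\<beta>\<close> generates \<open>K\<close>, the tensor product therefore inherits every axiom from \<open>K\<close>.\<close>

locale balanced = H: rcorr H + G: rcorr G + K: rcorr K for H G K :: "'e corr" +
  fixes \<beta> :: "'e tvec \<Rightarrow> 'e tvec \<Rightarrow> 'e tvec"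
  assumes algebras [simp]: "ralg H = lalg G" "lalg K = lalg H" "ralg K = ralg G"
    and \<beta>_closed [simp]: "\<xi> \<in> hcar H \<Longrightarrow> \<zeta> \<in> hcar G \<Longrightarrow> \<beta> \<xi> \<zeta> \<in> hcar K"
    and \<beta>_hscl: "\<xi> \<in> hcar H \<Longrightarrow> \<zeta> \<in> hcar G \<Longrightarrow> \<beta> (hscl H z \<xi>) \<zeta> = hscl K z (\<beta> \<xi> \<zeta>)"
    and \<beta>_lact: "\<xi> \<in> hcar H \<Longrightarrow> \<zeta> \<in> hcar G \<Longrightarrow> a \<in> acar (lalg H) \<Longrightarrow> \<beta> (lact H a \<xi>) \<zeta> = lact K a (\<beta> \<xi> \<zeta>)"
    and \<beta>_ract: "\<xi> \<in> hcar H \<Longrightarrow> \<zeta> \<in> hcar G \<Longrightarrow> c \<in> acar (ralg G) \<Longrightarrow> \<beta> \<xi> (ract G \<zeta> c) = ract K (\<beta> \<xi> \<zeta>) c"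
    and \<beta>_hip: "\<xi> \<in> hcar H \<Longrightarrow> \<zeta> \<in> hcar G \<Longrightarrow> \<xi>' \<in> hcar H \<Longrightarrow> \<zeta>' \<in> hcar G \<Longrightarrow>
       hip K (\<beta> \<xi> \<zeta>) (\<beta> \<xi>' \<zeta>') = hip G (lact G (hip H \<xi> \<xi>') \<zeta>) \<zeta>'"
begin

definition tsum :: "('e tvec \<times> 'e tvec) list \<Rightarrow> 'e tvec" where
  "tsum s = lsum (hadd K) (hzero K) (map (\<lambda>(\<xi>, \<zeta>). \<beta> \<xi> \<zeta>) s)"

lemma tens_sums_simps [simp]:
  "[] \<in> tens_sums H G"
  "(\<xi>, \<zeta>) # s \<in> tens_sums H G \<longleftrightarrow> \<xi> \<in> hcar H \<and> \<zeta> \<in> hcar G \<and> s \<in> tens_sums H G"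
  "s @ t \<in> tens_sums H G \<longleftrightarrow> s \<in> tens_sums H G \<and> t \<in> tens_sums H G"
  by (auto simp: tens_sums_def)

lemma tsum_simps [simp]:
  "tsum [] = hzero K" "tsum ((\<xi>, \<zeta>) # s) = hadd K (\<beta> \<xi> \<zeta>) (tsum s)"
  by (simp_all add: tsum_def)

lemma tsum_closed [simp]: "s \<in> tens_sums H G \<Longrightarrow> tsum s \<in> hcar K"
  by (induction s) auto

lemma tsum_append [simp]: "s \<in> tens_sums H G \<Longrightarrow> t \<in> tens_sums H G \<Longrightarrow> tsum (s @ t) = hadd K (tsum s) (tsum t)"
  by (induction s) (auto simp: K.V.add_assoc)

lemma tens_scl_simps [simp]: "tens_scl H z [] = []" "tens_scl H z ((\<xi>, \<zeta>) # s) = (hscl H z \<xi>, \<zeta>) # tens_scl H z s"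
  by (simp_all add: tens_scl_def)

lemma tens_scl_closed [simp]: "s \<in> tens_sums H G \<Longrightarrow> tens_scl H z s \<in> tens_sums H G"
  by (induction s) auto

lemma tsum_scl [simp]: "s \<in> tens_sums H G \<Longrightarrow> tsum (tens_scl H z s) = hscl K z (tsum s)"
  by (induction s) (auto simp: \<beta>_hscl K.V.sc_add)

lemma lact_sums: "s \<in> tens_sums H G \<Longrightarrow> a \<in> acar (lalg H) \<Longrightarrow>
    map (\<lambda>(\<xi>, \<zeta>). (lact H a \<xi>, \<zeta>)) s \<in> tens_sums H G \<and>
    tsum (map (\<lambda>(\<xi>, \<zeta>). (lact H a \<xi>, \<zeta>)) s) = lact K a (tsum s)"
  by (induction s) (auto simp: \<beta>_lact K.lact_hadd)

lemma ract_sums: "s \<in> tens_sums H G \<Longrightarrow> c \<in> acar (ralg G) \<Longrightarrow>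
    map (\<lambda>(\<xi>, \<zeta>). (\<xi>, ract G \<zeta> c)) s \<in> tens_sums H G \<and>
    tsum (map (\<lambda>(\<xi>, \<zeta>). (\<xi>, ract G \<zeta> c)) s) = ract K (tsum s) c"
  by (induction s) (auto simp: \<beta>_ract K.ract_hadd)

text \<open>Sesquilinear expansion along the list product: a row with fixed first factor sums to an
  inner product with \<open>tsum t\<close>, and the rows add up. Membership in the algebra is
  carried along because sums can only be split inside the carrier.\<close>

lemma tens_ip: 
  assumes "s \<in> tens_sums H G" "t \<in> tens_sums H G"
  shows "tens_ip H G s t = hip K (tsum s) (tsum t)"
proof -
  define f where "f = (\<lambda>((\<xi>1, \<zeta>1), (\<xi>2, \<zeta>2)). hip G (lact G (hip H \<xi>1 \<xi>2) \<zeta>1) \<zeta>2)"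
  have row: "lsum (aadd (ralg G)) (azero (ralg G)) (map f (map (Pair (\<xi>, \<zeta>)) t)) = hip K (\<beta> \<xi> \<zeta>) (tsum t) \<and>
      set (map f (map (Pair (\<xi>, \<zeta>)) t)) \<subseteq> acar (ralg G)"
    if "\<xi> \<in> hcar H" "\<zeta> \<in> hcar G" for \<xi> \<zeta>
    using assms(2)
  proof (induction t)
    case (Cons p t)
    have "hip H \<xi> \<xi>' \<in> acar (lalg G)" if "\<xi>' \<in> hcar H" for \<xi>'
      using H.hip_closed[of \<xi> \<xi>'] that \<open>\<xi> \<in> hcar H\<close> by simp
    then show ?case
      using Cons that by (cases p) (auto simp: f_def \<beta>_hip K.hip_hadd_right)
  qed (use that K.hip_0_right in simp)
  have "lsum (aadd (ralg G)) (azero (ralg G)) (map f (List.product s t)) = hip K (tsum s) (tsum t) \<and>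
      set (map f (List.product s t)) \<subseteq> acar (ralg G)"
    using assms(1)
  proof (induction s)
    case (Cons p s)
    obtain \<xi> \<zeta> where p: "p = (\<xi>, \<zeta>)" by (cases p)
    then have *: "\<xi> \<in> hcar H" "\<zeta> \<in> hcar G" "s \<in> tens_sums H G" using Cons.prems by auto
    then have s: "lsum (aadd (ralg G)) (azero (ralg G)) (map f (List.product s t)) = hip K (tsum s) (tsum t)"
      "set (map f (List.product s t)) \<subseteq> acar (ralg G)" using Cons.IH by auto
    note r = row[OF *(1,2)]
    have "lsum (aadd (ralg G)) (azero (ralg G)) (map f (List.product (p # s) t)) =
       aadd (ralg G) (lsum (aadd (ralg G)) (azero (ralg G)) (map f (map (Pair (\<xi>, \<zeta>)) t)))
         (lsum (aadd (ralg G)) (azero (ralg G)) (map f (List.product s t)))"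
      using G.R.lsum_append[OF conjunct2[OF r] s(2)] by (simp add: p)
    also have "\<dots> = hip K (tsum (p # s)) (tsum t)"
      unfolding conjunct1[OF r] s(1) using * assms(2) by (simp add: p K.hip_hadd)
    finally show ?case using r s(2) by (simp add: p)
  qed (use assms(2) K.hip_0_left in simp)
  then show ?thesis by (simp add: tens_ip_def f_def)
qed

text \<open>A formal difference is null exactly when its image in \<open>K\<close> is, and there the
  inner product is definite.\<close>

lemma tens_eq_iff:
  assumes "s \<in> tens_sums H G" "t \<in> tens_sums H G"
  shows "tens_eq H G s t \<longleftrightarrow> tsum s = tsum t"
proof -
  have "tens_eq H G s t \<longleftrightarrow> hadd K (tsum s) (hscl K (-1) (tsum t)) = hzero K"
    using assms K.hip_eq_0_iff[of "hadd K (tsum s) (hscl K (-1) (tsum t))"]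
    by (simp add: tens_eq_def Let_def tens_ip)
  also have "\<dots> \<longleftrightarrow> tsum s = tsum t"
    using K.V.minus_eq_0[of "tsum s" "tsum t"] assms by auto
  finally show ?thesis .
qed

lemma tens_cls:
  assumes "s \<in> tens_sums H G"
  shows "terms (tens_cls H G s) \<in> tens_sums H G" "tsum (terms (tens_cls H G s)) = tsum s"
proof -
  have "\<exists>t. t \<in> tens_sums H G \<and> tens_eq H G t s" using assms tens_eq_iff by blast
  from someI_ex[OF this] show "terms (tens_cls H G s) \<in> tens_sums H G" "tsum (terms (tens_cls H G s)) = tsum s"
    using assms tens_eq_iff by (auto simp: tens_cls_def)
qed

text \<open>Equal images make the two predicates under \<open>SOME\<close> the same predicate, so
  the same representative is chosen.\<close>

lemma tens_cls_cong:
  assumes "s \<in> tens_sums H G" "t \<in> tens_sums H G" "tsum s = tsum t"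
  shows "tens_cls H G s = tens_cls H G t"
proof -
  have "(\<lambda>r. r \<in> tens_sums H G \<and> tens_eq H G r s) = (\<lambda>r. r \<in> tens_sums H G \<and> tens_eq H G r t)"
    using assms tens_eq_iff by auto
  then show ?thesis by (simp add: tens_cls_def)
qed

definition tmap :: "'e tvec \<Rightarrow> 'e tvec" where
  "tmap = (\<lambda>x\<in>hcar (tensor H G). tsum (terms x))"

lemma tens_cls_hcar [simp]: "s \<in> tens_sums H G \<Longrightarrow> tens_cls H G s \<in> hcar (tensor H G)"
  by (simp add: tensor_simps(3))

lemma tmap_tens_cls [simp]: "s \<in> tens_sums H G \<Longrightarrow> tmap (tens_cls H G s) = tsum s"
  by (simp add: tmap_def tens_cls)

lemma terms_tensor [simp]: "x \<in> hcar (tensor H G) \<Longrightarrow> terms x \<in> tens_sums H G"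
  using tens_cls(1) by (auto simp: tensor_simps(3))

lemma tmap_eq: "x \<in> hcar (tensor H G) \<Longrightarrow> tmap x = tsum (terms x)"
  by (simp add: tmap_def)

definition comparison :: "'e ccell2" where
  "comparison = \<lparr>csrc = tensor H G, ctgt = K, cmap = tmap\<rparr>"

lemma tmap_iso:
  assumes surj: "\<And>\<kappa>. \<kappa> \<in> hcar K \<Longrightarrow> \<exists>s\<in>tens_sums H G. tsum s = \<kappa>"
  shows "corr_iso (tensor H G) K tmap"
  unfolding corr_iso_def
proof (intro conjI ballI allI)
  show "bij_betw tmap (hcar (tensor H G)) (hcar K)"
    unfolding bij_betw_def
  proof
    show "inj_on tmap (hcar (tensor H G))"
      by (auto simp: inj_on_def tensor_simps(3) intro: tens_cls_cong)
    show "tmap ` hcar (tensor H G) = hcar K"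
      using surj by (force simp: tensor_simps(3) image_image)
  qed
  show "lalg (tensor H G) = lalg K" "ralg (tensor H G) = ralg K" by (simp_all add: tensor_simps)
  show "hzero (tensor H G) \<in> hcar (tensor H G)" "tmap (hzero (tensor H G)) = hzero K"
    by (simp_all add: tensor_simps)
next
  fix x y assume "x \<in> hcar (tensor H G)" "y \<in> hcar (tensor H G)"
  then show "hadd (tensor H G) x y \<in> hcar (tensor H G)" "tmap (hadd (tensor H G) x y) = hadd K (tmap x) (tmap y)"
    "hip (tensor H G) x y = hip K (tmap x) (tmap y)"
    by (simp_all add: tmap_eq tens_cls tensor_simps tens_ip)
next
  fix x c assume "x \<in> hcar (tensor H G)"
  then show "hscl (tensor H G) c x \<in> hcar (tensor H G)" "tmap (hscl (tensor H G) c x) = hscl K c (tmap x)"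
    by (simp_all add: tmap_eq tens_cls tensor_simps)
next
  fix x a assume "x \<in> hcar (tensor H G)" "a \<in> acar (lalg K)"
  then show "lact (tensor H G) a x \<in> hcar (tensor H G)" "tmap (lact (tensor H G) a x) = lact K a (tmap x)"
    using lact_sums[of "terms x" a] by (simp_all add: tmap_eq tens_cls tensor_simps)
next
  fix x a assume "x \<in> hcar (tensor H G)" "a \<in> acar (ralg K)"
  then show "ract (tensor H G) x a \<in> hcar (tensor H G)" "tmap (ract (tensor H G) x a) = ract K (tmap x) a"
    using ract_sums[of "terms x" a] by (simp_all add: tmap_eq tens_cls tensor_simps)
qed

end

section \<open>Compatibility of \<open>\<Psi>\<close> with composition\<close>

lemma (in conn) rcorr_H: "rcorr H"
  by unfold_locales (rule H_right_correspondence)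

lemma (in conn) hadd_lsum:
  assumes "set vs \<subseteq> lev TH k"
  shows "lsum (hadd H) (hzero H) (map (\<lambda>v. Elem (germ TH k v)) vs) =
     Elem (germ TH k (lsum (pls (N k)) (zer (N k) (Y k) (fob (F k) (X k))) vs))"
  using assms
proof (induction vs)
  case (Cons v vs)
  then have "lsum (pls (N k)) (zer (N k) (Y k) (fob (F k) (X k))) vs \<in> lev TH k"
    using C.K.lsum_hom[of "Y k" k "fob (F k) (X k)" vs] by simp
  then show ?case using Cons by simp
qed (simp add: hzero_germ[of k])

text \<open>A map on pairs of vectors rather than on the tensor product, so that its laws can be
  checked on simple tensors by formulas at one level.\<close>

definition bal :: "(('o, 'm) cat \<Rightarrow> 'o) \<Rightarrow> ('o, 'm) ucell1 \<Rightarrow> ('o, 'm) ucell1 \<Rightarrow>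
    (nat \<times> 'm) set tvec \<Rightarrow> (nat \<times> 'm) set tvec \<Rightarrow> (nat \<times> 'm) set tvec" where
  "bal b \<Lambda> \<Omega> \<xi> \<zeta> = Elem (lim2 (corr_tower b \<Lambda>) (corr_tower b \<Omega>) (corr_tower b (uc_comp \<Omega> \<Lambda>))
     (\<lambda>k u v. cmp (cats (ucod \<Omega>) k) (fmp (ufun \<Omega> k) u) v) (elem \<xi>) (elem \<zeta>))"

locale composable = L: conn b \<Gamma> \<Delta> \<Lambda> + O: conn b \<Delta> \<Sigma> \<Omega> for b \<Gamma> \<Delta> \<Sigma> \<Lambda> \<Omega>

sublocale composable \<subseteq> C: conn b \<Gamma> \<Sigma> "uc_comp \<Omega> \<Lambda>"
  by (rule conn_comp) unfold_locales

context composable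
begin

lemma ufun_comp [simp]: "ufun (uc_comp \<Omega> \<Lambda>) k = fcomp (cats \<Gamma> k) (ufun \<Omega> k) (ufun \<Lambda> k)"
  by (simp add: uc_comp_def)

lemma ucon_comp [simp]: "a \<in> obj (cats \<Gamma> k) \<Longrightarrow> ucon (uc_comp \<Omega> \<Lambda>) k a =
    cmp (cats \<Sigma> (Suc k)) (fmp (ufun \<Omega> (Suc k)) (ucon \<Lambda> k a)) (ucon \<Omega> k (fob (ufun \<Lambda> k) a))"
  by (simp add: uc_comp_def)

text \<open>Compatibility with the inclusions is naturality of the unitary of \<Omega> at
  \<open>u\<close>, a morphism of the middle category: that unitary is moved past the image of
  \<open>u\<close> and meets \<open>v\<close>.\<close>

lemma bal_germ [simp]:
  assumes "u \<in> lev L.TH k" "v \<in> lev O.TH k"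
  shows "bal b \<Lambda> \<Omega> (Elem (germ L.TH k u)) (Elem (germ O.TH k v)) =
    Elem (germ C.TH k (cmp (cats \<Sigma> k) (fmp (ufun \<Omega> k) u) v))"
proof -
  have "lim2 L.TH O.TH C.TH (\<lambda>k u v. cmp (cats \<Sigma> k) (fmp (ufun \<Omega> k) u) v) (germ L.TH k u) (germ O.TH k v) =
      germ C.TH k (cmp (cats \<Sigma> k) (fmp (ufun \<Omega> k) u) v)"
    by (rule lim2_germ[OF L.tower_TH O.tower_TH C.tower_TH _ assms]) auto
  then show ?thesis by (simp add: bal_def)
qed

lemma bal_cases2:
  assumes "\<xi> \<in> hcar L.H" "\<zeta> \<in> hcar O.H"
  obtains k u v where "u \<in> lev L.TH k" "\<xi> = Elem (germ L.TH k u)" "v \<in> lev O.TH k" "\<zeta> = Elem (germ O.TH k v)"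
  using eventually_happens[OF eventually_conj[OF L.hcar_eventually[OF assms(1)] O.hcar_eventually[OF assms(2)]]]
  by auto

text \<open>The inner products match because \<open>ufun \<Omega> k\<close> respects composition and
  adjoints: it maps the inner product of two vectors of \<Lambda> to the middle factor that remains
  between the vectors of \<Omega>.\<close>

lemma balanced: "balanced L.H O.H C.H (bal b \<Lambda> \<Omega>)"
proof (intro balanced.intro balanced_axioms.intro L.rcorr_H O.rcorr_H C.rcorr_H)
  fix \<xi> \<zeta> assume "\<xi> \<in> hcar L.H" "\<zeta> \<in> hcar O.H"
  then obtain k u v where *: "u \<in> lev L.TH k" "\<xi> = Elem (germ L.TH k u)" "v \<in> lev O.TH k" "\<zeta> = Elem (germ O.TH k v)"
    by (rule bal_cases2)
  show "bal b \<Lambda> \<Omega> \<xi> \<zeta> \<in> hcar C.H" "bal b \<Lambda> \<Omega> (hscl L.H z \<xi>) \<zeta> = hscl C.H z (bal b \<Lambda> \<Omega> \<xi> \<zeta>)" for z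
    using * by simp_all
next
  fix \<xi> \<zeta> a assume "\<xi> \<in> hcar L.H" "\<zeta> \<in> hcar O.H" "a \<in> acar (lalg L.H)"
  then have "\<forall>\<^sub>F k in sequentially. (\<exists>v\<in>lev L.TH k. \<xi> = Elem (germ L.TH k v)) \<and>
      (\<exists>v\<in>lev O.TH k. \<zeta> = Elem (germ O.TH k v)) \<and> (\<exists>v\<in>lev L.D.TA k. a = germ L.D.TA k v)"
    by (intro eventually_conj L.hcar_eventually O.hcar_eventually L.D.TA.lim_eventually) auto
  from eventually_happens[OF this] show "bal b \<Lambda> \<Omega> (lact L.H a \<xi>) \<zeta> = lact C.H a (bal b \<Lambda> \<Omega> \<xi> \<zeta>)"
    by auto
next
  fix \<xi> \<zeta> c assume "\<xi> \<in> hcar L.H" "\<zeta> \<in> hcar O.H" "c \<in> acar (ralg O.H)"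
  then have "\<forall>\<^sub>F k in sequentially. (\<exists>v\<in>lev L.TH k. \<xi> = Elem (germ L.TH k v)) \<and>
      (\<exists>v\<in>lev O.TH k. \<zeta> = Elem (germ O.TH k v)) \<and> (\<exists>v\<in>lev O.C.TA k. c = germ O.C.TA k v)"
    by (intro eventually_conj L.hcar_eventually O.hcar_eventually O.C.TA.lim_eventually) auto
  from eventually_happens[OF this] show "bal b \<Lambda> \<Omega> \<xi> (ract O.H \<zeta> c) = ract C.H (bal b \<Lambda> \<Omega> \<xi> \<zeta>) c"
    by auto
next
  fix \<xi> \<zeta> \<xi>' \<zeta>' assume "\<xi> \<in> hcar L.H" "\<zeta> \<in> hcar O.H" "\<xi>' \<in> hcar L.H" "\<zeta>' \<in> hcar O.H"
  then have "\<forall>\<^sub>F k in sequentially. (\<exists>v\<in>lev L.TH k. \<xi> = Elem (germ L.TH k v)) \<and>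
      (\<exists>v\<in>lev O.TH k. \<zeta> = Elem (germ O.TH k v)) \<and> (\<exists>v\<in>lev L.TH k. \<xi>' = Elem (germ L.TH k v)) \<and>
      (\<exists>v\<in>lev O.TH k. \<zeta>' = Elem (germ O.TH k v))"
    by (intro eventually_conj L.hcar_eventually O.hcar_eventually) auto
  from eventually_happens[OF this]
  show "hip C.H (bal b \<Lambda> \<Omega> \<xi> \<zeta>) (bal b \<Lambda> \<Omega> \<xi>' \<zeta>') = hip O.H (lact O.H (hip L.H \<xi> \<xi>') \<zeta>) \<zeta>'"
    by auto
qed simp_all

text \<open>\<open>balanced\<close> does not record additivity in the second variable. It is used
  for associativity, where the second factor is itself a sum of simple tensors.\<close>

lemma bal_hadd_right:
  assumes "\<xi> \<in> hcar L.H" "\<zeta> \<in> hcar O.H" "\<zeta>' \<in> hcar O.H"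
  shows "bal b \<Lambda> \<Omega> \<xi> (hadd O.H \<zeta> \<zeta>') = hadd C.H (bal b \<Lambda> \<Omega> \<xi> \<zeta>) (bal b \<Lambda> \<Omega> \<xi> \<zeta>')"
proof -
  have "\<forall>\<^sub>F k in sequentially. (\<exists>v\<in>lev L.TH k. \<xi> = Elem (germ L.TH k v)) \<and>
      (\<exists>v\<in>lev O.TH k. \<zeta> = Elem (germ O.TH k v)) \<and> (\<exists>v\<in>lev O.TH k. \<zeta>' = Elem (germ O.TH k v))"
    using assms by (intro eventually_conj L.hcar_eventually O.hcar_eventually) auto
  from eventually_happens[OF this] show ?thesis by (auto simp: O.C.K.cmp_pls)
qed

lemma bal_hzero_right:
  assumes "\<xi> \<in> hcar L.H"
  shows "bal b \<Lambda> \<Omega> \<xi> (hzero O.H) = hzero C.H"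
proof -
  obtain k v where "v \<in> lev L.TH k" "\<xi> = Elem (germ L.TH k v)" using assms by (rule L.hcar_cases)
  then show ?thesis by (simp add: O.hzero_germ[of k] C.hzero_germ[of k])
qed

end

sublocale composable \<subseteq> B: balanced "Psi1 b \<Lambda>" "Psi1 b \<Omega>" "Psi1 b (uc_comp \<Omega> \<Lambda>)" "bal b \<Lambda> \<Omega>"
  by (rule balanced)

context composable
begin

lemma bal_surj:
  assumes "\<kappa> \<in> hcar C.H"
  shows "\<exists>s\<in>tens_sums L.H O.H. B.tsum s = \<kappa>"
proof -
  obtain k t where t: "t \<in> lev C.TH k" "\<kappa> = Elem (germ C.TH k t)"
    using assms by (rule C.hcar_cases)
  have t': "t \<in> arr (cats \<Sigma> k)" "src (cats \<Sigma> k) t = O.Y k" "tgt (cats \<Sigma> k) t = fob (ufun \<Omega> k) (fob (ufun \<Lambda> k) (L.X k))"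
    using t by auto
  obtain ps where ps: "L.C.K.resolves k (L.Y k) (fob (ufun \<Lambda> k) (L.X k)) ps"
    using L.C.K.generates_resolves[OF L.C.xob_generates, of "fob (ufun \<Lambda> k) (L.X k)" k] by auto
  let ?D = "cats \<Delta> k" and ?S = "cats \<Sigma> k" and ?a = "fob (ufun \<Lambda> k) (L.X k)"
  have psD: "fst p \<in> lev L.TH k \<and> snd p \<in> lev L.TH k" if "p \<in> set ps" for p
    using ps that unfolding L.C.K.resolves_def by (cases p) auto
  define f where "f = (\<lambda>p. cmp ?D (fst p) (adj ?D (snd p)))"
  have f_hom: "set (map f ps) \<subseteq> hom ?D ?a ?a" using psD by (auto simp: f_def)
  have sum: "lsum (pls ?D) (zer ?D ?a ?a) (map f ps) = idn ?D ?a"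
    using ps by (simp add: L.C.K.resolves_def f_def case_prod_unfold)
  \<comment> \<open>As the second member of a pair in \<open>ps\<close> starts at
    \<open>L.Y k\<close>, the image of its adjoint takes \<open>t\<close> to a vector in the tower
    of \<Omega>.\<close>
  define s where "s = map (\<lambda>p. (Elem (germ L.TH k (fst p)),
      Elem (germ O.TH k (cmp ?S (fmp (ufun \<Omega> k) (adj ?D (snd p))) t)))) ps"
  have s: "s \<in> tens_sums L.H O.H"
    using psD t' by (auto simp: s_def tens_sums_def intro!: L.germ_hcar O.germ_hcar)
  have "B.tsum s = lsum (hadd C.H) (hzero C.H) (map (\<lambda>v. Elem (germ C.TH k v)) (map (\<lambda>p. cmp ?S (fmp (ufun \<Omega> k) (f p)) t) ps))"
    unfolding B.tsum_def s_def using psD t' 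
    by (auto simp: f_def intro!: arg_cong[of _ _ "lsum _ _"])
  also have "\<dots> = Elem (germ C.TH k (lsum (pls ?S) (zer ?S (O.Y k) (fob (ufun \<Omega> k) ?a)) (map (\<lambda>p. cmp ?S (fmp (ufun \<Omega> k) (f p)) t) ps)))"
  proof -
    have "set (map (\<lambda>p. cmp ?S (fmp (ufun \<Omega> k) (f p)) t) ps) \<subseteq> lev C.TH k"
      using f_hom t' by (auto simp: image_subset_iff)
    from C.hadd_lsum[OF this] show ?thesis by simp
  qed
  also have "lsum (pls ?S) (zer ?S (O.Y k) (fob (ufun \<Omega> k) ?a)) (map (\<lambda>p. cmp ?S (fmp (ufun \<Omega> k) (f p)) t) ps) =
     cmp ?S (fmp (ufun \<Omega> k) (lsum (pls ?D) (zer ?D ?a ?a) (map f ps))) t"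
    using f_hom t' O.L.fmp_lsum[OF _ _ f_hom]
      O.C.K.lsum_cmp[of "fob (ufun \<Omega> k) ?a" k "map (fmp (ufun \<Omega> k)) (map f ps)" "fob (ufun \<Omega> k) ?a" t]
    by (auto simp: comp_def image_subset_iff)
  also have "\<dots> = t" using t' by (simp add: sum)
  finally show ?thesis using s t by blast
qed

lemmas tmap_corr_iso = B.tmap_iso[OF bal_surj]

lemma comparison_unitary: "B.comparison \<in> Unitary2 CORR (tensor L.H O.H) C.H"
proof -
  interpret I: corr_isomorphism C.H "tensor L.H O.H" B.tmap
    by unfold_locales (rule tmap_corr_iso)
  show ?thesis unfolding B.comparison_def by (rule I.unitary) (simp add: B.tmap_def)
qed

end

text \<open>The exchange square of the composite is pasted from those of \<open>h\<close> and
  \<open>g\<close> and from naturality of \<open>g\<close> at the unitaries of \<Lambda>1. The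
  second part is naturality of the comparison map on simple tensors.\<close>

lemma horiz_seq:
  assumes "conn b \<Gamma> \<Delta> \<Lambda>1" "conn b \<Gamma> \<Delta> \<Lambda>2" "conn b \<Delta> \<Sigma> \<Omega>1" "conn b \<Delta> \<Sigma> \<Omega>2"
    and h: "h \<in> uc_seqs \<Lambda>1 \<Lambda>2" and g: "g \<in> uc_seqs \<Omega>1 \<Omega>2"
  shows "(\<lambda>k. \<lambda>a\<in>obj (cats \<Gamma> k). cmp (cats \<Sigma> k) (fmp (ufun \<Omega>2 k) (h k a)) (g k (fob (ufun \<Lambda>1 k) a)))
      \<in> uc_seqs (uc_comp \<Omega>1 \<Lambda>1) (uc_comp \<Omega>2 \<Lambda>2)" (is "?gh \<in> _")
    and "\<xi> \<in> hcar (Psi1 b \<Lambda>1) \<Longrightarrow> \<zeta> \<in> hcar (Psi1 b \<Omega>1) \<Longrightarrow>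
      bal b \<Lambda>2 \<Omega>2 (seq_map b \<Lambda>1 \<Lambda>2 h \<xi>) (seq_map b \<Omega>1 \<Omega>2 g \<zeta>) =
      seq_map b (uc_comp \<Omega>1 \<Lambda>1) (uc_comp \<Omega>2 \<Lambda>2)
        (\<lambda>k. \<lambda>a\<in>obj (cats \<Gamma> k). cmp (cats \<Sigma> k) (fmp (ufun \<Omega>2 k) (h k a)) (g k (fob (ufun \<Lambda>1 k) a)))
        (bal b \<Lambda>1 \<Omega>1 \<xi> \<zeta>)"
proof -
  interpret S: composable b \<Gamma> \<Delta> \<Sigma> \<Lambda>1 \<Omega>1 by (intro composable.intro assms)
  interpret T: composable b \<Gamma> \<Delta> \<Sigma> \<Lambda>2 \<Omega>2 by (intro composable.intro assms)
  interpret P: parallel b \<Gamma> \<Delta> \<Lambda>1 \<Lambda>2 by (intro parallel.intro assms)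
  interpret Q: parallel b \<Delta> \<Sigma> \<Omega>1 \<Omega>2 by (intro parallel.intro assms)
  interpret R: parallel b \<Gamma> \<Sigma> "uc_comp \<Omega>1 \<Lambda>1" "uc_comp \<Omega>2 \<Lambda>2" by unfold_locales
  note [simp] = P.seqD(1-3)[OF h] Q.seqD(1-3)[OF g]
  show gh: "?gh \<in> uc_seqs (uc_comp \<Omega>1 \<Lambda>1) (uc_comp \<Omega>2 \<Lambda>2)"
  proof (rule R.seqI)
    fix k f assume f: "f \<in> arr (cats \<Gamma> k)"
    let ?C = "cats \<Sigma> k" and ?a = "src (cats \<Gamma> k) f" and ?b = "tgt (cats \<Gamma> k) f"
    have 1: "fmp (ufun \<Omega>2 k) (cmp (cats \<Delta> k) (h k ?b) (fmp (ufun \<Lambda>1 k) f)) =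
        fmp (ufun \<Omega>2 k) (cmp (cats \<Delta> k) (fmp (ufun \<Lambda>2 k) f) (h k ?a))"
      using f P.seqD(4)[OF h, of f k] by simp
    have 2: "cmp ?C (fmp (ufun \<Omega>2 k) (h k ?b)) (fmp (ufun \<Omega>2 k) (fmp (ufun \<Lambda>1 k) f)) =
        cmp ?C (fmp (ufun \<Omega>2 k) (fmp (ufun \<Lambda>2 k) f)) (fmp (ufun \<Omega>2 k) (h k ?a))"
      using 1 f by simp
    have "cmp ?C (?gh k ?b) (fmp (ufun (uc_comp \<Omega>1 \<Lambda>1) k) f) =
        cmp ?C (fmp (ufun \<Omega>2 k) (h k ?b)) (cmp ?C (g k (fob (ufun \<Lambda>1 k) ?b)) (fmp (ufun \<Omega>1 k) (fmp (ufun \<Lambda>1 k) f)))"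
      using f by simp
    also have "\<dots> = cmp ?C (cmp ?C (fmp (ufun \<Omega>2 k) (h k ?b)) (fmp (ufun \<Omega>2 k) (fmp (ufun \<Lambda>1 k) f))) (g k (fob (ufun \<Lambda>1 k) ?a))"
      using f Q.seqD(4)[OF g, of "fmp (ufun \<Lambda>1 k) f" k] by simp
    also have "\<dots> = cmp ?C (fmp (ufun (uc_comp \<Omega>2 \<Lambda>2) k) f) (?gh k ?a)"
      unfolding 2 using f by simp
    finally show "cmp ?C (?gh k ?b) (fmp (ufun (uc_comp \<Omega>1 \<Lambda>1) k) f) =
         cmp ?C (fmp (ufun (uc_comp \<Omega>2 \<Lambda>2) k) f) (?gh k ?a)" .
  next
    show "\<forall>\<^sub>F k in sequentially. exchange (uc_comp \<Omega>1 \<Lambda>1) (uc_comp \<Omega>2 \<Lambda>2) k (?gh k) (?gh (Suc k))"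
      using P.seqD(6)[OF h] Q.seqD(6)[OF g]
    proof eventually_elim
      case (elim k)
      show ?case unfolding R.exchange_iff
      proof
        fix a assume a: "a \<in> obj (cats \<Gamma> k)"
        let ?C = "cats \<Sigma> (Suc k)" and ?D = "cats \<Delta> (Suc k)"
        let ?F = "\<lambda>f. fmp (ufun \<Omega>2 (Suc k)) f"
        have 1: "cmp ?D (ucon \<Lambda>2 k a) (fmp (gam \<Delta> k) (h k a)) = cmp ?D (h (Suc k) (fob (gam \<Gamma> k) a)) (ucon \<Lambda>1 k a)"
          using elim a unfolding P.exchange_iff by auto
        have 2: "cmp ?C (ucon \<Omega>2 k (fob (ufun \<Lambda>1 k) a)) (fmp (gam \<Sigma> k) (g k (fob (ufun \<Lambda>1 k) a))) =
            cmp ?C (g (Suc k) (fob (gam \<Delta> k) (fob (ufun \<Lambda>1 k) a))) (ucon \<Omega>1 k (fob (ufun \<Lambda>1 k) a))"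
          using elim a unfolding Q.exchange_iff by auto
        have 3: "cmp ?C (g (Suc k) (fob (ufun \<Lambda>1 (Suc k)) (fob (gam \<Gamma> k) a))) (fmp (ufun \<Omega>1 (Suc k)) (ucon \<Lambda>1 k a)) =
            cmp ?C (?F (ucon \<Lambda>1 k a)) (g (Suc k) (fob (gam \<Delta> k) (fob (ufun \<Lambda>1 k) a)))"
          using Q.seqD(4)[OF g, of "ucon \<Lambda>1 k a" "Suc k"] a by simp
        have 4: "cmp ?C (?F (ucon \<Lambda>2 k a)) (?F (fmp (gam \<Delta> k) (h k a))) =
            cmp ?C (?F (h (Suc k) (fob (gam \<Gamma> k) a))) (?F (ucon \<Lambda>1 k a))"
          using arg_cong[OF 1, of ?F] a by simp
        have "cmp ?C (ucon (uc_comp \<Omega>2 \<Lambda>2) k a) (fmp (gam \<Sigma> k) (?gh k a)) =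
            cmp ?C (cmp ?C (?F (ucon \<Lambda>2 k a)) (?F (fmp (gam \<Delta> k) (h k a))))
              (cmp ?C (ucon \<Omega>2 k (fob (ufun \<Lambda>1 k) a)) (fmp (gam \<Sigma> k) (g k (fob (ufun \<Lambda>1 k) a))))"
          using a by simp
        also have "\<dots> = cmp ?C (?F (h (Suc k) (fob (gam \<Gamma> k) a))) (cmp ?C (cmp ?C (?F (ucon \<Lambda>1 k a))
            (g (Suc k) (fob (gam \<Delta> k) (fob (ufun \<Lambda>1 k) a)))) (ucon \<Omega>1 k (fob (ufun \<Lambda>1 k) a)))"
          unfolding 2 4 using a by simp
        also have "\<dots> = cmp ?C (?gh (Suc k) (fob (gam \<Gamma> k) a)) (ucon (uc_comp \<Omega>1 \<Lambda>1) k a)"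
          unfolding 3[symmetric] using a by simp
        finally show "cmp ?C (ucon (uc_comp \<Omega>2 \<Lambda>2) k a) (fmp (gam \<Sigma> k) (?gh k a)) =
            cmp ?C (?gh (Suc k) (fob (gam \<Gamma> k) a)) (ucon (uc_comp \<Omega>1 \<Lambda>1) k a)" .
      qed
    qed
  qed auto
  assume xi: "\<xi> \<in> hcar (Psi1 b \<Lambda>1)" and zeta: "\<zeta> \<in> hcar (Psi1 b \<Omega>1)"
  have "\<forall>\<^sub>F k in sequentially. (\<exists>v\<in>lev S.L.TH k. \<xi> = Elem (germ S.L.TH k v)) \<and>
      (\<exists>v\<in>lev S.O.TH k. \<zeta> = Elem (germ S.O.TH k v)) \<and>
      (\<forall>v\<in>lev S.L.TH k. seq_map b \<Lambda>1 \<Lambda>2 h (Elem (germ S.L.TH k v)) =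
         Elem (germ T.L.TH k (cmp (cats \<Delta> k) (h k (S.L.X k)) v))) \<and>
      (\<forall>v\<in>lev S.O.TH k. seq_map b \<Omega>1 \<Omega>2 g (Elem (germ S.O.TH k v)) =
         Elem (germ T.O.TH k (cmp (cats \<Sigma> k) (g k (S.O.X k)) v))) \<and>
      (\<forall>v\<in>lev S.C.TH k. seq_map b (uc_comp \<Omega>1 \<Lambda>1) (uc_comp \<Omega>2 \<Lambda>2) ?gh (Elem (germ S.C.TH k v)) =
         Elem (germ T.C.TH k (cmp (cats \<Sigma> k) (?gh k (S.L.X k)) v)))"
    by (intro eventually_conj S.L.hcar_eventually S.O.hcar_eventually xi zeta
        P.seq_map_germ[OF h] Q.seq_map_germ[OF g] R.seq_map_germ[OF gh])
  from eventually_happens[OF this] obtain k u v where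
    u: "u \<in> lev S.L.TH k" "\<xi> = Elem (germ S.L.TH k u)" and v: "v \<in> lev S.O.TH k" "\<zeta> = Elem (germ S.O.TH k v)"
    and maps: "\<forall>v\<in>lev S.L.TH k. seq_map b \<Lambda>1 \<Lambda>2 h (Elem (germ S.L.TH k v)) =
         Elem (germ T.L.TH k (cmp (cats \<Delta> k) (h k (S.L.X k)) v))"
      "\<forall>v\<in>lev S.O.TH k. seq_map b \<Omega>1 \<Omega>2 g (Elem (germ S.O.TH k v)) =
         Elem (germ T.O.TH k (cmp (cats \<Sigma> k) (g k (S.O.X k)) v))"
      "\<forall>v\<in>lev S.C.TH k. seq_map b (uc_comp \<Omega>1 \<Lambda>1) (uc_comp \<Omega>2 \<Lambda>2) ?gh (Elem (germ S.C.TH k v)) =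
         Elem (germ T.C.TH k (cmp (cats \<Sigma> k) (?gh k (S.L.X k)) v))"
    by auto
  have u': "u \<in> arr (cats \<Delta> k)" "src (cats \<Delta> k) u = S.L.Y k" "tgt (cats \<Delta> k) u = fob (ufun \<Lambda>1 k) (S.L.X k)"
    and v': "v \<in> arr (cats \<Sigma> k)" "src (cats \<Sigma> k) v = S.O.Y k" "tgt (cats \<Sigma> k) v = fob (ufun \<Omega>1 k) (S.L.Y k)"
    using u v by auto
  \<comment> \<open>Naturality of \<open>g\<close> at \<open>u\<close>, a morphism of the middle
    category, lets \<open>g\<close> act on \<open>v\<close> first.\<close>
  have nat: "cmp (cats \<Sigma> k) (g k (fob (ufun \<Lambda>1 k) (S.L.X k))) (cmp (cats \<Sigma> k) (fmp (ufun \<Omega>1 k) u) v) =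
      cmp (cats \<Sigma> k) (fmp (ufun \<Omega>2 k) u) (cmp (cats \<Sigma> k) (g k (S.L.Y k)) v)"
  proof -
    have "cmp (cats \<Sigma> k) (g k (fob (ufun \<Lambda>1 k) (S.L.X k))) (cmp (cats \<Sigma> k) (fmp (ufun \<Omega>1 k) u) v) =
        cmp (cats \<Sigma> k) (cmp (cats \<Sigma> k) (g k (fob (ufun \<Lambda>1 k) (S.L.X k))) (fmp (ufun \<Omega>1 k) u)) v"
      using u' v' by simp
    also have "\<dots> = cmp (cats \<Sigma> k) (fmp (ufun \<Omega>2 k) u) (cmp (cats \<Sigma> k) (g k (S.L.Y k)) v)"
      using u' v' Q.seqD(4)[OF g, of u k] by simp
    finally show ?thesis .
  qed
  have lhs: "bal b \<Lambda>2 \<Omega>2 (seq_map b \<Lambda>1 \<Lambda>2 h \<xi>) (seq_map b \<Omega>1 \<Omega>2 g \<zeta>) =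
     Elem (germ T.C.TH k (cmp (cats \<Sigma> k) (fmp (ufun \<Omega>2 k) (cmp (cats \<Delta> k) (h k (S.L.X k)) u))
       (cmp (cats \<Sigma> k) (g k (S.L.Y k)) v)))"
    unfolding u(2) v(2) maps(1)[rule_format, OF u(1)] maps(2)[rule_format, OF v(1)]
    by (rule T.bal_germ) (use u' v' in simp_all)
  have "cmp (cats \<Sigma> k) (fmp (ufun \<Omega>1 k) u) v \<in> lev S.C.TH k" using u' v' by simp
  then have rhs: "seq_map b (uc_comp \<Omega>1 \<Lambda>1) (uc_comp \<Omega>2 \<Lambda>2) ?gh (bal b \<Lambda>1 \<Omega>1 \<xi> \<zeta>) =
     Elem (germ T.C.TH k (cmp (cats \<Sigma> k) (?gh k (S.L.X k)) (cmp (cats \<Sigma> k) (fmp (ufun \<Omega>1 k) u) v)))"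
    unfolding u(2) v(2) S.bal_germ[OF u(1) v(1)] using maps(3) by blast
  show "bal b \<Lambda>2 \<Omega>2 (seq_map b \<Lambda>1 \<Lambda>2 h \<xi>) (seq_map b \<Omega>1 \<Omega>2 g \<zeta>) =
      seq_map b (uc_comp \<Omega>1 \<Lambda>1) (uc_comp \<Omega>2 \<Lambda>2) ?gh (bal b \<Lambda>1 \<Omega>1 \<xi> \<zeta>)"
    unfolding lhs rhs using u' v' nat by simp
qed

section \<open>Strict associativity and unit laws of 1-cells, and the comparison maps at these
  places\<close>

lemma fcomp_assoc:
  assumes "starfun M N F"
  shows "fcomp M (fcomp N H G) F = fcomp M H (fcomp M G F)"
proof -
  interpret starfun M N F by fact
  show ?thesis by (auto simp: fcomp_def compose_def)
qed

text \<open>By functoriality of \<Theta> both connection unitaries are the same product of three.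
  Extensionality turns pointwise agreement of functors and transformations into equality of
  records.\<close>

lemma uc_comp_assoc:
  assumes "conn b \<Gamma> \<Delta> \<Lambda>" "conn b \<Delta> \<Sigma> \<Omega>" "conn b \<Sigma> \<Xi> \<Theta>"
  shows "uc_comp (uc_comp \<Theta> \<Omega>) \<Lambda> = uc_comp \<Theta> (uc_comp \<Omega> \<Lambda>)"
proof -
  interpret S: composable b \<Gamma> \<Delta> \<Sigma> \<Lambda> \<Omega> by (intro composable.intro assms)
  interpret T: composable b \<Delta> \<Sigma> \<Xi> \<Omega> \<Theta> by (intro composable.intro assms)
  have "ufun (uc_comp (uc_comp \<Theta> \<Omega>) \<Lambda>) = ufun (uc_comp \<Theta> (uc_comp \<Omega> \<Lambda>))"
    using fcomp_assoc[OF S.L.L.starfun_axioms] by (simp add: uc_comp_def)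
  moreover have "ucon (uc_comp (uc_comp \<Theta> \<Omega>) \<Lambda>) = ucon (uc_comp \<Theta> (uc_comp \<Omega> \<Lambda>))"
    by (intro ext) (auto simp: uc_comp_def restrict_def)
  ultimately show ?thesis by (simp add: uc_comp_def)
qed

text \<open>At a common level both sides are the composite \<Theta>(\<Omega>(u)) \<Theta>(v)
  w.\<close>

lemma bal_assoc:
  assumes "conn b \<Gamma> \<Delta> \<Lambda>" "conn b \<Delta> \<Sigma> \<Omega>" "conn b \<Sigma> \<Xi> \<Theta>"
    and "\<xi> \<in> hcar (Psi1 b \<Lambda>)" "\<zeta> \<in> hcar (Psi1 b \<Omega>)" "\<kappa> \<in> hcar (Psi1 b \<Theta>)"
  shows "bal b (uc_comp \<Omega> \<Lambda>) \<Theta> (bal b \<Lambda> \<Omega> \<xi> \<zeta>) \<kappa> = bal b \<Lambda> (uc_comp \<Theta> \<Omega>) \<xi> (bal b \<Omega> \<Theta> \<zeta> \<kappa>)"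
proof -
  interpret S: composable b \<Gamma> \<Delta> \<Sigma> \<Lambda> \<Omega> by (intro composable.intro assms)
  interpret T: composable b \<Delta> \<Sigma> \<Xi> \<Omega> \<Theta> by (intro composable.intro assms)
  interpret S': composable b \<Gamma> \<Sigma> \<Xi> "uc_comp \<Omega> \<Lambda>" \<Theta>
    by (intro composable.intro assms S.C.conn_axioms)
  interpret T': composable b \<Gamma> \<Delta> \<Xi> \<Lambda> "uc_comp \<Theta> \<Omega>"
    by (intro composable.intro assms T.C.conn_axioms)
  have "\<forall>\<^sub>F k in sequentially. (\<exists>v\<in>lev S.L.TH k. \<xi> = Elem (germ S.L.TH k v)) \<and>
      (\<exists>v\<in>lev S.O.TH k. \<zeta> = Elem (germ S.O.TH k v)) \<and> (\<exists>v\<in>lev T.O.TH k. \<kappa> = Elem (germ T.O.TH k v))"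
    using assms(4-6) by (intro eventually_conj S.L.hcar_eventually S.O.hcar_eventually T.O.hcar_eventually)
  from eventually_happens[OF this] obtain k u v w where
    u: "u \<in> lev S.L.TH k" "\<xi> = Elem (germ S.L.TH k u)" and v: "v \<in> lev S.O.TH k" "\<zeta> = Elem (germ S.O.TH k v)"
    and w: "w \<in> lev T.O.TH k" "\<kappa> = Elem (germ T.O.TH k w)" by auto
  have "cmp (cats \<Sigma> k) (fmp (ufun \<Omega> k) u) v \<in> lev S.C.TH k"
    "cmp (cats \<Xi> k) (fmp (ufun \<Theta> k) v) w \<in> lev T.C.TH k" using u(1) v(1) w(1) by auto
  from S'.bal_germ[OF this(1) w(1)] T'.bal_germ[OF u(1) this(2)]
  show ?thesis
    unfolding u(2) v(2) w(2) S.bal_germ[OF u(1) v(1)] T.bal_germ[OF v(1) w(1)]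
    using u(1) v(1) w(1) by (simp add: uc_comp_assoc[OF assms(1-3)])
qed

text \<open>Made for the algebra tower and the tower of the identity 1-cell. The inclusions of the
  latter also compose with an identity, so agreement of the two can be claimed on the levels
  only.\<close>

lemma germ_tower_cong:
  assumes S: "tower S" and "\<And>k. lev S k = lev T k" "\<And>k v. v \<in> lev S k \<Longrightarrow> inc S k v = inc T k v"
    and v: "v \<in> lev S k"
  shows "germ S k v = germ T k v"
proof -
  interpret tower S by fact
  have eq: "push S k j v = push T k j v" if "v \<in> lev S k" for k j v
  proof (induction j)
    case (Suc j)
    then show ?case using assms(3)[OF push_lev[OF that, of j]] by simp
  qed simp
  have "(l, w) \<in> germ S k v \<longleftrightarrow> (l, w) \<in> germ T k v" for l w
    by (cases "w \<in> lev S l") (simp_all add: germ_def eq v flip: assms(2))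
  then show ?thesis by auto
qed

lemma ucell1_eqI:
  fixes \<Lambda> \<Omega> :: "('o, 'm) ucell1"
  assumes "udom \<Lambda> = udom \<Omega>" "ucod \<Lambda> = ucod \<Omega>" "\<And>k. fob (ufun \<Lambda> k) = fob (ufun \<Omega> k)"
    "\<And>k. fmp (ufun \<Lambda> k) = fmp (ufun \<Omega> k)" "\<And>k. ucon \<Lambda> k = ucon \<Omega> k"
  shows "\<Lambda> = \<Omega>"
proof -
  have "ufun \<Lambda> = ufun \<Omega>" using assms by (intro ext functr.equality) auto
  moreover have "ucon \<Lambda> = ucon \<Omega>" using assms by blast
  ultimately show ?thesis using assms by (intro ucell1.equality) auto
qed

context conn
begin

lemma fun_ext: "fob (F k) \<in> extensional (obj (M k))" "fmp (F k) \<in> extensional (arr (M k))"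
  using L.fob_extensional L.fmp_extensional by (auto simp: PiE_def)

lemma uc_comp_id_left: "uc_comp (uc_id1 \<Delta>) \<Lambda> = \<Lambda>"
proof (rule ucell1_eqI)
  fix k
  show "fob (ufun (uc_comp (uc_id1 \<Delta>) \<Lambda>) k) = fob (F k)"
    by (rule extensionalityI[of _ "obj (M k)"]) (auto simp: uc_comp_def uc_id1_def fun_ext fcomp_def compose_def fid_def)
  show "fmp (ufun (uc_comp (uc_id1 \<Delta>) \<Lambda>) k) = fmp (F k)"
    by (rule extensionalityI[of _ "arr (M k)"]) (auto simp: uc_comp_def uc_id1_def fun_ext fcomp_def compose_def fid_def)
  show "ucon (uc_comp (uc_id1 \<Delta>) \<Lambda>) k = W k"
    by (rule extensionalityI[of _ "obj (M k)"]) (auto simp: uc_comp_def uc_id1_def ucon_extensional)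
qed (simp_all add: uc_comp_def uc_id1_def)

lemma uc_comp_id_right: "uc_comp \<Lambda> (uc_id1 \<Gamma>) = \<Lambda>"
proof (rule ucell1_eqI)
  fix k
  show "fob (ufun (uc_comp \<Lambda> (uc_id1 \<Gamma>)) k) = fob (F k)"
    by (rule extensionalityI[of _ "obj (M k)"]) (auto simp: uc_comp_def uc_id1_def fun_ext fcomp_def compose_def fid_def)
  show "fmp (ufun (uc_comp \<Lambda> (uc_id1 \<Gamma>)) k) = fmp (F k)"
    by (rule extensionalityI[of _ "arr (M k)"]) (auto simp: uc_comp_def uc_id1_def fun_ext fcomp_def compose_def fid_def)
  show "ucon (uc_comp \<Lambda> (uc_id1 \<Gamma>)) k = W k"
    by (rule extensionalityI[of _ "obj (M k)"]) (auto simp: uc_comp_def uc_id1_def ucon_extensional)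
qed (simp_all add: uc_comp_def uc_id1_def)

end

lemma ufun_id1 [simp]: "ufun (uc_id1 \<Gamma>) k = fid (cats \<Gamma> k)"
  and ucon_id1 [simp]: "a \<in> obj (cats \<Gamma> k) \<Longrightarrow> ucon (uc_id1 \<Gamma>) k a = idn (cats \<Gamma> (Suc k)) (fob (gam \<Gamma> k) a)"
  by (simp_all add: uc_id1_def)

text \<open>The unit comparison is the identity on vectors, since level k of both sides is the
  endomorphism algebra of \<open>xob b \<Gamma> k\<close>.\<close>

definition unit_cell :: "(('o, 'm) cat \<Rightarrow> 'o) \<Rightarrow> ('o, 'm) ucell0 \<Rightarrow> (nat \<times> 'm) set ccell2" where
  "unit_cell b \<Gamma> = \<lparr>csrc = corr_id1 (Psi0 b \<Gamma>), ctgt = Psi1 b (uc_id1 \<Gamma>),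
     cmap = (\<lambda>x\<in>hcar (corr_id1 (Psi0 b \<Gamma>)). x)\<rparr>"

lemma corr_id1_simps:
  "lalg (corr_id1 A) = A" "ralg (corr_id1 A) = A" "hcar (corr_id1 A) = Elem ` acar A"
  "hadd (corr_id1 A) x y = Elem (aadd A (elem x) (elem y))" "hzero (corr_id1 A) = Elem (azero A)"
  "hscl (corr_id1 A) z x = Elem (ascl A z (elem x))" "lact (corr_id1 A) a x = Elem (amul A a (elem x))"
  "ract (corr_id1 A) x c = Elem (amul A (elem x) c)" "hip (corr_id1 A) x y = amul A (astar A (elem y)) (elem x)"
  by (simp_all add: corr_id1_def)

context zcell
begin

lemma id_germ:
  assumes "v \<in> lev TA k"
  shows "germ (corr_tower b (uc_id1 \<Gamma>)) k v = germ TA k v"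
proof (rule germ_tower_cong[OF tower_TA _ _ assms, symmetric])
  interpret I: conn b \<Gamma> \<Gamma> "uc_id1 \<Gamma>" by (rule conn_id) unfold_locales
  show "lev TA k = lev I.TH k" for k by simp
  show "inc TA k v = inc I.TH k v" if "v \<in> lev TA k" for k v
    using that by simp
qed

lemma id_hcar: "hcar (corr_id1 A) = hcar (Psi1 b (uc_id1 \<Gamma>))"
proof -
  interpret I: conn b \<Gamma> \<Gamma> "uc_id1 \<Gamma>" by (rule conn_id) unfold_locales
  have "lev I.TH k = lev TA k" for k by simp
  then have "lim_set I.TH = lim_set TA"
    unfolding lim_set_def using id_germ by (auto simp del: I.lev_TH lev_TA) (metis+)
  then show ?thesis by (simp add: corr_id1_simps I.hcar_H)
qed

text \<open>The carriers coincide and the operations agree on germs, where both come from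
  \<open>cats \<Gamma> k\<close>. Off the carrier they may differ, so an isomorphism is claimed and
  not an equality.\<close>

lemma id_corr_iso: "corr_iso (corr_id1 A) (Psi1 b (uc_id1 \<Gamma>)) (\<lambda>x\<in>hcar (corr_id1 A). x)"
proof -
  interpret I: conn b \<Gamma> \<Gamma> "uc_id1 \<Gamma>" by (rule conn_id) unfold_locales
  have lev: "lev I.TH k = lev TA k" for k by simp
  have F: "fmp (ufun (uc_id1 \<Gamma>) k) f = f" if "f \<in> lev TA k" for f k using that by simp
  have cases2: "\<exists>k u v. u \<in> lev TA k \<and> x = Elem (germ TA k u) \<and> v \<in> lev TA k \<and> y = Elem (germ TA k v)"
    if "x \<in> hcar (corr_id1 A)" "y \<in> hcar (corr_id1 A)" for x y
  proof -
    obtain a c where "a \<in> lim_set TA" "x = Elem a" "c \<in> lim_set TA" "y = Elem c"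
      using \<open>x \<in> _\<close> \<open>y \<in> _\<close> unfolding corr_id1_simps acar_A by blast
    then show ?thesis using A_cases2[of a c] by metis
  qed
  have zero: "hzero I.H = Elem (azero A)"
    using I.hzero_germ[of 0] id_germ[of "zer (cats \<Gamma> 0) (X 0) (X 0)" 0]
    by (simp add: azero_germ[of 0])
  have mem [simp]: "Elem (germ TA k f) \<in> hcar (corr_id1 A)" if "f \<in> lev TA k" for k f
    using that unfolding corr_id1_simps acar_A by (intro imageI TA.germ_lim)
  have ops: "hadd I.H (Elem (germ TA k u)) (Elem (germ TA k v)) = Elem (germ TA k (pls (cats \<Gamma> k) u v))"
    "hscl I.H c (Elem (germ TA k u)) = Elem (germ TA k (scl (cats \<Gamma> k) c u))"
    "lact I.H (germ TA k v) (Elem (germ TA k u)) = Elem (germ TA k (cmp (cats \<Gamma> k) v u))"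
    "ract I.H (Elem (germ TA k u)) (germ TA k v) = Elem (germ TA k (cmp (cats \<Gamma> k) u v))"
    "hip I.H (Elem (germ TA k u)) (Elem (germ TA k v)) = germ TA k (cmp (cats \<Gamma> k) (adj (cats \<Gamma> k) v) u)"
    if "u \<in> lev TA k" "v \<in> lev TA k" for u v k c
  proof -
    have uv: "u \<in> lev I.TH k" "v \<in> lev I.TH k" using that by simp_all
    note g = id_germ[of _ k]
    have *: "pls (cats \<Gamma> k) u v \<in> lev TA k" "scl (cats \<Gamma> k) c u \<in> lev TA k" "cmp (cats \<Gamma> k) v u \<in> lev TA k"
      "cmp (cats \<Gamma> k) u v \<in> lev TA k" using that by simp_all
    show "hadd I.H (Elem (germ TA k u)) (Elem (germ TA k v)) = Elem (germ TA k (pls (cats \<Gamma> k) u v))"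
      using I.hadd_germ[OF uv] unfolding g[OF that(1)] g[OF that(2)] g[OF *(1)] .
    show "hscl I.H c (Elem (germ TA k u)) = Elem (germ TA k (scl (cats \<Gamma> k) c u))"
      using I.hscl_germ[OF uv(1), of c] unfolding g[OF that(1)] g[OF *(2)] .
    show "lact I.H (germ TA k v) (Elem (germ TA k u)) = Elem (germ TA k (cmp (cats \<Gamma> k) v u))"
      using I.lact_germ[OF that(2) uv(1)] unfolding F[OF that(2)] g[OF that(1)] g[OF *(3)] .
    show "ract I.H (Elem (germ TA k u)) (germ TA k v) = Elem (germ TA k (cmp (cats \<Gamma> k) u v))"
      using I.ract_germ[OF uv(1) that(2)] unfolding g[OF that(1)] g[OF *(4)] .
    show "hip I.H (Elem (germ TA k u)) (Elem (germ TA k v)) = germ TA k (cmp (cats \<Gamma> k) (adj (cats \<Gamma> k) v) u)"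
      using I.hip_germ[OF uv] unfolding g[OF that(1)] g[OF that(2)] .
  qed
  show ?thesis unfolding corr_iso_def
  proof (intro conjI ballI allI)
    show "bij_betw (\<lambda>x\<in>hcar (corr_id1 A). x) (hcar (corr_id1 A)) (hcar I.H)"
      unfolding id_hcar bij_betw_def inj_on_def by auto
    show "lalg (corr_id1 A) = lalg I.H" "ralg (corr_id1 A) = ralg I.H" by (simp_all add: corr_id1_simps)
    show "hzero (corr_id1 A) \<in> hcar (corr_id1 A)" by (simp add: corr_id1_simps azero_germ[of 0])
    then show "(\<lambda>x\<in>hcar (corr_id1 A). x) (hzero (corr_id1 A)) = hzero I.H"
      by (simp add: zero) (simp add: corr_id1_simps)
  next
    fix x y assume "x \<in> hcar (corr_id1 A)" "y \<in> hcar (corr_id1 A)"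
    then obtain k u v where *: "u \<in> lev TA k" "x = Elem (germ TA k u)" "v \<in> lev TA k" "y = Elem (germ TA k v)"
      using cases2 by blast
    show "hadd (corr_id1 A) x y \<in> hcar (corr_id1 A)"
      "(\<lambda>x\<in>hcar (corr_id1 A). x) (hadd (corr_id1 A) x y) =
       hadd I.H ((\<lambda>x\<in>hcar (corr_id1 A). x) x) ((\<lambda>x\<in>hcar (corr_id1 A). x) y)"
      "hip (corr_id1 A) x y = hip I.H ((\<lambda>x\<in>hcar (corr_id1 A). x) x) ((\<lambda>x\<in>hcar (corr_id1 A). x) y)"
      using * by (simp_all add: ops corr_id1_simps(4-))
  next
    fix x c assume "x \<in> hcar (corr_id1 A)"
    then obtain k u where *: "u \<in> lev TA k" "x = Elem (germ TA k u)"
      using cases2[of x x] by blast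
    show "hscl (corr_id1 A) c x \<in> hcar (corr_id1 A)"
      "(\<lambda>x\<in>hcar (corr_id1 A). x) (hscl (corr_id1 A) c x) = hscl I.H c ((\<lambda>x\<in>hcar (corr_id1 A). x) x)"
      using * by (simp_all add: ops corr_id1_simps(4-))
  next
    fix x a assume "x \<in> hcar (corr_id1 A)" "a \<in> acar (lalg I.H)"
    then obtain k u v where *: "u \<in> lev TA k" "x = Elem (germ TA k u)" "v \<in> lev TA k" "a = germ TA k v"
      using cases2[of x "Elem a"] by (auto simp: corr_id1_simps(3))
    show "lact (corr_id1 A) a x \<in> hcar (corr_id1 A)"
      "(\<lambda>x\<in>hcar (corr_id1 A). x) (lact (corr_id1 A) a x) = lact I.H a ((\<lambda>x\<in>hcar (corr_id1 A). x) x)"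
      using * by (simp_all add: ops corr_id1_simps(4-))
  next
    fix x a assume "x \<in> hcar (corr_id1 A)" "a \<in> acar (ralg I.H)"
    then obtain k u v where *: "u \<in> lev TA k" "x = Elem (germ TA k u)" "v \<in> lev TA k" "a = germ TA k v"
      using cases2[of x "Elem a"] by (auto simp: corr_id1_simps(3))
    show "ract (corr_id1 A) x a \<in> hcar (corr_id1 A)"
      "(\<lambda>x\<in>hcar (corr_id1 A). x) (ract (corr_id1 A) x a) = ract I.H ((\<lambda>x\<in>hcar (corr_id1 A). x) x) a"
      using * by (simp_all add: ops corr_id1_simps(4-))
  qed
qed

lemma unit_cell_unitary: "unit_cell b \<Gamma> \<in> Unitary2 CORR (corr_id1 A) (Psi1 b (uc_id1 \<Gamma>))"
proof -
  interpret I: conn b \<Gamma> \<Gamma> "uc_id1 \<Gamma>" by (rule conn_id) unfold_locales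
  interpret J: corr_isomorphism I.H "corr_id1 A" "\<lambda>x\<in>hcar (corr_id1 A). x"
    by unfold_locales (rule I.H_right_correspondence, rule id_corr_iso)
  show ?thesis unfolding unit_cell_def by (rule J.unitary) simp
qed

end

context conn
begin

text \<open>A unit on the left in functional order stands on the right in the tensor product, hence
  the right action.\<close>

lemma bal_unit_left:
  assumes "\<xi> \<in> hcar H" "x \<in> hcar (corr_id1 (Psi0 b \<Delta>))"
  shows "bal b \<Lambda> (uc_id1 \<Delta>) \<xi> x = ract H \<xi> (elem x)"
proof -
  interpret I: conn b \<Delta> \<Delta> "uc_id1 \<Delta>" by (rule conn_id) unfold_locales
  interpret S: composable b \<Gamma> \<Delta> \<Delta> \<Lambda> "uc_id1 \<Delta>" by unfold_locales
  obtain a where a: "a \<in> lim_set C.TA" "x = Elem a" using assms(2) by (auto simp: corr_id1_simps)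
  obtain k u v where *: "u \<in> lev TH k" "\<xi> = Elem (germ TH k u)" "v \<in> lev C.TA k" "x = Elem (germ C.TA k v)"
    using eventually_happens[OF eventually_conj[OF hcar_eventually[OF assms(1)] C.TA.lim_eventually[OF a(1)]]] a(2)
    by auto
  have "v \<in> lev I.TH k" using *(3) by simp
  from S.bal_germ[OF *(1) this] show ?thesis
    using * by (simp add: C.id_germ uc_comp_id_left)
qed

lemma bal_unit_right:
  assumes "\<xi> \<in> hcar H" "x \<in> hcar (corr_id1 (Psi0 b \<Gamma>))"
  shows "bal b (uc_id1 \<Gamma>) \<Lambda> x \<xi> = lact H (elem x) \<xi>"
proof -
  interpret I: conn b \<Gamma> \<Gamma> "uc_id1 \<Gamma>" by (rule conn_id) unfold_locales
  interpret S: composable b \<Gamma> \<Gamma> \<Delta> "uc_id1 \<Gamma>" \<Lambda> by unfold_locales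
  obtain a where a: "a \<in> lim_set D.TA" "x = Elem a" using assms(2) by (auto simp: corr_id1_simps)
  obtain k u v where *: "u \<in> lev TH k" "\<xi> = Elem (germ TH k u)" "v \<in> lev D.TA k" "x = Elem (germ D.TA k v)"
    using eventually_happens[OF eventually_conj[OF hcar_eventually[OF assms(1)] D.TA.lim_eventually[OF a(1)]]] a(2)
    by auto
  have "v \<in> lev I.TH k" using *(3) by simp
  from S.bal_germ[OF this *(1)] show ?thesis
    using * by (simp add: D.id_germ uc_comp_id_right)
qed

end

section \<open>Fullness and faithfulness\<close>

context starfun
begin

text \<open>\<open>p\<close> is composed with the image under \<open>F\<close> of the resolved
  identity. Having \<open>F\<close> built in lets the expansion serve components of natural
  transformations and exchange relations alike.\<close>

lemma resolves_expand:
  assumes "M.resolves x a ps" "a \<in> obj M" "p \<in> arr N" "src N p = fob F a"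
  shows "p = lsum (pls N) (zer N (fob F a) (tgt N p))
    (map (\<lambda>c. cmp N (cmp N p (fmp F (fst c))) (fmp F (adj M (snd c)))) ps)"
proof -
  define f where "f = (\<lambda>c. cmp M (fst c) (adj M (snd c)))"
  have psD: "fst c \<in> arr M \<and> src M (fst c) = x \<and> tgt M (fst c) = a \<and>
      snd c \<in> arr M \<and> src M (snd c) = x \<and> tgt M (snd c) = a" if "c \<in> set ps" for c
    using assms(1) that unfolding M.resolves_def by (cases c) auto
  have f: "set (map f ps) \<subseteq> hom M a a" using psD by (auto simp: f_def)
  have sum: "lsum (pls M) (zer M a a) (map f ps) = idn M a"
    using assms(1) by (simp add: M.resolves_def f_def case_prod_unfold)
  have "p = cmp N p (fmp F (lsum (pls M) (zer M a a) (map f ps)))" using assms by (simp add: sum)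
  also have "\<dots> = cmp N p (lsum (pls N) (zer N (fob F a) (fob F a)) (map (fmp F) (map f ps)))"
    using fmp_lsum[OF _ _ f] assms(2) by simp
  also have "\<dots> = lsum (pls N) (zer N (fob F a) (tgt N p)) (map (cmp N p) (map (fmp F) (map f ps)))"
    using f assms by (intro N.cmp_lsum) auto
  also have "map (cmp N p) (map (fmp F) (map f ps)) =
      map (\<lambda>c. cmp N (cmp N p (fmp F (fst c))) (fmp F (adj M (snd c)))) ps"
    using assms by (auto simp: f_def dest!: psD)
  finally show ?thesis .
qed

lemma resolves_cancel:
  assumes "M.resolves x a ps" "a \<in> obj M" "p \<in> arr N" "q \<in> arr N" "src N p = fob F a" "src N q = fob F a"
    "tgt N p = tgt N q" "\<And>c. c \<in> hom M x a \<Longrightarrow> cmp N p (fmp F c) = cmp N q (fmp F c)"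
  shows "p = q"
proof -
  have "fst c \<in> hom M x a" if "c \<in> set ps" for c
    using assms(1) that unfolding M.resolves_def by (cases c) auto
  then have "map (\<lambda>c. cmp N (cmp N p (fmp F (fst c))) (fmp F (adj M (snd c)))) ps =
      map (\<lambda>c. cmp N (cmp N q (fmp F (fst c))) (fmp F (adj M (snd c)))) ps"
    using assms(8) by auto
  then show ?thesis
    using resolves_expand[OF assms(1,2,3,5)] resolves_expand[OF assms(1,2,4,6)] assms(7) by metis
qed

end

text \<open>The case of the identity functor in \<open>resolves_cancel\<close>.\<close>

lemma (in semisimple) generates_cancel:
  assumes "generates y" "p \<in> arr C" "q \<in> arr C" "src C p = src C q" "tgt C p = tgt C q"
    "\<And>c. c \<in> hom C y (src C p) \<Longrightarrow> cmp C p c = cmp C q c"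
  shows "p = q"
proof -
  interpret I: starfun C C "fid C" by unfold_locales (rule star_functor_fid[OF star_category])
  obtain ps where "resolves y (src C p) ps" using generates_resolves[OF assms(1)] assms(2) by (metis src_obj)
  then show ?thesis by (rule I.resolves_cancel) (use assms in auto)
qed

text \<open>The value of the extension at \<open>a\<close> is \<open>\<Sum> G(c) \<gamma> F(e\<^sup>* )\<close> for a resolution \<open>\<Sum> c e\<^sup>* = 1\<close> of \<open>a\<close>.\<close>

lemma NT_extend:
  assumes "starfun M N F" "starfun M N G" "semisimple M" and x: "starcat.generates M x"
    and \<gamma>: "\<gamma> \<in> hom N (fob F x) (fob G x)"
    and comm: "\<And>\<alpha>. \<alpha> \<in> hom M x x \<Longrightarrow> cmp N \<gamma> (fmp F \<alpha>) = cmp N (fmp G \<alpha>) \<gamma>"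
  obtains \<eta> where "\<eta> \<in> NT M N F G" "\<eta> x = \<gamma>"
proof -
  interpret M: semisimple M by fact
  interpret F: starfun M N F by fact
  interpret G: starfun M N G by fact
  have [simp]: "x \<in> obj M" using x by (simp add: M.generates_def)
  have g: "\<gamma> \<in> arr N" "src N \<gamma> = fob F x" "tgt N \<gamma> = fob G x" using \<gamma> by auto
  have "\<forall>a\<in>obj M. \<exists>ps. M.resolves x a ps"
    using M.generates_resolves[OF x] by blast
  then obtain ps where ps: "\<And>a. a \<in> obj M \<Longrightarrow> M.resolves x a (ps a)" by metis
  have psD: "fst c \<in> arr M \<and> src M (fst c) = x \<and> tgt M (fst c) = a \<and>
      snd c \<in> arr M \<and> src M (snd c) = x \<and> tgt M (snd c) = a" if "a \<in> obj M" "c \<in> set (ps a)" for c a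
    using ps that unfolding M.resolves_def by (cases c) force
  define smd where "smd = (\<lambda>c. cmp N (fmp G (fst c)) (cmp N \<gamma> (fmp F (adj M (snd c)))))"
  define \<eta> where "\<eta> = (\<lambda>a\<in>obj M. lsum (pls N) (zer N (fob F a) (fob G a)) (map smd (ps a)))"
  have smds: "set (map smd (ps a)) \<subseteq> hom N (fob F a) (fob G a)" if "a \<in> obj M" for a
    using g that by (auto simp: smd_def dest!: psD)
  have \<eta>_hom: "\<eta> a \<in> hom N (fob F a) (fob G a)" if "a \<in> obj M" for a
    using F.N.lsum_hom[OF _ _ smds[OF that]] that by (simp add: \<eta>_def)
  \<comment> \<open>Naturality of \<eta> at morphisms from \<open>x\<close>; full naturality and the
    value at \<open>x\<close> are both read off from it.\<close>
  have key: "cmp N (\<eta> a) (fmp F c) = cmp N (fmp G c) \<gamma>" if a: "a \<in> obj M" and c: "c \<in> hom M x a" for a c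
  proof -
    have c': "c \<in> arr M" "src M c = x" "tgt M c = a" using c by auto
    have smd_c: "cmp N (smd d) (fmp F c) = cmp N (cmp N (fmp G (fst d)) (fmp G (adj M (snd d)))) (cmp N (fmp G c) \<gamma>)"
      if d: "d \<in> set (ps a)" for d
    proof -
      have d': "fst d \<in> arr M" "src M (fst d) = x" "tgt M (fst d) = a"
        "snd d \<in> arr M" "src M (snd d) = x" "tgt M (snd d) = a" using psD[OF a d] by auto
      \<comment> \<open>The composite of \<open>c\<close> with \<open>adj M (snd d)\<close> is an
        endomorphism of \<open>x\<close>, the only kind of morphism to which \<open>comm\<close>
        applies.\<close>
      have "cmp N \<gamma> (fmp F (cmp M (adj M (snd d)) c)) = cmp N (fmp G (cmp M (adj M (snd d)) c)) \<gamma>"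
        using d' c' by (intro comm) simp
      then show ?thesis using d' c' g by (simp add: smd_def)
    qed
    have "cmp N (\<eta> a) (fmp F c) = lsum (pls N) (zer N (fob F x) (fob G a)) (map (\<lambda>d. cmp N (smd d) (fmp F c)) (ps a))"
      using F.N.lsum_cmp[OF _ smds[OF a], of "fmp F c"] a c' by (simp add: \<eta>_def comp_def)
    also have "map (\<lambda>d. cmp N (smd d) (fmp F c)) (ps a) =
        map (\<lambda>d. cmp N (cmp N (fmp G (fst d)) (fmp G (adj M (snd d)))) (cmp N (fmp G c) \<gamma>)) (ps a)"
      using smd_c by simp
    also have "lsum (pls N) (zer N (fob F x) (fob G a)) \<dots> =
        cmp N (lsum (pls N) (zer N (fob G a) (fob G a)) (map (\<lambda>d. cmp N (fmp G (fst d)) (fmp G (adj M (snd d)))) (ps a)))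
          (cmp N (fmp G c) \<gamma>)"
      using a c' g by (subst F.N.lsum_cmp[where a = "fob G a"]) (auto simp: comp_def dest!: psD)
    also have "lsum (pls N) (zer N (fob G a) (fob G a)) (map (\<lambda>d. cmp N (fmp G (fst d)) (fmp G (adj M (snd d)))) (ps a))
       = idn N (fob G a)"
    proof -
      have expand: "idn N (fob G a) = lsum (pls N) (zer N (fob G a) (fob G a))
          (map (\<lambda>d. cmp N (cmp N (idn N (fob G a)) (fmp G (fst d))) (fmp G (adj M (snd d)))) (ps a))"
        using G.resolves_expand[OF ps[OF a] a, of "idn N (fob G a)"] a by simp
      have reduce: "map (\<lambda>d. cmp N (cmp N (idn N (fob G a)) (fmp G (fst d))) (fmp G (adj M (snd d)))) (ps a) =
          map (\<lambda>d. cmp N (fmp G (fst d)) (fmp G (adj M (snd d)))) (ps a)"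
        using a by (auto dest!: psD)
      show ?thesis by (rule sym[OF expand[unfolded reduce]])
    qed
    finally show ?thesis using a c' g by simp
  qed
  have "cmp N (\<eta> (tgt M f)) (fmp F f) = cmp N (fmp G f) (\<eta> (src M f))" if f: "f \<in> arr M" for f
  proof (rule F.resolves_cancel[OF ps])
    fix c assume c: "c \<in> hom M x (src M f)"
    have *: "\<eta> (src M f) \<in> arr N" "src N (\<eta> (src M f)) = fob F (src M f)" "tgt N (\<eta> (src M f)) = fob G (src M f)"
      "\<eta> (tgt M f) \<in> arr N" "src N (\<eta> (tgt M f)) = fob F (tgt M f)" "tgt N (\<eta> (tgt M f)) = fob G (tgt M f)"
      using \<eta>_hom[of "src M f"] \<eta>_hom[of "tgt M f"] f by auto
    have "cmp N (cmp N (\<eta> (tgt M f)) (fmp F f)) (fmp F c) = cmp N (fmp G (cmp M f c)) \<gamma>"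
      using c f * key[of "tgt M f" "cmp M f c"] by simp
    also have "\<dots> = cmp N (cmp N (fmp G f) (\<eta> (src M f))) (fmp F c)"
      using c f g * key[of "src M f" c] by simp
    finally show "cmp N (cmp N (\<eta> (tgt M f)) (fmp F f)) (fmp F c) = cmp N (cmp N (fmp G f) (\<eta> (src M f))) (fmp F c)" .
  qed (use f \<eta>_hom[of "src M f"] \<eta>_hom[of "tgt M f"] in simp_all)
  then have "\<eta> \<in> NT M N F G" using \<eta>_hom by (intro NT_I) (auto simp: \<eta>_def)
  moreover have "\<eta> x = \<gamma>" using key[of x "idn M x"] \<eta>_hom[of x] g by simp
  ultimately show ?thesis using that by blast
qed

lemma NT_D:
  assumes "\<eta> \<in> NT M N F G"
  shows "a \<in> obj M \<Longrightarrow> \<eta> a \<in> hom N (fob F a) (fob G a)"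
    and "f \<in> arr M \<Longrightarrow> cmp N (\<eta> (tgt M f)) (fmp F f) = cmp N (fmp G f) (\<eta> (src M f))"
    and "\<eta> \<in> extensional (obj M)"
  using assms by (auto simp: NT_def PiE_def Pi_def)

text \<open>Naturality at morphisms c from \<open>x\<close> to \<open>a\<close> expresses the
  composite of \<eta> a with the image of c through \<eta> x, and by \<open>resolves_cancel\<close>
  these composites determine \<eta> a.\<close>

lemma NT_unique:
  assumes "starfun M N F" "starfun M N G" "semisimple M" and x: "starcat.generates M x"
    and "\<eta> \<in> NT M N F G" "\<eta>' \<in> NT M N F G" "\<eta> x = \<eta>' x"
  shows "\<eta> = \<eta>'"
proof (rule extensionalityI[OF NT_D(3)[OF assms(5)] NT_D(3)[OF assms(6)]])
  interpret M: semisimple M by fact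
  interpret F: starfun M N F by fact
  interpret G: starfun M N G by fact
  fix a assume a: "a \<in> obj M"
  obtain ps where ps: "M.resolves x a ps" using M.generates_resolves[OF x a] by blast
  show "\<eta> a = \<eta>' a"
  proof (rule F.resolves_cancel[OF ps a])
    fix c assume "c \<in> hom M x a"
    then show "cmp N (\<eta> a) (fmp F c) = cmp N (\<eta>' a) (fmp F c)"
      using NT_D(2)[OF assms(5), of c] NT_D(2)[OF assms(6), of c] assms(7) by simp
  qed (use NT_D(1)[OF assms(5) a] NT_D(1)[OF assms(6) a] in auto)
qed

section \<open>Resolutions along the tower of a correspondence\<close>

context conn
begin

text \<open>The functor of \<Delta> maps a resolved identity to an identity, and conjugation by the
  unitary \<open>W\<close> keeps it one. Since an inclusion is \<open>W\<close> after the functor,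
  the conjugated summands are those of the included pairs.\<close>

lemma resolves_inc:
  assumes "C.K.resolves k (Y k) (fob (F k) (X k)) ps"
  shows "C.K.resolves (Suc k) (Y (Suc k)) (fob (F (Suc k)) (X (Suc k))) (map (map_prod (inc TH k) (inc TH k)) ps)"
proof -
  let ?N = "N (Suc k)" and ?w = "W k (X k)" and ?a = "fob (F k) (X k)"
  let ?b = "fob (F (Suc k)) (fob (gam \<Gamma> k) (X k))" and ?c = "fob (gam \<Delta> k) (fob (F k) (X k))"
  define f where "f = (\<lambda>p. cmp (N k) (fst p) (adj (N k) (snd p)))"
  have psD: "fst p \<in> arr (N k) \<and> src (N k) (fst p) = Y k \<and> tgt (N k) (fst p) = ?a \<and>
      snd p \<in> arr (N k) \<and> src (N k) (snd p) = Y k \<and> tgt (N k) (snd p) = ?a" if "p \<in> set ps" for p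
    using assms that unfolding C.K.resolves_def by (cases p) auto
  have f: "set (map f ps) \<subseteq> hom (N k) ?a ?a" using psD by (auto simp: f_def)
  have sum: "lsum (pls (N k)) (zer (N k) ?a ?a) (map f ps) = idn (N k) ?a"
    using assms by (simp add: C.K.resolves_def f_def case_prod_unfold)
  have Gf: "set (map (fmp (gam \<Delta> k)) (map f ps)) \<subseteq> hom ?N ?c ?c" using f by auto
  have "idn ?N ?b = cmp ?N ?w (cmp ?N (fmp (gam \<Delta> k) (lsum (pls (N k)) (zer (N k) ?a ?a) (map f ps))) (adj ?N ?w))"
    by (simp add: sum)
  also have "fmp (gam \<Delta> k) (lsum (pls (N k)) (zer (N k) ?a ?a) (map f ps)) =
      lsum (pls ?N) (zer ?N ?c ?c) (map (fmp (gam \<Delta> k)) (map f ps))"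
    by (rule C.G.fmp_lsum[OF _ _ f]) simp_all
  also have "cmp ?N (lsum (pls ?N) (zer ?N ?c ?c) (map (fmp (gam \<Delta> k)) (map f ps))) (adj ?N ?w) =
      lsum (pls ?N) (zer ?N ?b ?c) (map (\<lambda>g. cmp ?N g (adj ?N ?w)) (map (fmp (gam \<Delta> k)) (map f ps)))"
    using Gf by (subst C.K.lsum_cmp[where a = ?c]) auto
  also have "cmp ?N ?w (lsum (pls ?N) (zer ?N ?b ?c) (map (\<lambda>g. cmp ?N g (adj ?N ?w)) (map (fmp (gam \<Delta> k)) (map f ps)))) =
      lsum (pls ?N) (zer ?N ?b ?b) (map (cmp ?N ?w) (map (\<lambda>g. cmp ?N g (adj ?N ?w)) (map (fmp (gam \<Delta> k)) (map f ps))))"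
    using Gf by (subst C.K.cmp_lsum[where b = ?c]) auto
  also have "map (cmp ?N ?w) (map (\<lambda>g. cmp ?N g (adj ?N ?w)) (map (fmp (gam \<Delta> k)) (map f ps))) =
      map (\<lambda>(c, e). cmp ?N c (adj ?N e)) (map (map_prod (inc TH k) (inc TH k)) ps)"
    by (auto simp: f_def case_prod_unfold dest!: psD)
  finally have "lsum (pls ?N) (zer ?N ?b ?b) (map (\<lambda>(c, e). cmp ?N c (adj ?N e)) (map (map_prod (inc TH k) (inc TH k)) ps)) =
      idn ?N ?b" by (rule sym)
  moreover have "set (map (map_prod (inc TH k) (inc TH k)) ps) \<subseteq>
      hom ?N (fob (gam \<Delta> k) (Y k)) ?b \<times> hom ?N (fob (gam \<Delta> k) (Y k)) ?b"
    by (auto dest!: psD)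
  ultimately show ?thesis unfolding C.K.resolves_def by simp
qed

text \<open>One finite family thus resolves all levels at once, which is what makes the choice of
  \<open>K\<close> in \<open>full\<close> uniform.\<close>

lemma resolves_push:
  assumes "C.K.resolves 0 (Y 0) (fob (F 0) (X 0)) ps"
  shows "C.K.resolves k (Y k) (fob (F k) (X k)) (map (map_prod (push TH 0 k) (push TH 0 k)) ps)"
proof (induction k)
  case 0
  have "map_prod (push TH 0 0) (push TH 0 0) = id" by (auto simp: fun_eq_iff)
  then show ?case using assms by simp
next
  case (Suc k)
  have "map (map_prod (inc TH k) (inc TH k)) (map (map_prod (push TH 0 k) (push TH 0 k)) ps) =
      map (map_prod (push TH 0 (Suc k)) (push TH 0 (Suc k))) ps"
    by (auto simp del: inc_TH)
  then show ?case using resolves_inc[OF Suc] by (simp only:)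
qed

end

section \<open>Faithfulness and fullness on spaces of 2-cells\<close>

context parallel
begin

text \<open>Both sides at \<open>a\<close> start at the image of \<open>a\<close> under
  \<open>ufun \<Lambda> k\<close> followed by \<open>gam \<Delta> k\<close>. They are compared on
  images of morphisms from \<open>L.X k\<close> to \<open>a\<close>, along which naturality leads
  back to the relation at \<open>L.X k\<close>.\<close>

lemma exchangeI:
  assumes \<eta>: "\<eta> \<in> NT (cats \<Gamma> k) (cats \<Delta> k) (ufun \<Lambda> k) (ufun \<Omega> k)"
    and \<kappa>: "\<kappa> \<in> NT (cats \<Gamma> (Suc k)) (cats \<Delta> (Suc k)) (ufun \<Lambda> (Suc k)) (ufun \<Omega> (Suc k))"
    and at_x: "cmp (cats \<Delta> (Suc k)) (ucon \<Omega> k (L.X k)) (fmp (gam \<Delta> k) (\<eta> (L.X k))) =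
      cmp (cats \<Delta> (Suc k)) (\<kappa> (L.X (Suc k))) (ucon \<Lambda> k (L.X k))"
  shows "exchange \<Lambda> \<Omega> k \<eta> \<kappa>"
  unfolding exchange_iff
proof
  let ?N = "cats \<Delta> (Suc k)" and ?x = "L.X k"
  fix a assume a: "a \<in> obj (cats \<Gamma> k)"
  have \<eta>1: "\<eta> c \<in> arr (cats \<Delta> k)" "src (cats \<Delta> k) (\<eta> c) = fob (ufun \<Lambda> k) c" "tgt (cats \<Delta> k) (\<eta> c) = fob (ufun \<Omega> k) c"
    if "c \<in> obj (cats \<Gamma> k)" for c using NT_D(1)[OF \<eta> that] by auto
  have \<kappa>1: "\<kappa> c \<in> arr ?N" "src ?N (\<kappa> c) = fob (ufun \<Lambda> (Suc k)) c" "tgt ?N (\<kappa> c) = fob (ufun \<Omega> (Suc k)) c"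
    if "c \<in> obj (cats \<Gamma> (Suc k))" for c using NT_D(1)[OF \<kappa> that] by auto
  obtain ps where ps: "L.D.K.resolves k ?x a ps"
    using L.D.K.generates_resolves[OF L.D.xob_generates a] by blast
  interpret DF: starfun "cats \<Gamma> k" ?N "fcomp (cats \<Gamma> k) (gam \<Delta> k) (ufun \<Lambda> k)"
    by unfold_locales (rule star_functor_fcomp[OF L.L.starfun_axioms L.C.G.starfun_axioms])
  show "cmp ?N (ucon \<Omega> k a) (fmp (gam \<Delta> k) (\<eta> a)) = cmp ?N (\<kappa> (fob (gam \<Gamma> k) a)) (ucon \<Lambda> k a)"
  proof (rule DF.resolves_cancel[OF ps a])
    fix c assume "c \<in> hom (cats \<Gamma> k) ?x a"
    then have c: "c \<in> arr (cats \<Gamma> k)" "src (cats \<Gamma> k) c = ?x" "tgt (cats \<Gamma> k) c = a" by auto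
    have n1: "cmp (cats \<Delta> k) (\<eta> a) (fmp (ufun \<Lambda> k) c) = cmp (cats \<Delta> k) (fmp (ufun \<Omega> k) c) (\<eta> ?x)"
      using NT_D(2)[OF \<eta> c(1)] c by simp
    have n2: "cmp ?N (\<kappa> (fob (gam \<Gamma> k) a)) (fmp (ufun \<Lambda> (Suc k)) (fmp (gam \<Gamma> k) c)) =
        cmp ?N (fmp (ufun \<Omega> (Suc k)) (fmp (gam \<Gamma> k) c)) (\<kappa> (fob (gam \<Gamma> k) ?x))"
      using NT_D(2)[OF \<kappa>, of "fmp (gam \<Gamma> k) c"] c by simp
    have "cmp ?N (cmp ?N (ucon \<Omega> k a) (fmp (gam \<Delta> k) (\<eta> a))) (fmp (gam \<Delta> k) (fmp (ufun \<Lambda> k) c)) =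
        cmp ?N (ucon \<Omega> k a) (fmp (gam \<Delta> k) (cmp (cats \<Delta> k) (\<eta> a) (fmp (ufun \<Lambda> k) c)))"
      using c a \<eta>1 by simp
    also have "\<dots> = cmp ?N (fmp (ufun \<Omega> (Suc k)) (fmp (gam \<Gamma> k) c))
        (cmp ?N (ucon \<Omega> k ?x) (fmp (gam \<Delta> k) (\<eta> ?x)))"
      unfolding n1 using c a \<eta>1 by simp
    also have "\<dots> = cmp ?N (cmp ?N (fmp (ufun \<Omega> (Suc k)) (fmp (gam \<Gamma> k) c)) (\<kappa> (fob (gam \<Gamma> k) ?x))) (ucon \<Lambda> k ?x)"
      unfolding at_x using c a \<kappa>1 by simp
    also have "\<dots> = cmp ?N (cmp ?N (\<kappa> (fob (gam \<Gamma> k) a)) (ucon \<Lambda> k a)) (fmp (gam \<Delta> k) (fmp (ufun \<Lambda> k) c))"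
      unfolding n2[symmetric] using c a \<kappa>1 by simp
    finally show "cmp ?N (cmp ?N (ucon \<Omega> k a) (fmp (gam \<Delta> k) (\<eta> a))) (fmp (fcomp (cats \<Gamma> k) (gam \<Delta> k) (ufun \<Lambda> k)) c) =
        cmp ?N (cmp ?N (\<kappa> (fob (gam \<Gamma> k) a)) (ucon \<Lambda> k a)) (fmp (fcomp (cats \<Gamma> k) (gam \<Delta> k) (ufun \<Lambda> k)) c)"
      using c by simp
  qed (use a \<eta>1 \<kappa>1 in simp_all)
qed

text \<open>Two generators are used: \<open>L.Y k\<close> to pass from equal action on vectors to
  equal components at \<open>L.X k\<close>, and \<open>L.X k\<close> to pass from one component to
  the whole transformation.\<close>

lemma faithful:
  assumes h: "h \<in> uc_seqs \<Lambda> \<Omega>" and h': "h' \<in> uc_seqs \<Lambda> \<Omega>" and eq: "seq_map b \<Lambda> \<Omega> h = seq_map b \<Lambda> \<Omega> h'"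
  shows "\<forall>\<^sub>F k in sequentially. h k = h' k"
  using seq_map_germ[OF h] seq_map_germ[OF h']
proof eventually_elim
  case (elim k)
  note hD = seqD(1-3)[OF h, OF L.D.xob_obj[of k]] seqD(1-3)[OF h', OF L.D.xob_obj[of k]]
  have "h k (L.X k) = h' k (L.X k)"
  proof (rule L.C.K.generates_cancel[OF L.C.xob_generates])
    fix v assume "v \<in> hom (cats \<Delta> k) (L.Y k) (src (cats \<Delta> k) (h k (L.X k)))"
    then have v: "v \<in> lev L.TH k" using hD by simp
    then have "germ O.TH k (cmp (cats \<Delta> k) (h k (L.X k)) v) = germ O.TH k (cmp (cats \<Delta> k) (h' k (L.X k)) v)"
      using elim eq by (metis tvec.inject(1))
    then show "cmp (cats \<Delta> k) (h k (L.X k)) v = cmp (cats \<Delta> k) (h' k (L.X k)) v"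
      by (rule O.TH.germ_inj) (use v hD in simp_all)
  qed (simp_all add: hD)
  moreover have "h k \<in> NT (cats \<Gamma> k) (cats \<Delta> k) (ufun \<Lambda> k) (ufun \<Omega> k)"
    "h' k \<in> NT (cats \<Gamma> k) (cats \<Delta> k) (ufun \<Lambda> k) (ufun \<Omega> k)"
    using h h' by (simp_all add: uc_seqs_def)
  ultimately show ?case
    using NT_unique[OF L.L.starfun_axioms O.L.starfun_axioms L.D.K.semisimple_axioms L.D.xob_generates] by blast
qed

text \<open>A vector v at level k is the sum of the c with coefficients (adj e) v, which are
  endomorphisms of \<open>L.Y k\<close>. A right linear \<open>T\<close> is therefore determined on
  level k by its values on the c, and these are assumed to lie at level k too.\<close>

lemma level_matrix:
  assumes T: "T \<in> intertwiners L.H O.H" and ps: "L.C.K.resolves k (L.Y k) (fob (ufun \<Lambda> k) (L.X k)) ps"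
    and lev: "\<forall>q\<in>set ps. \<exists>t\<in>lev O.TH k. T (Elem (germ L.TH k (fst q))) = Elem (germ O.TH k t)"
  shows "\<exists>\<gamma>\<in>hom (cats \<Delta> k) (fob (ufun \<Lambda> k) (L.X k)) (fob (ufun \<Omega> k) (L.X k)).
    \<forall>v\<in>lev L.TH k. T (Elem (germ L.TH k v)) = Elem (germ O.TH k (cmp (cats \<Delta> k) \<gamma> v))"
proof -
  let ?N = "cats \<Delta> k" and ?a = "fob (ufun \<Lambda> k) (L.X k)" and ?c = "fob (ufun \<Omega> k) (L.X k)"
  interpret HL: rcorr L.H by (rule L.rcorr_H)
  interpret HO: rcorr O.H by (rule O.rcorr_H)
  have Tf: "T \<in> hcar L.H \<rightarrow>\<^sub>E hcar O.H"
    and Tadd: "\<And>x y. x \<in> hcar L.H \<Longrightarrow> y \<in> hcar L.H \<Longrightarrow> T (hadd L.H x y) = hadd O.H (T x) (T y)"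
    and Tscl: "\<And>z x. x \<in> hcar L.H \<Longrightarrow> T (hscl L.H z x) = hscl O.H z (T x)"
    and Tract: "\<And>x c. c \<in> acar (ralg L.H) \<Longrightarrow> x \<in> hcar L.H \<Longrightarrow> T (ract L.H x c) = ract O.H (T x) c"
    using T unfolding intertwiners_def by auto
  have T0: "T (hzero L.H) = hzero O.H"
    using Tscl[of "hzero L.H" 0] PiE_mem[OF Tf HL.V.zero_closed] by simp
  obtain \<tau> where \<tau>: "\<And>q. q \<in> set ps \<Longrightarrow> \<tau> q \<in> lev O.TH k"
    "\<And>q. q \<in> set ps \<Longrightarrow> T (Elem (germ L.TH k (fst q))) = Elem (germ O.TH k (\<tau> q))"
    using lev by metis
  have psD: "fst q \<in> lev L.TH k \<and> snd q \<in> lev L.TH k" if "q \<in> set ps" for q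
    using ps that unfolding L.C.K.resolves_def by (cases q) auto
  define f where "f = (\<lambda>q. cmp ?N (fst q) (adj ?N (snd q)))"
  define g where "g = (\<lambda>q. cmp ?N (\<tau> q) (adj ?N (snd q)))"
  have f: "set (map f ps) \<subseteq> hom ?N ?a ?a" using psD by (auto simp: f_def)
  have g: "set (map g ps) \<subseteq> hom ?N ?a ?c" using psD \<tau>(1) by (fastforce simp: g_def)
  have sum: "lsum (pls ?N) (zer ?N ?a ?a) (map f ps) = idn ?N ?a"
    using ps by (simp add: L.C.K.resolves_def f_def case_prod_unfold)
  define \<gamma> where "\<gamma> = lsum (pls ?N) (zer ?N ?a ?c) (map g ps)"
  have \<gamma>: "\<gamma> \<in> hom ?N ?a ?c" unfolding \<gamma>_def by (rule L.C.K.lsum_hom[OF _ _ g]) simp_all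
  have "T (Elem (germ L.TH k v)) = Elem (germ O.TH k (cmp ?N \<gamma> v))" if v: "v \<in> lev L.TH k" for v
  proof -
    have v': "v \<in> arr ?N" "src ?N v = L.Y k" "tgt ?N v = ?a" using v by auto
    let ?d = "\<lambda>q. cmp ?N (adj ?N (snd q)) v"
    have d: "?d q \<in> lev L.C.TA k" if "q \<in> set ps" for q using psD[OF that] v' by simp
    have fv: "cmp ?N (f q) v = cmp ?N (fst q) (?d q)" and gv: "cmp ?N (g q) v = cmp ?N (\<tau> q) (?d q)"
      if "q \<in> set ps" for q using psD[OF that] \<tau>(1)[OF that] v' by (simp_all add: f_def g_def)
    have fv_lev: "set (map (\<lambda>q. cmp ?N (f q) v) ps) \<subseteq> lev L.TH k" using f v' by auto
    have gv_lev: "set (map (\<lambda>q. cmp ?N (g q) v) ps) \<subseteq> lev O.TH k" using g v' by auto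
    have "v = cmp ?N (lsum (pls ?N) (zer ?N ?a ?a) (map f ps)) v" using v' by (simp add: sum)
    also have "\<dots> = lsum (pls ?N) (zer ?N (L.Y k) ?a) (map (\<lambda>q. cmp ?N (f q) v) ps)"
      using L.C.K.lsum_cmp[OF _ f, of v] v' by (simp add: comp_def)
    finally have v_eq: "v = \<dots>" .
    have "Elem (germ L.TH k v) = lsum (hadd L.H) (hzero L.H) (map (\<lambda>v. Elem (germ L.TH k v)) (map (\<lambda>q. cmp ?N (f q) v) ps))"
      unfolding L.hadd_lsum[OF fv_lev] using v_eq by simp
    also have "map (\<lambda>v. Elem (germ L.TH k v)) (map (\<lambda>q. cmp ?N (f q) v) ps) =
        map (\<lambda>q. ract L.H (Elem (germ L.TH k (fst q))) (germ L.C.TA k (?d q))) ps"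
      using fv L.ract_germ psD d by simp
    finally have "T (Elem (germ L.TH k v)) =
        T (lsum (hadd L.H) (hzero L.H) (map (\<lambda>q. ract L.H (Elem (germ L.TH k (fst q))) (germ L.C.TA k (?d q))) ps))"
      by simp
    also have "\<dots> = lsum (hadd O.H) (hzero O.H) (map T (map (\<lambda>q. ract L.H (Elem (germ L.TH k (fst q))) (germ L.C.TA k (?d q))) ps))"
    proof (rule lsum_image[where S = "hcar L.H"])
      have "ract L.H (Elem (germ L.TH k (fst q))) (germ L.C.TA k (?d q)) \<in> hcar L.H" if "q \<in> set ps" for q
        using L.ract_germ[of "fst q" k "?d q"] psD[OF that] d[OF that] v' by simp
      then show "set (map (\<lambda>q. ract L.H (Elem (germ L.TH k (fst q))) (germ L.C.TA k (?d q))) ps) \<subseteq> hcar L.H"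
        by auto
    qed (simp_all add: T0 Tadd)
    also have "map T (map (\<lambda>q. ract L.H (Elem (germ L.TH k (fst q))) (germ L.C.TA k (?d q))) ps) =
        map (\<lambda>v. Elem (germ O.TH k v)) (map (\<lambda>q. cmp ?N (g q) v) ps)"
    proof -
      have "T (ract L.H (Elem (germ L.TH k (fst q))) (germ L.C.TA k (?d q))) = Elem (germ O.TH k (cmp ?N (g q) v))"
        if q: "q \<in> set ps" for q
      proof -
        have "T (ract L.H (Elem (germ L.TH k (fst q))) (germ L.C.TA k (?d q))) =
            ract O.H (T (Elem (germ L.TH k (fst q)))) (germ L.C.TA k (?d q))"
          by (rule Tract) (use L.C.TA.germ_lim[OF d[OF q]] L.germ_hcar[OF conjunct1[OF psD[OF q]]] in simp_all)
        then show ?thesis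
          using O.ract_germ[OF \<tau>(1)[OF q] d[OF q]] \<tau>(2)[OF q] gv[OF q] by simp
      qed
      then show ?thesis by simp
    qed
    also have "lsum (hadd O.H) (hzero O.H) \<dots> =
        Elem (germ O.TH k (lsum (pls ?N) (zer ?N (L.Y k) ?c) (map (\<lambda>q. cmp ?N (g q) v) ps)))"
      by (rule O.hadd_lsum[OF gv_lev])
    also have "lsum (pls ?N) (zer ?N (L.Y k) ?c) (map (\<lambda>q. cmp ?N (g q) v) ps) = cmp ?N \<gamma> v"
      unfolding \<gamma>_def using L.C.K.lsum_cmp[OF _ g, of v] v' by (simp add: comp_def)
    finally show ?thesis .
  qed
  then show ?thesis using \<gamma> by blast
qed

lemma full:
  assumes T: "T \<in> intertwiners L.H O.H"
  shows "\<exists>h\<in>uc_seqs \<Lambda> \<Omega>. seq_map b \<Lambda> \<Omega> h = T"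
proof -
  have Tf: "T \<in> hcar L.H \<rightarrow>\<^sub>E hcar O.H"
    and Tlact: "\<And>x a. a \<in> acar (lalg L.H) \<Longrightarrow> x \<in> hcar L.H \<Longrightarrow> T (lact L.H a x) = lact O.H a (T x)"
    using T unfolding intertwiners_def by auto
  obtain ps where ps: "L.C.K.resolves 0 (L.Y 0) (fob (ufun \<Lambda> 0) (L.X 0)) ps"
    using L.C.K.generates_resolves[OF L.C.xob_generates, of "fob (ufun \<Lambda> 0) (L.X 0)" 0] by auto
  have ps_lev: "fst q \<in> lev L.TH 0" if "q \<in> set ps" for q
    using ps that unfolding L.C.K.resolves_def by (cases q) auto
  \<comment> \<open>Finitely many images lie in a common level and in all later ones; this is where
    finiteness of the generating family counts.\<close>
  have "\<forall>\<^sub>F k in sequentially. \<forall>q\<in>set ps. \<exists>t\<in>lev O.TH k. T (Elem (germ L.TH 0 (fst q))) = Elem (germ O.TH k t)"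
    using PiE_mem[OF Tf] by (intro eventually_ball_finite ballI O.hcar_eventually) (auto intro!: L.germ_hcar ps_lev simp del: L.lev_TH)
  then obtain K where K: "\<And>k q. K \<le> k \<Longrightarrow> q \<in> set ps \<Longrightarrow>
      \<exists>t\<in>lev O.TH k. T (Elem (germ L.TH 0 (fst q))) = Elem (germ O.TH k t)"
    unfolding eventually_sequentially by blast
  have "\<exists>\<gamma>. \<gamma> \<in> hom (cats \<Delta> k) (fob (ufun \<Lambda> k) (L.X k)) (fob (ufun \<Omega> k) (L.X k)) \<and>
    (\<forall>v\<in>lev L.TH k. T (Elem (germ L.TH k v)) = Elem (germ O.TH k (cmp (cats \<Delta> k) \<gamma> v)))" if "K \<le> k" for k
  proof -
    have "\<forall>q\<in>set (map (map_prod (push L.TH 0 k) (push L.TH 0 k)) ps).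
        \<exists>t\<in>lev O.TH k. T (Elem (germ L.TH k (fst q))) = Elem (germ O.TH k t)"
      using K[OF that] L.TH.germ_push[of 0 k] by (simp del: L.lev_TH O.lev_TH)
    from level_matrix[OF T L.resolves_push[OF ps] this] show ?thesis by blast
  qed
  then obtain \<gamma> where \<gamma>_hom: "\<And>k. K \<le> k \<Longrightarrow> \<gamma> k \<in> hom (cats \<Delta> k) (fob (ufun \<Lambda> k) (L.X k)) (fob (ufun \<Omega> k) (L.X k))"
    and T_\<gamma>: "\<And>k v. K \<le> k \<Longrightarrow> v \<in> lev L.TH k \<Longrightarrow>
      T (Elem (germ L.TH k v)) = Elem (germ O.TH k (cmp (cats \<Delta> k) (\<gamma> k) v))"
    by metis
  have \<gamma>D: "\<gamma> k \<in> arr (cats \<Delta> k)" "src (cats \<Delta> k) (\<gamma> k) = fob (ufun \<Lambda> k) (L.X k)"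
    "tgt (cats \<Delta> k) (\<gamma> k) = fob (ufun \<Omega> k) (L.X k)" if "K \<le> k" for k using \<gamma>_hom[OF that] by auto
  \<comment> \<open>Left linearity of \<open>T\<close>, tested on morphisms from the generator
    \<open>L.Y k\<close> and read back through injectivity of germs.\<close>
  have comm: "cmp (cats \<Delta> k) (\<gamma> k) (fmp (ufun \<Lambda> k) \<alpha>) = cmp (cats \<Delta> k) (fmp (ufun \<Omega> k) \<alpha>) (\<gamma> k)"
    if k: "K \<le> k" and \<alpha>: "\<alpha> \<in> hom (cats \<Gamma> k) (L.X k) (L.X k)" for k \<alpha>
  proof (rule L.C.K.generates_cancel[OF L.C.xob_generates])
    have \<alpha>': "\<alpha> \<in> arr (cats \<Gamma> k)" "src (cats \<Gamma> k) \<alpha> = L.X k" "tgt (cats \<Gamma> k) \<alpha> = L.X k" using \<alpha> by auto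
    fix v assume "v \<in> hom (cats \<Delta> k) (L.Y k) (src (cats \<Delta> k) (cmp (cats \<Delta> k) (\<gamma> k) (fmp (ufun \<Lambda> k) \<alpha>)))"
    then have v: "v \<in> arr (cats \<Delta> k)" "src (cats \<Delta> k) v = L.Y k" "tgt (cats \<Delta> k) v = fob (ufun \<Lambda> k) (L.X k)"
      using \<alpha>' \<gamma>D[OF k] by auto
    have v_lev: "v \<in> lev L.TH k" "cmp (cats \<Delta> k) (fmp (ufun \<Lambda> k) \<alpha>) v \<in> lev L.TH k"
      "cmp (cats \<Delta> k) (\<gamma> k) v \<in> lev O.TH k" and \<alpha>_lev: "\<alpha> \<in> lev L.D.TA k"
      using v \<alpha>' \<gamma>D[OF k] by auto
    have "Elem (germ O.TH k (cmp (cats \<Delta> k) (\<gamma> k) (cmp (cats \<Delta> k) (fmp (ufun \<Lambda> k) \<alpha>) v))) =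
        T (lact L.H (germ L.D.TA k \<alpha>) (Elem (germ L.TH k v)))"
      unfolding L.lact_germ[OF \<alpha>_lev v_lev(1)] by (rule T_\<gamma>[OF k v_lev(2), symmetric])
    also have "\<dots> = lact O.H (germ L.D.TA k \<alpha>) (T (Elem (germ L.TH k v)))"
      by (rule Tlact) (use L.D.TA.germ_lim[OF \<alpha>_lev] L.germ_hcar[OF v_lev(1)] in simp_all)
    also have "\<dots> = Elem (germ O.TH k (cmp (cats \<Delta> k) (fmp (ufun \<Omega> k) \<alpha>) (cmp (cats \<Delta> k) (\<gamma> k) v)))"
      unfolding T_\<gamma>[OF k v_lev(1)] by (rule O.lact_germ[OF \<alpha>_lev v_lev(3)])
    finally have "germ O.TH k (cmp (cats \<Delta> k) (\<gamma> k) (cmp (cats \<Delta> k) (fmp (ufun \<Lambda> k) \<alpha>) v)) =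
        germ O.TH k (cmp (cats \<Delta> k) (fmp (ufun \<Omega> k) \<alpha>) (cmp (cats \<Delta> k) (\<gamma> k) v))" by simp
    then have "cmp (cats \<Delta> k) (\<gamma> k) (cmp (cats \<Delta> k) (fmp (ufun \<Lambda> k) \<alpha>) v) =
        cmp (cats \<Delta> k) (fmp (ufun \<Omega> k) \<alpha>) (cmp (cats \<Delta> k) (\<gamma> k) v)"
      by (rule O.TH.germ_inj) (use v \<alpha>' \<gamma>D[OF k] in simp_all)
    then show "cmp (cats \<Delta> k) (cmp (cats \<Delta> k) (\<gamma> k) (fmp (ufun \<Lambda> k) \<alpha>)) v =
        cmp (cats \<Delta> k) (cmp (cats \<Delta> k) (fmp (ufun \<Omega> k) \<alpha>) (\<gamma> k)) v"
      using v \<alpha>' \<gamma>D[OF k] by simp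
  qed (use \<alpha> \<gamma>D[OF k] in auto)
  \<comment> \<open>A vector at level k and its inclusion at the next level are the same vector of
    the limit, so \<gamma> k and \<open>\<gamma> (Suc k)\<close> describe the same value of
    \<open>T\<close>.\<close>
  have exch: "cmp (cats \<Delta> (Suc k)) (ucon \<Omega> k (L.X k)) (fmp (gam \<Delta> k) (\<gamma> k)) =
      cmp (cats \<Delta> (Suc k)) (\<gamma> (Suc k)) (ucon \<Lambda> k (L.X k))" if k: "K \<le> k" for k
  proof -
    let ?N = "cats \<Delta> (Suc k)" and ?a = "fob (ufun \<Lambda> k) (L.X k)"
    have k1: "K \<le> Suc k" using k by simp
    have "?a \<in> obj (cats \<Delta> k)" by simp
    then obtain qs where qs: "L.C.K.resolves k (L.Y k) ?a qs"
      using L.C.K.generates_resolves[OF L.C.xob_generates] by blast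
    show ?thesis
    proof (rule L.C.G.resolves_cancel[OF qs])
      fix v assume "v \<in> hom (cats \<Delta> k) (L.Y k) ?a"
      then have v: "v \<in> lev L.TH k" "v \<in> arr (cats \<Delta> k)" "src (cats \<Delta> k) v = L.Y k" "tgt (cats \<Delta> k) v = ?a" by auto
      have "Elem (germ O.TH (Suc k) (cmp ?N (\<gamma> (Suc k)) (inc L.TH k v))) = T (Elem (germ L.TH (Suc k) (inc L.TH k v)))"
        by (rule T_\<gamma>[OF k1 L.TH.inc_lev[OF v(1)], symmetric])
      also have "\<dots> = Elem (germ O.TH k (cmp (cats \<Delta> k) (\<gamma> k) v))"
        unfolding L.TH.germ_inc by (rule T_\<gamma>[OF k v(1)])
      also have "\<dots> = Elem (germ O.TH (Suc k) (inc O.TH k (cmp (cats \<Delta> k) (\<gamma> k) v)))"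
        unfolding O.TH.germ_inc ..
      finally have "germ O.TH (Suc k) (cmp ?N (\<gamma> (Suc k)) (inc L.TH k v)) =
          germ O.TH (Suc k) (inc O.TH k (cmp (cats \<Delta> k) (\<gamma> k) v))" by simp
      then have "cmp ?N (\<gamma> (Suc k)) (inc L.TH k v) = inc O.TH k (cmp (cats \<Delta> k) (\<gamma> k) v)"
        by (rule O.TH.germ_inj) (use v \<gamma>D[OF k] \<gamma>D[OF k1] in simp_all)
      then show "cmp ?N (cmp ?N (ucon \<Omega> k (L.X k)) (fmp (gam \<Delta> k) (\<gamma> k))) (fmp (gam \<Delta> k) v) =
          cmp ?N (cmp ?N (\<gamma> (Suc k)) (ucon \<Lambda> k (L.X k))) (fmp (gam \<Delta> k) v)"
        using v \<gamma>D[OF k] \<gamma>D[OF k1] by simp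
    qed (use \<gamma>D[OF k] \<gamma>D[OF k1] in simp_all)
  qed
  \<comment> \<open>A representative sequence has a transformation at every level; below
    \<open>K\<close> the zero transformation fills the gap, as only late levels matter for the
    class.\<close>
  have "\<exists>\<eta>. \<eta> \<in> NT (cats \<Gamma> k) (cats \<Delta> k) (ufun \<Lambda> k) (ufun \<Omega> k) \<and> (K \<le> k \<longrightarrow> \<eta> (L.X k) = \<gamma> k)" for k
  proof (cases "K \<le> k")
    case True
    then show ?thesis
      using NT_extend[OF L.L.starfun_axioms O.L.starfun_axioms L.D.K.semisimple_axioms L.D.xob_generates
          \<gamma>_hom comm] by metis
  next
    case False
    have "(\<lambda>a\<in>obj (cats \<Gamma> k). zer (cats \<Delta> k) (fob (ufun \<Lambda> k) a) (fob (ufun \<Omega> k) a)) \<in>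
        NT (cats \<Gamma> k) (cats \<Delta> k) (ufun \<Lambda> k) (ufun \<Omega> k)"
      by (rule NT_I) auto
    then show ?thesis using False by blast
  qed
  then obtain h where hNT: "\<And>k. h k \<in> NT (cats \<Gamma> k) (cats \<Delta> k) (ufun \<Lambda> k) (ufun \<Omega> k)"
    and h\<gamma>: "\<And>k. K \<le> k \<Longrightarrow> h k (L.X k) = \<gamma> k" by metis
  have "exchange \<Lambda> \<Omega> k (h k) (h (Suc k))" if "K \<le> k" for k
    using exch[OF that] h\<gamma>[OF that] h\<gamma>[of "Suc k"] that by (intro exchangeI hNT) simp
  then have h: "h \<in> uc_seqs \<Lambda> \<Omega>"
    using hNT unfolding uc_seqs_def by (auto simp: eventually_sequentially)
  have "acts b \<Lambda> \<Omega> h T"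
    unfolding acts_iff eventually_sequentially using T_\<gamma> h\<gamma> by (metis)
  moreover have "T \<in> extensional (hcar L.H)" using Tf by (simp add: PiE_def)
  ultimately show ?thesis using seq_map_eqI[OF h] h by blast
qed

end

section \<open>The 2-functor\<close>

text \<open>Lets a factor of a balanced map be a tensor product or an identity correspondence
  itself, so that iterated tensor products map directly to one correspondence.\<close>

lemma balanced_iso_left:
  assumes "balanced H G K \<beta>" and iso: "corr_iso H' H f"
  shows "balanced H' G K (\<lambda>\<xi>. \<beta> (f \<xi>))"
proof -
  interpret B: balanced H G K \<beta> by fact
  interpret I: corr_isomorphism H H' f by unfold_locales (fact iso)
  interpret H': rcorr H' by unfold_locales (rule I.source_right_correspondence)
  show ?thesis
    by unfold_locales (simp_all add: B.\<beta>_hscl B.\<beta>_lact B.\<beta>_ract B.\<beta>_hip I.t_hip)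
qed

lemma balanced_iso_right:
  assumes "balanced H G K \<beta>" and iso: "corr_iso G' G g"
  shows "balanced H G' K (\<lambda>\<xi> \<zeta>. \<beta> \<xi> (g \<zeta>))"
proof -
  interpret B: balanced H G K \<beta> by fact
  interpret I: corr_isomorphism G G' g by unfold_locales (fact iso)
  interpret G': rcorr G' by unfold_locales (rule I.source_right_correspondence)
  have "hip H \<xi> \<xi>' \<in> acar (lalg G)" if "\<xi> \<in> hcar H" "\<xi>' \<in> hcar H" for \<xi> \<xi>'
    using B.H.hip_closed[OF that] by simp
  then show ?thesis
    by unfold_locales (simp_all add: B.\<beta>_hscl B.\<beta>_lact B.\<beta>_ract B.\<beta>_hip I.t_hip)
qed

text \<open>An identity known on simple tensors extends to formal sums, which reduces naturality and
  coherence to statements about \<open>bal\<close>.\<close>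

lemma tsum_transfer:
  assumes "balanced H G K \<beta>" "balanced H' G' K' \<beta>'"
    and fg: "\<And>\<xi>. \<xi> \<in> hcar H \<Longrightarrow> f \<xi> \<in> hcar H'" "\<And>\<zeta>. \<zeta> \<in> hcar G \<Longrightarrow> g \<zeta> \<in> hcar G'"
    and T: "T (hzero K) = hzero K'" "\<And>x y. x \<in> hcar K \<Longrightarrow> y \<in> hcar K \<Longrightarrow> T (hadd K x y) = hadd K' (T x) (T y)"
      "\<And>\<xi> \<zeta>. \<xi> \<in> hcar H \<Longrightarrow> \<zeta> \<in> hcar G \<Longrightarrow> T (\<beta> \<xi> \<zeta>) = \<beta>' (f \<xi>) (g \<zeta>)"
    and s: "s \<in> tens_sums H G"
  shows "map (\<lambda>(\<xi>, \<zeta>). (f \<xi>, g \<zeta>)) s \<in> tens_sums H' G' \<and>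
    balanced.tsum K' \<beta>' (map (\<lambda>(\<xi>, \<zeta>). (f \<xi>, g \<zeta>)) s) = T (balanced.tsum K \<beta> s)"
proof -
  interpret B: balanced H G K \<beta> by fact
  interpret B': balanced H' G' K' \<beta>' by fact
  show ?thesis using s by (induction s) (auto simp: fg T)
qed

text \<open>\<open>corr_tensor2\<close> returns a chosen representative. \<open>tmap\<close> does
  not see the choice, so its value can be computed from the formal sum before the choice is
  made.\<close>

lemma tmap_tensor2:
  assumes "balanced H G K \<beta>" "balanced H' G' K' \<beta>'"
    and cells: "csrc s = H" "csrc t = G" "ctgt s = H'" "ctgt t = G'" and x: "x \<in> hcar (tensor H G)"
    and sums: "map (\<lambda>(\<xi>, \<zeta>). (cmap s \<xi>, cmap t \<zeta>)) (terms x) \<in> tens_sums H' G'"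
  shows "cmap (corr_tensor2 s t) x \<in> hcar (tensor H' G')"
    and "balanced.tmap H' G' K' \<beta>' (cmap (corr_tensor2 s t) x) =
      balanced.tsum K' \<beta>' (map (\<lambda>(\<xi>, \<zeta>). (cmap s \<xi>, cmap t \<zeta>)) (terms x))"
proof -
  interpret B: balanced H G K \<beta> by fact
  interpret B': balanced H' G' K' \<beta>' by fact
  have *: "cmap (corr_tensor2 s t) x = tens_cls H' G' (map (\<lambda>(\<xi>, \<zeta>). (cmap s \<xi>, cmap t \<zeta>)) (terms x))"
    using x by (simp add: corr_tensor2_def cells)
  show "cmap (corr_tensor2 s t) x \<in> hcar (tensor H' G')"
    "balanced.tmap H' G' K' \<beta>' (cmap (corr_tensor2 s t) x) =
      balanced.tsum K' \<beta>' (map (\<lambda>(\<xi>, \<zeta>). (cmap s \<xi>, cmap t \<zeta>)) (terms x))"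
    unfolding * using sums by simp_all
qed

lemma corr_vert_vert:
  "corr_vert t (corr_vert s r) =
    \<lparr>csrc = csrc r, ctgt = ctgt t, cmap = (\<lambda>x\<in>hcar (csrc r). cmap t (cmap s (cmap r x)))\<rparr>"
  by (auto simp: corr_vert_def compose_def)

lemma corr_vert_vert_eqI:
  fixes c :: "'e ccell2"
  assumes "csrc r = csrc c" "ctgt t = ctgt c" "cmap c \<in> extensional (hcar (csrc c))"
    "\<And>x. x \<in> hcar (csrc c) \<Longrightarrow> cmap t (cmap s (cmap r x)) = cmap c x"
  shows "corr_vert t (corr_vert s r) = c"
proof -
  have "(\<lambda>x\<in>hcar (csrc c). cmap t (cmap s (cmap r x))) = cmap c"
    by (rule extensionalityI[of _ "hcar (csrc c)"]) (use assms in auto)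
  then show ?thesis unfolding corr_vert_vert using assms(1,2) by simp
qed

text \<open>The arguments follow functional order, as \<open>two_functor_with\<close> requires of
  its comparison cells, while the tensor product takes the two factors reversed.\<close>

definition compare :: "(('o, 'm) cat \<Rightarrow> 'o) \<Rightarrow> ('o, 'm) ucell1 \<Rightarrow> ('o, 'm) ucell1 \<Rightarrow> (nat \<times> 'm) set ccell2" where
  "compare b \<Omega> \<Lambda> = balanced.comparison (Psi1 b \<Lambda>) (Psi1 b \<Omega>) (Psi1 b (uc_comp \<Omega> \<Lambda>)) (bal b \<Lambda> \<Omega>)"

abbreviation compare_map :: "(('o, 'm) cat \<Rightarrow> 'o) \<Rightarrow> ('o, 'm) ucell1 \<Rightarrow> ('o, 'm) ucell1 \<Rightarrow>
    (nat \<times> 'm) set tvec \<Rightarrow> (nat \<times> 'm) set tvec" where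
  "compare_map b \<Omega> \<Lambda> \<equiv> balanced.tmap (Psi1 b \<Lambda>) (Psi1 b \<Omega>) (Psi1 b (uc_comp \<Omega> \<Lambda>)) (bal b \<Lambda> \<Omega>)"

lemma (in composable) compare_eq: "compare b \<Omega> \<Lambda> = \<lparr>csrc = tensor L.H O.H, ctgt = C.H, cmap = compare_map b \<Omega> \<Lambda>\<rparr>"
  by (simp add: compare_def B.comparison_def)

lemma uc2_parallel:
  assumes "base_choice b" "\<alpha> \<in> uc2"
  shows "parallel b (udom (usrc \<alpha>)) (ucod (usrc \<alpha>)) (usrc \<alpha>) (utgt \<alpha>)"
  using conn_uc1[OF assms(1), of "usrc \<alpha>"] conn_uc1[OF assms(1), of "utgt \<alpha>"] assms(2)
  by (simp add: uc2_def parallel_def)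

lemma equiv_uc_rel: "equiv (uc_seqs \<Lambda> \<Omega>) (uc_rel \<Lambda> \<Omega>)"
proof (rule equivI)
  show "uc_rel \<Lambda> \<Omega> \<subseteq> uc_seqs \<Lambda> \<Omega> \<times> uc_seqs \<Lambda> \<Omega>" by (auto simp: uc_rel_def)
  show "refl_on (uc_seqs \<Lambda> \<Omega>) (uc_rel \<Lambda> \<Omega>)" by (auto simp: refl_on_def uc_rel_def)
  show "sym (uc_rel \<Lambda> \<Omega>)" by (auto simp: sym_def uc_rel_def eq_commute)
  show "trans (uc_rel \<Lambda> \<Omega>)"
    by (rule transI) (auto simp: uc_rel_def elim: eventually_elim2)
qed

lemma uc2_represented:
  assumes "\<alpha> \<in> uc2"
  obtains h where "h \<in> uc_seqs (usrc \<alpha>) (utgt \<alpha>)" "represents h \<alpha>" "ucls \<alpha> = uc_rel (usrc \<alpha>) (utgt \<alpha>) `` {h}"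
proof -
  have "ucls \<alpha> \<in> uc_seqs (usrc \<alpha>) (utgt \<alpha>) // uc_rel (usrc \<alpha>) (utgt \<alpha>)" using assms by (simp add: uc2_def)
  then obtain h where h: "h \<in> uc_seqs (usrc \<alpha>) (utgt \<alpha>)" "ucls \<alpha> = uc_rel (usrc \<alpha>) (utgt \<alpha>) `` {h}"
    by (rule quotientE)
  then have "represents h \<alpha>" by (auto simp: represents_def uc_rel_def eq_commute)
  then show ?thesis using that h by blast
qed

lemma uc2_representative:
  assumes "\<alpha> \<in> uc2" "usrc \<alpha> = \<Lambda>" "utgt \<alpha> = \<Omega>"
  obtains h where "h \<in> uc_seqs \<Lambda> \<Omega>" "represents h \<alpha>" "ucls \<alpha> = uc_rel \<Lambda> \<Omega> `` {h}"
  using uc2_represented[OF assms(1)] unfolding assms(2,3) .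

lemma class_uc2:
  assumes "\<Lambda> \<in> uc1" "\<Omega> \<in> uc1" "udom \<Lambda> = udom \<Omega>" "ucod \<Lambda> = ucod \<Omega>" "h \<in> uc_seqs \<Lambda> \<Omega>"
  shows "uc_class \<Lambda> \<Omega> {h} \<in> uc2" "represents h (uc_class \<Lambda> \<Omega> {h})"
proof -
  have "ucls (uc_class \<Lambda> \<Omega> {h}) = uc_rel \<Lambda> \<Omega> `` {h}"
    using assms(5) by (auto simp: uc_class_def uc_rel_def eq_commute)
  then show "uc_class \<Lambda> \<Omega> {h} \<in> uc2"
    using assms quotientI[OF assms(5), of "uc_rel \<Lambda> \<Omega>"] by (simp add: uc2_def uc_class_def)
  show "represents h (uc_class \<Lambda> \<Omega> {h})"
    using assms(5) by (auto simp: represents_def uc_class_def)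
qed

section \<open>\<Psi> on the operations of 2-cells\<close>

lemma Psi2_id:
  assumes "conn b \<Gamma> \<Delta> \<Lambda>"
  shows "Psi2 b (uc_id2 \<Lambda>) = corr_id2 (Psi1 b \<Lambda>)"
proof -
  interpret P: parallel b \<Gamma> \<Delta> \<Lambda> \<Lambda> by (intro parallel.intro assms)
  have "represents (\<lambda>k. \<lambda>a\<in>obj (cats \<Gamma> k). idn (cats \<Delta> k) (fob (ufun \<Lambda> k) a)) (uc_id2 \<Lambda>)"
    unfolding uc_id2_def using id_seq(1)[OF assms] by (intro P.represents_class) auto
  then show ?thesis
    using P.Psi2_eq[of "uc_id2 \<Lambda>"] id_seq(2)[OF assms] by (simp add: uc_id2_def uc_class_def corr_id2_def)
qed

lemma Psi2_vert:
  assumes "parallel b \<Gamma> \<Delta> \<Lambda> \<Omega>" "parallel b \<Gamma> \<Delta> \<Omega> \<Theta>"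
    and \<alpha>: "usrc \<alpha> = \<Lambda>" "utgt \<alpha> = \<Omega>" and h: "represents h \<alpha>"
    and \<beta>: "usrc \<beta> = \<Omega>" "utgt \<beta> = \<Theta>" and g: "represents g \<beta>"
  shows "Psi2 b (uc_vert \<beta> \<alpha>) = corr_vert (Psi2 b \<beta>) (Psi2 b \<alpha>)"
proof -
  interpret P: parallel b \<Gamma> \<Delta> \<Lambda> \<Omega> by fact
  interpret Q: parallel b \<Gamma> \<Delta> \<Omega> \<Theta> by fact
  interpret R: parallel b \<Gamma> \<Delta> \<Lambda> \<Theta> by unfold_locales
  have hg: "h \<in> uc_seqs \<Lambda> \<Omega>" "g \<in> uc_seqs \<Omega> \<Theta>" using h g \<alpha> \<beta> by (auto simp: represents_def)
  note seq = vert_seq[OF P.L.conn_axioms P.O.conn_axioms Q.O.conn_axioms]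
  let ?gh = "\<lambda>g h k. \<lambda>a\<in>obj (cats \<Gamma> k). cmp (cats \<Delta> k) (g k a) (h k a)"
  have vd: "uc_vert \<beta> \<alpha> = uc_class \<Lambda> \<Theta> {?gh g h | g h. g \<in> ucls \<beta> \<and> h \<in> ucls \<alpha>}"
    by (simp add: uc_vert_def \<alpha> \<beta>)
  have "represents (?gh g h) (uc_vert \<beta> \<alpha>)"
    unfolding vd
    by (rule R.represents_class2[OF g h]) (use seq(1) in \<open>simp_all add: \<alpha> \<beta> del: restrict_apply\<close>)
  then have "Psi2 b (uc_vert \<beta> \<alpha>) = \<lparr>csrc = P.L.H, ctgt = Q.O.H, cmap = seq_map b \<Lambda> \<Theta> (?gh g h)\<rparr>"
    by (rule R.Psi2_eq[rotated 2]) (simp_all add: vd uc_class_def)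
  then show ?thesis
    unfolding P.Psi2_eq[OF \<alpha> h] Q.Psi2_eq[OF \<beta> g] seq(2)[OF hg] by (simp add: corr_vert_def)
qed

lemma Psi2_add:
  assumes "parallel b \<Gamma> \<Delta> \<Lambda> \<Omega>"
    and \<alpha>: "usrc \<alpha> = \<Lambda>" "utgt \<alpha> = \<Omega>" and h: "represents h \<alpha>"
    and \<beta>: "usrc \<beta> = \<Lambda>" "utgt \<beta> = \<Omega>" and g: "represents g \<beta>"
  shows "Psi2 b (uc_add \<beta> \<alpha>) = corr_add (Psi2 b \<beta>) (Psi2 b \<alpha>)"
proof -
  interpret P: parallel b \<Gamma> \<Delta> \<Lambda> \<Omega> by fact
  have hg: "h \<in> uc_seqs \<Lambda> \<Omega>" "g \<in> uc_seqs \<Lambda> \<Omega>" using h g \<alpha> \<beta> by (auto simp: represents_def)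
  note seq = add_seq[OF P.L.conn_axioms P.O.conn_axioms]
  let ?gh = "\<lambda>g h k. \<lambda>a\<in>obj (cats \<Gamma> k). pls (cats \<Delta> k) (g k a) (h k a)"
  have vd: "uc_add \<beta> \<alpha> = uc_class \<Lambda> \<Omega> {?gh g h | g h. g \<in> ucls \<beta> \<and> h \<in> ucls \<alpha>}"
    by (simp add: uc_add_def \<alpha> \<beta>)
  have "represents (?gh g h) (uc_add \<beta> \<alpha>)"
    unfolding vd
    by (rule P.represents_class2[OF g h]) (use seq(1) in \<open>simp_all add: \<alpha> \<beta> del: restrict_apply\<close>)
  then have "Psi2 b (uc_add \<beta> \<alpha>) = \<lparr>csrc = P.L.H, ctgt = P.O.H, cmap = seq_map b \<Lambda> \<Omega> (?gh g h)\<rparr>"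
    by (rule P.Psi2_eq[rotated 2]) (simp_all add: vd uc_class_def)
  then show ?thesis
    unfolding P.Psi2_eq[OF \<alpha> h] P.Psi2_eq[OF \<beta> g] seq(2)[OF hg] by (simp add: corr_add_def)
qed

lemma Psi2_scale:
  assumes "parallel b \<Gamma> \<Delta> \<Lambda> \<Omega>"
    and \<alpha>: "usrc \<alpha> = \<Lambda>" "utgt \<alpha> = \<Omega>" and h: "represents h \<alpha>"
  shows "Psi2 b (uc_scale z \<alpha>) = corr_scale z (Psi2 b \<alpha>)"
proof -
  interpret P: parallel b \<Gamma> \<Delta> \<Lambda> \<Omega> by fact
  have hs: "h \<in> uc_seqs \<Lambda> \<Omega>" using h \<alpha> by (auto simp: represents_def)
  let ?gh = "\<lambda>h k. \<lambda>a\<in>obj (cats \<Gamma> k). scl (cats \<Delta> k) z (h k a)"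
  have vd: "uc_scale z \<alpha> = uc_class \<Lambda> \<Omega> {?gh h | h. h \<in> ucls \<alpha>}"
    by (simp add: uc_scale_def \<alpha>)
  have "represents (?gh h) (uc_scale z \<alpha>)"
    unfolding vd
    by (rule P.represents_class1[OF h]) (use scale_seq(1)[OF P.L.conn_axioms P.O.conn_axioms] in \<open>simp_all add: \<alpha> del: restrict_apply\<close>)
  then have "Psi2 b (uc_scale z \<alpha>) = \<lparr>csrc = P.L.H, ctgt = P.O.H, cmap = seq_map b \<Lambda> \<Omega> (?gh h)\<rparr>"
    by (rule P.Psi2_eq[rotated 2]) (simp_all add: vd uc_class_def)
  then show ?thesis
    unfolding P.Psi2_eq[OF \<alpha> h] scale_seq(2)[OF P.L.conn_axioms P.O.conn_axioms hs] by (simp add: corr_scale_def)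
qed

lemma Psi2_star:
  assumes "parallel b \<Gamma> \<Delta> \<Lambda> \<Omega>"
    and \<alpha>: "usrc \<alpha> = \<Lambda>" "utgt \<alpha> = \<Omega>" and h: "represents h \<alpha>"
  shows "Psi2 b (uc_star \<alpha>) = corr_star (Psi2 b \<alpha>)"
proof -
  interpret P: parallel b \<Gamma> \<Delta> \<Lambda> \<Omega> by fact
  interpret Q: parallel b \<Gamma> \<Delta> \<Omega> \<Lambda> by unfold_locales
  have hs: "h \<in> uc_seqs \<Lambda> \<Omega>" using h \<alpha> by (auto simp: represents_def)
  let ?gh = "\<lambda>h k. \<lambda>a\<in>obj (cats \<Gamma> k). adj (cats \<Delta> k) (h k a)"
  have vd: "uc_star \<alpha> = uc_class \<Omega> \<Lambda> {?gh h | h. h \<in> ucls \<alpha>}"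
    by (simp add: uc_star_def \<alpha>)
  have "represents (?gh h) (uc_star \<alpha>)"
    unfolding vd
    by (rule Q.represents_class1[OF h]) (use P.adjoint_seq in \<open>simp_all add: \<alpha> del: restrict_apply\<close>)
  then have 1: "Psi2 b (uc_star \<alpha>) = \<lparr>csrc = P.O.H, ctgt = P.L.H, cmap = seq_map b \<Omega> \<Lambda> (?gh h)\<rparr>"
    by (rule Q.Psi2_eq[rotated 2]) (simp_all add: vd uc_class_def)
  have "(THE S. adjoint_maps P.L.H P.O.H (seq_map b \<Lambda> \<Omega> h) S) = seq_map b \<Omega> \<Lambda> (?gh h)"
    by (rule the_equality[where P = "adjoint_maps P.L.H P.O.H (seq_map b \<Lambda> \<Omega> h)", OF P.seq_map_adjoint[OF hs]])
      (rule adjoint_maps_unique[OF P.L.H_right_correspondence P.seq_map_funcset[OF hs] _ P.seq_map_adjoint[OF hs]])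
  then show ?thesis unfolding 1 P.Psi2_eq[OF \<alpha> h] by (simp add: corr_star_def)
qed

lemma (in parallel) Psi2_Hom2:
  assumes "usrc \<alpha> = \<Lambda>" "utgt \<alpha> = \<Omega>" "represents h \<alpha>"
  shows "Psi2 b \<alpha> \<in> Hom2 CORR L.H O.H"
proof -
  have "h \<in> uc_seqs \<Lambda> \<Omega>" using assms by (auto simp: represents_def)
  then show ?thesis
    using seq_map_intertwiner L.H_right_correspondence O.H_right_correspondence
    by (simp add: Psi2_eq[OF assms] Hom2_def CORR_def corr2_def)
qed

text \<open>Both sides send a formal sum to the value of one intertwiner at its sum in the
  correspondence of the source composite; \<open>horiz_seq\<close> supplies this on simple
  tensors.\<close>

lemma Psi2_horiz:
  assumes "parallel b \<Gamma> \<Delta> \<Lambda>1 \<Lambda>2" "parallel b \<Delta> \<Sigma> \<Omega>1 \<Omega>2"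
    and \<alpha>: "usrc \<alpha> = \<Lambda>1" "utgt \<alpha> = \<Lambda>2" and h: "represents h \<alpha>"
    and \<beta>: "usrc \<beta> = \<Omega>1" "utgt \<beta> = \<Omega>2" and g: "represents g \<beta>"
  shows "corr_vert (compare b \<Omega>2 \<Lambda>2) (corr_tensor2 (Psi2 b \<alpha>) (Psi2 b \<beta>)) =
    corr_vert (Psi2 b (uc_horiz \<beta> \<alpha>)) (compare b \<Omega>1 \<Lambda>1)"
proof -
  interpret P: parallel b \<Gamma> \<Delta> \<Lambda>1 \<Lambda>2 by fact
  interpret Q: parallel b \<Delta> \<Sigma> \<Omega>1 \<Omega>2 by fact
  interpret S: composable b \<Gamma> \<Delta> \<Sigma> \<Lambda>1 \<Omega>1 by unfold_locales
  interpret T: composable b \<Gamma> \<Delta> \<Sigma> \<Lambda>2 \<Omega>2 by unfold_locales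
  interpret R: parallel b \<Gamma> \<Sigma> "uc_comp \<Omega>1 \<Lambda>1" "uc_comp \<Omega>2 \<Lambda>2" by unfold_locales
  have hg: "h \<in> uc_seqs \<Lambda>1 \<Lambda>2" "g \<in> uc_seqs \<Omega>1 \<Omega>2" using h g \<alpha> \<beta> by (auto simp: represents_def)
  note seq = horiz_seq[OF P.L.conn_axioms P.O.conn_axioms Q.L.conn_axioms Q.O.conn_axioms]
  let ?gh = "\<lambda>g h k. \<lambda>a\<in>obj (cats \<Gamma> k). cmp (cats \<Sigma> k) (fmp (ufun \<Omega>2 k) (h k a)) (g k (fob (ufun \<Lambda>1 k) a))"
  have vd: "uc_horiz \<beta> \<alpha> = uc_class (uc_comp \<Omega>1 \<Lambda>1) (uc_comp \<Omega>2 \<Lambda>2) {?gh g h | g h. g \<in> ucls \<beta> \<and> h \<in> ucls \<alpha>}"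
    by (simp add: uc_horiz_def \<alpha> \<beta>)
  have "represents (?gh g h) (uc_horiz \<beta> \<alpha>)"
    unfolding vd
    by (rule R.represents_class2[OF g h]) (use seq(1) in \<open>simp_all add: \<alpha> \<beta> del: restrict_apply\<close>)
  then have horiz: "Psi2 b (uc_horiz \<beta> \<alpha>) = \<lparr>csrc = S.C.H, ctgt = T.C.H,
      cmap = seq_map b (uc_comp \<Omega>1 \<Lambda>1) (uc_comp \<Omega>2 \<Lambda>2) (?gh g h)\<rparr>"
    by (rule R.Psi2_eq[rotated 2]) (simp_all add: vd uc_class_def)
  let ?T = "seq_map b (uc_comp \<Omega>1 \<Lambda>1) (uc_comp \<Omega>2 \<Lambda>2) (?gh g h)"
  note P2 = P.Psi2_eq[OF \<alpha> h] Q.Psi2_eq[OF \<beta> g]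
  have gh: "?gh g h \<in> uc_seqs (uc_comp \<Omega>1 \<Lambda>1) (uc_comp \<Omega>2 \<Lambda>2)" by (rule seq(1)[OF hg])
  have T: "\<And>x y. x \<in> hcar S.C.H \<Longrightarrow> y \<in> hcar S.C.H \<Longrightarrow> ?T (hadd S.C.H x y) = hadd T.C.H (?T x) (?T y)"
    "\<And>z x. x \<in> hcar S.C.H \<Longrightarrow> ?T (hscl S.C.H z x) = hscl T.C.H z (?T x)"
    using R.seq_map_intertwiner[OF gh] unfolding intertwiners_def by blast+
  have T0: "?T (hzero S.C.H) = hzero T.C.H"
    using T(2)[of "hzero S.C.H" 0] PiE_mem[OF R.seq_map_funcset[OF gh] S.B.K.V.zero_closed] by simp
  have "T.B.tmap (cmap (corr_tensor2 (Psi2 b \<alpha>) (Psi2 b \<beta>)) x) = ?T (S.B.tmap x)"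
    if x: "x \<in> hcar (tensor P.L.H Q.L.H)" for x
  proof -
    have *: "map (\<lambda>(\<xi>, \<zeta>). (seq_map b \<Lambda>1 \<Lambda>2 h \<xi>, seq_map b \<Omega>1 \<Omega>2 g \<zeta>)) (terms x)
        \<in> tens_sums P.O.H Q.O.H \<and>
        T.B.tsum (map (\<lambda>(\<xi>, \<zeta>). (seq_map b \<Lambda>1 \<Lambda>2 h \<xi>, seq_map b \<Omega>1 \<Omega>2 g \<zeta>)) (terms x))
        = ?T (S.B.tsum (terms x))"
      by (rule tsum_transfer[OF S.balanced T.balanced _ _ T0 T(1) seq(2)[OF hg, symmetric] S.B.terms_tensor[OF x]])
        (use PiE_mem[OF P.seq_map_funcset[OF hg(1)]] PiE_mem[OF Q.seq_map_funcset[OF hg(2)]] in auto)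
    then have "T.B.tmap (cmap (corr_tensor2 (Psi2 b \<alpha>) (Psi2 b \<beta>)) x) = ?T (S.B.tsum (terms x))"
      using tmap_tensor2(2)[OF S.balanced T.balanced, of "Psi2 b \<alpha>" "Psi2 b \<beta>" x] x by (simp add: P2)
    then show ?thesis using x by (simp add: S.B.tmap_eq)
  qed
  then have "compose (hcar (tensor P.L.H Q.L.H)) T.B.tmap (cmap (corr_tensor2 (Psi2 b \<alpha>) (Psi2 b \<beta>))) =
      compose (hcar (tensor P.L.H Q.L.H)) ?T S.B.tmap"
    by (auto simp: compose_def restrict_def)
  moreover have "csrc (corr_tensor2 (Psi2 b \<alpha>) (Psi2 b \<beta>)) = tensor P.L.H Q.L.H"
    by (simp add: corr_tensor2_def P2)
  ultimately show ?thesis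
    unfolding S.compare_eq T.compare_eq horiz by (simp add: corr_vert_def)
qed

text \<open>Both composites send an element of the triple tensor product to the sum of its triple
  products. By strict associativity of 1-cells this sum lies in the same correspondence for both
  bracketings, and \<open>bal_assoc\<close> identifies the summands.\<close>

lemma Psi_assoc:
  assumes "conn b \<Gamma> \<Delta> \<Lambda>" "conn b \<Delta> \<Sigma> \<Omega>" "conn b \<Sigma> \<Xi> \<Theta>"
  shows "corr_vert (Psi2 b (uc_id2 (uc_comp \<Theta> (uc_comp \<Omega> \<Lambda>))))
      (corr_vert (compare b (uc_comp \<Theta> \<Omega>) \<Lambda>) (corr_tensor2 (corr_id2 (Psi1 b \<Lambda>)) (compare b \<Theta> \<Omega>))) =
    corr_vert (compare b \<Theta> (uc_comp \<Omega> \<Lambda>))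
      (corr_vert (corr_tensor2 (compare b \<Omega> \<Lambda>) (corr_id2 (Psi1 b \<Theta>)))
        (corr_reassoc (Psi1 b \<Lambda>) (Psi1 b \<Omega>) (Psi1 b \<Theta>)))"
proof -
  interpret S: composable b \<Gamma> \<Delta> \<Sigma> \<Lambda> \<Omega> by (intro composable.intro assms)
  interpret T: composable b \<Delta> \<Sigma> \<Xi> \<Omega> \<Theta> by (intro composable.intro assms)
  interpret S': composable b \<Gamma> \<Sigma> \<Xi> "uc_comp \<Omega> \<Lambda>" \<Theta>
    by (intro composable.intro assms S.C.conn_axioms)
  interpret T': composable b \<Gamma> \<Delta> \<Xi> \<Lambda> "uc_comp \<Theta> \<Omega>"
    by (intro composable.intro assms T.C.conn_axioms)
  let ?F = "Psi1 b \<Lambda>" and ?G = "Psi1 b \<Omega>" and ?K = "Psi1 b \<Theta>"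
  note assoc = uc_comp_assoc[OF assms]
  \<comment> \<open>\<open>L\<close> and \<open>R\<close> present the two bracketings of the triple
    tensor product by balanced maps to one correspondence.\<close>
  have L: "balanced ?F (tensor ?G ?K) S'.C.H (\<lambda>\<xi> y. bal b \<Lambda> (uc_comp \<Theta> \<Omega>) \<xi> (T.B.tmap y))"
    using balanced_iso_right[OF T'.balanced T.tmap_corr_iso] by (simp only: assoc)
  have R: "balanced (tensor ?F ?G) ?K S'.C.H (\<lambda>w. bal b (uc_comp \<Omega> \<Lambda>) \<Theta> (S.B.tmap w))"
    by (rule balanced_iso_left[OF S'.balanced S.tmap_corr_iso])
  interpret L: balanced ?F "tensor ?G ?K" S'.C.H "\<lambda>\<xi> y. bal b \<Lambda> (uc_comp \<Theta> \<Omega>) \<xi> (T.B.tmap y)" by (rule L)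
  interpret R: balanced "tensor ?F ?G" ?K S'.C.H "\<lambda>w. bal b (uc_comp \<Omega> \<Lambda>) \<Theta> (S.B.tmap w)" by (rule R)
  have tm: "T.B.tmap y \<in> hcar T.C.H" if "y \<in> hcar (tensor ?G ?K)" for y
    using that by (simp add: T.B.tmap_eq)
  have sm: "S.B.tmap y \<in> hcar S.C.H" if "y \<in> hcar (tensor ?F ?G)" for y
    using that by (simp add: S.B.tmap_eq)
  \<comment> \<open>The part of the list in \<open>corr_reassoc\<close> that stems from one pair of
    the outer sum.\<close>
  define expand where "expand = (\<lambda>(\<xi>, y). map (\<lambda>(\<zeta>, \<kappa>). (tens_cls ?F ?G [(\<xi>, \<zeta>)], \<kappa>)) (terms y))"
  have inner: "map (\<lambda>(\<zeta>, \<kappa>). (tens_cls ?F ?G [(\<xi>, \<zeta>)], \<kappa>)) t \<in> tens_sums (tensor ?F ?G) ?K \<and>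
      R.tsum (map (\<lambda>(\<zeta>, \<kappa>). (tens_cls ?F ?G [(\<xi>, \<zeta>)], \<kappa>)) t) = bal b \<Lambda> (uc_comp \<Theta> \<Omega>) \<xi> (T.B.tsum t)"
    if \<xi>: "\<xi> \<in> hcar ?F" and t: "t \<in> tens_sums ?G ?K" for \<xi> t
    using t
  proof (induction t)
    case Nil
    then show ?case using T'.bal_hzero_right[OF \<xi>] by (simp add: assoc)
  next
    case (Cons p t)
    obtain \<zeta> \<kappa> where p: "p = (\<zeta>, \<kappa>)" by (cases p)
    have *: "\<zeta> \<in> hcar ?G" "\<kappa> \<in> hcar ?K" "t \<in> tens_sums ?G ?K" using Cons.prems by (auto simp: p)
    have "bal b \<Lambda> (uc_comp \<Theta> \<Omega>) \<xi> (hadd T.C.H (bal b \<Omega> \<Theta> \<zeta> \<kappa>) (T.B.tsum t)) =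
       hadd T'.C.H (bal b \<Lambda> (uc_comp \<Theta> \<Omega>) \<xi> (bal b \<Omega> \<Theta> \<zeta> \<kappa>)) (bal b \<Lambda> (uc_comp \<Theta> \<Omega>) \<xi> (T.B.tsum t))"
      using * \<xi> by (intro T'.bal_hadd_right) simp_all
    moreover have "hadd S.C.H (bal b \<Lambda> \<Omega> \<xi> \<zeta>) (hzero S.C.H) = bal b \<Lambda> \<Omega> \<xi> \<zeta>"
      using * \<xi> by (intro S.B.K.V.add_0_right) simp
    ultimately show ?case
      using Cons.IH[OF *(3)] * \<xi> bal_assoc[OF assms \<xi> *(1,2)] by (simp add: p assoc)
  qed
  have outer: "concat (map expand s) \<in> tens_sums (tensor ?F ?G) ?K \<and> R.tsum (concat (map expand s)) = L.tsum s"
    if "s \<in> tens_sums ?F (tensor ?G ?K)" for s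
    using that
  proof (induction s)
    case Nil
    then show ?case by (simp add: assoc)
  next
    case (Cons p s)
    obtain \<xi> y where p: "p = (\<xi>, y)" by (cases p)
    have *: "\<xi> \<in> hcar ?F" "y \<in> hcar (tensor ?G ?K)" "s \<in> tens_sums ?F (tensor ?G ?K)" using Cons.prems by (auto simp: p)
    then show ?case
      using Cons.IH inner[of \<xi> "terms y"] by (simp add: p expand_def T.B.tmap_eq assoc)
  qed
  let ?id = "\<lambda>\<Lambda>. corr_id2 (Psi1 b \<Lambda>)"
  have "cmap (Psi2 b (uc_id2 (uc_comp \<Theta> (uc_comp \<Omega> \<Lambda>))))
        (T'.B.tmap (cmap (corr_tensor2 (?id \<Lambda>) (compare b \<Theta> \<Omega>)) x)) =
      S'.B.tmap (cmap (corr_tensor2 (compare b \<Omega> \<Lambda>) (?id \<Theta>)) (cmap (corr_reassoc ?F ?G ?K) x))"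
    if x: "x \<in> hcar (tensor ?F (tensor ?G ?K))" for x
  proof -
    have tx: "terms x \<in> tens_sums ?F (tensor ?G ?K)" using x by simp
    have 1: "map (\<lambda>(\<xi>, \<zeta>). (cmap (?id \<Lambda>) \<xi>, cmap (compare b \<Theta> \<Omega>) \<zeta>)) (terms x) \<in> tens_sums ?F T.C.H \<and>
        T'.B.tsum (map (\<lambda>(\<xi>, \<zeta>). (cmap (?id \<Lambda>) \<xi>, cmap (compare b \<Theta> \<Omega>) \<zeta>)) (terms x)) = L.tsum (terms x)"
      by (rule tsum_transfer[OF L T'.balanced _ _ _ _ _ tx, where T = "\<lambda>x. x"])
        (simp_all add: corr_id2_def T.compare_eq tm assoc)
    have lhs: "T'.B.tmap (cmap (corr_tensor2 (?id \<Lambda>) (compare b \<Theta> \<Omega>)) x) = L.tsum (terms x)"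
      using tmap_tensor2(2)[OF L T'.balanced _ _ _ _ x, of "?id \<Lambda>" "compare b \<Theta> \<Omega>"] 1
      by (simp add: corr_id2_def T.compare_eq)
    define z where "z = cmap (corr_reassoc ?F ?G ?K) x"
    have z: "z = tens_cls (tensor ?F ?G) ?K (concat (map expand (terms x)))"
      using x by (simp add: z_def corr_reassoc_def expand_def)
    have zt: "z \<in> hcar (tensor (tensor ?F ?G) ?K)" "R.tsum (terms z) = L.tsum (terms x)"
      using outer[OF tx] by (simp_all add: z R.tens_cls)
    have 2: "map (\<lambda>(\<xi>, \<zeta>). (cmap (compare b \<Omega> \<Lambda>) \<xi>, cmap (?id \<Theta>) \<zeta>)) (terms z) \<in> tens_sums S.C.H ?K \<and>
        S'.B.tsum (map (\<lambda>(\<xi>, \<zeta>). (cmap (compare b \<Omega> \<Lambda>) \<xi>, cmap (?id \<Theta>) \<zeta>)) (terms z)) = R.tsum (terms z)"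
      by (rule tsum_transfer[OF R S'.balanced _ _ _ _ _ R.terms_tensor[OF zt(1)], where T = "\<lambda>x. x"])
        (simp_all add: corr_id2_def S.compare_eq sm)
    have rhs: "S'.B.tmap (cmap (corr_tensor2 (compare b \<Omega> \<Lambda>) (?id \<Theta>)) z) = L.tsum (terms x)"
      using tmap_tensor2(2)[OF R S'.balanced _ _ _ _ zt(1), of "compare b \<Omega> \<Lambda>" "?id \<Theta>"] 2 zt(2)
      by (simp add: corr_id2_def S.compare_eq)
    \<comment> \<open>The identity 2-cell is a restricted function, so membership in the carrier is
      what makes it fix the sum.\<close>
    have "L.tsum (terms x) \<in> hcar S'.C.H" by (rule L.tsum_closed[OF tx])
    then show ?thesis
      unfolding lhs z_def[symmetric] rhs Psi2_id[OF S'.C.conn_axioms] by (simp add: corr_id2_def)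
  qed
  note pointwise = this
  have "csrc (corr_tensor2 (?id \<Lambda>) (compare b \<Theta> \<Omega>)) = tensor ?F (tensor ?G ?K)"
    by (simp add: corr_tensor2_def corr_id2_def T.compare_eq)
  moreover have "csrc (corr_reassoc ?F ?G ?K) = tensor ?F (tensor ?G ?K)" by (simp add: corr_reassoc_def)
  moreover have "ctgt (Psi2 b (uc_id2 (uc_comp \<Theta> (uc_comp \<Omega> \<Lambda>)))) = S'.C.H"
    unfolding Psi2_id[OF S'.C.conn_axioms] by (simp add: corr_id2_def)
  ultimately show ?thesis
    using pointwise
    by (intro corr_vert_vert_eqI) (simp_all add: corr_vert_vert S'.compare_eq T'.compare_eq)
qed

text \<open>By \<open>bal_unit_left\<close> both sides send a formal sum of pairs \<xi>, c to the
  sum of the products \<xi> c. The order of the tensor factors matches the left unitor of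
  \<open>UC\<close> with the right unit of the tensor product.\<close>

lemma Psi_unit_left:
  assumes "conn b \<Gamma> \<Delta> \<Lambda>"
  shows "corr_vert (Psi2 b (uc_id2 \<Lambda>))
      (corr_vert (compare b (uc_id1 \<Delta>) \<Lambda>) (corr_tensor2 (corr_id2 (Psi1 b \<Lambda>)) (unit_cell b \<Delta>))) =
    corr_unit_right (Psi1 b \<Lambda>)"
proof -
  interpret L: conn b \<Gamma> \<Delta> \<Lambda> by fact
  interpret I: conn b \<Delta> \<Delta> "uc_id1 \<Delta>" by (rule conn_id) unfold_locales
  interpret S: composable b \<Gamma> \<Delta> \<Delta> \<Lambda> "uc_id1 \<Delta>" by unfold_locales
  let ?U = "corr_id1 (Psi0 b \<Delta>)"
  have B: "balanced L.H ?U S.C.H (\<lambda>\<xi> \<zeta>. bal b \<Lambda> (uc_id1 \<Delta>) \<xi> ((\<lambda>x\<in>hcar ?U. x) \<zeta>))"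
    by (rule balanced_iso_right[OF S.balanced L.C.id_corr_iso])
  interpret B: balanced L.H ?U S.C.H "\<lambda>\<xi> \<zeta>. bal b \<Lambda> (uc_id1 \<Delta>) \<xi> ((\<lambda>x\<in>hcar ?U. x) \<zeta>)" by (rule B)
  have "cmap (Psi2 b (uc_id2 \<Lambda>)) (S.B.tmap (cmap (corr_tensor2 (corr_id2 L.H) (unit_cell b \<Delta>)) x)) =
      cmap (corr_unit_right L.H) x" if x: "x \<in> hcar (tensor L.H ?U)" for x
  proof -
    have tx: "terms x \<in> tens_sums L.H ?U" using x by simp
    have 1: "map (\<lambda>(\<xi>, \<zeta>). (cmap (corr_id2 L.H) \<xi>, cmap (unit_cell b \<Delta>) \<zeta>)) (terms x) \<in> tens_sums L.H I.H \<and>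
        S.B.tsum (map (\<lambda>(\<xi>, \<zeta>). (cmap (corr_id2 L.H) \<xi>, cmap (unit_cell b \<Delta>) \<zeta>)) (terms x)) = B.tsum (terms x)"
      by (rule tsum_transfer[OF B S.balanced _ _ _ _ _ tx, where T = "\<lambda>x. x"])
        (simp_all add: corr_id2_def unit_cell_def L.C.id_hcar)
    have 2: "S.B.tmap (cmap (corr_tensor2 (corr_id2 L.H) (unit_cell b \<Delta>)) x) = B.tsum (terms x)"
      using tmap_tensor2(2)[OF B S.balanced _ _ _ _ x, of "corr_id2 L.H" "unit_cell b \<Delta>"] 1
      by (simp add: corr_id2_def unit_cell_def)
    have 3: "B.tsum s = lsum (hadd L.H) (hzero L.H) (map (\<lambda>(\<xi>, c). ract L.H \<xi> (elem c)) s)"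
      if "s \<in> tens_sums L.H ?U" for s
    proof -
      have "map (\<lambda>(\<xi>, \<zeta>). bal b \<Lambda> (uc_id1 \<Delta>) \<xi> ((\<lambda>x\<in>hcar ?U. x) \<zeta>)) s = map (\<lambda>(\<xi>, c). ract L.H \<xi> (elem c)) s"
        using that by (auto simp: tens_sums_def L.bal_unit_left)
      then show ?thesis unfolding B.tsum_def unfolding L.uc_comp_id_left by (simp only:)
    qed
    note B.tsum_closed[OF tx, unfolded 3[OF tx], unfolded L.uc_comp_id_left]
    then show ?thesis
      unfolding 2 3[OF tx] Psi2_id[OF assms] using x by (simp add: corr_id2_def corr_unit_right_def)
  qed
  note pointwise = this
  have "csrc (corr_tensor2 (corr_id2 L.H) (unit_cell b \<Delta>)) = tensor L.H ?U"
    by (simp add: corr_tensor2_def corr_id2_def unit_cell_def)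
  moreover have "csrc (corr_unit_right L.H) = tensor L.H ?U" "ctgt (corr_unit_right L.H) = L.H"
    "cmap (corr_unit_right L.H) \<in> extensional (hcar (tensor L.H ?U))"
    by (simp_all add: corr_unit_right_def)
  moreover have "ctgt (Psi2 b (uc_id2 \<Lambda>)) = L.H"
    unfolding Psi2_id[OF assms] by (simp add: corr_id2_def)
  ultimately show ?thesis
    using pointwise by (intro corr_vert_vert_eqI) (simp_all add: S.compare_eq)
qed

lemma Psi_unit_right:
  assumes "conn b \<Gamma> \<Delta> \<Lambda>"
  shows "corr_vert (Psi2 b (uc_id2 \<Lambda>))
      (corr_vert (compare b \<Lambda> (uc_id1 \<Gamma>)) (corr_tensor2 (unit_cell b \<Gamma>) (corr_id2 (Psi1 b \<Lambda>)))) =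
    corr_unit_left (Psi1 b \<Lambda>)"
proof -
  interpret L: conn b \<Gamma> \<Delta> \<Lambda> by fact
  interpret I: conn b \<Gamma> \<Gamma> "uc_id1 \<Gamma>" by (rule conn_id) unfold_locales
  interpret S: composable b \<Gamma> \<Gamma> \<Delta> "uc_id1 \<Gamma>" \<Lambda> by unfold_locales
  let ?U = "corr_id1 (Psi0 b \<Gamma>)"
  have B: "balanced ?U L.H S.C.H (\<lambda>\<xi>. bal b (uc_id1 \<Gamma>) \<Lambda> ((\<lambda>x\<in>hcar ?U. x) \<xi>))"
    by (rule balanced_iso_left[OF S.balanced L.D.id_corr_iso])
  interpret B: balanced ?U L.H S.C.H "\<lambda>\<xi>. bal b (uc_id1 \<Gamma>) \<Lambda> ((\<lambda>x\<in>hcar ?U. x) \<xi>)" by (rule B)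
  have "cmap (Psi2 b (uc_id2 \<Lambda>)) (S.B.tmap (cmap (corr_tensor2 (unit_cell b \<Gamma>) (corr_id2 L.H)) x)) =
      cmap (corr_unit_left L.H) x" if x: "x \<in> hcar (tensor ?U L.H)" for x
  proof -
    have tx: "terms x \<in> tens_sums ?U L.H" using x by simp
    have 1: "map (\<lambda>(\<xi>, \<zeta>). (cmap (unit_cell b \<Gamma>) \<xi>, cmap (corr_id2 L.H) \<zeta>)) (terms x) \<in> tens_sums I.H L.H \<and>
        S.B.tsum (map (\<lambda>(\<xi>, \<zeta>). (cmap (unit_cell b \<Gamma>) \<xi>, cmap (corr_id2 L.H) \<zeta>)) (terms x)) = B.tsum (terms x)"
      by (rule tsum_transfer[OF B S.balanced _ _ _ _ _ tx, where T = "\<lambda>x. x"])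
        (simp_all add: corr_id2_def unit_cell_def L.D.id_hcar)
    have 2: "S.B.tmap (cmap (corr_tensor2 (unit_cell b \<Gamma>) (corr_id2 L.H)) x) = B.tsum (terms x)"
      using tmap_tensor2(2)[OF B S.balanced _ _ _ _ x, of "unit_cell b \<Gamma>" "corr_id2 L.H"] 1
      by (simp add: corr_id2_def unit_cell_def)
    have 3: "B.tsum s = lsum (hadd L.H) (hzero L.H) (map (\<lambda>(a, \<xi>). lact L.H (elem a) \<xi>) s)"
      if "s \<in> tens_sums ?U L.H" for s
    proof -
      have "map (\<lambda>(\<xi>, \<zeta>). bal b (uc_id1 \<Gamma>) \<Lambda> ((\<lambda>x\<in>hcar ?U. x) \<xi>) \<zeta>) s = map (\<lambda>(a, \<xi>). lact L.H (elem a) \<xi>) s"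
        using that by (auto simp: tens_sums_def L.bal_unit_right)
      then show ?thesis unfolding B.tsum_def unfolding L.uc_comp_id_right by (simp only:)
    qed
    note B.tsum_closed[OF tx, unfolded 3[OF tx], unfolded L.uc_comp_id_right]
    then show ?thesis
      unfolding 2 3[OF tx] Psi2_id[OF assms] using x by (simp add: corr_id2_def corr_unit_left_def)
  qed
  note pointwise = this
  have "csrc (corr_tensor2 (unit_cell b \<Gamma>) (corr_id2 L.H)) = tensor ?U L.H"
    by (simp add: corr_tensor2_def corr_id2_def unit_cell_def)
  moreover have "csrc (corr_unit_left L.H) = tensor ?U L.H" "ctgt (corr_unit_left L.H) = L.H"
    "cmap (corr_unit_left L.H) \<in> extensional (hcar (tensor ?U L.H))"
    by (simp_all add: corr_unit_left_def)
  moreover have "ctgt (Psi2 b (uc_id2 \<Lambda>)) = L.H"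
    unfolding Psi2_id[OF assms] by (simp add: corr_id2_def)
  ultimately show ?thesis
    using pointwise by (intro corr_vert_vert_eqI) (simp_all add: S.compare_eq)
qed

text \<open>\<open>faithful\<close> yields eventual equality, which is the very relation divided out
  in a 2-cell; \<open>full\<close> yields a sequence whose class is the preimage.\<close>

lemma Psi2_bij:
  assumes parallel: "parallel b \<Gamma> \<Delta> \<Lambda> \<Omega>" and uc: "\<Lambda> \<in> uc1" "\<Omega> \<in> uc1"
  shows "bij_betw (Psi2 b) (Hom2 UC \<Lambda> \<Omega>) (Hom2 CORR (Psi1 b \<Lambda>) (Psi1 b \<Omega>))"
proof -
  interpret P: parallel b \<Gamma> \<Delta> \<Lambda> \<Omega> by fact
  have par: "udom \<Lambda> = udom \<Omega>" "ucod \<Lambda> = ucod \<Omega>" by simp_all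
  have Hom: "Hom2 UC \<Lambda> \<Omega> = {\<alpha> \<in> uc2. usrc \<alpha> = \<Lambda> \<and> utgt \<alpha> = \<Omega>}" by (simp add: Hom2_def UC_def)
  show ?thesis unfolding Hom
  proof (rule bij_betw_imageI)
    show "inj_on (Psi2 b) {\<alpha> \<in> uc2. usrc \<alpha> = \<Lambda> \<and> utgt \<alpha> = \<Omega>}"
    proof (rule inj_onI)
      fix \<alpha> \<beta> assume "\<alpha> \<in> {\<alpha> \<in> uc2. usrc \<alpha> = \<Lambda> \<and> utgt \<alpha> = \<Omega>}" "\<beta> \<in> {\<alpha> \<in> uc2. usrc \<alpha> = \<Lambda> \<and> utgt \<alpha> = \<Omega>}"
        and eq: "Psi2 b \<alpha> = Psi2 b \<beta>"
      then have \<alpha>: "\<alpha> \<in> uc2" "usrc \<alpha> = \<Lambda>" "utgt \<alpha> = \<Omega>" and \<beta>: "\<beta> \<in> uc2" "usrc \<beta> = \<Lambda>" "utgt \<beta> = \<Omega>" by auto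
      obtain h where h: "h \<in> uc_seqs \<Lambda> \<Omega>" "represents h \<alpha>" "ucls \<alpha> = uc_rel \<Lambda> \<Omega> `` {h}"
        by (rule uc2_representative[OF \<alpha>])
      obtain g where g: "g \<in> uc_seqs \<Lambda> \<Omega>" "represents g \<beta>" "ucls \<beta> = uc_rel \<Lambda> \<Omega> `` {g}"
        by (rule uc2_representative[OF \<beta>])
      have "seq_map b \<Lambda> \<Omega> h = seq_map b \<Lambda> \<Omega> g"
        using eq unfolding P.Psi2_eq[OF \<alpha>(2,3) h(2)] P.Psi2_eq[OF \<beta>(2,3) g(2)] by simp
      then have "\<forall>\<^sub>F k in sequentially. h k = g k" by (rule P.faithful[OF h(1) g(1)])
      then have "(h, g) \<in> uc_rel \<Lambda> \<Omega>" using h(1) g(1) by (simp add: uc_rel_def)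
      then have "ucls \<alpha> = ucls \<beta>" unfolding h(3) g(3) by (rule equiv_class_eq[OF equiv_uc_rel])
      then show "\<alpha> = \<beta>" using \<alpha> \<beta> by (intro ucell2.equality) auto
    qed
    show "Psi2 b ` {\<alpha> \<in> uc2. usrc \<alpha> = \<Lambda> \<and> utgt \<alpha> = \<Omega>} = Hom2 CORR P.L.H P.O.H"
    proof (intro equalityI subsetI)
      fix t assume "t \<in> Psi2 b ` {\<alpha> \<in> uc2. usrc \<alpha> = \<Lambda> \<and> utgt \<alpha> = \<Omega>}"
      then obtain \<alpha> where \<alpha>: "\<alpha> \<in> uc2" "usrc \<alpha> = \<Lambda>" "utgt \<alpha> = \<Omega>" "t = Psi2 b \<alpha>" by blast
      obtain h where "represents h \<alpha>" using uc2_represented[OF \<alpha>(1)] by blast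
      then show "t \<in> Hom2 CORR P.L.H P.O.H" unfolding \<alpha>(4) by (rule P.Psi2_Hom2[OF \<alpha>(2,3)])
    next
      fix t assume "t \<in> Hom2 CORR P.L.H P.O.H"
      then have t: "csrc t = P.L.H" "ctgt t = P.O.H" "cmap t \<in> intertwiners P.L.H P.O.H"
        by (auto simp: Hom2_def CORR_def corr2_def)
      obtain h where h: "h \<in> uc_seqs \<Lambda> \<Omega>" "seq_map b \<Lambda> \<Omega> h = cmap t" using P.full[OF t(3)] by blast
      note cls = class_uc2[OF uc par h(1)]
      have ends: "usrc (uc_class \<Lambda> \<Omega> {h}) = \<Lambda>" "utgt (uc_class \<Lambda> \<Omega> {h}) = \<Omega>" by (simp_all add: uc_class_def)
      have "t = Psi2 b (uc_class \<Lambda> \<Omega> {h})"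
        unfolding P.Psi2_eq[OF ends cls(2)] h(2) using t by (intro ccell2.equality) simp_all
      then show "t \<in> Psi2 b ` {\<alpha> \<in> uc2. usrc \<alpha> = \<Lambda> \<and> utgt \<alpha> = \<Omega>}" using cls(1) ends by blast
    qed
  qed
qed

theorem theorem3p15:
  fixes b :: "('o, 'm) cat \<Rightarrow> 'o"
  assumes "base_choice b"
  shows "two_functor UC CORR (Psi0 b) (Psi1 b) (Psi2 b) \<and>
         star_linear_on_2cells UC CORR (Psi2 b) \<and>
         fully_faithful_on_2cells UC CORR (Psi1 b) (Psi2 b)"
proof (intro conjI)
  note bc = assms
  note conn = conn_uc1[OF bc]
  have cells: "Cell0 UC = uc0" "Cell1 UC = uc1" "Cell2 UC = uc2" "Src1 UC = udom" "Tgt1 UC = ucod"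
    "Src2 UC = usrc" "Tgt2 UC = utgt" "Id1 UC = uc_id1" "Comp UC = uc_comp" "Id2 UC = uc_id2"
    "Vert UC = uc_vert" "Horiz UC = uc_horiz" "LUnit UC = uc_id2" "RUnit UC = uc_id2"
    "Assoc UC \<Theta> \<Omega> \<Lambda> = uc_id2 (uc_comp \<Theta> (uc_comp \<Omega> \<Lambda>))"
    "Add2 UC = uc_add" "Scale2 UC = uc_scale" "Star2 UC = uc_star"
    for \<Theta> \<Omega> \<Lambda> by (simp_all add: UC_def)
  have corr_cells: "Cell0 CORR = Collect afd_pre_cstar_algebra" "Cell1 CORR = Collect right_correspondence"
    "Src1 CORR = lalg" "Tgt1 CORR = ralg" "Id1 CORR = corr_id1" "Comp CORR G H = tensor H G"
    "Id2 CORR = corr_id2" "Vert CORR = corr_vert" "Horiz CORR t s = corr_tensor2 s t"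
    "Assoc CORR K G H = corr_reassoc H G K" "LUnit CORR = corr_unit_right" "RUnit CORR = corr_unit_left"
    "Add2 CORR = corr_add" "Scale2 CORR = corr_scale" "Star2 CORR = corr_star"
    for G H K :: "(nat \<times> 'm) set corr" and s t by (simp_all add: CORR_def)
  have "two_functor_with UC CORR (Psi0 b) (Psi1 b) (Psi2 b) (compare b) (unit_cell b)"
    unfolding two_functor_with_def cells corr_cells
  proof (intro conjI ballI allI impI)
    fix \<Gamma> :: "('o, 'm) ucell0" assume "\<Gamma> \<in> uc0"
    then interpret Z: zcell b \<Gamma> using bc by unfold_locales
    show "Psi0 b \<Gamma> \<in> Collect afd_pre_cstar_algebra" by (simp add: Z.A_afd)
    show "unit_cell b \<Gamma> \<in> Unitary2 CORR (corr_id1 (Psi0 b \<Gamma>)) (Psi1 b (uc_id1 \<Gamma>))"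
      by (rule Z.unit_cell_unitary)
  next
    fix \<Gamma> \<Delta> :: "('o, 'm) ucell0" and \<Lambda> assume "\<Lambda> \<in> Hom1 UC \<Gamma> \<Delta>"
    then have \<Lambda>: "\<Lambda> \<in> uc1" "udom \<Lambda> = \<Gamma>" "ucod \<Lambda> = \<Delta>" by (simp_all add: Hom1_def cells)
    interpret L: conn b \<Gamma> \<Delta> \<Lambda> using conn[OF \<Lambda>(1)] \<Lambda> by simp
    show "Psi1 b \<Lambda> \<in> Hom1 CORR (Psi0 b \<Gamma>) (Psi0 b \<Delta>)"
      using L.H_right_correspondence by (simp add: Hom1_def corr_cells)
  next
    fix \<Lambda> \<Omega> :: "('o, 'm) ucell1" and \<alpha> assume "\<alpha> \<in> Hom2 UC \<Lambda> \<Omega>"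
    then have \<alpha>: "\<alpha> \<in> uc2" "usrc \<alpha> = \<Lambda>" "utgt \<alpha> = \<Omega>" by (simp_all add: Hom2_def cells)
    have P: "parallel b (udom \<Lambda>) (ucod \<Lambda>) \<Lambda> \<Omega>" using uc2_parallel[OF bc \<alpha>(1)] \<alpha> by simp
    obtain h where "represents h \<alpha>" using uc2_represented[OF \<alpha>(1)] by blast
    then show "Psi2 b \<alpha> \<in> Hom2 CORR (Psi1 b \<Lambda>) (Psi1 b \<Omega>)" by (rule parallel.Psi2_Hom2[OF P \<alpha>(2,3)])
  next
    fix \<Lambda> :: "('o, 'm) ucell1" assume \<Lambda>: "\<Lambda> \<in> uc1"
    show "Psi2 b (uc_id2 \<Lambda>) = corr_id2 (Psi1 b \<Lambda>)" by (rule Psi2_id[OF conn[OF \<Lambda>]])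
    show "corr_vert (Psi2 b (uc_id2 \<Lambda>))
        (corr_vert (compare b (uc_id1 (ucod \<Lambda>)) \<Lambda>) (corr_tensor2 (corr_id2 (Psi1 b \<Lambda>)) (unit_cell b (ucod \<Lambda>)))) =
      corr_unit_right (Psi1 b \<Lambda>)" by (rule Psi_unit_left[OF conn[OF \<Lambda>]])
    show "corr_vert (Psi2 b (uc_id2 \<Lambda>))
        (corr_vert (compare b \<Lambda> (uc_id1 (udom \<Lambda>))) (corr_tensor2 (unit_cell b (udom \<Lambda>)) (corr_id2 (Psi1 b \<Lambda>)))) =
      corr_unit_left (Psi1 b \<Lambda>)" by (rule Psi_unit_right[OF conn[OF \<Lambda>]])
  next
    fix \<alpha> \<beta> :: "('o, 'm) ucell2" assume \<alpha>: "\<alpha> \<in> uc2" and \<beta>: "\<beta> \<in> uc2" and eq: "usrc \<beta> = utgt \<alpha>"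
    obtain h where h: "represents h \<alpha>" using uc2_represented[OF \<alpha>] by blast
    obtain g where g: "represents g \<beta>" using uc2_represented[OF \<beta>] by blast
    have "udom (utgt \<alpha>) = udom (usrc \<alpha>)" "ucod (utgt \<alpha>) = ucod (usrc \<alpha>)" using \<alpha> by (simp_all add: uc2_def)
    then have "parallel b (udom (usrc \<alpha>)) (ucod (usrc \<alpha>)) (utgt \<alpha>) (utgt \<beta>)"
      using uc2_parallel[OF bc \<beta>] by (simp add: eq)
    from Psi2_vert[OF uc2_parallel[OF bc \<alpha>] this refl refl h eq refl g]
    show "Psi2 b (uc_vert \<beta> \<alpha>) = corr_vert (Psi2 b \<beta>) (Psi2 b \<alpha>)" .
  next
    fix \<Lambda> \<Omega> :: "('o, 'm) ucell1" assume *: "\<Lambda> \<in> uc1" "\<Omega> \<in> uc1" "udom \<Omega> = ucod \<Lambda>"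
    have "composable b (udom \<Lambda>) (ucod \<Lambda>) (ucod \<Omega>) \<Lambda> \<Omega>"
      using conn[OF *(1)] conn[OF *(2)] *(3) by (simp add: composable_def)
    from composable.comparison_unitary[OF this]
    show "compare b \<Omega> \<Lambda> \<in> Unitary2 CORR (tensor (Psi1 b \<Lambda>) (Psi1 b \<Omega>)) (Psi1 b (uc_comp \<Omega> \<Lambda>))"
      unfolding compare_def .
  next
    fix \<alpha> \<beta> :: "('o, 'm) ucell2" assume \<alpha>: "\<alpha> \<in> uc2" and \<beta>: "\<beta> \<in> uc2" and eq: "udom (usrc \<beta>) = ucod (usrc \<alpha>)"
    obtain h where h: "represents h \<alpha>" using uc2_represented[OF \<alpha>] by blast
    obtain g where g: "represents g \<beta>" using uc2_represented[OF \<beta>] by blast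
    from Psi2_horiz[OF uc2_parallel[OF bc \<alpha>] uc2_parallel[OF bc \<beta>, unfolded eq] refl refl h refl refl g]
    show "corr_vert (compare b (utgt \<beta>) (utgt \<alpha>)) (corr_tensor2 (Psi2 b \<alpha>) (Psi2 b \<beta>)) =
      corr_vert (Psi2 b (uc_horiz \<beta> \<alpha>)) (compare b (usrc \<beta>) (usrc \<alpha>))" .
  next
    fix \<Lambda> \<Omega> \<Theta> :: "('o, 'm) ucell1"
    assume *: "\<Lambda> \<in> uc1" "\<Omega> \<in> uc1" "\<Theta> \<in> uc1" "udom \<Omega> = ucod \<Lambda>" "udom \<Theta> = ucod \<Omega>"
    show "corr_vert (Psi2 b (uc_id2 (uc_comp \<Theta> (uc_comp \<Omega> \<Lambda>))))
      (corr_vert (compare b (uc_comp \<Theta> \<Omega>) \<Lambda>) (corr_tensor2 (corr_id2 (Psi1 b \<Lambda>)) (compare b \<Theta> \<Omega>))) =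
    corr_vert (compare b \<Theta> (uc_comp \<Omega> \<Lambda>))
      (corr_vert (corr_tensor2 (compare b \<Omega> \<Lambda>) (corr_id2 (Psi1 b \<Theta>)))
        (corr_reassoc (Psi1 b \<Lambda>) (Psi1 b \<Omega>) (Psi1 b \<Theta>)))"
      using Psi_assoc[OF conn[OF *(1)]] conn[OF *(2)] conn[OF *(3)] *(4,5) by simp
  qed
  then show "two_functor UC CORR (Psi0 b) (Psi1 b) (Psi2 b)"
    unfolding two_functor_def by blast
  show "star_linear_on_2cells UC CORR (Psi2 b)"
    unfolding star_linear_on_2cells_def cells corr_cells
  proof (intro conjI ballI allI impI)
    fix \<alpha> \<beta> :: "('o, 'm) ucell2" assume *: "\<alpha> \<in> uc2" "\<beta> \<in> uc2" and eq: "usrc \<alpha> = usrc \<beta>" "utgt \<alpha> = utgt \<beta>"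
    obtain h where h: "represents h \<alpha>" using uc2_represented[OF *(1)] by blast
    obtain g where g: "represents g \<beta>" using uc2_represented[OF *(2)] by blast
    show "Psi2 b (uc_add \<alpha> \<beta>) = corr_add (Psi2 b \<alpha>) (Psi2 b \<beta>)"
      by (rule Psi2_add[OF uc2_parallel[OF bc *(2)] refl refl g eq h])
  next
    fix \<alpha> :: "('o, 'm) ucell2" and z assume *: "\<alpha> \<in> uc2"
    obtain h where h: "represents h \<alpha>" using uc2_represented[OF *] by blast
    show "Psi2 b (uc_scale z \<alpha>) = corr_scale z (Psi2 b \<alpha>)"
      by (rule Psi2_scale[OF uc2_parallel[OF bc *] refl refl h])
    show "Psi2 b (uc_star \<alpha>) = corr_star (Psi2 b \<alpha>)"
      by (rule Psi2_star[OF uc2_parallel[OF bc *] refl refl h])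
  qed
  show "fully_faithful_on_2cells UC CORR (Psi1 b) (Psi2 b)"
    unfolding fully_faithful_on_2cells_def cells
  proof (intro ballI impI)
    fix \<Lambda> \<Omega> :: "('o, 'm) ucell1"
    assume *: "\<Lambda> \<in> uc1" "\<Omega> \<in> uc1" "udom \<Lambda> = udom \<Omega>" "ucod \<Lambda> = ucod \<Omega>"
    have "parallel b (udom \<Lambda>) (ucod \<Lambda>) \<Lambda> \<Omega>"
      using conn[OF *(1)] conn[OF *(2)] *(3,4) by (simp add: parallel_def)
    then show "bij_betw (Psi2 b) (Hom2 UC \<Lambda> \<Omega>) (Hom2 CORR (Psi1 b \<Lambda>) (Psi1 b \<Omega>))"
      using *(1,2) by (rule Psi2_bij)
  qed
qed

end
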